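(* There is a polynomial-time algorithm that, given a defeasible graph $G=G^{str}\cup G^{def}$ and a triple $\tau$ which is either a $\rho df_\bot$-triple or a defeasible triple, decides whether $G\models_{\min}\tau$.
   Context: **Syntax.** $U$ (URI references) and $L$ (literals, plain or typed) are disjoint sets; terms are the elements of $UL=U\cup L$. $\rho df_\bot=\{\mathsf{sp},\mathsf{sc},\mathsf{type},\mathsf{dom},\mathsf{range},\bot_c,\bot_p\}\subseteq U$. A ($\rho df_\bot$-)triple is $(s,p,o)\in UL\times U\times UL$ with $s,o\notin\rho df_\bot$; a graph is a finite set of triples; $\mathrm{uni}(G)$ is the set of terms occurring in it. A defeasible triple is $\langle s,p,o\rangle$ with $p\in\{\mathsf{sc},\mathsf{sp}\}$, $s,o\in UL\setminus\rho df_\bot$. A defeasible graph is $G=G^{str}\cup G^{def}$ with $G^{str}$ a graph and $G^{def}$ a finite set of defeasible triples. $G^s=G^{str}\cup\{(s,p,o):\langle s,p,o\rangle\in G^{def}\}$. **Closure.** Rules (metavariables range over $UL$): (2a) $(A,\mathsf{sp},B),(B,\mathsf{sp},C)\Rightarrow(A,\mathsf{sp},C)$; (2b) $(D,\mathsf{sp},E),(X,D,Y)\Rightarrow(X,E,Y)$; (3a) $(A,\mathsf{sc},B),(B,\mathsf{sc},C)\Rightarrow(A,\mathsf{sc},C)$; (3b) $(A,\mathsf{sc},B),(X,\mathsf{type},A)\Rightarrow(X,\mathsf{type},B)$; (4a) $(D,\mathsf{dom},B),(X,D,Y)\Rightarrow(X,\mathsf{type},B)$; (4b) $(D,\mathsf{range},B),(X,D,Y)\Rightarrow(Y,\mathsf{type},B)$;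 (5a) $(A,\bot_c,B)\Rightarrow(B,\bot_c,A)$; (5b) $(A,\bot_c,B),(C,\mathsf{sc},A)\Rightarrow(C,\bot_c,B)$; (5c) $(A,\bot_c,A)\Rightarrow(A,\bot_c,B)$; (6a) $(A,\bot_p,B)\Rightarrow(B,\bot_p,A)$; (6b) $(A,\bot_p,B),(C,\mathsf{sp},A)\Rightarrow(C,\bot_p,B)$; (6c) $(A,\bot_p,A)\Rightarrow(A,\bot_p,B)$; (7a) $(A,\mathsf{dom},C),(B,\mathsf{dom},D),(C,\bot_c,D)\Rightarrow(A,\bot_p,B)$; (7b) $(A,\mathsf{range},C),(B,\mathsf{range},D),(C,\bot_c,D)\Rightarrow(A,\bot_p,B)$. $\mathrm{Cl}(G)$ is the closure of $G$ under these rules. **Interpretations.** An interpretation over $V\subseteq UL$ is $\mathcal I=\langle\Delta_R,\Delta_P,\Delta_C,\Delta_L,P[\cdot],C[\cdot],\cdot^{\mathcal I}\rangle$ with finite sets $\Delta_C\subseteq\Delta_R$, $L\cap V\subseteq\Delta_L\subseteq\Delta_R$, $\Delta_P$, maps $P:\Delta_P\to2^{\Delta_R\times\Delta_R}$, $C:\Delta_C\to2^{\Delta_R}$, and $\cdot^{\mathcal I}:UL\cap V\to\Delta_R\cup\Delta_P$, the identity on plain literals and mapping literals into $\Delta_R$. $\mathcal I\Vdash G$ iff $\mathcal I$ interprets (at least) $\rho df_\bot\cup\mathrm{uni}(G)$ and, writing $P_e=P[e^{\mathcal I}]$: for each $(s,p,o)\in G$, $p^{\mathcal I}\in\Delta_P$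 and $(s^{\mathcal I},o^{\mathcal I})\in P[p^{\mathcal I}]$; $e^{\mathcal I}\in\Delta_P$ for $e\in\rho df_\bot$; $P_{\mathsf{sp}}$ is transitive over $\Delta_P$ and $(p,q)\in P_{\mathsf{sp}}$ implies $p,q\in\Delta_P$, $P[p]\subseteq P[q]$; $P_{\mathsf{sc}}$ is transitive over $\Delta_C$ and $(c,d)\in P_{\mathsf{sc}}$ implies $c,d\in\Delta_C$, $C[c]\subseteq C[d]$; $x\in C[c]$ iff $(x,c)\in P_{\mathsf{type}}$, and $(x,c)\in P_{\mathsf{type}}$ implies $c\in\Delta_C$; $(p,c)\in P_{\mathsf{dom}}$ (resp. $P_{\mathsf{range}}$) implies $p\in\Delta_P$, $c\in\Delta_C$ and, for all $(x,y)\in P[p]$, $x\in C[c]$ (resp. $y\in C[c]$); $P_{\bot_c}$ is a symmetric relation on $\Delta_C$ with: $(c,d)\in P_{\bot_c}$, $(e,c)\in P_{\mathsf{sc}}$ imply $(e,d)\in P_{\bot_c}$, and $(c,c)\in P_{\bot_c}$, $d\in\Delta_C$ imply $(c,d)\in P_{\bot_c}$; $P_{\bot_p}$ is a symmetric relation on $\Delta_P$ with the same two properties for $\mathsf{sp}$, $\Delta_P$; if $(p,c),(q,d)\in P_{\mathsf{dom}}$ (or both in $P_{\mathsf{range}}$) and $(c,d)\in P_{\bot_c}$ then $(p,q)\in P_{\bot_p}$. **Ranked models.** For a defeasible graph $G$ fix the domains $\Delta_R=\mathrm{uni}(G^s)\cup\rho df_\bot$; $\Delta_P=\rho df_\bot\cup\{p\in\mathrm{uni}(G^s):p$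 is the predicate of a triple, the subject or object of an $\mathsf{sp}$- or $\bot_p$-triple, or the subject of a $\mathsf{dom}$- or $\mathsf{range}$-triple of $\mathrm{Cl}(G^s)\}$; $\Delta_C=\{c\in\mathrm{uni}(G^s):c$ is the object of a $\mathsf{type}$-, $\mathsf{dom}$- or $\mathsf{range}$-triple, or the subject or object of an $\mathsf{sc}$- or $\bot_c$-triple of $\mathrm{Cl}(G^s)\}$; $\Delta_L=\mathrm{uni}(G^s)\cap L$. Let $\mathcal M$ be the set of all interpretations over $\rho df_\bot\cup\mathrm{uni}(G^s)$ with these domains. A ranked interpretation is $\mathcal R=(\mathcal M,r)$ with $r:\mathcal M\to\mathbb N\cup\{\infty\}$ attaining $0$ and such that if $r$ attains $i\in\mathbb N$, $i>0$, it attains $i-1$. $\mathcal M_{\mathbb N}=\{\mathcal I:r(\mathcal I)<\infty\}$. $\mathrm{cmin}(t,\mathcal R)$ (resp. $\mathrm{pmin}(t,\mathcal R)$) is the set of $\mathcal I\in\mathcal M_{\mathbb N}$ of least rank among those in $\mathcal M_{\mathbb N}$ with $\mathcal I\not\Vdash(t,\bot_c,t)$ (resp. $\mathcal I\not\Vdash(t,\bot_p,t)$). $\mathcal R\Vdash(s,p,o)$ iff all $\mathcal I\in\mathcal M_{\mathbb N}$ satisfy it; $\mathcal R\Vdash\langle c,\mathsf{sc},d\rangle$ iff $\mathcal I\Vdash(c,\mathsf{sc},d)$ for all $\mathcal I\in\mathrm{cmin}(c,\mathcal R)$; $\mathcal R\Vdash\langle p,\mathsf{sp},q\rangle$ iff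 $\mathcal I\Vdash(p,\mathsf{sp},q)$ for all $\mathcal I\in\mathrm{pmin}(p,\mathcal R)$. $\mathcal R$ is a ranked model of $G$ if it satisfies every element of $G$. Put $(\mathcal M,r)\preceq(\mathcal M,r')$ iff $r\le r'$ pointwise; $G$ has a unique $\preceq$-minimal ranked model $\mathcal R_{\min G}$. $G\models_{\min}\tau$ iff $\mathcal R_{\min G}\Vdash\tau$. *)

theory Defs
  imports
    "HOL-Library.Extended_Nat"
    "HOL-Library.FuncSet"
    "HOL-Computational_Algebra.Polynomial"
begin

section \<open>Syntax\<close>

text \<open>
  URI references are the seven vocabulary items and otherwise arbitrary names. A typed literal
  consists of its lexical form and its datatype URI; that URI does not thereby count as occurring
  in a graph.
\<close>

datatype uri = SP | SC | TYP | DOM | RANGE | BOTC | BOTP | Name string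

datatype rdf_term = URI uri | PlainLit string | TypedLit string uri

definition Lits :: "rdf_term set" where
  "Lits = range PlainLit \<union> range (case_prod TypedLit)"

definition rdf_bot :: "rdf_term set" where
  "rdf_bot = URI ` {SP, SC, TYP, DOM, RANGE, BOTC, BOTP}"

type_synonym triple = "rdf_term \<times> uri \<times> rdf_term"

fun wf_triple :: "triple \<Rightarrow> bool" where
  "wf_triple (s, p, oo) \<longleftrightarrow> s \<notin> rdf_bot \<and> oo \<notin> rdf_bot"

fun terms_of :: "triple \<Rightarrow> rdf_term set" where
  "terms_of (s, p, oo) = {s, URI p, oo}"

definition uni :: "triple set \<Rightarrow> rdf_term set" where
  "uni G = (\<Union>t\<in>G. terms_of t)"

datatype stmt = Strict triple | Defeasible triple

fun wf_stmt :: "stmt \<Rightarrow> bool" where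
  "wf_stmt (Strict t) \<longleftrightarrow> wf_triple t"
| "wf_stmt (Defeasible (s, p, oo)) \<longleftrightarrow> wf_triple (s, p, oo) \<and> p \<in> {SC, SP}"

definition defeasible_graph :: "stmt set \<Rightarrow> bool" where
  "defeasible_graph G \<longleftrightarrow> finite G \<and> (\<forall>x\<in>G. wf_stmt x)"

definition strictified :: "stmt set \<Rightarrow> triple set" where
  "strictified G = {t. Strict t \<in> G \<or> Defeasible t \<in> G}"


section \<open>Closure\<close>

text \<open>
  All triples in a rule instance have to be well-formed. For a well-formed \<^term>\<open>G\<close> this is
  automatic except where stated: \<open>D\<close> and \<open>E\<close> in rules 2b, 4a, 4b are URI references since they
  occur in predicate position, and the free \<open>B\<close> of rules 5c and 6c is outside the vocabulary.
\<close>

inductive_set Cl :: "triple set \<Rightarrow> triple set" for G :: "triple set" where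
  base: "t \<in> G \<Longrightarrow> t \<in> Cl G"
| r2a: "(A, SP, B) \<in> Cl G \<Longrightarrow> (B, SP, C) \<in> Cl G \<Longrightarrow> (A, SP, C) \<in> Cl G"
| r2b: "(URI D, SP, URI E) \<in> Cl G \<Longrightarrow> (X, D, Y) \<in> Cl G \<Longrightarrow> (X, E, Y) \<in> Cl G"
| r3a: "(A, SC, B) \<in> Cl G \<Longrightarrow> (B, SC, C) \<in> Cl G \<Longrightarrow> (A, SC, C) \<in> Cl G"
| r3b: "(A, SC, B) \<in> Cl G \<Longrightarrow> (X, TYP, A) \<in> Cl G \<Longrightarrow> (X, TYP, B) \<in> Cl G"
| r4a: "(URI D, DOM, B) \<in> Cl G \<Longrightarrow> (X, D, Y) \<in> Cl G \<Longrightarrow> (X, TYP, B) \<in> Cl G"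
| r4b: "(URI D, RANGE, B) \<in> Cl G \<Longrightarrow> (X, D, Y) \<in> Cl G \<Longrightarrow> (Y, TYP, B) \<in> Cl G"
| r5a: "(A, BOTC, B) \<in> Cl G \<Longrightarrow> (B, BOTC, A) \<in> Cl G"
| r5b: "(A, BOTC, B) \<in> Cl G \<Longrightarrow> (C, SC, A) \<in> Cl G \<Longrightarrow> (C, BOTC, B) \<in> Cl G"
| r5c: "(A, BOTC, A) \<in> Cl G \<Longrightarrow> B \<notin> rdf_bot \<Longrightarrow> (A, BOTC, B) \<in> Cl G"
| r6a: "(A, BOTP, B) \<in> Cl G \<Longrightarrow> (B, BOTP, A) \<in> Cl G"
| r6b: "(A, BOTP, B) \<in> Cl G \<Longrightarrow> (C, SP, A) \<in> Cl G \<Longrightarrow> (C, BOTP, B) \<in> Cl G"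
| r6c: "(A, BOTP, A) \<in> Cl G \<Longrightarrow> B \<notin> rdf_bot \<Longrightarrow> (A, BOTP, B) \<in> Cl G"
| r7a: "(A, DOM, C) \<in> Cl G \<Longrightarrow> (B, DOM, D) \<in> Cl G \<Longrightarrow> (C, BOTC, D) \<in> Cl G \<Longrightarrow> (A, BOTP, B) \<in> Cl G"
| r7b: "(A, RANGE, C) \<in> Cl G \<Longrightarrow> (B, RANGE, D) \<in> Cl G \<Longrightarrow> (C, BOTC, D) \<in> Cl G \<Longrightarrow> (A, BOTP, B) \<in> Cl G"


section \<open>Interpretations\<close>

text \<open>
  The domains are sets of terms: those of the interpretations underlying ranked models are, and
  plain literals have to denote themselves. The three maps are extensional, so that an
  interpretation is determined by its values on the stated domains.
\<close>

record interp =
  voc :: "rdf_term set"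
  DR :: "rdf_term set"
  DP :: "rdf_term set"
  DC :: "rdf_term set"
  DL :: "rdf_term set"
  Pext :: "rdf_term \<Rightarrow> (rdf_term \<times> rdf_term) set"
  Cext :: "rdf_term \<Rightarrow> rdf_term set"
  den :: "rdf_term \<Rightarrow> rdf_term"

definition interpretation_of :: "rdf_term set \<Rightarrow> interp \<Rightarrow> bool" where
  "interpretation_of V I \<longleftrightarrow>
     voc I = V \<and>
     finite (DR I) \<and> finite (DP I) \<and> finite (DC I) \<and> finite (DL I) \<and>
     DC I \<subseteq> DR I \<and> Lits \<inter> V \<subseteq> DL I \<and> DL I \<subseteq> DR I \<and>
     Pext I \<in> DP I \<rightarrow>\<^sub>E Pow (DR I \<times> DR I) \<and>
     Cext I \<in> DC I \<rightarrow>\<^sub>E Pow (DR I) \<and>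
     den I \<in> V \<rightarrow>\<^sub>E DR I \<union> DP I \<and>
     (\<forall>w. PlainLit w \<in> V \<longrightarrow> den I (PlainLit w) = PlainLit w) \<and>
     (\<forall>l\<in>Lits \<inter> V. den I l \<in> DR I)"

abbreviation PU :: "interp \<Rightarrow> uri \<Rightarrow> (rdf_term \<times> rdf_term) set" where
  "PU I e \<equiv> Pext I (den I (URI e))"

definition models :: "interp \<Rightarrow> triple set \<Rightarrow> bool" where
  "models I G \<longleftrightarrow>
     rdf_bot \<union> uni G \<subseteq> voc I \<and>
     (\<forall>(s, p, oo)\<in>G. den I (URI p) \<in> DP I \<and> (den I s, den I oo) \<in> PU I p) \<and>
     (\<forall>e\<in>rdf_bot. den I e \<in> DP I) \<and>
     trans_on (DP I) (PU I SP) \<and>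
     (\<forall>(p, q)\<in>PU I SP. p \<in> DP I \<and> q \<in> DP I \<and> Pext I p \<subseteq> Pext I q) \<and>
     trans_on (DC I) (PU I SC) \<and>
     (\<forall>(c, d)\<in>PU I SC. c \<in> DC I \<and> d \<in> DC I \<and> Cext I c \<subseteq> Cext I d) \<and>
     (\<forall>c\<in>DC I. \<forall>x. x \<in> Cext I c \<longleftrightarrow> (x, c) \<in> PU I TYP) \<and>
     (\<forall>(x, c)\<in>PU I TYP. c \<in> DC I) \<and>
     (\<forall>(p, c)\<in>PU I DOM. p \<in> DP I \<and> c \<in> DC I \<and> (\<forall>(x, y)\<in>Pext I p. x \<in> Cext I c)) \<and>
     (\<forall>(p, c)\<in>PU I RANGE. p \<in> DP I \<and> c \<in> DC I \<and> (\<forall>(x, y)\<in>Pext I p. y \<in> Cext I c)) \<and>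
     PU I BOTC \<subseteq> DC I \<times> DC I \<and> sym (PU I BOTC) \<and>
     (\<forall>c d e. (c, d) \<in> PU I BOTC \<and> (e, c) \<in> PU I SC \<longrightarrow> (e, d) \<in> PU I BOTC) \<and>
     (\<forall>c. (c, c) \<in> PU I BOTC \<longrightarrow> (\<forall>d\<in>DC I. (c, d) \<in> PU I BOTC)) \<and>
     PU I BOTP \<subseteq> DP I \<times> DP I \<and> sym (PU I BOTP) \<and>
     (\<forall>p q r. (p, q) \<in> PU I BOTP \<and> (r, p) \<in> PU I SP \<longrightarrow> (r, q) \<in> PU I BOTP) \<and>
     (\<forall>p. (p, p) \<in> PU I BOTP \<longrightarrow> (\<forall>q\<in>DP I. (p, q) \<in> PU I BOTP)) \<and>
     (\<forall>p q c d. (p, c) \<in> PU I DOM \<and> (q, d) \<in> PU I DOM \<and> (c, d) \<in> PU I BOTC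
        \<longrightarrow> (p, q) \<in> PU I BOTP) \<and>
     (\<forall>p q c d. (p, c) \<in> PU I RANGE \<and> (q, d) \<in> PU I RANGE \<and> (c, d) \<in> PU I BOTC
        \<longrightarrow> (p, q) \<in> PU I BOTP)"


section \<open>Ranked models and minimal entailment\<close>

definition DeltaP :: "stmt set \<Rightarrow> rdf_term set" where
  "DeltaP G = rdf_bot \<union>
     {p \<in> uni (strictified G).
        (\<exists>s u x. p = URI u \<and> (s, u, x) \<in> Cl (strictified G)) \<or>
        (\<exists>x. \<exists>u\<in>{SP, BOTP}. (p, u, x) \<in> Cl (strictified G) \<or> (x, u, p) \<in> Cl (strictified G)) \<or>
        (\<exists>x. \<exists>u\<in>{DOM, RANGE}. (p, u, x) \<in> Cl (strictified G))}"

definition DeltaC :: "stmt set \<Rightarrow> rdf_term set" where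
  "DeltaC G =
     {c \<in> uni (strictified G).
        (\<exists>x. \<exists>u\<in>{TYP, DOM, RANGE}. (x, u, c) \<in> Cl (strictified G)) \<or>
        (\<exists>x. \<exists>u\<in>{SC, BOTC}. (c, u, x) \<in> Cl (strictified G) \<or> (x, u, c) \<in> Cl (strictified G))}"

definition Interps :: "stmt set \<Rightarrow> interp set" where
  "Interps G =
     {I. interpretation_of (rdf_bot \<union> uni (strictified G)) I \<and>
         DR I = uni (strictified G) \<union> rdf_bot \<and>
         DP I = DeltaP G \<and> DC I = DeltaC G \<and> DL I = uni (strictified G) \<inter> Lits}"

text \<open>
  As \<^term>\<open>Interps G\<close> is determined by \<^term>\<open>G\<close>, a ranked interpretation is given by its
  ranking alone.
\<close>

definition ranked_interp :: "stmt set \<Rightarrow> (interp \<Rightarrow> enat) \<Rightarrow> bool" where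
  "ranked_interp G r \<longleftrightarrow>
     r \<in> Interps G \<rightarrow>\<^sub>E UNIV \<and> 0 \<in> r ` Interps G \<and>
     (\<forall>i::nat. i > 0 \<longrightarrow> enat i \<in> r ` Interps G \<longrightarrow> enat (i - 1) \<in> r ` Interps G)"

definition finite_rank :: "stmt set \<Rightarrow> (interp \<Rightarrow> enat) \<Rightarrow> interp set" where
  "finite_rank G r = {I \<in> Interps G. r I < \<infinity>}"

definition least_rank :: "(interp \<Rightarrow> enat) \<Rightarrow> interp set \<Rightarrow> interp set" where
  "least_rank r S = {I \<in> S. \<forall>J\<in>S. r I \<le> r J}"

definition cmin :: "rdf_term \<Rightarrow> stmt set \<Rightarrow> (interp \<Rightarrow> enat) \<Rightarrow> interp set" where
  "cmin t G r = least_rank r {I \<in> finite_rank G r. \<not> models I {(t, BOTC, t)}}"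

definition pmin :: "rdf_term \<Rightarrow> stmt set \<Rightarrow> (interp \<Rightarrow> enat) \<Rightarrow> interp set" where
  "pmin t G r = least_rank r {I \<in> finite_rank G r. \<not> models I {(t, BOTP, t)}}"

fun ranked_sat :: "stmt set \<Rightarrow> (interp \<Rightarrow> enat) \<Rightarrow> stmt \<Rightarrow> bool" where
  "ranked_sat G r (Strict t) \<longleftrightarrow> (\<forall>I\<in>finite_rank G r. models I {t})"
| "ranked_sat G r (Defeasible (s, p, oo)) \<longleftrightarrow>
     (p = SC \<and> (\<forall>I\<in>cmin s G r. models I {(s, SC, oo)})) \<or>
     (p = SP \<and> (\<forall>I\<in>pmin s G r. models I {(s, SP, oo)}))"

definition ranked_model :: "stmt set \<Rightarrow> (interp \<Rightarrow> enat) \<Rightarrow> bool" where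
  "ranked_model G r \<longleftrightarrow> ranked_interp G r \<and> (\<forall>x\<in>G. ranked_sat G r x)"

definition rank_le :: "stmt set \<Rightarrow> (interp \<Rightarrow> enat) \<Rightarrow> (interp \<Rightarrow> enat) \<Rightarrow> bool" where
  "rank_le G r r' \<longleftrightarrow> (\<forall>I\<in>Interps G. r I \<le> r' I)"

definition minimal_ranked_model :: "stmt set \<Rightarrow> (interp \<Rightarrow> enat) \<Rightarrow> bool" where
  "minimal_ranked_model G r \<longleftrightarrow>
     ranked_model G r \<and> (\<forall>r'. ranked_model G r' \<and> rank_le G r' r \<longrightarrow> r' = r)"

text \<open>A defeasible graph has exactly one minimal ranked model, which the description picks out.\<close>

definition R_min :: "stmt set \<Rightarrow> interp \<Rightarrow> enat" where
  "R_min G = (THE r. minimal_ranked_model G r)"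

definition min_entails :: "stmt set \<Rightarrow> stmt \<Rightarrow> bool" (infix "\<Turnstile>min" 50) where
  "G \<Turnstile>min x \<longleftrightarrow> ranked_sat G (R_min G) x"


section \<open>Polynomial-time decidability\<close>

text \<open>
  Deterministic multi-tape Turing machines. The states are \<open>{..<num_states}\<close>, the tape symbols are
  \<open>{..<num_symbols}\<close>, where 0 is the blank and 1 and 2 stand for the input bits 0 and 1. The
  transition function gets the state and the scanned symbols (one per tape) and yields the new
  state and, for each tape, the symbol written and the head movement. Its values elsewhere than on
  the finitely many arguments constrained in \<open>wf_tm\<close> are never used.
\<close>

record tm =
  num_tapes :: nat
  num_states :: nat
  num_symbols :: nat
  start :: nat
  accept :: nat
  reject :: nat
  trans_fun :: "nat \<Rightarrow> nat list \<Rightarrow> nat \<times> (nat \<times> int) list"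

definition wf_tm :: "tm \<Rightarrow> bool" where
  "wf_tm M \<longleftrightarrow>
     num_tapes M \<ge> 1 \<and> num_symbols M \<ge> 3 \<and>
     start M < num_states M \<and> accept M < num_states M \<and> reject M < num_states M \<and>
     accept M \<noteq> reject M \<and>
     (\<forall>q<num_states M. \<forall>rs. length rs = num_tapes M \<and> set rs \<subseteq> {..<num_symbols M} \<longrightarrow>
        (case trans_fun M q rs of (q', acts) \<Rightarrow>
           q' < num_states M \<and> length acts = num_tapes M \<and>
           (\<forall>(a, d)\<in>set acts. a < num_symbols M \<and> d \<in> {-1, 0, 1})))"

text \<open>A tape is two-way infinite and comes with its head position.\<close>

type_synonym tape = "(int \<Rightarrow> nat) \<times> int"
type_synonym config = "nat \<times> tape list"

fun tape_action :: "tape \<Rightarrow> nat \<times> int \<Rightarrow> tape" where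
  "tape_action (f, h) (a, d) = (f(h := a), h + d)"

fun tm_step :: "tm \<Rightarrow> config \<Rightarrow> config" where
  "tm_step M (q, ts) =
     (if q = accept M \<or> q = reject M then (q, ts)
      else let (q', acts) = trans_fun M q (map (\<lambda>(f, h). f h) ts)
           in (q', map2 tape_action ts acts))"

definition input_tape :: "bool list \<Rightarrow> tape" where
  "input_tape w =
     (\<lambda>i. if 0 \<le> i \<and> i < int (length w) then (if w ! nat i then 2 else 1) else 0, 0)"

definition tm_init :: "tm \<Rightarrow> bool list \<Rightarrow> config" where
  "tm_init M w = (start M, input_tape w # replicate (num_tapes M - 1) (\<lambda>_. 0, 0))"

text \<open>
  The problem with instances \<^term>\<open>Inst\<close>, presented as words through \<^term>\<open>enc\<close>, and question
  \<^term>\<open>Q\<close>. Halting states are fixed by \<open>tm_step\<close>, so it suffices to look at the state after the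
  time bound.
\<close>

definition poly_time_decidable :: "'i set \<Rightarrow> ('i \<Rightarrow> bool list) \<Rightarrow> ('i \<Rightarrow> bool) \<Rightarrow> bool" where
  "poly_time_decidable Inst enc Q \<longleftrightarrow>
     (\<exists>M. \<exists>b :: nat poly. wf_tm M \<and>
        (\<forall>x\<in>Inst.
           fst ((tm_step M ^^ poly b (length (enc x))) (tm_init M (enc x))) =
             (if Q x then accept M else reject M)))"


section \<open>Encoding of instances\<close>

text \<open>All codes are prefix-free; their length is linear in the total length of the names.\<close>

fun enc_char :: "char \<Rightarrow> bool list" where
  "enc_char (Char b0 b1 b2 b3 b4 b5 b6 b7) = [b0, b1, b2, b3, b4, b5, b6, b7]"

definition enc_list :: "('a \<Rightarrow> bool list) \<Rightarrow> 'a list \<Rightarrow> bool list" where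
  "enc_list e xs = concat (map (\<lambda>x. True # e x) xs) @ [False]"

fun enc_uri :: "uri \<Rightarrow> bool list" where
  "enc_uri SP = [False, False, False]"
| "enc_uri SC = [False, False, True]"
| "enc_uri TYP = [False, True, False]"
| "enc_uri DOM = [False, True, True]"
| "enc_uri RANGE = [True, False, False]"
| "enc_uri BOTC = [True, False, True]"
| "enc_uri BOTP = [True, True, False]"
| "enc_uri (Name w) = [True, True, True] @ enc_list enc_char w"

fun enc_term :: "rdf_term \<Rightarrow> bool list" where
  "enc_term (URI u) = [False] @ enc_uri u"
| "enc_term (PlainLit w) = [True, False] @ enc_list enc_char w"
| "enc_term (TypedLit w u) = [True, True] @ enc_list enc_char w @ enc_uri u"

fun enc_triple :: "triple \<Rightarrow> bool list" where
  "enc_triple (s, p, oo) = enc_term s @ enc_uri p @ enc_term oo"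

fun enc_stmt :: "stmt \<Rightarrow> bool list" where
  "enc_stmt (Strict t) = [False] @ enc_triple t"
| "enc_stmt (Defeasible t) = [True] @ enc_triple t"

text \<open>A defeasible graph is presented by any list of its elements.\<close>

fun enc_instance :: "stmt list \<times> stmt \<Rightarrow> bool list" where
  "enc_instance (xs, x) = enc_list enc_stmt xs @ enc_stmt x"

end

theory Submission
  imports Defs
begin

text \<open>
  The minimal ranked model gives an interpretation of the strict part the least level at which it
  satisfies every defeasible triple still present or its vacuity, where a triple \<open>\<langle>s, p, o\<rangle>\<close> survives from level \<open>i\<close> to
  level \<open>i + 1\<close> iff all interpretations of level \<open>i\<close> satisfy its vacuity \<open>(s, \<bottom>, s)\<close>. An interpretation
  that satisfies only the vacuity of a defeasible triple still satisfies every vacuity derived with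
  the help of that triple. Hence levels can be computed by closing the strict triples
  together with the surviving ones under the rules, and canonical interpretations show that this
  closure is complete. The levels are stable after at most as many steps as there are defeasible
  triples.

  With the positions of the input word as domain, parsing the input, closing all levels and answering
  the query are three strata of a Datalog program with fixed clauses. A Datalog stratum is a loop
  program whose loops all have the same polynomial bound, and a loop program runs on a multi-tape
  machine that keeps each table on a tape of its own, addressed by the number whose digits are the
  arguments.
\<close>

section \<open>Structured programs for Turing machines\<close>

text \<open>The interpretations of a level are cut out by disjunctions, a triple or its vacuity, so
  they are not the models of any one set of triples. It helps that vacuities, and defeasible triples
  up to vacuity, pass through the rules; rules 7a and 7b do no harm because no defeasible triple has
  predicate \<open>DOM\<close> or \<open>RANGE\<close>. At the stable level every surviving triple
  has a derivable vacuity and the disjunctions collapse, which is why strict queries get a closure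
  of their own. \<open>Cl\<close> itself is not the closure needed: interpretations may treat a
  literal as a property, so triples with a literal in predicate position take part in derivations.
  Levels shrink, yet survival is a positive condition, the derivability of a vacuity. All levels
  together are therefore one least fixed point, and negation is confined to the bits, to the ends of
  the order and to the final search for the first level that lacks a vacuity. Positions can also
  serve as level numbers, since they outnumber the statements.\<close>

datatype cmd = Move nat int | Write nat nat | Then cmd cmd | Branch nat nat cmd cmd | Until nat nat cmd

type_synonym tapes = "nat \<Rightarrow> tape"

definition scan :: "tapes \<Rightarrow> nat \<Rightarrow> nat" where
  "scan T i = fst (T i) (snd (T i))"

fun st :: "cmd list \<times> tapes \<Rightarrow> cmd list \<times> tapes" where
  "st ([], T) = ([], T)"
| "st (Move i d # K, T) = (K, T(i := (fst (T i), snd (T i) + d)))"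
| "st (Write i a # K, T) = (K, T(i := ((fst (T i))(snd (T i) := a), snd (T i))))"
| "st (Then c d # K, T) = (c # d # K, T)"
| "st (Branch i a c d # K, T) = ((if scan T i = a then c else d) # K, T)"
| "st (Until i a c # K, T) = (if scan T i = a then (K, T) else (c # Until i a c # K, T))"

text \<open>The finitely many continuations of a program serve as the states of its machine.\<close>

fun conts :: "cmd \<Rightarrow> cmd list \<Rightarrow> cmd list set" where
  "conts (Then c d) K = {Then c d # K} \<union> conts c (d # K) \<union> conts d K"
| "conts (Branch i a c d) K = {Branch i a c d # K} \<union> conts c K \<union> conts d K"
| "conts (Until i a c) K = {Until i a c # K} \<union> conts c (Until i a c # K)"
| "conts c K = {c # K}"

lemma finite_conts: "finite (conts c K)"
  by (induction c arbitrary: K) auto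

lemma conts_start: "c # K \<in> conts c K"
  by (cases c) auto

lemma conts_step: "k \<in> conts c K \<Longrightarrow> fst (st (k, T)) \<in> insert K (conts c K)"
proof (induction c arbitrary: K)
  case (Then c d)
  then show ?case using conts_start[of c "d # K"] conts_start[of d K] by fastforce
next
  case (Branch i a c d)
  then show ?case using conts_start[of c K] conts_start[of d K] by (auto split: if_splits)
next
  case (Until i a c)
  then show ?case using conts_start[of c "Until i a c # K"] Until.IH[of "Until i a c # K"]
    by (auto split: if_splits)
qed auto

fun wfc :: "nat \<Rightarrow> nat \<Rightarrow> cmd \<Rightarrow> bool" where
  "wfc k S (Move i d) \<longleftrightarrow> i < k \<and> d \<in> {-1, 0, 1}"
| "wfc k S (Write i a) \<longleftrightarrow> i < k \<and> a < S"
| "wfc k S (Then c d) \<longleftrightarrow> wfc k S c \<and> wfc k S d"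
| "wfc k S (Branch i a c d) \<longleftrightarrow> i < k \<and> wfc k S c \<and> wfc k S d"
| "wfc k S (Until i a c) \<longleftrightarrow> i < k \<and> wfc k S c"

lemma wfc_conts: "x \<in> conts c K \<Longrightarrow> wfc k S c \<Longrightarrow> list_all (wfc k S) K \<Longrightarrow> list_all (wfc k S) x"
  by (induction c arbitrary: K) auto

text \<open>A step of \<open>st\<close> touches at most the scanned cell and the head of one tape.
  Splitting it into \<open>ctl\<close> and \<open>acts_of\<close>, both functions of the scanned
  symbols, gives it the shape of a transition function.\<close>

definition acts_of :: "cmd list \<Rightarrow> nat \<Rightarrow> nat \<Rightarrow> nat \<times> int" where
  "acts_of K i a = (case K of
      Move j d # _ \<Rightarrow> (a, if i = j then d else 0)
    | Write j b # _ \<Rightarrow> (if i = j then b else a, 0)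
    | _ \<Rightarrow> (a, 0))"

text \<open>Control sees the tapes through the scanned symbols alone, so tapes that are constantly
  \<open>f i\<close> stand for all tapes that show \<open>f i\<close>.\<close>

definition ctl :: "cmd list \<Rightarrow> (nat \<Rightarrow> nat) \<Rightarrow> cmd list" where
  "ctl K f = fst (st (K, \<lambda>i. (\<lambda>_. f i, 0)))"

lemma tape_action_eq: "tape_action t (a, d) = ((fst t)(snd t := a), snd t + d)"
  by (cases t) simp

lemma st_ctl_acts:
  "st (K, T) = (ctl K (scan T), \<lambda>i. tape_action (T i) (acts_of K i (scan T i)))"
proof (cases K)
  case (Cons c K')
  then show ?thesis
    by (cases c) (auto simp: ctl_def acts_of_def scan_def tape_action_eq)
qed (auto simp: ctl_def acts_of_def scan_def tape_action_eq)

lemma ctl_cong: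
  assumes "list_all (wfc k S) K" "\<And>i. i < k \<Longrightarrow> f i = g i"
  shows "ctl K f = ctl K g"
proof (cases K)
  case (Cons c K')
  then show ?thesis using assms by (cases c) (auto simp: ctl_def scan_def)
qed (auto simp: ctl_def)

definition start_tapes :: "bool list \<Rightarrow> tapes" where
  "start_tapes w i = (if i = 0 then input_tape w else (\<lambda>_. 0, 0))"

text \<open>The continuations are numbered to serve as states, and \<open>m\<close> and
  \<open>Suc m\<close> are added for acceptance and rejection. The end of the program is not yet a
  halting state: the state of \<open>[]\<close> takes one more step, which reads tape
  \<open>j\<close> and decides; hence the bound \<open>b + 1\<close>.\<close>

theorem poly_time_decidableI:
  fixes c :: cmd and b :: "nat poly"
  assumes wf: "wfc k S c" "3 \<le> S" "j < k"
    and run: "\<And>x. x \<in> Inst \<Longrightarrow> \<exists>n T. n \<le> poly b (length (enc x)) \<and>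
      (st ^^ n) ([c], start_tapes (enc x)) = ([], T) \<and> (scan T j = 2 \<longleftrightarrow> Q x)"
  shows "poly_time_decidable Inst enc Q"
proof -
  define F where "F = insert [] (conts c [])"
  have finF: "finite F" by (simp add: F_def finite_conts)
  define m where "m = card F"
  obtain \<phi> where \<phi>: "bij_betw \<phi> F {0..<m}"
    using ex_bij_betw_finite_nat[OF finF] unfolding m_def by blast
  define \<psi> where "\<psi> = inv_into F \<phi>"
  have \<psi>\<phi>: "\<psi> (\<phi> K) = K" if "K \<in> F" for K
    using \<phi> that by (simp add: \<psi>_def bij_betw_def)
  have \<phi>m: "\<phi> K < m" if "K \<in> F" for K
    using \<phi> that by (force simp: bij_betw_def)
  have \<psi>F: "\<psi> q \<in> F" if "q < m" for q
    using \<phi> that by (metis \<psi>_def atLeastLessThan_iff bij_betw_def inv_into_into le0)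
  define M where "M = \<lparr>num_tapes = k, num_states = m + 2, num_symbols = S, start = \<phi> [c],
     accept = m, reject = Suc m,
     trans_fun = (\<lambda>q rs. if q < m then
        (if \<psi> q = [] then (if rs ! j = 2 then m else Suc m)
          else \<phi> (ctl (\<psi> q) (\<lambda>i. rs ! i)),
         map (\<lambda>i. acts_of (\<psi> q) i (rs ! i)) [0..<k]) else (q, replicate k (0, 0)))\<rparr>"
  have Fstep: "fst (st (K, T)) \<in> F" if "K \<in> F" for K T
    using that conts_step[of K c "[]" T] by (auto simp: F_def)
  have ctlF: "ctl K f \<in> F" if "K \<in> F" for K f
    using Fstep[OF that] by (simp add: ctl_def)
  have wfF: "list_all (wfc k S) K" if "K \<in> F" for K
    using that wfc_conts[of K c "[]" k S] wf by (auto simp: F_def)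
  have acts_wf: "fst (acts_of K i a) < S \<and> snd (acts_of K i a) \<in> {-1, 0, 1}"
    if "K \<in> F" "a < S" for K i a
    using wfF[OF that(1)] that(2)
    by (auto simp: acts_of_def split: list.splits cmd.splits)
  have F0: "[c] \<in> F" by (simp add: F_def conts_start)
  have wfM: "wf_tm M"
    unfolding wf_tm_def
  proof (intro conjI allI impI)
    fix q rs
    assume q: "q < num_states M" and rs: "length rs = num_tapes M \<and> set rs \<subseteq> {..<num_symbols M}"
    show "case trans_fun M q rs of (q', acts) \<Rightarrow>
           q' < num_states M \<and> length acts = num_tapes M \<and>
           (\<forall>(a, d)\<in>set acts. a < num_symbols M \<and> d \<in> {-1, 0, 1})"
    proof (cases "q < m")
      case True
      have *: "rs ! i < S" if "i < k" for i
        using rs that nth_mem[of i rs] by (force simp: M_def)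
      have "case acts_of (\<psi> q) i (rs ! i) of (a, d) \<Rightarrow> a < S \<and> (d = -1 \<or> d = 0 \<or> d = 1)"
        if "i < k" for i
        using acts_wf[OF \<psi>F[OF True] *[OF that], of i] by (auto split: prod.splits)
      moreover have "\<phi> (ctl (\<psi> q) f) < m + 2" for f
        using \<phi>m[OF ctlF[OF \<psi>F[OF True]], of f] by simp
      ultimately show ?thesis using True by (auto simp: M_def)
    next
      case False
      then show ?thesis using q \<open>3 \<le> S\<close> by (auto simp: M_def)
    qed
  next
    have "\<phi> [c] < m" using \<phi>m F0 by blast
    then show "start M < num_states M" by (simp add: M_def)
  qed (use wf in \<open>auto simp: M_def\<close>)
  define rep where "rep = (\<lambda>(K, T::tapes). (\<phi> K, map T [0..<k]))"
  have scans: "map (\<lambda>(f, h). f h) (map T [0..<k]) ! i = scan T i" if "i < k" for T :: tapes and i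
    using that by (simp add: scan_def split_beta)
  have rep_step: "tm_step M (rep (K, T)) = rep (st (K, T))" if "K \<in> F" "K \<noteq> []" for K T
  proof -
    have "\<phi> K < m" using \<phi>m that by blast
    let ?rs = "map (\<lambda>(f, h). f h) (map T [0..<k])"
    have 1: "ctl K (\<lambda>i. ?rs ! i) = ctl K (scan T)"
      by (rule ctl_cong[OF wfF[OF that(1)]]) (rule scans)
    have 2: "map2 tape_action (map T [0..<k]) (map (\<lambda>i. acts_of K i (?rs ! i)) [0..<k])
       = map (\<lambda>i. tape_action (T i) (acts_of K i (scan T i))) [0..<k]"
      by (rule nth_equalityI) (auto simp: scan_def split_beta)
    show ?thesis
      using \<open>\<phi> K < m\<close> that 1 2
      by (simp add: rep_def M_def \<psi>\<phi> st_ctl_acts Let_def del: map_map)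
  qed
  have rep_steps: "(tm_step M ^^ n) (rep (K, T)) = rep ((st ^^ n) (K, T))"
    if "K \<in> F" "\<forall>i<n. fst ((st ^^ i) (K, T)) \<noteq> []" for n K T
    using that(2)
  proof (induction n)
    case (Suc n)
    have inF: "fst ((st ^^ i) (K, T)) \<in> F" for i
      by (induction i) (use that(1) Fstep in \<open>auto, metis prod.collapse\<close>)
    have "tm_step M (rep ((st ^^ n) (K, T))) = rep (st ((st ^^ n) (K, T)))"
      using rep_step[OF inF[of n], of "snd ((st ^^ n) (K, T))"] Suc.prems by simp
    then show ?case using Suc by simp
  qed simp
  have fix_final: "(tm_step M ^^ n) (q, ts) = (q, ts)" if "q = accept M \<or> q = reject M" for n q ts
    by (induction n) (use that in auto)
  have "fst ((tm_step M ^^ poly (b + 1) (length (enc x))) (tm_init M (enc x))) =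
             (if Q x then accept M else reject M)" if x: "x \<in> Inst" for x
  proof -
    obtain n T where n: "n \<le> poly b (length (enc x))"
      and r: "(st ^^ n) ([c], start_tapes (enc x)) = ([], T)" and s: "scan T j = 2 \<longleftrightarrow> Q x"
      using run[OF x] by blast
    \<comment> \<open>\<open>st\<close> idles at the empty continuation whereas the machine leaves
      it at once, so the two run in parallel only until the continuation first becomes
      empty.\<close>
    define n0 where "n0 = (LEAST i. fst ((st ^^ i) ([c], start_tapes (enc x))) = [])"
    have n0: "fst ((st ^^ n0) ([c], start_tapes (enc x))) = []" "n0 \<le> n"
      unfolding n0_def by (rule LeastI[of _ n], simp add: r) (rule Least_le, simp add: r)
    have lt: "\<forall>i<n0. fst ((st ^^ i) ([c], start_tapes (enc x))) \<noteq> []"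
      unfolding n0_def using not_less_Least by blast
    have stay: "(st ^^ i) ([], T') = ([], T')" for i T' by (induction i) auto
    have "(st ^^ n) ([c], start_tapes (enc x)) = (st ^^ (n - n0)) ((st ^^ n0) ([c], start_tapes (enc x)))"
      using n0(2) by (metis comp_apply funpow_add le_add_diff_inverse2)
    then have r0: "(st ^^ n0) ([c], start_tapes (enc x)) = ([], T)"
      using n0(1) r stay by (cases "(st ^^ n0) ([c], start_tapes (enc x))") simp
    have "tm_init M (enc x) = rep ([c], start_tapes (enc x))"
      using \<open>j < k\<close> by (auto simp: tm_init_def rep_def M_def start_tapes_def intro!: nth_equalityI)
    then have "(tm_step M ^^ n0) (tm_init M (enc x)) = rep ([], T)"
      using rep_steps[OF F0 lt] r0 by simp
    then have "(tm_step M ^^ Suc n0) (tm_init M (enc x)) = tm_step M (rep ([], T))"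
      by simp
    also have "fst \<dots> = (if Q x then accept M else reject M)"
      using \<open>j < k\<close> s \<phi>m[of "[]"] by (auto simp: rep_def M_def F_def \<psi>\<phi> scan_def split_beta)
    finally have fst_eq: "fst ((tm_step M ^^ Suc n0) (tm_init M (enc x)))
        = (if Q x then accept M else reject M)" .
    define ts where "ts = snd ((tm_step M ^^ Suc n0) (tm_init M (enc x)))"
    have ts: "(tm_step M ^^ Suc n0) (tm_init M (enc x)) = (if Q x then accept M else reject M, ts)"
      unfolding ts_def fst_eq[symmetric] by (rule prod.collapse[symmetric])
    define l where "l = poly (b + 1) (length (enc x))"
    have "Suc n0 \<le> l" using n n0 by (simp add: l_def)
    then have "(tm_step M ^^ l) (tm_init M (enc x))
       = (tm_step M ^^ (l - Suc n0)) ((tm_step M ^^ Suc n0) (tm_init M (enc x)))"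
      using funpow_add[of "l - Suc n0" "Suc n0" "tm_step M"] by simp
    also have "\<dots> = (if Q x then accept M else reject M, ts)"
      unfolding ts by (rule fix_final) simp
    finally show ?thesis by (simp add: l_def)
  qed
  then show ?thesis
    unfolding poly_time_decidable_def by (intro exI[of _ M] exI[of _ "b + 1"] conjI wfM ballI)
qed

text \<open>Quantifying over the rest \<open>K\<close> of the program makes runs composable. As
  \<open>n\<close> is only an upper bound, branches of different cost can share one
  polynomial.\<close>

definition runs :: "cmd \<Rightarrow> tapes \<Rightarrow> nat \<Rightarrow> tapes \<Rightarrow> bool" where
  "runs c T n T' \<longleftrightarrow> (\<forall>K. \<exists>m\<le>n. (st ^^ m) (c # K, T) = (K, T'))"

lemma runs_mono: "runs c T n T' \<Longrightarrow> n \<le> n' \<Longrightarrow> runs c T n' T'"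
  unfolding runs_def by (meson le_trans)

lemma runs_Move: "runs (Move i d) T 1 (T(i := (fst (T i), snd (T i) + d)))"
  unfolding runs_def by (auto intro!: exI[of _ 1])

lemma runs_Write: "runs (Write i a) T 1 (T(i := ((fst (T i))(snd (T i) := a), snd (T i))))"
  unfolding runs_def by (auto intro!: exI[of _ 1])

lemma runs_step:
  assumes "\<And>K. \<exists>m\<le>n. (st ^^ m) (st (c # K, T)) = (K, T')"
  shows "runs c T (Suc n) T'"
  unfolding runs_def
proof
  fix K
  obtain m where "m \<le> n" "(st ^^ m) (st (c # K, T)) = (K, T')" using assms by blast
  then show "\<exists>m\<le>Suc n. (st ^^ m) (c # K, T) = (K, T')"
    by (intro exI[of _ "Suc m"]) (simp add: funpow_Suc_right del: funpow.simps)
qed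

lemma funpow_trans: "(f ^^ m) x = y \<Longrightarrow> (f ^^ n) y = z \<Longrightarrow> (f ^^ (n + m)) x = z"
  by (simp add: funpow_add)

lemma runs_Then:
  assumes "runs c T n T1" "runs d T1 m T2"
  shows "runs (Then c d) T (n + m + 1) T2"
  unfolding Suc_eq_plus1[symmetric]
proof (rule runs_step)
  fix K
  obtain i where i: "i \<le> n" "(st ^^ i) (c # d # K, T) = (d # K, T1)" using assms(1) runs_def by blast
  obtain j where j: "j \<le> m" "(st ^^ j) (d # K, T1) = (K, T2)" using assms(2) runs_def by blast
  show "\<exists>l\<le>n + m. (st ^^ l) (st (Then c d # K, T)) = (K, T2)"
    using funpow_trans[OF i(2) j(2)] i(1) j(1) by (intro exI[of _ "j + i"]) simp
qed

lemma runs_Branch: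
  assumes "runs (if scan T i = a then c else d) T n T'"
  shows "runs (Branch i a c d) T (Suc n) T'"
  by (rule runs_step) (use assms in \<open>auto simp: runs_def\<close>)

lemma runs_Until_stop: "scan T i = a \<Longrightarrow> runs (Until i a c) T 1 T"
  unfolding runs_def by (auto intro!: exI[of _ 1])

lemma runs_Until_step:
  assumes "scan T i \<noteq> a" "runs c T n T1" "runs (Until i a c) T1 m T2"
  shows "runs (Until i a c) T (n + m + 1) T2"
  unfolding Suc_eq_plus1[symmetric]
proof (rule runs_step)
  fix K
  obtain l where i: "l \<le> n" "(st ^^ l) (c # Until i a c # K, T) = (Until i a c # K, T1)"
    using assms(2) runs_def by blast
  obtain j where j: "j \<le> m" "(st ^^ j) (Until i a c # K, T1) = (K, T2)" using assms(3) runs_def by blast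
  show "\<exists>l\<le>n + m. (st ^^ l) (st (Until i a c # K, T)) = (K, T2)"
    using funpow_trans[OF i(2) j(2)] i(1) j(1) assms(1) by (intro exI[of _ "j + l"]) simp
qed

text \<open>\<open>Ts j\<close> are the tapes before round \<open>j\<close>. A loop unfolds at its
  front, so the induction is on the number \<open>l\<close> of rounds still to come.\<close>

lemma runs_Until:
  assumes "\<And>j. j < m \<Longrightarrow> scan (Ts j) i \<noteq> a \<and> runs c (Ts j) n (Ts (Suc j))"
    and "scan (Ts m) i = a"
  shows "runs (Until i a c) (Ts 0) (m * (n + 1) + 1) (Ts m)"
proof -
  have "l \<le> m \<Longrightarrow> runs (Until i a c) (Ts (m - l)) (l * (n + 1) + 1) (Ts m)" for l
  proof (induction l)
    case 0
    then show ?case using runs_Until_stop[OF assms(2)] by simp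
  next
    case (Suc l)
    then have "m - Suc l < m" and eq: "Suc (m - Suc l) = m - l" by auto
    from runs_Until_step[OF conjunct1[OF assms(1)[OF this(1)]] conjunct2[OF assms(1)[OF this(1)], unfolded eq] Suc.IH]
    show ?case using Suc.prems by (simp add: algebra_simps)
  qed
  from this[of m] show ?thesis by simp
qed

section \<open>Loop programs over tables\<close>

datatype 't lp = LSkip | LSeq "'t lp" "'t lp" | LSet 't "nat list"
  | LIf 't "nat list" "'t lp" "'t lp" | LFor "'t lp"

type_synonym 't tabs = "'t \<Rightarrow> nat list \<Rightarrow> bool"

text \<open>All loops run over \<open>0, \<dots>, D - 1\<close>; the loop at nesting depth \<open>d\<close> binds variable \<open>d\<close>.\<close>

primrec exec :: "nat \<Rightarrow> 't lp \<Rightarrow> nat \<Rightarrow> (nat \<Rightarrow> nat) \<Rightarrow> 't tabs \<Rightarrow> 't tabs" where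
  "exec D LSkip d e R = R"
| "exec D (LSeq a b) d e R = exec D b d e (exec D a d e R)"
| "exec D (LSet t xs) d e R = R(t := (R t)(map e xs := True))"
| "exec D (LIf t xs a b) d e R = (if R t (map e xs) then exec D a d e R else exec D b d e R)"
| "exec D (LFor c) d e R = fold (\<lambda>i. exec D c (Suc d) (e(d := i))) [0..<D] R"

text \<open>Base-\<open>D\<close> notation with the least significant digit first, so an address is
  reached by adding digit times \<open>D ^ k\<close> while the argument list is traversed from the
  left.\<close>

primrec idx :: "nat \<Rightarrow> nat list \<Rightarrow> nat" where
  "idx D [] = 0"
| "idx D (x # xs) = x + D * idx D xs"

lemma idx_less: "set xs \<subseteq> {..<D} \<Longrightarrow> idx D xs < D ^ length xs"
proof (induction xs)
  case (Cons x xs)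
  then have "idx D xs + 1 \<le> D ^ length xs" "x < D" by auto
  then have "x + D * idx D xs < D * (idx D xs + 1)" by simp
  also have "\<dots> \<le> D * D ^ length xs" using \<open>idx D xs + 1 \<le> _\<close> mult_le_mono2 by blast
  finally show ?case by simp
qed simp

lemma idx_inj:
  "length xs = length ys \<Longrightarrow> set xs \<subseteq> {..<D} \<Longrightarrow> set ys \<subseteq> {..<D} \<Longrightarrow> idx D xs = idx D ys \<Longrightarrow> xs = ys"
proof (induction xs ys rule: list_induct2)
  case (Cons x xs y ys)
  then have "x < D" "y < D" "x + D * idx D xs = y + D * idx D ys" by auto
  then have "x = y \<and> idx D xs = idx D ys"
    by (metis add_left_cancel mod_less mod_mult_self2 mult_cancel1 not_less_zero)
  then show ?case using Cons by auto
qed simp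

text \<open>A loop variable is the head position on such a tape. The marks make both ends visible to
  the machine: \<open>1\<close> stops rewinding, and \<open>3\<close> at cell \<open>D\<close> ends
  the loop.\<close>

definition cnt :: "nat \<Rightarrow> int \<Rightarrow> nat" where
  "cnt D p = (if p = 0 then 1 else if p = int D then 3 else 0)"

definition tabf :: "nat \<Rightarrow> nat \<Rightarrow> (nat list \<Rightarrow> bool) \<Rightarrow> int \<Rightarrow> nat" where
  "tabf D a r p = (if p = 0 then 1
     else if \<exists>xs. length xs = a \<and> set xs \<subseteq> {..<D} \<and> p = 1 + int (idx D xs) \<and> r xs then 2 else 0)"

lemma cnt_simps [simp]: "cnt D 0 = 1" "0 < D \<Longrightarrow> cnt D (int D) = 3"
  "0 < m \<Longrightarrow> cnt D (int m) \<noteq> 1" "0 < m \<Longrightarrow> cnt D (int m) \<noteq> Suc 0" "m < D \<Longrightarrow> cnt D (int m) \<noteq> 3"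
  by (auto simp: cnt_def)

lemma tabf_0 [simp]: "tabf D a r 0 = 1"
  and tabf_pos: "0 < p \<Longrightarrow> tabf D a r p \<noteq> 1"
  by (auto simp: tabf_def)

lemma tabf_idx:
  assumes "length xs = a" "set xs \<subseteq> {..<D}"
  shows "tabf D a r (1 + int (idx D xs)) = 2 \<longleftrightarrow> r xs"
  using assms idx_inj[OF _ assms(2)] by (simp add: tabf_def) metis

lemma tabf_upd:
  assumes "length xs = a" "set xs \<subseteq> {..<D}"
  shows "(tabf D a r)(1 + int (idx D xs) := 2) = tabf D a (r(xs := True))"
proof
  fix p
  consider "p = 1 + int (idx D xs)" | "p \<noteq> 1 + int (idx D xs)" by blast
  then show "((tabf D a r)(1 + int (idx D xs) := 2)) p = tabf D a (r(xs := True)) p"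
  proof cases
    case 1
    then show ?thesis using assms by (auto simp: tabf_def)
  next
    case 2
    then have "(\<exists>ys. length ys = a \<and> set ys \<subseteq> {..<D} \<and> p = 1 + int (idx D ys) \<and> r ys) \<longleftrightarrow>
      (\<exists>ys. length ys = a \<and> set ys \<subseteq> {..<D} \<and> p = 1 + int (idx D ys) \<and> (r(xs := True)) ys)"
      by (metis fun_upd_other fun_upd_same)
    with 2 show ?thesis by (simp add: tabf_def)
  qed
qed

section \<open>Head movements and the addressing of table cells\<close>

definition rewind :: "nat \<Rightarrow> cmd" where
  "rewind i = Until i 1 (Move i (-1))"

lemma runs_rewind:
  assumes "T i = (f, int m)" "f 0 = 1" "\<And>p. 0 < p \<Longrightarrow> f (int p) \<noteq> 1"
  shows "runs (rewind i) T (2 * m + 1) (T(i := (f, 0)))"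
proof -
  define Ts where "Ts = (\<lambda>j. T(i := (f, int (m - j))))"
  have "runs (Until i 1 (Move i (-1))) (Ts 0) (m * (1 + 1) + 1) (Ts m)"
  proof (rule runs_Until)
    fix j assume "j < m"
    then have "Ts (Suc j) = (Ts j)(i := (fst (Ts j i), snd (Ts j i) + (-1)))"
      by (auto simp: Ts_def)
    then show "scan (Ts j) i \<noteq> 1 \<and> runs (Move i (-1)) (Ts j) 1 (Ts (Suc j))"
      using runs_Move[of i "-1" "Ts j"] assms(3)[of "m - j"] \<open>j < m\<close>
      by (simp add: scan_def) (simp add: Ts_def)
  qed (use assms in \<open>simp add: Ts_def scan_def\<close>)
  moreover have "Ts 0 = T" using assms(1) by (auto simp: Ts_def)
  ultimately show ?thesis by (simp add: Ts_def rewind_def mult_2 mult_2_right)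
qed

text \<open>
  Tape \<open>0\<close> holds the input. It is followed by one counter tape per loop variable, a scratch counter,
  \<open>A\<close> counters that stay at zero, and one tape per table. Cell \<open>0\<close> of a table's tape carries the
  marker \<open>1\<close>; the facts are the cells \<open>1 + idx D xs\<close> that carry \<open>2\<close>.
\<close>

locale layout =
  fixes ix :: "'t :: finite \<Rightarrow> nat" and ar :: "'t \<Rightarrow> nat" and V A nt :: nat
  assumes ix: "bij_betw ix UNIV {..<nt}" and ar_le: "\<And>t. ar t \<le> A"
begin

definition vt :: "nat \<Rightarrow> nat" where "vt v = 1 + v"
definition sc :: nat where "sc = 1 + V"
definition zt :: "nat \<Rightarrow> nat" where "zt k = 2 + V + k"
definition tt :: "'t \<Rightarrow> nat" where "tt t = 2 + V + A + ix t"
definition nm :: nat where "nm = 2 + V + A + nt"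

lemmas lay_defs = vt_def sc_def zt_def tt_def

lemma inj_ix: "ix s = ix t \<longleftrightarrow> s = t"
  using ix by (auto simp: bij_betw_def inj_on_def)

lemma ix_less: "ix t < nt"
  using ix by (auto simp: bij_betw_def)

text \<open>The configuration between two commands: the heads of tables and auxiliary counters rest
  at cell \<open>0\<close>, and only the counters of loop variables carry a value. Every compiled
  command restores this form.\<close>

definition mk :: "nat \<Rightarrow> (nat \<Rightarrow> nat) \<Rightarrow> 't tabs \<Rightarrow> tape \<Rightarrow> tapes" where
  "mk D e R x i = (if i = 0 then x else if i \<le> V then (cnt D, int (e (i - 1)))
     else if i < 2 + V + A then (cnt D, 0)
     else if i < nm then let t = inv ix (i - (2 + V + A)) in (tabf D (ar t) (R t), 0)
     else (\<lambda>_. 0, 0))"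

lemma inv_ix [simp]: "inv ix (ix t) = t"
  using ix by (simp add: bij_betw_def)

lemma mk_simps [simp]:
  "v < V \<Longrightarrow> mk D e R x (vt v) = (cnt D, int (e v))"
  "mk D e R x sc = (cnt D, 0)"
  "k < A \<Longrightarrow> mk D e R x (zt k) = (cnt D, 0)"
  "mk D e R x (tt t) = (tabf D (ar t) (R t), 0)"
  using ix_less[of t] by (auto simp: mk_def lay_defs nm_def)

lemma mk_upd_var: "v < V \<Longrightarrow> (mk D e R x)(vt v := (cnt D, int j)) = mk D (e(v := j)) R x"
  by (rule ext) (auto simp: mk_def lay_defs)

lemma tt_eq [simp]: "tt s = tt t \<longleftrightarrow> s = t"
  by (simp add: tt_def inj_ix)

lemma mk_upd_tab: "(mk D e R x)(tt t := (tabf D (ar t) r, 0)) = mk D e (R(t := r)) x"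
proof
  fix i
  show "((mk D e R x)(tt t := (tabf D (ar t) r, 0))) i = mk D e (R(t := r)) x i"
  proof (cases "i \<ge> 2 + V + A \<and> i < nm")
    case True
    then have "i - (2 + V + A) \<in> {..<nt}" by (auto simp: nm_def)
    then obtain s where s: "i - (2 + V + A) = ix s" using ix by (auto simp: bij_betw_def)
    have "i = tt s" using True s unfolding tt_def by linarith
    then show ?thesis by simp
  qed (use ix_less[of t] in \<open>auto simp: mk_def tt_def nm_def\<close>)
qed

text \<open>Adds \<open>D ^ k\<close> to a head position. The machine knows \<open>D\<close> only as
  the length of its counters, so the power is spelled out by \<open>k\<close> nested loops, each on
  a counter of its own.\<close>

primrec move_pow :: "nat \<Rightarrow> nat \<Rightarrow> cmd" where
  "move_pow t 0 = Move t 1"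
| "move_pow t (Suc k) = Then (Until (zt k) 3 (Then (move_pow t k) (Move (zt k) 1))) (rewind (zt k))"

primrec move_pow_time :: "nat \<Rightarrow> nat poly" where
  "move_pow_time 0 = 1"
| "move_pow_time (Suc k) = [:0, 1:] * (move_pow_time k + 5) + 3"

lemma runs_move_pow:
  "0 < D \<Longrightarrow> \<forall>j<k. T (zt j) = (cnt D, 0) \<Longrightarrow> 2 + V + k \<le> t \<Longrightarrow> T t = (f, h)
     \<Longrightarrow> runs (move_pow t k) T (poly (move_pow_time k) D) (T(t := (f, h + int (D ^ k))))"
proof (induction k arbitrary: T f h)
  case 0
  then show ?case using runs_Move[of t 1 T] by (simp add: fun_upd_def)
next
  case (Suc k)
  note as = Suc.prems
  have neq: "t \<noteq> zt k" and neqz: "\<And>j. j < k \<Longrightarrow> zt j \<noteq> t \<and> zt j \<noteq> zt k"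
    using as(3) by (auto simp: zt_def)
  define Ts where "Ts = (\<lambda>j. T(zt k := (cnt D, int j), t := (f, h + int (j * D ^ k))))"
  let ?p = "poly (move_pow_time k) D"
  have 1: "runs (Until (zt k) 3 (Then (move_pow t k) (Move (zt k) 1))) (Ts 0) (D * ((?p + 1 + 1) + 1) + 1) (Ts D)"
  proof (rule runs_Until)
    fix j assume j: "j < D"
    have 1: "runs (move_pow t k) (Ts j) ?p ((Ts j)(t := (f, h + int (j * D ^ k) + int (D ^ k))))"
      by (rule Suc.IH) (use as neqz in \<open>auto simp: Ts_def\<close>)
    have 2: "runs (Move (zt k) 1) ((Ts j)(t := (f, h + int (j * D ^ k) + int (D ^ k)))) 1 (Ts (Suc j))"
      using runs_Move[of "zt k" 1 "(Ts j)(t := (f, h + int (j * D ^ k) + int (D ^ k)))"] neq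
      by (simp add: Ts_def fun_upd_twist[of t "zt k"] algebra_simps)
    show "scan (Ts j) (zt k) \<noteq> 3 \<and>
        runs (Then (move_pow t k) (Move (zt k) 1)) (Ts j) (?p + 1 + 1) (Ts (Suc j))"
      using runs_Then[OF 1 2] j neq by (simp add: scan_def Ts_def)
  qed (use as neq in \<open>simp add: Ts_def scan_def\<close>)
  have 2: "runs (rewind (zt k)) (Ts D) (2 * D + 1) ((Ts D)(zt k := (cnt D, 0)))"
    by (rule runs_rewind) (use neq in \<open>auto simp: Ts_def\<close>)
  have "Ts 0 = T" using as neq by (auto simp: Ts_def)
  moreover have "(Ts D)(zt k := (cnt D, 0)) = T(t := (f, h + int (D ^ Suc k)))"
    using as neq by (auto simp: Ts_def)
  moreover have "D * ((?p + 1 + 1) + 1) + 1 + (2 * D + 1) + 1 = poly (move_pow_time (Suc k)) D"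
    by (simp add: algebra_simps)
  ultimately show ?case using runs_Then[OF 1 2] by (simp only: move_pow.simps)
qed

text \<open>Counting the value of counter \<open>i\<close> down destroys it. The scratch counter
  \<open>sc\<close> records the rounds, and a second loop pays them back.\<close>

definition move_mul :: "nat \<Rightarrow> nat \<Rightarrow> nat \<Rightarrow> cmd" where
  "move_mul t i k = Then (Until i 1 (Then (move_pow t k) (Then (Move i (-1)) (Move sc 1))))
     (Until sc 1 (Then (Move sc (-1)) (Move i 1)))"

definition move_mul_time :: "nat \<Rightarrow> nat poly" where
  "move_mul_time k = [:0, 1:] * (move_pow_time k + 9) + 3"

lemma runs_move_mul:
  assumes as: "0 < D" "m < D" "\<forall>j<k. T (zt j) = (cnt D, 0)" "2 + V + k \<le> t"
      "i < sc" "T i = (cnt D, int m)" "T sc = (cnt D, 0)" "T t = (f, h)"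
  shows "runs (move_mul t i k) T (poly (move_mul_time k) D) (T(t := (f, h + int (m * D ^ k))))"
proof -
  have neq: "i \<noteq> sc" "i \<noteq> t" "sc \<noteq> t" "sc \<noteq> i" "t \<noteq> sc" "t \<noteq> i" and neqz: "\<And>j. zt j \<noteq> sc \<and> zt j \<noteq> i"
    using as(4,5) by (auto simp: zt_def sc_def)
  have neqz': "\<And>j. j < k \<Longrightarrow> zt j \<noteq> t" using as(4) by (auto simp: zt_def)
  let ?p = "poly (move_pow_time k) D"
  have down: "runs (Then (Move a (-1)) (Move b 1)) S (1 + 1 + 1)
      (S(a := (fst (S a), snd (S a) - 1), b := (fst (S b), snd (S b) + 1)))" if "a \<noteq> b" for a b S
    using runs_Then[OF runs_Move[of a "-1" S] runs_Move[of b 1]] that by simp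
  define Ts where "Ts = (\<lambda>j. T(i := (cnt D, int (m - j)), sc := (cnt D, int j), t := (f, h + int (j * D ^ k))))"
  have 1: "runs (Until i 1 (Then (move_pow t k) (Then (Move i (-1)) (Move sc 1)))) (Ts 0)
      (m * ((?p + (1 + 1 + 1) + 1) + 1) + 1) (Ts m)"
  proof (rule runs_Until)
    fix j assume j: "j < m"
    define S where "S = (Ts j)(t := (f, h + int (j * D ^ k) + int (D ^ k)))"
    have 1: "runs (move_pow t k) (Ts j) ?p S"
      unfolding S_def by (rule runs_move_pow) (use as neqz neqz' in \<open>auto simp: Ts_def\<close>)
    have "S(i := (fst (S i), snd (S i) - 1), sc := (fst (S sc), snd (S sc) + 1)) = Ts (Suc j)"
      using neq j by (auto simp: S_def Ts_def algebra_simps of_nat_diff)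
    then have 2: "runs (Then (Move i (-1)) (Move sc 1)) S (1 + 1 + 1) (Ts (Suc j))"
      using down[OF neq(1), of S] by metis
    have "scan (Ts j) i \<noteq> 1" using j neq cnt_simps(4)[of "m - j" D] by (simp add: scan_def Ts_def)
    then show "scan (Ts j) i \<noteq> 1 \<and>
        runs (Then (move_pow t k) (Then (Move i (-1)) (Move sc 1))) (Ts j) (?p + (1 + 1 + 1) + 1) (Ts (Suc j))"
      using runs_Then[OF 1 2] by (intro conjI)
  qed (use as neq in \<open>simp add: Ts_def scan_def\<close>)
  define Us where "Us = (\<lambda>j. T(i := (cnt D, int j), sc := (cnt D, int (m - j)), t := (f, h + int (m * D ^ k))))"
  have 2: "runs (Until sc 1 (Then (Move sc (-1)) (Move i 1))) (Us 0) (m * ((1 + 1 + 1) + 1) + 1) (Us m)"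
  proof (rule runs_Until)
    fix j assume j: "j < m"
    have "(Us j)(sc := (fst (Us j sc), snd (Us j sc) - 1), i := (fst (Us j i), snd (Us j i) + 1)) = Us (Suc j)"
      using neq j by (auto simp: Us_def algebra_simps of_nat_diff)
    then have "runs (Then (Move sc (-1)) (Move i 1)) (Us j) (1 + 1 + 1) (Us (Suc j))"
      using down[OF neq(4), of "Us j"] by metis
    moreover have "scan (Us j) sc \<noteq> 1" using j neq cnt_simps(4)[of "m - j" D] by (simp add: scan_def Us_def)
    ultimately show "scan (Us j) sc \<noteq> 1 \<and>
        runs (Then (Move sc (-1)) (Move i 1)) (Us j) (1 + 1 + 1) (Us (Suc j))" by (intro conjI)
  qed (use as neq in \<open>simp add: Us_def scan_def\<close>)
  have eq: "Us 0 = Ts m" by (simp add: Ts_def Us_def)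
  have 3: "Ts 0 = T" using as neq by (auto simp: Ts_def)
  have 4: "Us m = T(t := (f, h + int (m * D ^ k)))" using as neq by (auto simp: Us_def)
  have "m * (?p + 9) \<le> D * (?p + 9)" using as(2) by simp
  then have 5: "(m * ((?p + (1 + 1 + 1) + 1) + 1) + 1) + (m * ((1 + 1 + 1) + 1) + 1) + 1 \<le> poly (move_mul_time k) D"
    by (simp add: move_mul_time_def algebra_simps)
  show ?thesis
    using runs_mono[OF runs_Then[OF 1 2[unfolded eq]] 5] unfolding move_mul_def 3 4 .
qed

primrec seek_from :: "nat \<Rightarrow> nat list \<Rightarrow> nat \<Rightarrow> cmd" where
  "seek_from t [] k = Move t 0"
| "seek_from t (v # vs) k = Then (move_mul t (vt v) k) (seek_from t vs (Suc k))"

primrec seek_time :: "nat list \<Rightarrow> nat \<Rightarrow> nat poly" where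
  "seek_time [] k = 1"
| "seek_time (v # vs) k = move_mul_time k + seek_time vs (Suc k) + 1"

lemma runs_seek_from:
  "k + length vs \<le> A \<Longrightarrow> set vs \<subseteq> {..<V} \<Longrightarrow> 0 < D \<Longrightarrow> \<forall>v\<in>set vs. e v < D \<Longrightarrow> 2 + V + A \<le> t \<Longrightarrow>
   T = (mk D e R x)(t := (f, h)) \<Longrightarrow>
   runs (seek_from t vs k) T (poly (seek_time vs k) D) (T(t := (f, h + int (D ^ k * idx D (map e vs)))))"
proof (induction vs arbitrary: k T h)
  case Nil
  then show ?case using runs_Move[of t 0 T] by (simp add: fun_upd_def)
next
  case (Cons v vs)
  note as = Cons.prems
  have v: "v < V" "k < A" "sc \<noteq> t" "vt v \<noteq> t" "t \<noteq> vt v" "vt v < sc" "2 + V + k \<le> t"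
    "\<And>j. j < k \<Longrightarrow> zt j \<noteq> t"
    using as by (auto simp: lay_defs)
  have 1: "runs (move_mul t (vt v) k) T (poly (move_mul_time k) D) (T(t := (f, h + int (e v * D ^ k))))"
    by (rule runs_move_mul) (use as v in auto)
  have 2: "runs (seek_from t vs (Suc k)) (T(t := (f, h + int (e v * D ^ k)))) (poly (seek_time vs (Suc k)) D)
     ((T(t := (f, h + int (e v * D ^ k))))(t := (f, h + int (e v * D ^ k) + int (D ^ Suc k * idx D (map e vs)))))"
    by (rule Cons.IH) (use as in auto)
  have "h + int (e v * D ^ k) + int (D ^ Suc k * idx D (map e vs)) = h + int (D ^ k * idx D (map e (v # vs)))"
    by (simp add: algebra_simps)
  with runs_Then[OF 1 2] show ?case
    unfolding fun_upd_upd seek_from.simps seek_time.simps poly_add poly_1 by argo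
qed

text \<open>The initial move steps over the marker in cell \<open>0\<close>.\<close>

definition seek :: "'t \<Rightarrow> nat list \<Rightarrow> cmd" where
  "seek t vs = Then (Move (tt t) 1) (seek_from (tt t) vs 0)"

lemma runs_seek:
  assumes "length vs = ar t" "set vs \<subseteq> {..<V}" "0 < D" "\<forall>v\<in>set vs. e v < D"
  shows "runs (seek t vs) (mk D e R x) (poly (seek_time vs 0 + 2) D)
      ((mk D e R x)(tt t := (tabf D (ar t) (R t), 1 + int (idx D (map e vs)))))"
proof -
  have 1: "runs (Move (tt t) 1) (mk D e R x) 1 ((mk D e R x)(tt t := (tabf D (ar t) (R t), 1)))"
    using runs_Move[of "tt t" 1 "mk D e R x"] by simp
  have 2: "runs (seek_from (tt t) vs 0) ((mk D e R x)(tt t := (tabf D (ar t) (R t), 1))) (poly (seek_time vs 0) D)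
    (((mk D e R x)(tt t := (tabf D (ar t) (R t), 1)))(tt t := (tabf D (ar t) (R t), 1 + int (D ^ 0 * idx D (map e vs)))))"
    by (rule runs_seek_from) (use assms ar_le[of t] in \<open>auto simp: tt_def\<close>)
  from runs_Then[OF 1 2] show ?thesis by (simp add: seek_def)
qed

section \<open>Compilation of loop programs\<close>

primrec comp :: "'t lp \<Rightarrow> nat \<Rightarrow> cmd" where
  "comp LSkip d = Move 0 0"
| "comp (LSeq a b) d = Then (comp a d) (comp b d)"
| "comp (LSet t vs) d = Then (seek t vs) (Then (Write (tt t) 2) (rewind (tt t)))"
| "comp (LIf t vs a b) d = Then (seek t vs)
     (Branch (tt t) 2 (Then (rewind (tt t)) (comp a d)) (Then (rewind (tt t)) (comp b d)))"
| "comp (LFor c) d = Then (Until (vt d) 3 (Then (comp c (Suc d)) (Move (vt d) 1))) (rewind (vt d))"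

primrec comp_time :: "'t lp \<Rightarrow> nat poly" where
  "comp_time LSkip = 1"
| "comp_time (LSeq a b) = comp_time a + comp_time b + 1"
| "comp_time (LSet t vs) = seek_time vs 0 + 8 + 2 * monom 1 (ar t)"
| "comp_time (LIf t vs a b) = seek_time vs 0 + comp_time a + comp_time b + 8 + 2 * monom 1 (ar t)"
| "comp_time (LFor c) = [:0, 1:] * (comp_time c + 5) + 3"

primrec wfl :: "'t lp \<Rightarrow> nat \<Rightarrow> bool" where
  "wfl LSkip d \<longleftrightarrow> True"
| "wfl (LSeq a b) d \<longleftrightarrow> wfl a d \<and> wfl b d"
| "wfl (LSet t vs) d \<longleftrightarrow> length vs = ar t \<and> set vs \<subseteq> {..<d} \<and> d \<le> V"
| "wfl (LIf t vs a b) d \<longleftrightarrow> length vs = ar t \<and> set vs \<subseteq> {..<d} \<and> d \<le> V \<and> wfl a d \<and> wfl b d"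
| "wfl (LFor c) d \<longleftrightarrow> d < V \<and> wfl c (Suc d)"

text \<open>A loop does not initialise its counter; it relies on finding it at \<open>0\<close> and
  leaves it there. Hence the unbound variables are required to have value \<open>0\<close>.\<close>

lemma runs_comp:
  "wfl c d \<Longrightarrow> 0 < D \<Longrightarrow> \<forall>v<d. e v < D \<Longrightarrow> \<forall>v\<ge>d. e v = 0 \<Longrightarrow>
     runs (comp c d) (mk D e R x) (poly (comp_time c) D) (mk D e (exec D c d e R) x)"
proof (induction c arbitrary: d e R)
  case LSkip
  then show ?case using runs_Move[of 0 0 "mk D e R x"] by simp
next
  case (LSeq a b)
  have 1: "runs (comp a d) (mk D e R x) (poly (comp_time a) D) (mk D e (exec D a d e R) x)"
    using LSeq by simp
  have 2: "runs (comp b d) (mk D e (exec D a d e R) x) (poly (comp_time b) D) (mk D e (exec D b d e (exec D a d e R)) x)"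
    using LSeq by simp
  from runs_Then[OF 1 2] show ?case by simp
next
  case (LSet t vs)
  let ?xs = "map e vs" let ?T = "mk D e R x"
  have xs: "length ?xs = ar t" "set ?xs \<subseteq> {..<D}" using LSet by auto
  have 1: "runs (seek t vs) ?T (poly (seek_time vs 0 + 2) D) (?T(tt t := (tabf D (ar t) (R t), 1 + int (idx D ?xs))))"
    by (rule runs_seek) (use LSet in auto)
  have 2: "runs (Write (tt t) 2) (?T(tt t := (tabf D (ar t) (R t), 1 + int (idx D ?xs)))) 1
      (?T(tt t := (tabf D (ar t) ((R t)(?xs := True)), 1 + int (idx D ?xs))))"
    using runs_Write[of "tt t" 2 "?T(tt t := (tabf D (ar t) (R t), 1 + int (idx D ?xs)))"]
    by (simp add: tabf_upd[OF xs])
  have 3: "runs (rewind (tt t)) (?T(tt t := (tabf D (ar t) ((R t)(?xs := True)), 1 + int (idx D ?xs))))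
    (2 * (1 + idx D ?xs) + 1)
    ((?T(tt t := (tabf D (ar t) ((R t)(?xs := True)), 1 + int (idx D ?xs))))(tt t := (tabf D (ar t) ((R t)(?xs := True)), 0)))"
    by (rule runs_rewind) (use tabf_pos in auto)
  have "idx D ?xs < D ^ ar t" using idx_less[OF xs(2)] xs(1) by simp
  then have le: "poly (seek_time vs 0 + 2) D + (1 + (2 * (1 + idx D ?xs) + 1) + 1) + 1 \<le> poly (comp_time (LSet t vs)) D"
    by (simp add: poly_monom)
  from runs_mono[OF runs_Then[OF 1 runs_Then[OF 2 3]] le]
  show ?case unfolding fun_upd_upd mk_upd_tab comp.simps exec.simps .
next
  case (LIf t vs a b)
  let ?xs = "map e vs" let ?T = "mk D e R x"
  let ?S = "?T(tt t := (tabf D (ar t) (R t), 1 + int (idx D ?xs)))"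
  let ?p = "poly (comp_time a) D" and ?q = "poly (comp_time b) D"
  have xs: "length ?xs = ar t" "set ?xs \<subseteq> {..<D}" using LIf.prems by auto
  have 1: "runs (seek t vs) ?T (poly (seek_time vs 0 + 2) D) ?S"
    by (rule runs_seek) (use LIf.prems in auto)
  have "runs (rewind (tt t)) ?S (2 * (1 + idx D ?xs) + 1) (?S(tt t := (tabf D (ar t) (R t), 0)))"
    by (rule runs_rewind) (use tabf_pos in auto)
  moreover have "?S(tt t := (tabf D (ar t) (R t), 0)) = ?T"
    using mk_upd_tab[of D e R x t "R t"] by simp
  ultimately have 2: "runs (rewind (tt t)) ?S (2 * (1 + idx D ?xs) + 1) ?T" by (simp only:)
  have 3: "runs (if R t ?xs then Then (rewind (tt t)) (comp a d) else Then (rewind (tt t)) (comp b d)) ?S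
     (2 * (1 + idx D ?xs) + 1 + (?p + ?q) + 1) (mk D e (exec D (LIf t vs a b) d e R) x)"
  proof (cases "R t ?xs")
    case True
    have "runs (comp a d) ?T (?p + ?q) (mk D e (exec D a d e R) x)"
      by (rule runs_mono[of _ _ ?p]) (use LIf in auto)
    from runs_Then[OF 2 this] True show ?thesis by simp
  next
    case False
    have "runs (comp b d) ?T (?p + ?q) (mk D e (exec D b d e R) x)"
      by (rule runs_mono[of _ _ ?q]) (use LIf in auto)
    from runs_Then[OF 2 this] False show ?thesis by simp
  qed
  have sc: "scan ?S (tt t) = 2 \<longleftrightarrow> R t ?xs"
    using tabf_idx[OF xs] by (simp add: scan_def)
  have 4: "runs (Branch (tt t) 2 (Then (rewind (tt t)) (comp a d)) (Then (rewind (tt t)) (comp b d))) ?S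
     (Suc (2 * (1 + idx D ?xs) + 1 + (?p + ?q) + 1)) (mk D e (exec D (LIf t vs a b) d e R) x)"
    by (rule runs_Branch) (unfold sc, rule 3)
  have "idx D ?xs < D ^ ar t" using idx_less[OF xs(2)] xs(1) by simp
  then have le: "poly (seek_time vs 0 + 2) D + Suc (2 * (1 + idx D ?xs) + 1 + (?p + ?q) + 1) + 1
      \<le> poly (comp_time (LIf t vs a b)) D"
    by (simp add: poly_monom)
  from runs_mono[OF runs_Then[OF 1 4] le] show ?case by (simp only: comp.simps)
next
  case (LFor c)
  note as = LFor.prems(2-4)
  have dV: "d < V" using LFor.prems by simp
  let ?p = "poly (comp_time c) D"
  define Rs where "Rs = (\<lambda>j. fold (\<lambda>i. exec D c (Suc d) (e(d := i))) [0..<j] R)"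
  define Ts where "Ts = (\<lambda>j. mk D (e(d := j)) (Rs j) x)"
  have 1: "runs (Until (vt d) 3 (Then (comp c (Suc d)) (Move (vt d) 1))) (Ts 0) (D * ((?p + 1 + 1) + 1) + 1) (Ts D)"
  proof (rule runs_Until)
    fix j assume j: "j < D"
    have "runs (comp c (Suc d)) (mk D (e(d := j)) (Rs j) x) ?p (mk D (e(d := j)) (exec D c (Suc d) (e(d := j)) (Rs j)) x)"
      by (rule LFor.IH) (use LFor.prems j in \<open>auto simp: less_Suc_eq\<close>)
    then have 1: "runs (comp c (Suc d)) (Ts j) ?p (mk D (e(d := j)) (Rs (Suc j)) x)"
      by (simp add: Ts_def Rs_def)
    have 2: "runs (Move (vt d) 1) (mk D (e(d := j)) (Rs (Suc j)) x) 1 (Ts (Suc j))"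
      using runs_Move[of "vt d" 1 "mk D (e(d := j)) (Rs (Suc j)) x"] dV
        mk_upd_var[OF dV, of D "e(d := j)" "Rs (Suc j)" x "Suc j"]
      by (simp add: Ts_def add.commute)
    show "scan (Ts j) (vt d) \<noteq> 3 \<and> runs (Then (comp c (Suc d)) (Move (vt d) 1)) (Ts j)
        (?p + 1 + 1) (Ts (Suc j))"
      using runs_Then[OF 1 2] dV j by (simp add: scan_def Ts_def)
  qed (use as dV in \<open>simp add: scan_def Ts_def\<close>)
  have 2: "runs (rewind (vt d)) (Ts D) (2 * D + 1) ((Ts D)(vt d := (cnt D, 0)))"
    by (rule runs_rewind) (use dV in \<open>auto simp: Ts_def\<close>)
  have e0: "e(d := 0) = e" using as(3) by auto
  have end_eq: "(Ts D)(vt d := (cnt D, 0)) = mk D e (Rs D) x"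
    using mk_upd_var[OF dV, of D "e(d := D)" "Rs D" x 0] e0 by (simp add: Ts_def)
  have start_eq: "Ts 0 = mk D e R x" using e0 by (simp add: Ts_def Rs_def)
  have time: "D * ((?p + 1 + 1) + 1) + 1 + (2 * D + 1) + 1 = poly (comp_time (LFor c)) D"
    by (simp add: algebra_simps)
  have ex: "exec D (LFor c) d e R = Rs D" by (simp add: Rs_def)
  show ?case
    using runs_Then[OF 1 2] unfolding start_eq end_eq time ex comp.simps .
qed

end

section \<open>Setting up the tapes\<close>

definition bit_tab :: "'t \<Rightarrow> bool list \<Rightarrow> 't tabs" where
  "bit_tab bt w t xs \<longleftrightarrow> t = bt \<and> (\<exists>i<length w. xs = [i] \<and> w ! i)"

primrec seqs :: "cmd list \<Rightarrow> cmd" where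
  "seqs [] = Move 0 0"
| "seqs (c # cs) = Then c (seqs cs)"

lemma runs_skip: "runs (Move 0 0) T 1 T"
  using runs_Move[of 0 0 T] by simp

lemma runs_seqs:
  assumes "\<And>i T. i \<in> set is \<Longrightarrow> T i = T0 i \<Longrightarrow> runs (c i) T n (T(i := g i))" "distinct is"
  shows "runs (seqs (map c is)) T0 (length is * (n + 1) + 1) (\<lambda>i. if i \<in> set is then g i else T0 i)"
proof -
  have "runs (seqs (map c js)) T (length js * (n + 1) + 1) (\<lambda>i. if i \<in> set js then g i else T i)"
    if "set js \<subseteq> set is" "distinct js" "\<And>i. i \<in> set js \<Longrightarrow> T i = T0 i" for js T
    using that
  proof (induction js arbitrary: T)
    case Nil
    then show ?case using runs_skip by simp
  next
    case (Cons j js)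
    have 1: "runs (c j) T n (T(j := g j))" using assms(1) Cons.prems by simp
    have 2: "runs (seqs (map c js)) (T(j := g j)) (length js * (n + 1) + 1)
        (\<lambda>i. if i \<in> set js then g i else (T(j := g j)) i)"
      by (rule Cons.IH) (use Cons.prems in auto)
    have "(\<lambda>i. if i \<in> set js then g i else (T(j := g j)) i) = (\<lambda>i. if i \<in> set (j # js) then g i else T i)"
      by auto
    with runs_Then[OF 1 2] show ?case by (simp add: algebra_simps)
  qed
  then show ?thesis using assms(2) by blast
qed

context layout
begin

definition counters :: "nat list" where "counters = [1..<2 + V + A]"

text \<open>The heads of the counters accompany the head of the input and so learn its length. One
  further move puts the end mark at \<open>length w + 1\<close>: the values of a variable are then
  all positions of the word, including the one behind its last bit.\<close>

definition load :: "'t \<Rightarrow> cmd" where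
  "load bt = Then (seqs (map (\<lambda>i. Write i 1) [1..<nm])) (Then (Move (tt bt) 1)
     (Then (Until 0 0 (Then (Branch 0 2 (Write (tt bt) 2) (Move 0 0))
              (seqs (map (\<lambda>i. Move i 1) (tt bt # 0 # counters)))))
     (Then (seqs (map (\<lambda>i. Move i 1) counters)) (Then (seqs (map (\<lambda>i. Write i 3) counters))
     (Then (seqs (map rewind counters)) (rewind (tt bt)))))))"

text \<open>The invariant of the scanning loop after \<open>k\<close> bits.\<close>

definition load_tapes :: "'t \<Rightarrow> bool list \<Rightarrow> nat \<Rightarrow> tapes" where
  "load_tapes bt w k i = (if i = 0 then (fst (input_tape w), int k)
     else if i < 2 + V + A then ((\<lambda>_. 0)(0 := 1), int k)
     else if i = tt bt then (\<lambda>p. if p = 0 then 1 else if 0 < p \<and> p \<le> int k \<and> w ! nat (p - 1) then 2 else 0, 1 + int k)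
     else if i < nm then ((\<lambda>_. 0)(0 := 1), 0) else (\<lambda>_. 0, 0))"

lemma tt_facts: "2 + V + A \<le> tt t" "tt t < nm" "tt t \<noteq> 0"
  using ix_less[of t] by (auto simp: tt_def nm_def)

lemma runs_load:
  assumes bt: "ar bt = 1"
  shows "\<exists>p :: nat poly. \<forall>w. runs (load bt) (start_tapes w) (poly p (length w))
     (mk (length w + 1) (\<lambda>_. 0) (bit_tab bt w) (fst (input_tape w), int (length w)))"
proof -
  define C where "C = length counters"
  have setC: "set counters = {1..<2 + V + A}" "distinct counters" by (auto simp: counters_def)
  have R: "runs (load bt) (start_tapes w)
     ((nm - 1) * (1 + 1) + 1 + (1 + ((length w * ((1 + 1 + ((C + 2) * (1 + 1) + 1) + 1) + 1) + 1) +
       ((C * (1 + 1) + 1) + ((C * (1 + 1) + 1) + ((C * ((2 * (length w + 1) + 1) + 1) + 1) +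
       (2 * (1 + length w) + 1) + 1) + 1) + 1) + 1) + 1) + 1)
     (mk (length w + 1) (\<lambda>_. 0) (bit_tab bt w) (fst (input_tape w), int (length w)))" for w
  proof -
    let ?N = "length w" let ?L = "load_tapes bt w"
    define T1 where "T1 = (\<lambda>i. if i \<in> set [1..<nm] then ((\<lambda>_. 0)(0 := 1), 0) else start_tapes w i)"
    have 1: "runs (seqs (map (\<lambda>i. Write i 1) [1..<nm])) (start_tapes w) (length [1..<nm] * (1 + 1) + 1) T1"
      unfolding T1_def
    proof (rule runs_seqs)
      fix i T assume "i \<in> set [1..<nm]" and T: "T i = start_tapes w i"
      then have "T i = (\<lambda>_. 0, 0)" by (auto simp: start_tapes_def)
      then show "runs (Write i 1) T 1 (T(i := ((\<lambda>_. 0)(0 := 1), 0)))" using runs_Write[of i 1 T] by simp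
    qed simp
    have "T1(tt bt := (fst (T1 (tt bt)), snd (T1 (tt bt)) + 1)) = ?L 0"
    proof
      fix i
      have "(\<lambda>p. if p = 0 then 1 else if 0 < p \<and> p \<le> 0 \<and> w ! nat (p - 1) then 2 else 0) = (\<lambda>_ :: int. 0 :: nat)(0 := 1)"
        by auto
      then show "(T1(tt bt := (fst (T1 (tt bt)), snd (T1 (tt bt)) + 1))) i = ?L 0 i"
        using tt_facts[of bt] by (auto simp: T1_def load_tapes_def start_tapes_def input_tape_def nm_def)
    qed
    then have 2: "runs (Move (tt bt) 1) T1 1 (?L 0)" using runs_Move[of "tt bt" 1 T1] by simp
    have 3: "runs (Until 0 0 (Then (Branch 0 2 (Write (tt bt) 2) (Move 0 0))
         (seqs (map (\<lambda>i. Move i 1) (tt bt # 0 # counters))))) (?L 0)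
         (?N * ((1 + 1 + ((C + 2) * (1 + 1) + 1) + 1) + 1) + 1) (?L ?N)"
    proof (rule runs_Until)
      fix k assume k: "k < ?N"
      have sc: "scan (?L k) 0 = (if w ! k then 2 else 1)"
        using k by (simp add: scan_def load_tapes_def input_tape_def)
      define S where "S = (if w ! k then (?L k)(tt bt := ((fst (?L k (tt bt)))(1 + int k := 2), 1 + int k)) else ?L k)"
      have sn: "snd (?L k (tt bt)) = 1 + int k" using tt_facts[of bt] by (simp add: load_tapes_def)
      have b: "runs (Branch 0 2 (Write (tt bt) 2) (Move 0 0)) (?L k) (1 + 1) S"
        unfolding Suc_eq_plus1[symmetric]
        by (rule runs_Branch) (use sc runs_Write[of "tt bt" 2 "?L k"] runs_skip[of "?L k"] sn in \<open>simp add: S_def\<close>)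
      have m: "runs (seqs (map (\<lambda>i. Move i 1) (tt bt # 0 # counters))) S
          (length (tt bt # 0 # counters) * (1 + 1) + 1)
          (\<lambda>i. if i \<in> set (tt bt # 0 # counters) then (fst (S i), snd (S i) + 1) else S i)"
      proof (rule runs_seqs)
        fix i T assume "T i = S i"
        then show "runs (Move i 1) T 1 (T(i := (fst (S i), snd (S i) + 1)))"
          using runs_Move[of i 1 T] by simp
      qed (use setC tt_facts[of bt] in auto)
      have "(\<lambda>i. if i \<in> set (tt bt # 0 # counters) then (fst (S i), snd (S i) + 1) else S i) = ?L (Suc k)"
      proof
        fix i
        have "fst (S (tt bt)) = (\<lambda>p. if p = 0 then 1 else if 0 < p \<and> p \<le> int (Suc k) \<and> w ! nat (p - 1) then 2 else 0)"
          using tt_facts[of bt] by (auto simp: S_def load_tapes_def fun_eq_iff) (smt (verit) nat_int)+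
        then show "(if i \<in> set (tt bt # 0 # counters) then (fst (S i), snd (S i) + 1) else S i) = ?L (Suc k) i"
          using tt_facts[of bt] by (auto simp: setC S_def load_tapes_def)
      qed
      with runs_Then[OF b m] sc
      show "scan (?L k) 0 \<noteq> 0 \<and> runs (Then (Branch 0 2 (Write (tt bt) 2) (Move 0 0))
         (seqs (map (\<lambda>i. Move i 1) (tt bt # 0 # counters)))) (?L k) (1 + 1 + ((C + 2) * (1 + 1) + 1) + 1) (?L (Suc k))"
        by (simp add: C_def)
    qed (simp add: scan_def load_tapes_def input_tape_def)
    define S1 where "S1 = (\<lambda>i. if i \<in> set counters then ((\<lambda>_. 0)(0 := 1), int (?N + 1)) else ?L ?N i)"
    have 4: "runs (seqs (map (\<lambda>i. Move i 1) counters)) (?L ?N) (C * (1 + 1) + 1) S1"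
      unfolding S1_def C_def
    proof (rule runs_seqs)
      fix i T assume "i \<in> set counters" "T i = ?L ?N i"
      then show "runs (Move i 1) T 1 (T(i := ((\<lambda>_. 0)(0 := 1), int (?N + 1))))"
        using runs_Move[of i 1 T] by (simp add: load_tapes_def setC add.commute)
    qed (rule setC)
    define S2 where "S2 = (\<lambda>i. if i \<in> set counters then (cnt (?N + 1), int (?N + 1)) else S1 i)"
    have cnt: "((\<lambda>_. 0)(0 := 1))(int (?N + 1) := 3) = cnt (?N + 1)"
      by (auto simp: cnt_def fun_eq_iff)
    have 5: "runs (seqs (map (\<lambda>i. Write i 3) counters)) S1 (C * (1 + 1) + 1) S2"
      unfolding S2_def C_def
    proof (rule runs_seqs)
      fix i T assume "i \<in> set counters" "T i = S1 i"
      then have "T i = ((\<lambda>_. 0)(0 := 1), int (?N + 1))" by (simp add: S1_def)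
      then show "runs (Write i 3) T 1 (T(i := (cnt (?N + 1), int (?N + 1))))"
        using runs_Write[of i 3 T] unfolding cnt[symmetric] by simp
    qed (rule setC)
    define S3 where "S3 = (\<lambda>i. if i \<in> set counters then (cnt (?N + 1), 0) else S2 i)"
    have 6: "runs (seqs (map rewind counters)) S2 (C * ((2 * (?N + 1) + 1) + 1) + 1) S3"
      unfolding S3_def C_def
    proof (rule runs_seqs)
      fix i T assume "i \<in> set counters" "T i = S2 i"
      then show "runs (rewind i) T (2 * (?N + 1) + 1) (T(i := (cnt (?N + 1), 0)))"
        by (intro runs_rewind) (simp_all add: S2_def cnt_def)
    qed (rule setC)
    have S3bt: "S3 (tt bt) = (\<lambda>p. if p = 0 then 1 else if 0 < p \<and> p \<le> int ?N \<and> w ! nat (p - 1) then 2 else 0, int (1 + ?N))"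
      using tt_facts[of bt] by (auto simp: S3_def S2_def S1_def load_tapes_def setC)
    have 7: "runs (rewind (tt bt)) S3 (2 * (1 + ?N) + 1) (S3(tt bt := (fst (S3 (tt bt)), 0)))"
      by (rule runs_rewind) (simp_all add: S3bt)
    have tabbt: "tabf (?N + 1) (ar bt) (bit_tab bt w bt) = fst (S3 (tt bt))"
    proof
      fix p
      have "(\<exists>xs. length xs = 1 \<and> set xs \<subseteq> {..<?N + 1} \<and> p = 1 + int (idx (?N + 1) xs) \<and> bit_tab bt w bt xs)
         \<longleftrightarrow> 0 < p \<and> p \<le> int ?N \<and> w ! nat (p - 1)" (is "?A \<longleftrightarrow> ?B")
      proof
        assume ?B
        then show ?A by (intro exI[of _ "[nat (p - 1)]"]) (auto simp: bit_tab_def)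
      qed (auto simp: bit_tab_def)
      then show "tabf (?N + 1) (ar bt) (bit_tab bt w bt) p = fst (S3 (tt bt)) p"
        unfolding tabf_def bt S3bt by simp
    qed
    have tabo: "tabf (?N + 1) (ar t) (bit_tab bt w t) = (\<lambda>_. 0)(0 := 1)" if "t \<noteq> bt" for t
      using that by (auto simp: tabf_def bit_tab_def fun_eq_iff)
    have "S3(tt bt := (fst (S3 (tt bt)), 0)) = mk (?N + 1) (\<lambda>_. 0) (bit_tab bt w) (fst (input_tape w), int ?N)"
    proof
      fix i
      show "(S3(tt bt := (fst (S3 (tt bt)), 0))) i = mk (?N + 1) (\<lambda>_. 0) (bit_tab bt w) (fst (input_tape w), int ?N) i"
      proof (cases "i \<ge> 2 + V + A \<and> i < nm")
        case True
        then have "i - (2 + V + A) \<in> {..<nt}" by (auto simp: nm_def)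
        then obtain t where t: "i - (2 + V + A) = ix t" using ix by (auto simp: bij_betw_def)
        have it: "i = tt t" using True t unfolding tt_def by linarith
        show ?thesis
        proof (cases "t = bt")
          case True
          then show ?thesis unfolding it using tabbt by simp
        next
          case False
          then show ?thesis unfolding it using tabo[OF False] tt_facts[of t]
            by (simp add: S3_def S2_def S1_def load_tapes_def setC)
        qed
      next
        case False
        then show ?thesis using tt_facts[of bt]
          by (auto simp: S3_def S2_def S1_def load_tapes_def setC mk_def nm_def)
      qed
    qed
    with 7 have 7: "runs (rewind (tt bt)) S3 (2 * (1 + ?N) + 1)
       (mk (?N + 1) (\<lambda>_. 0) (bit_tab bt w) (fst (input_tape w), int ?N))" by simp
    show ?thesis
      using runs_Then[OF 1 runs_Then[OF 2 runs_Then[OF 3 runs_Then[OF 4 runs_Then[OF 5 runs_Then[OF 6 7]]]]]]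
      unfolding load_def by simp
  qed
  show ?thesis
  proof (intro exI[of _ "[:2 * nm + 8 * C + 30, 4 * C + 20:]"] allI)
    show "runs (load bt) (start_tapes w) (poly [:2 * nm + 8 * C + 30, 4 * C + 20:] (length w))
       (mk (length w + 1) (\<lambda>_. 0) (bit_tab bt w) (fst (input_tape w), int (length w)))" for w
      by (rule runs_mono[OF R]) (simp add: algebra_simps)
  qed
qed

section \<open>Well-formedness of the compiled programs\<close>

lemma wfc_seqs: "(\<And>c. c \<in> set cs \<Longrightarrow> wfc k S c) \<Longrightarrow> 0 < k \<Longrightarrow> wfc k S (seqs cs)"
  by (induction cs) auto

lemma wfc_load: "wfc nm 4 (load bt)"
proof -
  have nm: "0 < nm" "tt bt < nm" "\<And>i. i \<in> set counters \<Longrightarrow> i < nm"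
    using ix_less[of bt] by (auto simp: nm_def tt_def counters_def)
  show ?thesis unfolding load_def
    by (auto simp: rewind_def nm intro!: wfc_seqs)
qed

lemma wfc_move_pow: "k \<le> A \<Longrightarrow> t < nm \<Longrightarrow> wfc nm 4 (move_pow t k)"
  by (induction k) (auto simp: rewind_def zt_def nm_def)

lemma wfc_seek_from: "k + length vs \<le> A \<Longrightarrow> set vs \<subseteq> {..<V} \<Longrightarrow> t < nm \<Longrightarrow> wfc nm 4 (seek_from t vs k)"
proof (induction vs arbitrary: k)
  case (Cons v vs)
  then show ?case using wfc_move_pow[of k t] by (auto simp: move_mul_def sc_def vt_def nm_def)
qed auto

lemma wfc_comp: "wfl c d \<Longrightarrow> wfc nm 4 (comp c d)"
proof (induction c arbitrary: d)
  case (LSet t vs)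
  have "set vs \<subseteq> {..<V}" using LSet by auto
  then show ?case using LSet wfc_seek_from[of 0 vs "tt t"] ar_le[of t] tt_facts[of t]
    by (auto simp: seek_def rewind_def)
next
  case (LIf t vs a b)
  have "set vs \<subseteq> {..<V}" using LIf by auto
  then show ?case using LIf wfc_seek_from[of 0 vs "tt t"] ar_le[of t] tt_facts[of t]
    by (auto simp: seek_def rewind_def)
next
  case (LFor c)
  then show ?case by (auto simp: rewind_def vt_def nm_def)
qed (auto simp: nm_def)

theorem loop_program_decides:
  assumes wf: "wfl c 0" and bt: "ar bt = 1" and ans: "ar ans = 0"
    and Q: "\<And>x. x \<in> Inst \<Longrightarrow> Q x \<longleftrightarrow>
      exec (length (enc x) + 1) c 0 (\<lambda>_. 0) (bit_tab bt (enc x)) ans []"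
  shows "poly_time_decidable Inst enc Q"
proof -
  obtain p :: "nat poly" where p: "\<And>w. runs (load bt) (start_tapes w) (poly p (length w))
     (mk (length w + 1) (\<lambda>_. 0) (bit_tab bt w) (fst (input_tape w), int (length w)))"
    using runs_load[OF bt] by blast
  \<comment> \<open>The only cell of the nullary table \<open>ans\<close> has address
    \<open>1\<close>, which is where the last move puts the head.\<close>
  define prog where "prog = Then (load bt) (Then (comp c 0) (Move (tt ans) 1))"
  have run: "\<exists>T. runs prog (start_tapes w) (poly (p + pcompose (comp_time c) [:1, 1:] + 3) (length w)) T \<and>
     (scan T (tt ans) = 2 \<longleftrightarrow> exec (length w + 1) c 0 (\<lambda>_. 0) (bit_tab bt w) ans [])" for w
  proof -
    let ?D = "length w + 1" let ?x = "(fst (input_tape w), int (length w))"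
    let ?R = "exec ?D c 0 (\<lambda>_. 0) (bit_tab bt w)"
    have 2: "runs (comp c 0) (mk ?D (\<lambda>_. 0) (bit_tab bt w) ?x) (poly (comp_time c) ?D) (mk ?D (\<lambda>_. 0) ?R ?x)"
      by (rule runs_comp[OF wf]) auto
    define T where "T = (mk ?D (\<lambda>_. 0) ?R ?x)(tt ans := (tabf ?D 0 (?R ans), 1))"
    have 3: "runs (Move (tt ans) 1) (mk ?D (\<lambda>_. 0) ?R ?x) 1 T"
      using runs_Move[of "tt ans" 1 "mk ?D (\<lambda>_. 0) ?R ?x"] by (simp add: T_def ans)
    have "scan T (tt ans) = 2 \<longleftrightarrow> ?R ans []"
      using tabf_idx[of "[]" 0 ?D "?R ans"] by (simp add: T_def scan_def)
    moreover have "poly (comp_time c) ?D = poly (pcompose (comp_time c) [:1, 1:]) (length w)"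
      by (simp add: poly_pcompose add.commute)
    ultimately show ?thesis
      using runs_Then[OF p[of w] runs_Then[OF 2 3]]
      by (intro exI[of _ T]) (auto simp: prog_def elim: runs_mono)
  qed
  have "wfc nm 4 prog" using wfc_load wfc_comp[OF wf] tt_facts[of ans] by (simp add: prog_def)
  then show ?thesis
  proof (rule poly_time_decidableI[where j = "tt ans" and b = "p + pcompose (comp_time c) [:1, 1:] + 3"])
    fix x assume "x \<in> Inst"
    obtain T where T: "runs prog (start_tapes (enc x)) (poly (p + pcompose (comp_time c) [:1, 1:] + 3) (length (enc x))) T"
      "scan T (tt ans) = 2 \<longleftrightarrow> exec (length (enc x) + 1) c 0 (\<lambda>_. 0) (bit_tab bt (enc x)) ans []"
      using run by blast
    then show "\<exists>n T. n \<le> poly (p + pcompose (comp_time c) [:1, 1:] + 3) (length (enc x)) \<and>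
      (st ^^ n) ([prog], start_tapes (enc x)) = ([], T) \<and> (scan T (tt ans) = 2 \<longleftrightarrow> Q x)"
      unfolding runs_def Q[OF \<open>x \<in> Inst\<close>] by blast
  qed (use tt_facts in auto)
qed

end

section \<open>Datalog with negated input tables\<close>

text \<open>A clause consists of its number of variables, its head and the arguments of the head, and its body.\<close>

type_synonym 't literal = "bool \<times> 't \<times> nat list"
type_synonym 't clause = "nat \<times> 't \<times> nat list \<times> 't literal list"

text \<open>Negative literals are read in the input \<open>I\<close>, not in \<open>X\<close>.
  Consequence is therefore monotone in \<open>X\<close>, and least models make sense in spite of
  negation.\<close>

definition lits :: "'t tabs \<Rightarrow> 't tabs \<Rightarrow> nat list \<Rightarrow> 't literal list \<Rightarrow> bool" where
  "lits I X as B \<longleftrightarrow> (\<forall>(b, t, xs)\<in>set B. if b then X t (map ((!) as) xs) else \<not> I t (map ((!) as) xs))"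

definition sat_clause :: "nat \<Rightarrow> 't tabs \<Rightarrow> 't tabs \<Rightarrow> 't clause \<Rightarrow> bool" where
  "sat_clause D I X = (\<lambda>(n, h, hs, B). \<forall>as. length as = n \<and> set as \<subseteq> {..<D} \<and> lits I X as B
     \<longrightarrow> X h (map ((!) as) hs))"

definition dl_closed :: "nat \<Rightarrow> 't clause list \<Rightarrow> 't tabs \<Rightarrow> 't tabs \<Rightarrow> bool" where
  "dl_closed D P I X \<longleftrightarrow> (\<forall>cl\<in>set P. sat_clause D I X cl)"

definition least_model :: "nat \<Rightarrow> 't clause list \<Rightarrow> 't tabs \<Rightarrow> 't tabs \<Rightarrow> bool" where
  "least_model D P I R \<longleftrightarrow> I \<le> R \<and> dl_closed D P I R \<and> (\<forall>X. I \<le> X \<and> dl_closed D P I X \<longrightarrow> R \<le> X)"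

definition heads :: "'t clause list \<Rightarrow> 't set" where
  "heads P = (\<lambda>(n, h, hs, B). h) ` set P"

definition stratified :: "'t clause list \<Rightarrow> bool" where
  "stratified P \<longleftrightarrow> (\<forall>(n, h, hs, B)\<in>set P. \<forall>(b, t, xs)\<in>set B. \<not> b \<longrightarrow> t \<notin> heads P)"

text \<open>A clause numbers its variables from \<open>0\<close>; inside \<open>d\<close> loops they
  are bound at depths \<open>d\<close>, \<open>d + 1\<close> and so on, hence the shift.\<close>

fun ifs :: "nat \<Rightarrow> 't literal list \<Rightarrow> 't lp \<Rightarrow> 't lp" where
  "ifs d [] c = c"
| "ifs d ((b, t, xs) # B) c = (if b then LIf t (map ((+) d) xs) (ifs d B c) LSkip
     else LIf t (map ((+) d) xs) LSkip (ifs d B c))"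

primrec fors :: "nat \<Rightarrow> 't lp \<Rightarrow> 't lp" where
  "fors 0 c = c"
| "fors (Suc n) c = LFor (fors n c)"

fun clause_prog :: "nat \<Rightarrow> 't clause \<Rightarrow> 't lp" where
  "clause_prog d (n, h, hs, B) = fors n (ifs d B (LSet h (map ((+) d) hs)))"

definition pass :: "nat \<Rightarrow> 't clause list \<Rightarrow> 't lp" where
  "pass d P = foldr LSeq (map (clause_prog d) P) LSkip"

text \<open>\<open>K\<close> nested loops repeat the pass \<open>D ^ K\<close> times; for \<open>A + nt \<le> K\<close> this exceeds the number of facts.\<close>

definition stratum :: "nat \<Rightarrow> 't clause list \<Rightarrow> 't lp" where
  "stratum K P = fors K (pass K P)"

section \<open>Invariants and fixed points of the compiled strata\<close>

lemma fold_inv: "(\<And>i R. i < m \<Longrightarrow> \<Phi> R \<Longrightarrow> \<Phi> (f i R)) \<Longrightarrow> \<Phi> R \<Longrightarrow> \<Phi> (fold f [0..<m] R)"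
  by (induction m) auto

lemma exec_infl: "R \<le> exec D c d e R"
proof (induction c arbitrary: d e R)
  case (LSeq a b)
  then show ?case by (metis exec.simps(2) order_trans)
next
  case (LFor c)
  show ?case unfolding exec.simps
    by (rule fold_inv[where \<Phi> = "\<lambda>X. R \<le> X"]) (use LFor order_trans in blast)+
qed (auto simp: le_fun_def)

text \<open>The environment reached inside \<open>length as\<close> further loops entered at depth
  \<open>d\<close>.\<close>

definition envd :: "nat \<Rightarrow> nat list \<Rightarrow> (nat \<Rightarrow> nat) \<Rightarrow> nat \<Rightarrow> nat" where
  "envd d as e v = (if d \<le> v \<and> v < d + length as then as ! (v - d) else e v)"

lemma envd_Nil [simp]: "envd d [] e = e"
  by (auto simp: envd_def)

lemma envd_Cons: "envd d (i # as) e = envd (Suc d) as (e(d := i))"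
  by (auto simp: envd_def fun_eq_iff nth_Cons' Suc_diff_le)

lemma map_envd: "set xs \<subseteq> {..<length as} \<Longrightarrow> map (envd d as e) (map ((+) d) xs) = map ((!) as) xs"
  by (auto simp: envd_def)

lemma fors_inv:
  assumes "\<And>as R. length as = n \<Longrightarrow> set as \<subseteq> {..<D} \<Longrightarrow> \<Phi> R \<Longrightarrow> \<Phi> (exec D c (d + n) (envd d as e) R)" "\<Phi> R"
  shows "\<Phi> (exec D (fors n c) d e R)"
  using assms
proof (induction n arbitrary: d e R)
  case 0
  then show ?case by (metis add.right_neutral empty_iff empty_set envd_Nil fors.simps(1) list.size(3) subsetI)
next
  case (Suc n)
  show ?case unfolding fors.simps exec.simps
  proof (rule fold_inv[where \<Phi> = \<Phi>])
    fix i R' assume i: "i < D" and R': "\<Phi> R'"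
    show "\<Phi> (exec D (fors n c) (Suc d) (e(d := i)) R')"
    proof (rule Suc.IH)
      fix as R assume as: "length as = n" "set as \<subseteq> {..<D}" "\<Phi> R"
      show "\<Phi> (exec D c (Suc d + n) (envd (Suc d) as (e(d := i))) R)"
        using Suc.prems(1)[of "i # as" R] as i by (simp add: envd_Cons)
    qed (rule R')
  qed (rule Suc.prems)
qed

text \<open>Each step can only increase the value, so a fold that returns to its start has not moved
  on the way. This turns a pass without effect into closure under every clause instance.\<close>

lemma fold_fix:
  assumes "\<And>i R. R \<le> f i R" "fold f xs R = R" "i \<in> set xs"
  shows "f i R = (R :: 'a :: order)"
proof -
  have ge: "R \<le> fold f xs R" for xs R
  proof (induction xs arbitrary: R)
    case (Cons x xs)
    then show ?case using assms(1)[of R x] order_trans by fastforce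
  qed simp
  show ?thesis using assms(2,3)
  proof (induction xs)
    case (Cons x xs)
    have "f x R \<le> R" using ge[of "f x R" xs] Cons.prems(1) by simp
    then have "f x R = R" using assms(1)[of R x] by (rule antisym)
    then show ?case using Cons by auto
  qed simp
qed

lemma fors_fix:
  "exec D (fors n c) d e R = R \<Longrightarrow> length as = n \<Longrightarrow> set as \<subseteq> {..<D} \<Longrightarrow> exec D c (d + n) (envd d as e) R = R"
proof (induction n arbitrary: d e as)
  case (Suc n)
  then obtain i as' where as: "as = i # as'" "length as' = n" "set as' \<subseteq> {..<D}" "i < D"
    by (cases as) auto
  have "exec D (fors n c) (Suc d) (e(d := i)) R = R"
  proof (rule fold_fix[where xs = "[0..<D]" and f = "\<lambda>i. exec D (fors n c) (Suc d) (e(d := i))"])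
    show "fold (\<lambda>i. exec D (fors n c) (Suc d) (e(d := i))) [0..<D] R = R" using Suc.prems(1) by simp
  qed (use as exec_infl in simp_all)
  from Suc.IH[OF this as(2,3)] show ?case by (simp add: as envd_Cons fun_upd_def)
qed simp

lemma exec_ifs:
  "exec D (ifs d B c) d' e R = (if \<forall>(b, t, xs)\<in>set B. R t (map e (map ((+) d) xs)) = b then exec D c d' e R else R)"
  by (induction d B c rule: ifs.induct) auto

text \<open>Tables that are not heads keep their input value, so in a stratified program a negative
  literal may be evaluated in the current tables instead of \<open>I\<close>.\<close>

definition good :: "'t clause list \<Rightarrow> 't tabs \<Rightarrow> 't tabs \<Rightarrow> bool" where
  "good P I R \<longleftrightarrow> I \<le> R \<and> (\<forall>t. t \<notin> heads P \<longrightarrow> R t = I t)"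

context layout
begin

fun wf_clause :: "'t clause \<Rightarrow> bool" where
  "wf_clause (n, h, hs, B) \<longleftrightarrow> length hs = ar h \<and> set hs \<subseteq> {..<n} \<and>
     (\<forall>(b, t, xs)\<in>set B. length xs = ar t \<and> set xs \<subseteq> {..<n})"

definition wf_stratum :: "'t clause list \<Rightarrow> bool" where
  "wf_stratum P \<longleftrightarrow> (\<forall>cl\<in>set P. wf_clause cl) \<and> stratified P"

text \<open>The link between loops and clauses: at the bottom of its loops a clause makes exactly
  one inference, for the arguments \<open>as\<close>.\<close>

lemma exec_instance:
  assumes cl: "(n, h, hs, B) \<in> set P" and P: "wf_stratum P" and g: "good P I R" and as: "length as = n"
  shows "exec D (ifs d B (LSet h (map ((+) d) hs))) d' (envd d as e) R =
     (if lits I R as B then R(h := (R h)(map ((!) as) hs := True)) else R)"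
proof -
  have wf: "wf_clause (n, h, hs, B)" using P cl unfolding wf_stratum_def by blast
  have neg: "t \<notin> heads P" if "(False, t, xs) \<in> set B" for t xs
    using P cl that by (fastforce simp: wf_stratum_def stratified_def)
  have hs: "map (envd d as e) (map ((+) d) hs) = map ((!) as) hs"
    by (rule map_envd) (use wf as in simp)
  have lit: "R t (map (envd d as e) (map ((+) d) xs)) = b \<longleftrightarrow>
      (if b then R t (map ((!) as) xs) else \<not> I t (map ((!) as) xs))" if "(b, t, xs) \<in> set B" for b t xs
  proof -
    have "map (envd d as e) (map ((+) d) xs) = map ((!) as) xs"
      by (rule map_envd) (use wf as that in auto)
    moreover have "\<not> b \<longrightarrow> R t = I t" using neg[of t xs] that g by (cases b) (auto simp: good_def)
    ultimately show ?thesis by (cases b) (simp_all del: map_map)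
  qed
  have "(\<forall>(b, t, xs)\<in>set B. R t (map (envd d as e) (map ((+) d) xs)) = b) \<longleftrightarrow> lits I R as B"
    unfolding lits_def
  proof (intro ball_cong refl)
    fix x assume x: "x \<in> set B"
    obtain b t xs where "x = (b, t, xs)" by (cases x)
    then show "(case x of (b, t, xs) \<Rightarrow> R t (map (envd d as e) (map ((+) d) xs)) = b) \<longleftrightarrow>
        (case x of (b, t, xs) \<Rightarrow> if b then R t (map ((!) as) xs) else \<not> I t (map ((!) as) xs))"
      using lit[of b t xs] x by (simp del: map_map)
  qed
  then show ?thesis unfolding exec_ifs exec.simps hs by presburger
qed

lemma good_step: "good P I R \<Longrightarrow> (n, h, hs, B) \<in> set P \<Longrightarrow> good P I (R(h := (R h)(xs := True)))"
  by (force simp: good_def le_fun_def heads_def)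

lemma clause_good:
  assumes cl: "cl \<in> set P" and P: "wf_stratum P" and g: "good P I R"
  shows "good P I (exec D (clause_prog d cl) d e R)"
proof -
  obtain n h hs B where c: "cl = (n, h, hs, B)" by (cases cl)
  show ?thesis unfolding c clause_prog.simps
    by (rule fors_inv[where \<Phi> = "good P I"]) (use c cl P g good_step in \<open>auto simp: exec_instance\<close>)
qed

lemma clause_below:
  assumes cl: "cl \<in> set P" and P: "wf_stratum P" and g: "good P I R" and X: "dl_closed D P I X" and le: "R \<le> X"
  shows "exec D (clause_prog d cl) d e R \<le> X"
proof -
  obtain n h hs B where c: "cl = (n, h, hs, B)" by (cases cl)
  have "good P I (exec D (clause_prog d cl) d e R) \<and> exec D (clause_prog d cl) d e R \<le> X"
    unfolding c clause_prog.simps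
  proof (rule fors_inv[where \<Phi> = "\<lambda>R. good P I R \<and> R \<le> X"])
    fix as R assume as: "length as = n" "set as \<subseteq> {..<D}" and R: "good P I R \<and> R \<le> X"
    have cl': "(n, h, hs, B) \<in> set P" using cl c by simp
    have "X h (map ((!) as) hs)" if "lits I R as B"
    proof -
      have "lits I X as B" using that R unfolding lits_def le_fun_def by fastforce
      then show ?thesis using X cl' as by (fastforce simp: dl_closed_def sat_clause_def)
    qed
    then show "good P I (exec D (ifs d B (LSet h (map ((+) d) hs))) (d + n) (envd d as e) R) \<and>
       exec D (ifs d B (LSet h (map ((+) d) hs))) (d + n) (envd d as e) R \<le> X"
      unfolding exec_instance[OF cl' P conjunct1[OF R] as(1)]
      using R good_step[OF _ cl'] by (auto simp: le_fun_def)
  qed (use g le in simp)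
  then show ?thesis by simp
qed

lemma clause_fix:
  assumes cl: "cl \<in> set P" and P: "wf_stratum P" and g: "good P I R"
    and eq: "exec D (clause_prog d cl) d e R = R"
  shows "sat_clause D I R cl"
proof -
  obtain n h hs B where c: "cl = (n, h, hs, B)" by (cases cl)
  have cl': "(n, h, hs, B) \<in> set P" using cl c by simp
  have "R h (map ((!) as) hs)" if as: "length as = n" "set as \<subseteq> {..<D}" and l: "lits I R as B" for as
  proof -
    have "exec D (ifs d B (LSet h (map ((+) d) hs))) (d + n) (envd d as e) R = R"
      by (rule fors_fix) (use eq as c in auto)
    then have "R(h := (R h)(map ((!) as) hs := True)) = R"
      unfolding exec_instance[OF cl' P g as(1)] using l by simp
    then show ?thesis by (metis fun_upd_same)
  qed
  then show ?thesis by (auto simp: c sat_clause_def)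
qed

lemma pass_inv:
  assumes "\<And>cl R. cl \<in> set P \<Longrightarrow> \<Phi> R \<Longrightarrow> \<Phi> (exec D (clause_prog d cl) d e R)" "\<Phi> R"
  shows "\<Phi> (exec D (pass d P) d e R)"
  using assms by (induction P arbitrary: R) (auto simp: pass_def)

lemma pass_fix: "exec D (pass d P) d e R = R \<Longrightarrow> cl \<in> set P \<Longrightarrow> exec D (clause_prog d cl) d e R = R"
proof (induction P)
  case (Cons c P)
  have "exec D (clause_prog d c) d e R \<le> R"
    using exec_infl[of "exec D (clause_prog d c) d e R" D "pass d P" d e] Cons.prems(1) by (simp add: pass_def)
  then have eq: "exec D (clause_prog d c) d e R = R" using exec_infl antisym by blast
  then show ?case using Cons by (auto simp: pass_def)
qed simp

definition universe :: "nat \<Rightarrow> ('t \<times> nat list) set" where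
  "universe D = (SIGMA t:UNIV. {xs. set xs \<subseteq> {..<D} \<and> length xs = ar t})"

lemma finite_universe: "finite (universe D)"
  unfolding universe_def by (intro finite_SigmaI finite_lists_length_eq) auto

lemma card_universe: "0 < D \<Longrightarrow> card (universe D) \<le> nt * D ^ A"
proof -
  assume D: "0 < D"
  have nt: "card (UNIV :: 't set) = nt" using bij_betw_same_card[OF ix] by simp
  have "card (universe D) = (\<Sum>t\<in>(UNIV :: 't set). D ^ ar t)"
    unfolding universe_def by (subst card_SigmaI) (auto simp: card_lists_length_eq finite_lists_length_eq)
  also have "\<dots> \<le> (\<Sum>t\<in>(UNIV :: 't set). D ^ A)"
    by (intro sum_mono power_increasing ar_le) (use D in simp)
  finally show ?thesis by (simp add: nt)
qed

lemma exec_universe: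
  "wfl c d \<Longrightarrow> \<forall>v<d. e v < D \<Longrightarrow> exec D c d e R t xs \<Longrightarrow> R t xs \<or> (t, xs) \<in> universe D"
proof (induction c arbitrary: d e R t xs)
  case (LSet s vs)
  then show ?case by (auto simp: universe_def split: if_splits)
next
  case (LFor c)
  have "\<forall>t xs. fold (\<lambda>i. exec D c (Suc d) (e(d := i))) [0..<D] R t xs \<longrightarrow> R t xs \<or> (t, xs) \<in> universe D"
  proof (rule fold_inv[where \<Phi> = "\<lambda>X. \<forall>t xs. X t xs \<longrightarrow> R t xs \<or> (t, xs) \<in> universe D"])
    fix i X assume i: "i < D" and X: "\<forall>t xs. X t xs \<longrightarrow> R t xs \<or> (t, xs) \<in> universe D"
    have env: "\<forall>v<Suc d. (e(d := i)) v < D" using LFor.prems(2) i by (simp add: less_Suc_eq)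
    show "\<forall>t xs. exec D c (Suc d) (e(d := i)) X t xs \<longrightarrow> R t xs \<or> (t, xs) \<in> universe D"
      using LFor.IH[OF _ env, of X] LFor.prems(1) X unfolding wfl.simps by blast
  qed simp
  then show ?case using LFor.prems by auto
qed (auto split: if_splits, blast+)

definition size_tab :: "nat \<Rightarrow> 't tabs \<Rightarrow> nat" where
  "size_tab D R = card {(t, xs) \<in> universe D. R t xs}"

lemma size_tab_less:
  assumes "R \<le> R'" "R' \<noteq> R" "\<And>t xs. R' t xs \<Longrightarrow> R t xs \<or> (t, xs) \<in> universe D"
  shows "size_tab D R < size_tab D R'"
  unfolding size_tab_def
proof (rule psubset_card_mono)
  show "finite {(t, xs) \<in> universe D. R' t xs}"
    by (rule finite_subset[OF _ finite_universe[of D]]) auto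
  obtain t xs where "R' t xs" "\<not> R t xs" using assms(1,2) by (metis le_funD le_boolD antisym predicate2I)
  then show "{(t, xs) \<in> universe D. R t xs} \<subset> {(t, xs) \<in> universe D. R' t xs}"
    using assms(1,3) unfolding le_fun_def by fastforce
qed

lemma wfl_ifs:
  "(\<forall>(b, t, xs)\<in>set B. length xs = ar t \<and> set xs \<subseteq> {..<n}) \<Longrightarrow> d + n \<le> V \<Longrightarrow> wfl c (d + n) \<Longrightarrow> wfl (ifs d B c) (d + n)"
  by (induction d B c rule: ifs.induct) auto

lemma wfl_fors: "wfl c (d + n) \<Longrightarrow> d + n \<le> V \<Longrightarrow> wfl (fors n c) d"
  by (induction n arbitrary: d) auto

lemma wfl_clause: "wf_clause cl \<Longrightarrow> d + fst cl \<le> V \<Longrightarrow> wfl (clause_prog d cl) d"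
proof -
  assume wf: "wf_clause cl" and V: "d + fst cl \<le> V"
  obtain n h hs B where c: "cl = (n, h, hs, B)" by (cases cl)
  have "wfl (LSet h (map ((+) d) hs)) (d + n)" using wf V c by auto
  moreover have "\<forall>(b, t, xs)\<in>set B. length xs = ar t \<and> set xs \<subseteq> {..<n}" using wf c by simp
  ultimately have "wfl (ifs d B (LSet h (map ((+) d) hs))) (d + n)" using wfl_ifs V c by simp
  then show ?thesis using wfl_fors V by (simp add: c)
qed

lemma wfl_pass: "\<forall>cl\<in>set P. wf_clause cl \<and> d + fst cl \<le> V \<Longrightarrow> wfl (pass d P) d"
  by (induction P) (auto simp: pass_def wfl_clause)

lemma wfl_stratum: "wf_stratum P \<Longrightarrow> \<forall>cl\<in>set P. K + fst cl \<le> V \<Longrightarrow> K \<le> V \<Longrightarrow> wfl (stratum K P) 0"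
  unfolding stratum_def by (rule wfl_fors) (auto simp: wf_stratum_def intro!: wfl_pass)

text \<open>There is no test for convergence. After \<open>m\<close> passes the tables are closed or
  contain at least \<open>m\<close> facts of the right format, and there are at most
  \<open>nt * D ^ A\<close> of these; since \<open>nt < 2 ^ nt\<close> and \<open>2 \<le> D\<close>,
  the \<open>D ^ K\<close> passes are more than that.\<close>

lemma stratum_correct:
  assumes P: "wf_stratum P" and V: "\<forall>cl\<in>set P. K + fst cl \<le> V" and D: "2 \<le> D" and K: "A + nt \<le> K"
  shows "least_model D P I (exec D (stratum K P) 0 (\<lambda>_. 0) I)"
proof -
  let ?f = "exec D (pass K P) K"
  have f_good: "good P I (?f e R)" if "good P I R" for e R
    by (rule pass_inv[where \<Phi> = "good P I"]) (use that clause_good P in auto)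
  have f_below: "good P I (?f e R) \<and> ?f e R \<le> X" if "dl_closed D P I X" "good P I R" "R \<le> X" for e R X
    by (rule pass_inv[where \<Phi> = "\<lambda>R. good P I R \<and> R \<le> X"])
      (use that clause_good[OF _ P] clause_below[OF _ P] in blast)+
  have f_fix: "dl_closed D P I R" if "good P I R" "?f e R = R" for e R
    unfolding dl_closed_def using pass_fix[OF that(2)] clause_fix[OF _ P that(1)] by blast
  have wfr: "wfl (pass K P) K" using P V by (auto simp: wf_stratum_def intro!: wfl_pass)
  define \<Psi> where "\<Psi> = (\<lambda>m R. good P I R \<and> (dl_closed D P I R \<or> m \<le> size_tab D R))"
  have f_\<Psi>: "\<Psi> (Suc m) (?f e R)" if R: "\<Psi> m R" and e: "\<forall>v<K. e v < D" for m e R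
  proof (cases "?f e R = R")
    case True
    then show ?thesis using R f_fix by (auto simp: \<Psi>_def)
  next
    case False
    have "\<not> dl_closed D P I R"
    proof
      assume "dl_closed D P I R"
      then have "?f e R \<le> R" using f_below R by (auto simp: \<Psi>_def)
      then show False using False exec_infl antisym by blast
    qed
    moreover have "size_tab D R < size_tab D (?f e R)"
      by (rule size_tab_less[OF exec_infl False]) (rule exec_universe[OF wfr e])
    ultimately show ?thesis using R f_good by (auto simp: \<Psi>_def)
  qed
  have loop: "\<Psi> m R \<Longrightarrow> d + n = K \<Longrightarrow> \<forall>v<d. e v < D \<Longrightarrow> \<Psi> (m + D ^ n) (exec D (fors n (pass K P)) d e R)" for m n d e R
  proof (induction n arbitrary: m d e R)
    case 0
    then show ?case using f_\<Psi>[of m R e] by simp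
  next
    case (Suc n)
    note IH = Suc.IH and prems = Suc.prems
    have "j \<le> D \<Longrightarrow> \<Psi> (m + j * D ^ n) (fold (\<lambda>i. exec D (fors n (pass K P)) (Suc d) (e(d := i))) [0..<j] R)" for j
    proof (induction j)
      case (Suc j)
      let ?X = "fold (\<lambda>i. exec D (fors n (pass K P)) (Suc d) (e(d := i))) [0..<j] R"
      have "\<forall>v<Suc d. (e(d := j)) v < D" using prems(3) Suc.prems by (simp add: less_Suc_eq)
      then have "\<Psi> (m + j * D ^ n + D ^ n) (exec D (fors n (pass K P)) (Suc d) (e(d := j)) ?X)"
        using IH[of "m + j * D ^ n" ?X "Suc d" "e(d := j)"] Suc prems(2) by fastforce
      moreover have "m + j * D ^ n + D ^ n = m + Suc j * D ^ n" by simp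
      moreover have "fold (\<lambda>i. exec D (fors n (pass K P)) (Suc d) (e(d := i))) [0..<Suc j] R =
          exec D (fors n (pass K P)) (Suc d) (e(d := j)) ?X" by simp
      ultimately show ?case by (simp only:)
    qed (use prems in simp)
    from this[of D] show ?case by simp
  qed
  let ?R = "exec D (stratum K P) 0 (\<lambda>_. 0) I"
  have "\<Psi> 0 I" by (simp add: \<Psi>_def good_def)
  then have R: "\<Psi> (D ^ K) ?R" using loop[of 0 I 0 K "\<lambda>_. 0"] by (simp add: stratum_def)
  have "size_tab D ?R \<le> nt * D ^ A"
  proof -
    have "size_tab D ?R \<le> card (universe D)"
      unfolding size_tab_def by (rule card_mono[OF finite_universe]) auto
    then show ?thesis using card_universe[of D] D by linarith
  qed
  also have "\<dots> < D ^ nt * D ^ A"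
  proof -
    have "nt < 2 ^ nt" by (rule less_exp)
    also have "(2 :: nat) ^ nt \<le> D ^ nt" using D by (simp add: power_mono)
    finally show ?thesis using D by simp
  qed
  also have "\<dots> \<le> D ^ K" using K D by (simp add: power_add[symmetric] add.commute power_increasing)
  finally have "dl_closed D P I ?R" "I \<le> ?R" using R by (auto simp: \<Psi>_def good_def)
  moreover have "?R \<le> X" if X: "I \<le> X" "dl_closed D P I X" for X
  proof -
    have "good P I ?R \<and> ?R \<le> X"
      unfolding stratum_def
      by (rule fors_inv[where \<Phi> = "\<lambda>R. good P I R \<and> R \<le> X"]) (use X f_below in \<open>auto simp: good_def\<close>)
    then show ?thesis by simp
  qed
  ultimately show ?thesis by (simp add: least_model_def)
qed

end

section \<open>The minimal ranked model\<close>

definition strs :: "stmt set \<Rightarrow> triple set" where "strs G = {t. Strict t \<in> G}"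
definition defs :: "stmt set \<Rightarrow> triple set" where "defs G = {t. Defeasible t \<in> G}"

text \<open>The triple whose failure makes an interpretation count in \<open>cmin\<close> or
  \<open>pmin\<close>: a defeasible triple demands nothing of interpretations that satisfy its
  vacuity.\<close>

fun vac :: "triple \<Rightarrow> triple" where
  "vac (s, p, oo) = (s, if p = SC then BOTC else BOTP, s)"

abbreviation sat :: "interp \<Rightarrow> triple \<Rightarrow> bool" where
  "sat I t \<equiv> models I {t}"

text \<open>For \<open>E = lev G i\<close> these are the interpretations of rank at most
  \<open>i\<close>. What they must satisfy for \<open>E\<close> is a disjunction, so this set is not
  given as the models of a graph.\<close>

definition WE :: "stmt set \<Rightarrow> triple set \<Rightarrow> interp set" where
  "WE G E = {I \<in> Interps G. (\<forall>t\<in>strs G. sat I t) \<and> (\<forall>d\<in>E. sat I (vac d) \<or> sat I d)}"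

primrec lev :: "stmt set \<Rightarrow> nat \<Rightarrow> triple set" where
  "lev G 0 = defs G"
| "lev G (Suc i) = {d \<in> lev G i. \<forall>I\<in>WE G (lev G i). sat I (vac d)}"

abbreviation Wl :: "stmt set \<Rightarrow> nat \<Rightarrow> interp set" where
  "Wl G i \<equiv> WE G (lev G i)"

definition rk :: "stmt set \<Rightarrow> interp \<Rightarrow> enat" where
  "rk G = restrict (\<lambda>I. if \<exists>i. I \<in> Wl G i then enat (LEAST i. I \<in> Wl G i) else \<infinity>) (Interps G)"

lemma lev_antimono: "i \<le> j \<Longrightarrow> lev G j \<subseteq> lev G i"
  by (rule lift_Suc_antimono_le[of "lev G"]) auto

lemma Wl_mono: "i \<le> j \<Longrightarrow> Wl G i \<subseteq> Wl G j"
  using lev_antimono[of i j G] by (auto simp: WE_def)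

lemma rk_le_iff: "I \<in> Interps G \<Longrightarrow> rk G I \<le> enat i \<longleftrightarrow> I \<in> Wl G i"
proof
  assume I: "I \<in> Interps G" and le: "rk G I \<le> enat i"
  then obtain j where j: "I \<in> Wl G j" by (auto simp: rk_def split: if_splits)
  then have "I \<in> Wl G (LEAST i. I \<in> Wl G i)" by (rule LeastI)
  moreover have "(LEAST i. I \<in> Wl G i) \<le> i" using le I j by (auto simp: rk_def split: if_splits)
  ultimately show "I \<in> Wl G i" using Wl_mono by blast
next
  assume "I \<in> Interps G" "I \<in> Wl G i"
  then show "rk G I \<le> enat i" using Least_le[of "\<lambda>i. I \<in> Wl G i" i] by (auto simp: rk_def)
qed

lemma rk_finite_iff: "I \<in> Interps G \<Longrightarrow> rk G I < \<infinity> \<longleftrightarrow> (\<exists>i. I \<in> Wl G i)"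
  by (auto simp: rk_def)

lemma finite_rank_rk: "finite_rank G (rk G) = (\<Union>i. Wl G i)"
  using rk_finite_iff by (fastforce simp: finite_rank_def WE_def)

lemma rk_eq: "I \<in> Interps G \<Longrightarrow> rk G I = enat i \<longleftrightarrow> I \<in> Wl G i \<and> (\<forall>j<i. I \<notin> Wl G j)"
proof -
  assume I: "I \<in> Interps G"
  show ?thesis
  proof
    assume eq: "rk G I = enat i"
    then have "I \<in> Wl G i" using rk_le_iff[OF I, of i] by simp
    moreover have "I \<notin> Wl G j" if "j < i" for j
      using rk_le_iff[OF I, of j] eq that by simp
    ultimately show "I \<in> Wl G i \<and> (\<forall>j<i. I \<notin> Wl G j)" by blast
  next
    assume as: "I \<in> Wl G i \<and> (\<forall>j<i. I \<notin> Wl G j)"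
    then have "rk G I \<le> enat i" using rk_le_iff[OF I] by blast
    then obtain j where j: "rk G I = enat j" "j \<le> i" by (cases "rk G I") auto
    then show "rk G I = enat i" using rk_le_iff[OF I, of j] as by (cases "j < i") auto
  qed
qed

definition wfd :: "triple \<Rightarrow> bool" where
  "wfd d \<longleftrightarrow> wf_triple d \<and> fst (snd d) \<in> {SC, SP}"

lemma wfd_defs: "defeasible_graph G \<Longrightarrow> d \<in> defs G \<Longrightarrow> wfd d"
  by (cases d) (auto simp: defeasible_graph_def defs_def wfd_def)

lemma ranked_sat_Defeasible:
  "wfd d \<Longrightarrow> ranked_sat G r (Defeasible d) \<longleftrightarrow>
     (\<forall>I\<in>least_rank r {I \<in> finite_rank G r. \<not> sat I (vac d)}. sat I d)"
  by (cases d) (auto simp: wfd_def cmin_def pmin_def)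

text \<open>The violators of \<open>vac d\<close> of least rank are those in the first level that
  contains a violator.\<close>

lemma rk_defeasible_iff:
  "(\<forall>I\<in>least_rank (rk G) {I \<in> finite_rank G (rk G). \<not> sat I (vac d)}. sat I d) \<longleftrightarrow>
   (\<forall>i. (\<exists>I\<in>Wl G i. \<not> sat I (vac d)) \<and> (\<forall>j<i. \<forall>I\<in>Wl G j. sat I (vac d)) \<longrightarrow>
      (\<forall>I\<in>Wl G i. sat I (vac d) \<or> sat I d))"
proof -
  have *: "I \<in> least_rank (rk G) {I \<in> finite_rank G (rk G). \<not> sat I (vac d)} \<longleftrightarrow>
      (\<exists>i. I \<in> Wl G i \<and> \<not> sat I (vac d) \<and> (\<forall>j<i. \<forall>I\<in>Wl G j. sat I (vac d)))" (is "?L \<longleftrightarrow> ?R") for I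
  proof
    assume L: ?L
    then have I: "I \<in> Interps G" "\<not> sat I (vac d)" by (auto simp: least_rank_def finite_rank_def)
    obtain i where i: "rk G I = enat i" using L by (auto simp: least_rank_def finite_rank_def less_infinityE)
    have "sat J (vac d)" if "j < i" "J \<in> Wl G j" for j J
    proof (rule ccontr)
      assume "\<not> sat J (vac d)"
      then have "rk G I \<le> rk G J" using L that by (auto simp: least_rank_def finite_rank_rk)
      moreover have "rk G J \<le> enat j" using that rk_le_iff by (auto simp: WE_def)
      ultimately show False using i that by (metis enat_ord_simps(1) leD le_trans order_trans)
    qed
    then show ?R using I i rk_eq by blast
  next
    assume ?R
    then obtain i where i: "I \<in> Wl G i" "\<not> sat I (vac d)" "\<forall>j<i. \<forall>I\<in>Wl G j. sat I (vac d)" by blast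
    then have I: "I \<in> Interps G" by (simp add: WE_def)
    have "rk G I \<le> rk G J" if J: "J \<in> Wl G k" "\<not> sat J (vac d)" for J k
    proof -
      have JI: "J \<in> Interps G" using J by (simp add: WE_def)
      have "rk G J < \<infinity>" using rk_finite_iff[OF JI] J by blast
      then obtain m where m: "rk G J = enat m" by auto
      then have "J \<in> Wl G m" using rk_eq[OF JI] by blast
      then have "i \<le> m" using i(3) J(2) by (meson not_le)
      moreover have "rk G I \<le> enat i" using rk_le_iff[OF I] i(1) by blast
      ultimately show ?thesis unfolding m by (meson enat_ord_simps(1) order_trans)
    qed
    then show ?L using i by (auto simp: least_rank_def finite_rank_rk)
  qed
  show ?thesis unfolding Ball_def * by (meson linorder_neqE_nat)
qed

text \<open>Ranks have no gaps: an interpretation that enters only at level \<open>k + 1\<close>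
  fails some \<open>d\<close> that is dropped after level \<open>k\<close>, and it is dropped
  because some \<open>J\<close> in level \<open>k\<close> violates \<open>vac d\<close>. As
  \<open>d\<close> had survived all earlier steps, \<open>J\<close> is in no earlier level and has
  rank exactly \<open>k\<close>.\<close>

lemma rk_ranked_model:
  assumes G: "defeasible_graph G" and ne: "Wl G 0 \<noteq> {}"
  shows "ranked_model G (rk G)"
proof -
  have "rk G \<in> Interps G \<rightarrow>\<^sub>E UNIV" by (auto simp: rk_def)
  moreover have "0 \<in> rk G ` Interps G"
  proof -
    obtain I where I: "I \<in> Wl G 0" using ne by blast
    then have "I \<in> Interps G" by (simp add: WE_def)
    then show ?thesis using rk_eq[of I G 0] I by (auto simp: image_iff zero_enat_def intro!: bexI[of _ I])
  qed
  moreover have "enat (i - 1) \<in> rk G ` Interps G" if i: "i > 0" "enat i \<in> rk G ` Interps G" for i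
  proof -
    obtain k where k: "i = Suc k" using i(1) gr0_implies_Suc by blast
    obtain I where I: "I \<in> Interps G" "rk G I = enat (Suc k)" using i k by auto
    then have W: "I \<in> Wl G (Suc k)" "I \<notin> Wl G k" using rk_eq[OF I(1)] by auto
    then obtain d where d: "d \<in> lev G k" "\<not> sat I (vac d)" "\<not> sat I d" by (auto simp: WE_def)
    then have "d \<notin> lev G (Suc k)" using W(1) unfolding WE_def by blast
    then obtain J where J: "J \<in> Wl G k" "\<not> sat J (vac d)" using d(1) unfolding lev.simps by blast
    have "J \<notin> Wl G j" if "j < k" for j
    proof
      assume "J \<in> Wl G j"
      moreover have "d \<in> lev G (Suc j)" using lev_antimono[of "Suc j" k G] that d(1) by auto
      ultimately show False using J(2) by auto
    qed
    moreover have "J \<in> Interps G" using J by (simp add: WE_def)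
    ultimately have "rk G J = enat k" using rk_eq[of J G k] J by blast
    then show ?thesis using k \<open>J \<in> Interps G\<close> by (metis diff_Suc_1 imageI)
  qed
  ultimately have ri: "ranked_interp G (rk G)" by (auto simp: ranked_interp_def)
  have "ranked_sat G (rk G) x" if x: "x \<in> G" for x
  proof (cases x)
    case (Strict t)
    then have "t \<in> strs G" using x by (simp add: strs_def)
    then show ?thesis unfolding Strict ranked_sat.simps finite_rank_rk WE_def by blast
  next
    case (Defeasible d)
    then have d: "d \<in> defs G" using x by (simp add: defs_def)
    have "sat I (vac d) \<or> sat I d"
      if i: "\<forall>j<i. \<forall>I\<in>Wl G j. sat I (vac d)" and I: "I \<in> Wl G i" for i I
    proof -
      have "k \<le> i \<Longrightarrow> d \<in> lev G k" for k
      proof (induction k)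
        case (Suc k)
        then show ?case using i unfolding lev.simps Suc_le_eq by auto
      qed (use d in simp)
      then show ?thesis using I by (auto simp: WE_def)
    qed
    then show ?thesis
      unfolding Defeasible ranked_sat_Defeasible[OF wfd_defs[OF G d]] rk_defeasible_iff by blast
  qed
  then show ?thesis using ri by (simp add: ranked_model_def)
qed

text \<open>Strong induction on the rank \<open>k\<close> that \<open>r\<close> gives to
  \<open>I\<close>. If \<open>I\<close> failed a \<open>d\<close> still present at level
  \<open>k\<close>, then \<open>r\<close> would have to put a violator \<open>J\<close> of
  \<open>vac d\<close> at some rank \<open>j < k\<close>. By induction \<open>J\<close> lies in
  level \<open>j\<close>, but then \<open>d\<close> would be gone by level
  \<open>j + 1\<close>.\<close>

lemma rk_least:
  assumes G: "defeasible_graph G" and r: "ranked_model G r"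
  shows "rank_le G (rk G) r"
proof -
  have *: "I \<in> Interps G \<Longrightarrow> r I = enat k \<Longrightarrow> I \<in> Wl G k" for k I
  proof (induction k arbitrary: I rule: less_induct)
    case (less k)
    have fin: "I \<in> finite_rank G r" using less.prems by (simp add: finite_rank_def)
    have "sat I t" if "t \<in> strs G" for t
      using r that fin by (auto simp: ranked_model_def strs_def)
    moreover have "sat I (vac d) \<or> sat I d" if d: "d \<in> lev G k" for d
    proof (rule ccontr)
      assume neg: "\<not> (sat I (vac d) \<or> sat I d)"
      have dG: "d \<in> defs G" using lev_antimono[of 0 k G] d by auto
      then have "ranked_sat G r (Defeasible d)" using r by (auto simp: ranked_model_def defs_def)
      then have "I \<notin> least_rank r {I \<in> finite_rank G r. \<not> sat I (vac d)}"
        using neg ranked_sat_Defeasible[OF wfd_defs[OF G dG]] by blast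
      then obtain J where J: "J \<in> finite_rank G r" "\<not> sat J (vac d)" "r J < r I"
        using fin neg by (auto simp: least_rank_def not_le)
      then obtain j where j: "r J = enat j" "j < k" using less.prems(2) by (cases "r J") auto
      then have "J \<in> Wl G j" using less.IH J by (simp add: finite_rank_def)
      moreover have "d \<in> lev G (Suc j)" using lev_antimono[of "Suc j" k G] j d by auto
      ultimately show False using J(2) by auto
    qed
    ultimately show ?case using less.prems by (auto simp: WE_def)
  qed
  show ?thesis
    unfolding rank_le_def
  proof
    fix I assume I: "I \<in> Interps G"
    show "rk G I \<le> r I"
    proof (cases "r I")
      case (enat k)
      then show ?thesis using *[OF I enat] rk_le_iff[OF I] by simp
    qed simp
  qed
qed

lemma R_min_eq:
  assumes G: "defeasible_graph G" and ne: "Wl G 0 \<noteq> {}"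
  shows "R_min G = rk G"
proof -
  have ext: "r = rk G" if r: "ranked_model G r" and le: "rank_le G r (rk G)" for r
  proof (rule extensionalityI[of _ "Interps G"])
    show "r \<in> extensional (Interps G)" using r by (auto simp: ranked_model_def ranked_interp_def PiE_def)
    show "rk G \<in> extensional (Interps G)" by (simp add: rk_def)
    show "r I = rk G I" if "I \<in> Interps G" for I
      using le rk_least[OF G r] that by (auto simp: rank_le_def intro: antisym)
  qed
  show ?thesis
    unfolding R_min_def
  proof (rule the_equality)
    show "minimal_ranked_model G (rk G)"
      using rk_ranked_model[OF G ne] ext by (auto simp: minimal_ranked_model_def)
    show "r = rk G" if "minimal_ranked_model G r" for r
      using that rk_ranked_model[OF G ne] rk_least[OF G] by (auto simp: minimal_ranked_model_def)
  qed
qed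

section \<open>A closure for generalized triples\<close>

text \<open>
  Rule 5c is restricted to terms that every interpretation is forced to treat as classes. A self-disjoint
  class puts all non-vocabulary terms into \<open>DeltaC\<close>, but a term without a class position may still denote a
  vocabulary item, which is not in \<open>DeltaC\<close>; a plain literal denotes itself.
\<close>

inductive der :: "rdf_term set \<Rightarrow> triple set \<Rightarrow> rdf_term \<Rightarrow> rdf_term \<Rightarrow> rdf_term \<Rightarrow> bool"
  and cls :: "rdf_term set \<Rightarrow> triple set \<Rightarrow> rdf_term \<Rightarrow> bool" for U X where
  base: "(A, p, B) \<in> X \<Longrightarrow> der U X A (URI p) B"
| d2a: "der U X A (URI SP) B \<Longrightarrow> der U X B (URI SP) C \<Longrightarrow> der U X A (URI SP) C"
| d2b: "der U X D (URI SP) E \<Longrightarrow> der U X A D B \<Longrightarrow> der U X A E B"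
| d3a: "der U X A (URI SC) B \<Longrightarrow> der U X B (URI SC) C \<Longrightarrow> der U X A (URI SC) C"
| d3b: "der U X A (URI SC) B \<Longrightarrow> der U X Y (URI TYP) A \<Longrightarrow> der U X Y (URI TYP) B"
| d4a: "der U X D (URI DOM) B \<Longrightarrow> der U X Y D Z \<Longrightarrow> der U X Y (URI TYP) B"
| d4b: "der U X D (URI RANGE) B \<Longrightarrow> der U X Y D Z \<Longrightarrow> der U X Z (URI TYP) B"
| d5a: "der U X A (URI BOTC) B \<Longrightarrow> der U X B (URI BOTC) A"
| d5b: "der U X A (URI BOTC) B \<Longrightarrow> der U X C (URI SC) A \<Longrightarrow> der U X C (URI BOTC) B"
| d5c: "der U X A (URI BOTC) A \<Longrightarrow> cls U X B \<Longrightarrow> der U X A (URI BOTC) B"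
| d6a: "der U X A (URI BOTP) B \<Longrightarrow> der U X B (URI BOTP) A"
| d6b: "der U X A (URI BOTP) B \<Longrightarrow> der U X C (URI SP) A \<Longrightarrow> der U X C (URI BOTP) B"
| d6c: "der U X A (URI BOTP) A \<Longrightarrow> B \<in> U \<Longrightarrow> B \<notin> rdf_bot \<Longrightarrow> der U X A (URI BOTP) B"
| d7a: "der U X A (URI DOM) C \<Longrightarrow> der U X B (URI DOM) D \<Longrightarrow> der U X C (URI BOTC) D \<Longrightarrow> der U X A (URI BOTP) B"
| d7b: "der U X A (URI RANGE) C \<Longrightarrow> der U X B (URI RANGE) D \<Longrightarrow> der U X C (URI BOTC) D \<Longrightarrow> der U X A (URI BOTP) B"
| c1: "der U X A (URI p) B \<Longrightarrow> p \<in> {TYP, DOM, RANGE, SC, BOTC} \<Longrightarrow> cls U X B"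
| c2: "der U X B (URI p) A \<Longrightarrow> p \<in> {SC, BOTC} \<Longrightarrow> cls U X B"
| c3: "PlainLit w \<in> U \<Longrightarrow> cls U X (PlainLit w)"

definition wfX :: "rdf_term set \<Rightarrow> triple set \<Rightarrow> bool" where
  "wfX U X \<longleftrightarrow> (\<forall>t\<in>X. wf_triple t) \<and> uni X \<subseteq> U \<union> rdf_bot"

lemma rdf_bot_simps [simp]: "URI SP \<in> rdf_bot" "URI SC \<in> rdf_bot" "URI TYP \<in> rdf_bot"
  "URI DOM \<in> rdf_bot" "URI RANGE \<in> rdf_bot" "URI BOTC \<in> rdf_bot" "URI BOTP \<in> rdf_bot"
  "PlainLit w \<notin> rdf_bot" "TypedLit w u \<notin> rdf_bot" "URI (Name n) \<notin> rdf_bot"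
  by (auto simp: rdf_bot_def)

lemma der_wf:
  assumes "wfX U X"
  shows "der U X A p B \<Longrightarrow> A \<in> U - rdf_bot \<and> B \<in> U - rdf_bot \<and> p \<in> U \<union> rdf_bot"
    and "cls U X B \<Longrightarrow> B \<in> U - rdf_bot"
proof (induction rule: der_cls.inducts)
  case (base A p B)
  then show ?case using assms by (fastforce simp: wfX_def uni_def)
qed auto

text \<open>Satisfaction of a generalized triple: as in \<open>der\<close>, the predicate may be any
  term.\<close>

definition holds :: "interp \<Rightarrow> rdf_term \<Rightarrow> rdf_term \<Rightarrow> rdf_term \<Rightarrow> bool" where
  "holds I A p B \<longleftrightarrow> models I {} \<and> {A, p, B} \<subseteq> voc I \<and> den I p \<in> DP I \<and> (den I A, den I B) \<in> Pext I (den I p)"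

lemma models_Un:
  "models I G \<longleftrightarrow> models I {} \<and> uni G \<subseteq> voc I \<and>
     (\<forall>(s, p, oo)\<in>G. den I (URI p) \<in> DP I \<and> (den I s, den I oo) \<in> PU I p)"
  unfolding models_def by (simp add: uni_def) argo

lemma sat_holds: "sat I (A, p, B) \<longleftrightarrow> holds I A (URI p) B"
  by (subst models_Un) (auto simp: holds_def uni_def)

section \<open>The model conditions, one at a time\<close>

context
  fixes I
  assumes mod: "models I {}"
begin

lemma str_voc: "rdf_bot \<subseteq> voc I" using mod by (simp add: models_def)
lemma str_DP: "e \<in> rdf_bot \<Longrightarrow> den I e \<in> DP I" using mod by (simp add: models_def)

lemma str_SP: "(p, q) \<in> PU I SP \<Longrightarrow> p \<in> DP I \<and> q \<in> DP I \<and> Pext I p \<subseteq> Pext I q"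
proof -
  from mod have "\<forall>(p, q)\<in>PU I SP. p \<in> DP I \<and> q \<in> DP I \<and> Pext I p \<subseteq> Pext I q"
    unfolding models_def by (elim conjE)
  then show "(p, q) \<in> PU I SP \<Longrightarrow> p \<in> DP I \<and> q \<in> DP I \<and> Pext I p \<subseteq> Pext I q" 
    by blast
qed

lemma str_SP_trans: "(p, q) \<in> PU I SP \<Longrightarrow> (q, r) \<in> PU I SP \<Longrightarrow> (p, r) \<in> PU I SP"
proof -
  from mod have "trans_on (DP I) (PU I SP)"
    unfolding models_def by (elim conjE)
  then show "(p, q) \<in> PU I SP \<Longrightarrow> (q, r) \<in> PU I SP \<Longrightarrow> (p, r) \<in> PU I SP" 
    using str_SP unfolding trans_on_def by meson
qed

lemma str_SC: "(c, d) \<in> PU I SC \<Longrightarrow> c \<in> DC I \<and> d \<in> DC I \<and> Cext I c \<subseteq> Cext I d"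
proof -
  from mod have "\<forall>(c, d)\<in>PU I SC. c \<in> DC I \<and> d \<in> DC I \<and> Cext I c \<subseteq> Cext I d"
    unfolding models_def by (elim conjE)
  then show "(c, d) \<in> PU I SC \<Longrightarrow> c \<in> DC I \<and> d \<in> DC I \<and> Cext I c \<subseteq> Cext I d" 
    by blast
qed

lemma str_SC_trans: "(p, q) \<in> PU I SC \<Longrightarrow> (q, r) \<in> PU I SC \<Longrightarrow> (p, r) \<in> PU I SC"
proof -
  from mod have "trans_on (DC I) (PU I SC)"
    unfolding models_def by (elim conjE)
  then show "(p, q) \<in> PU I SC \<Longrightarrow> (q, r) \<in> PU I SC \<Longrightarrow> (p, r) \<in> PU I SC" 
    using str_SC unfolding trans_on_def by meson
qed

lemma str_DOM: "(p, c) \<in> PU I DOM \<Longrightarrow> p \<in> DP I \<and> c \<in> DC I \<and> (\<forall>x y. (x, y) \<in> Pext I p \<longrightarrow> x \<in> Cext I c)"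
proof -
  from mod have "\<forall>(p, c)\<in>PU I DOM. p \<in> DP I \<and> c \<in> DC I \<and> (\<forall>(x, y)\<in>Pext I p. x \<in> Cext I c)"
    unfolding models_def by (elim conjE)
  then show "(p, c) \<in> PU I DOM \<Longrightarrow> p \<in> DP I \<and> c \<in> DC I \<and> (\<forall>x y. (x, y) \<in> Pext I p \<longrightarrow> x \<in> Cext I c)" 
    by blast
qed

lemma str_RANGE: "(p, c) \<in> PU I RANGE \<Longrightarrow> p \<in> DP I \<and> c \<in> DC I \<and> (\<forall>x y. (x, y) \<in> Pext I p \<longrightarrow> y \<in> Cext I c)"
proof -
  from mod have "\<forall>(p, c)\<in>PU I RANGE. p \<in> DP I \<and> c \<in> DC I \<and> (\<forall>(x, y)\<in>Pext I p. y \<in> Cext I c)"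
    unfolding models_def by (elim conjE)
  then show "(p, c) \<in> PU I RANGE \<Longrightarrow> p \<in> DP I \<and> c \<in> DC I \<and> (\<forall>x y. (x, y) \<in> Pext I p \<longrightarrow> y \<in> Cext I c)" 
    by blast
qed

lemma str_BOTC_SC: "(c, d) \<in> PU I BOTC \<Longrightarrow> (e, c) \<in> PU I SC \<Longrightarrow> (e, d) \<in> PU I BOTC"
proof -
  from mod have "\<forall>c d e. (c, d) \<in> PU I BOTC \<and> (e, c) \<in> PU I SC \<longrightarrow> (e, d) \<in> PU I BOTC"
    unfolding models_def by (elim conjE)
  then show "(c, d) \<in> PU I BOTC \<Longrightarrow> (e, c) \<in> PU I SC \<Longrightarrow> (e, d) \<in> PU I BOTC" 
    by blast
qed

lemma str_BOTC_self: "(c, c) \<in> PU I BOTC \<Longrightarrow> d \<in> DC I \<Longrightarrow> (c, d) \<in> PU I BOTC"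
proof -
  from mod have "\<forall>c. (c, c) \<in> PU I BOTC \<longrightarrow> (\<forall>d\<in>DC I. (c, d) \<in> PU I BOTC)"
    unfolding models_def by (elim conjE)
  then show "(c, c) \<in> PU I BOTC \<Longrightarrow> d \<in> DC I \<Longrightarrow> (c, d) \<in> PU I BOTC" 
    by blast
qed

lemma str_BOTP_SP: "(p, q) \<in> PU I BOTP \<Longrightarrow> (r, p) \<in> PU I SP \<Longrightarrow> (r, q) \<in> PU I BOTP"
proof -
  from mod have "\<forall>p q r. (p, q) \<in> PU I BOTP \<and> (r, p) \<in> PU I SP \<longrightarrow> (r, q) \<in> PU I BOTP"
    unfolding models_def by (elim conjE)
  then show "(p, q) \<in> PU I BOTP \<Longrightarrow> (r, p) \<in> PU I SP \<Longrightarrow> (r, q) \<in> PU I BOTP" 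
    by blast
qed

lemma str_BOTP_self: "(p, p) \<in> PU I BOTP \<Longrightarrow> q \<in> DP I \<Longrightarrow> (p, q) \<in> PU I BOTP"
proof -
  from mod have "\<forall>p. (p, p) \<in> PU I BOTP \<longrightarrow> (\<forall>q\<in>DP I. (p, q) \<in> PU I BOTP)"
    unfolding models_def by (elim conjE)
  then show "(p, p) \<in> PU I BOTP \<Longrightarrow> q \<in> DP I \<Longrightarrow> (p, q) \<in> PU I BOTP" 
    by blast
qed

lemma str_7a: "(p, c) \<in> PU I DOM \<Longrightarrow> (q, d) \<in> PU I DOM \<Longrightarrow> (c, d) \<in> PU I BOTC \<Longrightarrow> (p, q) \<in> PU I BOTP"
proof -
  from mod have "\<forall>p q c d. (p, c) \<in> PU I DOM \<and> (q, d) \<in> PU I DOM \<and> (c, d) \<in> PU I BOTC \<longrightarrow> (p, q) \<in> PU I BOTP"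
    unfolding models_def by (elim conjE)
  then show "(p, c) \<in> PU I DOM \<Longrightarrow> (q, d) \<in> PU I DOM \<Longrightarrow> (c, d) \<in> PU I BOTC \<Longrightarrow> (p, q) \<in> PU I BOTP" 
    by blast
qed

lemma str_7b: "(p, c) \<in> PU I RANGE \<Longrightarrow> (q, d) \<in> PU I RANGE \<Longrightarrow> (c, d) \<in> PU I BOTC \<Longrightarrow> (p, q) \<in> PU I BOTP"
proof -
  from mod have "\<forall>p q c d. (p, c) \<in> PU I RANGE \<and> (q, d) \<in> PU I RANGE \<and> (c, d) \<in> PU I BOTC \<longrightarrow> (p, q) \<in> PU I BOTP"
    unfolding models_def by (elim conjE)
  then show "(p, c) \<in> PU I RANGE \<Longrightarrow> (q, d) \<in> PU I RANGE \<Longrightarrow> (c, d) \<in> PU I BOTC \<Longrightarrow> (p, q) \<in> PU I BOTP" 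
    by blast
qed

lemma str_TYP: "(x, c) \<in> PU I TYP \<longleftrightarrow> c \<in> DC I \<and> x \<in> Cext I c"
proof -
  from mod have "\<forall>c\<in>DC I. \<forall>x. x \<in> Cext I c \<longleftrightarrow> (x, c) \<in> PU I TYP"
    unfolding models_def by (elim conjE)
  moreover from mod have "\<forall>(x, c)\<in>PU I TYP. c \<in> DC I"
    unfolding models_def by (elim conjE)
  ultimately show ?thesis by blast
qed

lemma str_BOTC: "(c, d) \<in> PU I BOTC \<Longrightarrow> c \<in> DC I \<and> d \<in> DC I \<and> (d, c) \<in> PU I BOTC"
proof -
  from mod have "PU I BOTC \<subseteq> DC I \<times> DC I" unfolding models_def by (elim conjE)
  moreover from mod have "sym (PU I BOTC)" unfolding models_def by (elim conjE)
  ultimately show "(c, d) \<in> PU I BOTC \<Longrightarrow> c \<in> DC I \<and> d \<in> DC I \<and> (d, c) \<in> PU I BOTC"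
    by (meson SigmaD1 SigmaD2 subsetD symD)
qed

lemma str_BOTP: "(p, q) \<in> PU I BOTP \<Longrightarrow> p \<in> DP I \<and> q \<in> DP I \<and> (q, p) \<in> PU I BOTP"
proof -
  from mod have "PU I BOTP \<subseteq> DP I \<times> DP I" unfolding models_def by (elim conjE)
  moreover from mod have "sym (PU I BOTP)" unfolding models_def by (elim conjE)
  ultimately show "(p, q) \<in> PU I BOTP \<Longrightarrow> p \<in> DP I \<and> q \<in> DP I \<and> (q, p) \<in> PU I BOTP"
    by (meson SigmaD1 SigmaD2 subsetD symD)
qed

end

section \<open>Soundness of the rules in a single interpretation\<close>

lemma holds_vocab:
  "URI u \<in> rdf_bot \<Longrightarrow> holds I A (URI u) B \<longleftrightarrow>
     models I {} \<and> A \<in> voc I \<and> B \<in> voc I \<and> (den I A, den I B) \<in> PU I u"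
  using str_voc[of I] str_DP[of I "URI u"] by (auto simp: holds_def)

text \<open>Rules 5c and 6c are the exceptions: they are sound only for a \<open>B\<close> that
  denotes a class or a property, respectively.\<close>

lemma holds_rules:
  "holds I A (URI SP) B \<Longrightarrow> holds I B (URI SP) C \<Longrightarrow> holds I A (URI SP) C"
  "holds I D (URI SP) E \<Longrightarrow> holds I A D B \<Longrightarrow> holds I A E B"
  "holds I A (URI SC) B \<Longrightarrow> holds I B (URI SC) C \<Longrightarrow> holds I A (URI SC) C"
  "holds I A (URI SC) B \<Longrightarrow> holds I Y (URI TYP) A \<Longrightarrow> holds I Y (URI TYP) B"
  "holds I D (URI DOM) B \<Longrightarrow> holds I Y D Z \<Longrightarrow> holds I Y (URI TYP) B"
  "holds I D (URI RANGE) B \<Longrightarrow> holds I Y D Z \<Longrightarrow> holds I Z (URI TYP) B"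
  "holds I A (URI BOTC) B \<Longrightarrow> holds I B (URI BOTC) A"
  "holds I A (URI BOTC) B \<Longrightarrow> holds I C (URI SC) A \<Longrightarrow> holds I C (URI BOTC) B"
  "holds I A (URI BOTC) A \<Longrightarrow> B \<in> voc I \<Longrightarrow> den I B \<in> DC I \<Longrightarrow> holds I A (URI BOTC) B"
  "holds I A (URI BOTP) B \<Longrightarrow> holds I B (URI BOTP) A"
  "holds I A (URI BOTP) B \<Longrightarrow> holds I C (URI SP) A \<Longrightarrow> holds I C (URI BOTP) B"
  "holds I A (URI BOTP) A \<Longrightarrow> B \<in> voc I \<Longrightarrow> den I B \<in> DP I \<Longrightarrow> holds I A (URI BOTP) B"
  "holds I A (URI DOM) C \<Longrightarrow> holds I B (URI DOM) D \<Longrightarrow> holds I C (URI BOTC) D \<Longrightarrow> holds I A (URI BOTP) B"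
  "holds I A (URI RANGE) C \<Longrightarrow> holds I B (URI RANGE) D \<Longrightarrow> holds I C (URI BOTC) D \<Longrightarrow> holds I A (URI BOTP) B"
  subgoal by (auto simp: holds_vocab intro: str_SP_trans)
  subgoal by (auto simp: holds_def dest: str_SP)
  subgoal by (auto simp: holds_vocab intro: str_SC_trans)
  subgoal by (auto simp: holds_vocab str_TYP dest: str_SC)
  subgoal by (auto simp: holds_vocab str_TYP) (auto simp: holds_def dest: str_DOM)
  subgoal by (auto simp: holds_vocab str_TYP) (auto simp: holds_def dest: str_RANGE)
  subgoal by (auto simp: holds_vocab dest: str_BOTC)
  subgoal by (auto simp: holds_vocab intro: str_BOTC_SC)
  subgoal by (auto simp: holds_vocab intro: str_BOTC_self)
  subgoal by (auto simp: holds_vocab dest: str_BOTP)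
  subgoal by (auto simp: holds_vocab intro: str_BOTP_SP)
  subgoal by (auto simp: holds_vocab intro: str_BOTP_self)
  subgoal by (auto simp: holds_vocab intro: str_7a)
  subgoal by (auto simp: holds_vocab intro: str_7b)
  done

lemma holds_DC:
  "holds I A (URI p) B \<Longrightarrow> p \<in> {TYP, DOM, RANGE, SC, BOTC} \<Longrightarrow> B \<in> voc I \<and> den I B \<in> DC I"
  "holds I A (URI p) B \<Longrightarrow> p \<in> {SC, BOTC} \<Longrightarrow> A \<in> voc I \<and> den I A \<in> DC I"
  by (auto simp: holds_vocab str_TYP dest: str_DOM str_RANGE str_SC str_BOTC)

text \<open>An interpretation that satisfies a defeasible triple only vacuously still satisfies every
  derivable triple that can feed back into the disjointness relations, up to emptiness of its
  subject or object.\<close>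

definition weak :: "interp \<Rightarrow> rdf_term \<Rightarrow> rdf_term \<Rightarrow> rdf_term \<Rightarrow> bool" where
  "weak I A p B \<longleftrightarrow>
     (p = URI SC \<longrightarrow> holds I A (URI SC) B \<or> holds I A (URI BOTC) A) \<and>
     (p = URI SP \<longrightarrow> holds I A (URI SP) B \<or> holds I A (URI BOTP) A) \<and>
     (p = URI BOTC \<longrightarrow> holds I A (URI BOTC) B \<or> holds I A (URI BOTC) A \<or> holds I B (URI BOTC) B) \<and>
     (p = URI BOTP \<longrightarrow> holds I A (URI BOTP) B \<or> holds I A (URI BOTP) A \<or> holds I B (URI BOTP) B) \<and>
     (p = URI DOM \<longrightarrow> holds I A (URI DOM) B) \<and>
     (p = URI RANGE \<longrightarrow> holds I A (URI RANGE) B)"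

lemma self_BOTC: "holds I A (URI BOTC) A \<Longrightarrow> holds I C (URI SC) A \<Longrightarrow> holds I C (URI BOTC) C"
  by (meson holds_rules(7,8))

lemma self_BOTP: "holds I A (URI BOTP) A \<Longrightarrow> holds I C (URI SP) A \<Longrightarrow> holds I C (URI BOTP) C"
  by (meson holds_rules(10,11))

text \<open>The base case may supply only a vacuity. Rules 2a, 3a, 5b and 6b hand it on to the new
  subject, because whatever lies below a self-disjoint term is self-disjoint. Triples with
  \<open>DOM\<close> or \<open>RANGE\<close> hold outright: no defeasible triple has these
  predicates, and no rule yields them, as \<open>E\<close> in rule 2b is outside the vocabulary.
  They make \<open>C\<close> and \<open>D\<close> denote classes, so in rules 7a and 7b
  self-disjointness of one of them already gives the disjointness wanted.\<close>

lemma der_weak: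
  assumes X: "wfX U X"
    and sat: "\<And>A p B. (A, p, B) \<in> X \<Longrightarrow>
      holds I A (URI p) B \<or> (p \<in> {SC, SP} \<and> sat I (vac (A, p, B)))"
  shows "der U X A p B \<Longrightarrow> weak I A p B"
    and "cls U X B \<Longrightarrow> True"
proof (induction rule: der_cls.inducts)
  case (base A p B)
  then show ?case using sat[of A p B] by (auto simp: weak_def sat_holds)
next
  case (d2a A B C)
  then show ?case
    using holds_rules(1)[of I A B C] self_BOTP[of I B A] by (auto simp: weak_def)
next
  case (d2b D E A B)
  have "E \<notin> rdf_bot" using der_wf(1)[OF X d2b(1)] by simp
  then show ?case by (auto simp: weak_def)
next
  case (d3a A B C)
  then show ?case
    using holds_rules(3)[of I A B C] self_BOTC[of I B A] by (auto simp: weak_def)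
next
  case (d5b A B C)
  then show ?case
    using holds_rules(8)[of I A B C] self_BOTC[of I A C] by (auto simp: weak_def)
next
  case (d6b A B C)
  then show ?case
    using holds_rules(11)[of I A B C] self_BOTP[of I A C] by (auto simp: weak_def)
next
  case (d7a A C B D)
  have h: "holds I A (URI DOM) C" "holds I B (URI DOM) D" using d7a(2,4) by (simp_all add: weak_def)
  note m = holds_DC(1)[OF h(1)] holds_DC(1)[OF h(2)]
  have "holds I C (URI BOTC) D \<or> holds I C (URI BOTC) C \<or> holds I D (URI BOTC) D"
    using d7a(6) by (simp add: weak_def)
  then have "holds I C (URI BOTC) D"
    using m holds_rules(9)[of I C D] holds_rules(9)[of I D C] holds_rules(7)[of I D C] by auto
  then show ?case using holds_rules(13)[OF h] by (simp add: weak_def)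
next
  case (d7b A C B D)
  have h: "holds I A (URI RANGE) C" "holds I B (URI RANGE) D" using d7b(2,4) by (simp_all add: weak_def)
  note m = holds_DC(1)[OF h(1)] holds_DC(1)[OF h(2)]
  have "holds I C (URI BOTC) D \<or> holds I C (URI BOTC) C \<or> holds I D (URI BOTC) D"
    using d7b(6) by (simp add: weak_def)
  then have "holds I C (URI BOTC) D"
    using m holds_rules(9)[of I C D] holds_rules(9)[of I D C] holds_rules(7)[of I D C] by auto
  then show ?case using holds_rules(14)[OF h] by (simp add: weak_def)
qed (auto simp: weak_def intro: holds_rules(7,10))

text \<open>\<open>hC\<close> comes into force only once a self-disjoint class is derivable. Before
  that a plain literal may satisfy \<open>cls\<close> without denoting a class, which accounts for
  the second alternative in the claim on \<open>cls\<close>; afterwards it denotes one, since it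
  denotes itself.\<close>

lemma der_sound:
  assumes X: "wfX U X" and mod: "models I {}"
    and sat: "\<And>A p B. (A, p, B) \<in> X \<Longrightarrow> holds I A (URI p) B"
    and U: "U \<subseteq> voc I" and plain: "\<And>w. PlainLit w \<in> U \<Longrightarrow> den I (PlainLit w) = PlainLit w"
    and hC: "\<And>A. der U X A (URI BOTC) A \<Longrightarrow> U - rdf_bot \<subseteq> DC I"
    and hP: "\<And>A. der U X A (URI BOTP) A \<Longrightarrow> den I ` U \<subseteq> DP I"
  shows "der U X A p B \<Longrightarrow> holds I A p B"
    and "cls U X B \<Longrightarrow> den I B \<in> DC I \<or> (\<exists>w. B = PlainLit w)"
proof (induction rule: der_cls.inducts)
  case (base A p B)
  then show ?case using sat by blast
next
  case (d5c A B)
  have "B \<in> U - rdf_bot" using der_wf(2)[OF X] d5c by blast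
  then have "den I B \<in> DC I" using d5c hC[OF d5c(1)] plain by fastforce
  then show ?case using d5c holds_rules(9) \<open>B \<in> U - rdf_bot\<close> U by blast
next
  case (d6c A B)
  then show ?case using hP[OF d6c(1)] holds_rules(12) U by blast
next
  case (c1 A p B)
  then show ?case using holds_DC(1) by blast
next
  case (c2 B p A)
  then show ?case using holds_DC(2) by blast
qed (blast intro: holds_rules)+

section \<open>Canonical interpretations\<close>

text \<open>The terms that must denote properties. Together with the vocabulary they are the ones
  whose denotations are kept apart, since each carries an extension of its own.\<close>

definition PR :: "rdf_term set \<Rightarrow> triple set \<Rightarrow> rdf_term set" where
  "PR U X = {p. (\<exists>A B. der U X A p B)} \<union> {p. \<exists>B. \<exists>u\<in>{SP, BOTP, DOM, RANGE}. der U X p (URI u) B}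
     \<union> {p. \<exists>A. \<exists>u\<in>{SP, BOTP}. der U X A (URI u) p}"

definition CP :: "rdf_term set \<Rightarrow> triple set \<Rightarrow> rdf_term set" where
  "CP U X = {c. (\<exists>A. \<exists>u\<in>{TYP, DOM, RANGE, SC, BOTC}. der U X A (URI u) c)
      \<or> (\<exists>A. \<exists>u\<in>{SC, BOTC}. der U X c (URI u) A)}"

text \<open>
  The denotation \<open>d\<close> is a parameter because refuting an instance of rule 5c requires a term that denotes
  a vocabulary item.
\<close>

locale canon =
  fixes G :: "stmt set" and U V :: "rdf_term set" and X :: "triple set" and d :: "rdf_term \<Rightarrow> rdf_term"
  assumes U: "U = uni (strictified G)" and V: "V = rdf_bot \<union> U" and finU: "finite U"
    and X: "wfX U X"
    and injU: "inj_on d (U - rdf_bot)" and injP: "inj_on d (rdf_bot \<union> PR U X)"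
    and dP: "d ` (rdf_bot \<union> PR U X) \<subseteq> DeltaP G" and dC: "d ` CP U X \<subseteq> DeltaC G"
    and dV: "d ` V \<subseteq> V" and plain: "\<And>w. PlainLit w \<in> U \<Longrightarrow> d (PlainLit w) = PlainLit w"
begin

definition rel :: "rdf_term \<Rightarrow> (rdf_term \<times> rdf_term) set" where
  "rel p = {(d A, d B) | A B. der U X A p B}"

text \<open>A self-disjoint class must be disjoint from every element of \<open>DeltaC G\<close>,
  also from those that are not the denotation of a term in class position; likewise for properties
  and \<open>DeltaP G\<close>. This calls for rows and columns that no derivable triple accounts
  for.\<close>

definition P0 :: "rdf_term \<Rightarrow> (rdf_term \<times> rdf_term) set" where
  "P0 x = \<Union> {rel p | p. d p = x \<and> p \<in> rdf_bot \<union> PR U X}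
     \<union> (if x = d (URI BOTC) then {(a, e). \<exists>A. der U X A (URI BOTC) A \<and> e \<in> DeltaC G \<and> a = d A} \<union>
          {(e, a). \<exists>A. der U X A (URI BOTC) A \<and> e \<in> DeltaC G \<and> a = d A} else {})
     \<union> (if x = d (URI BOTP) then {(a, e). \<exists>A. der U X A (URI BOTP) A \<and> e \<in> DeltaP G \<and> a = d A} \<union>
          {(e, a). \<exists>A. der U X A (URI BOTP) A \<and> e \<in> DeltaP G \<and> a = d A} else {})"

definition J :: interp where
  "J = \<lparr>voc = V, DR = V, DP = DeltaP G, DC = DeltaC G, DL = U \<inter> Lits,
     Pext = restrict P0 (DeltaP G),
     Cext = (\<lambda>c\<in>DeltaC G. {x. (x, c) \<in> rel (URI TYP)}),
     den = restrict d V\<rparr>"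

lemmas wf = der_wf(1)[OF X]

lemma d_eq: "A \<in> U - rdf_bot \<Longrightarrow> B \<in> U - rdf_bot \<Longrightarrow> d A = d B \<longleftrightarrow> A = B"
  using injU by (auto simp: inj_on_def)

lemma dp_eq: "p \<in> rdf_bot \<union> PR U X \<Longrightarrow> q \<in> rdf_bot \<union> PR U X \<Longrightarrow> d p = d q \<longleftrightarrow> p = q"
  using injP by (meson inj_on_def)

lemma Union_rel:
  "p \<in> rdf_bot \<union> PR U X \<Longrightarrow> \<Union> {rel q | q. d q = d p \<and> q \<in> rdf_bot \<union> PR U X} = rel p"
  using dp_eq by auto

lemma P0_eq:
  assumes "p \<in> rdf_bot \<union> PR U X" "p \<noteq> URI BOTC" "p \<noteq> URI BOTP"
  shows "P0 (d p) = rel p"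
proof -
  have "\<Union> {rel q | q. d q = d p \<and> q \<in> rdf_bot \<union> PR U X} = rel p"
    by (rule Union_rel) (rule assms)
  moreover have "d p \<noteq> d (URI BOTC)" "d p \<noteq> d (URI BOTP)"
    using dp_eq[OF assms(1)] assms by auto
  ultimately show ?thesis by (simp add: P0_def)
qed

lemma P0_BOTC: "P0 (d (URI BOTC)) = rel (URI BOTC)
   \<union> {(a, e). \<exists>A. der U X A (URI BOTC) A \<and> e \<in> DeltaC G \<and> a = d A}
   \<union> {(e, a). \<exists>A. der U X A (URI BOTC) A \<and> e \<in> DeltaC G \<and> a = d A}"
proof -
  have "\<Union> {rel q | q. d q = d (URI BOTC) \<and> q \<in> rdf_bot \<union> PR U X} = rel (URI BOTC)"
    by (rule Union_rel) simp
  moreover have "d (URI BOTC) \<noteq> d (URI BOTP)" using dp_eq[of "URI BOTC" "URI BOTP"] by simp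
  ultimately show ?thesis by (simp add: P0_def Un_assoc)
qed

lemma P0_BOTP: "P0 (d (URI BOTP)) = rel (URI BOTP)
   \<union> {(a, e). \<exists>A. der U X A (URI BOTP) A \<and> e \<in> DeltaP G \<and> a = d A}
   \<union> {(e, a). \<exists>A. der U X A (URI BOTP) A \<and> e \<in> DeltaP G \<and> a = d A}"
proof -
  have "\<Union> {rel q | q. d q = d (URI BOTP) \<and> q \<in> rdf_bot \<union> PR U X} = rel (URI BOTP)"
    by (rule Union_rel) simp
  moreover have "d (URI BOTP) \<noteq> d (URI BOTC)" using dp_eq[of "URI BOTC" "URI BOTP"] by simp
  ultimately show ?thesis by (simp add: P0_def Un_assoc)
qed

lemma rel_iff: "A \<in> U - rdf_bot \<Longrightarrow> B \<in> U - rdf_bot \<Longrightarrow> (d A, d B) \<in> rel p \<longleftrightarrow> der U X A p B"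
  unfolding rel_def using wf d_eq by blast

lemma PR_der: "der U X A p B \<Longrightarrow> p \<in> PR U X" by (auto simp: PR_def)

lemma rel_V: "rel p \<subseteq> V \<times> V"
proof -
  have "der U X A p B \<Longrightarrow> d A \<in> V \<and> d B \<in> V" for A B
    using wf[of A p B] dV by (auto simp: V)
  then show ?thesis by (auto simp: rel_def)
qed

lemma P0_V: "P0 x \<subseteq> V \<times> V"
proof -
  have dA: "der U X A p B \<Longrightarrow> d A \<in> V \<and> d B \<in> V" for A p B
    using wf[of A p B] dV by (auto simp: V)
  have 1: "\<Union> {rel p | p. d p = x \<and> p \<in> rdf_bot \<union> PR U X} \<subseteq> V \<times> V"
    using rel_V by blast
  have 2: "DeltaC G \<subseteq> V" "DeltaP G \<subseteq> V" by (auto simp: DeltaC_def DeltaP_def V U)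
  show ?thesis unfolding P0_def
    by (intro Un_least 1) (use 2 dA in \<open>auto split: if_splits\<close>)
qed

lemma mem_V: "x \<in> U \<Longrightarrow> x \<in> V" "x \<in> rdf_bot \<Longrightarrow> x \<in> V"
  by (auto simp: V)

lemma den_J [simp]: "p \<in> V \<Longrightarrow> den J p = d p"
  by (simp add: J_def)

lemma Pext_J: "p \<in> rdf_bot \<union> PR U X \<Longrightarrow> Pext J (d p) = P0 (d p)"
  using dP by (auto simp: J_def)

lemma J_Interps: "J \<in> Interps G"
proof -
  have eq: "rdf_bot \<union> uni (strictified G) = V" "uni (strictified G) \<union> rdf_bot = V" "uni (strictified G) = U"
    by (auto simp: U V)
  have fin: "finite V" using finU by (simp add: V rdf_bot_def)
  have C: "DeltaC G \<subseteq> V" and P: "DeltaP G \<subseteq> V" by (auto simp: DeltaC_def DeltaP_def U V)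
  have lits: "Lits \<inter> V \<subseteq> U \<inter> Lits" "U \<subseteq> V" by (auto simp: V Lits_def)
  have "interpretation_of V J"
    unfolding interpretation_of_def
  proof (intro conjI allI impI ballI)
    show "Pext J \<in> DP J \<rightarrow>\<^sub>E Pow (DR J \<times> DR J)" using P0_V by (auto simp: J_def)
    show "Cext J \<in> DC J \<rightarrow>\<^sub>E Pow (DR J)" using rel_V by (auto simp: J_def)
    show "den J \<in> V \<rightarrow>\<^sub>E DR J \<union> DP J" using dV by (auto simp: J_def)
    show "den J (PlainLit w) = PlainLit w" if "PlainLit w \<in> V" for w
    proof -
      have "PlainLit w \<in> U" using that by (simp add: V)
      then show ?thesis using that plain by (simp add: J_def)
    qed
    show "den J l \<in> DR J" if "l \<in> Lits \<inter> V" for l using that dV by (auto simp: J_def)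
  qed (use fin C P lits finU in \<open>auto simp: J_def intro: finite_subset\<close>)
  then show ?thesis unfolding Interps_def mem_Collect_eq eq(1,2) by (simp add: J_def flip: U)
qed

lemma PU_J: "e \<in> {SP, SC, TYP, DOM, RANGE} \<Longrightarrow> PU J e = rel (URI e)"
  "PU J BOTC = P0 (d (URI BOTC))" "PU J BOTP = P0 (d (URI BOTP))"
proof -
  have *: "URI e \<in> V" if "URI e \<in> rdf_bot" for e using that by (simp add: V)
  show "PU J e = rel (URI e)" if "e \<in> {SP, SC, TYP, DOM, RANGE}"
    using that Pext_J[of "URI e"] P0_eq[of "URI e"] *[of e] by auto
  show "PU J BOTC = P0 (d (URI BOTC))" using Pext_J[of "URI BOTC"] *[of BOTC] by auto
  show "PU J BOTP = P0 (d (URI BOTP))" using Pext_J[of "URI BOTP"] *[of BOTP] by auto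
qed

lemma mem_P: "der U X A (URI u) B \<Longrightarrow> u \<in> {SP, BOTP, DOM, RANGE} \<Longrightarrow> A \<in> PR U X \<and> d A \<in> DeltaP G"
  "der U X A (URI u) B \<Longrightarrow> u \<in> {SP, BOTP} \<Longrightarrow> B \<in> PR U X \<and> d B \<in> DeltaP G"
  using dP unfolding PR_def by blast+

lemma mem_C: "der U X A (URI u) B \<Longrightarrow> u \<in> {TYP, DOM, RANGE, SC, BOTC} \<Longrightarrow> d B \<in> DeltaC G"
  "der U X A (URI u) B \<Longrightarrow> u \<in> {SC, BOTC} \<Longrightarrow> d A \<in> DeltaC G"
  using dC unfolding CP_def by blast+

lemma rel_prop: "p \<in> PR U X \<Longrightarrow> p \<notin> rdf_bot \<Longrightarrow> Pext J (d p) = rel p"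
  using Pext_J[of p] P0_eq[of p] rdf_bot_simps(6,7) by (metis UnI2)

lemma relE: "(x, y) \<in> rel p \<Longrightarrow> (\<And>A B. x = d A \<Longrightarrow> y = d B \<Longrightarrow> der U X A p B \<Longrightarrow> thesis) \<Longrightarrow> thesis"
  by (auto simp: rel_def)

lemma relI: "der U X A p B \<Longrightarrow> (d A, d B) \<in> rel p"
  by (auto simp: rel_def)

text \<open>Distinct subjects and objects have distinct denotations, so pairs that meet in the
  interpretation come from triples that meet in the closure.\<close>

lemma join: "der U X A p B \<Longrightarrow> der U X B' q C \<Longrightarrow> d B = d B' \<Longrightarrow> B' = B"
  "der U X B p A \<Longrightarrow> der U X B' q C \<Longrightarrow> d B = d B' \<Longrightarrow> B' = B"
  "der U X A p B \<Longrightarrow> der U X C q B' \<Longrightarrow> d B = d B' \<Longrightarrow> B' = B"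
  using wf d_eq by blast+

lemma rel_comp:
  assumes "(x, y) \<in> rel p" "(y, z) \<in> rel q"
    and "\<And>A B C. der U X A p B \<Longrightarrow> der U X B q C \<Longrightarrow> der U X A r C"
  shows "(x, z) \<in> rel r"
proof -
  obtain A B where 1: "x = d A" "y = d B" "der U X A p B" using assms(1) by (rule relE)
  obtain B' C where 2: "y = d B'" "z = d C" "der U X B' q C" using assms(2) by (rule relE)
  have "B' = B" using join(1)[OF 1(3) 2(3)] 1(2) 2(1) by simp
  then show ?thesis using 1 2 assms(3) relI by blast
qed

lemma BOTC_SC: "(c, e) \<in> P0 (d (URI BOTC)) \<Longrightarrow> (f, c) \<in> rel (URI SC) \<Longrightarrow> (f, e) \<in> P0 (d (URI BOTC))"
proof (erule relE)
  fix C A assume f: "f = d C" and c: "c = d A" and sc: "der U X C (URI SC) A"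
    and "(c, e) \<in> P0 (d (URI BOTC))"
  then consider (1) A' B where "d A = d A'" "e = d B" "der U X A' (URI BOTC) B"
    | (2) A' where "d A = d A'" "der U X A' (URI BOTC) A'" "e \<in> DeltaC G"
    | (3) B where "e = d B" "der U X B (URI BOTC) B" unfolding P0_BOTC rel_def by blast
  then show "(f, e) \<in> P0 (d (URI BOTC))"
  proof cases
    case 1
    then have "A' = A" using join(1)[OF sc 1(3)] by simp
    then have "der U X C (URI BOTC) B" using d5b sc 1 by blast
    then show ?thesis using f 1 relI by (auto simp: P0_BOTC)
  next
    case 2
    then have "A' = A" using join(1)[OF sc 2(2)] by simp
    then have "der U X C (URI BOTC) C" using d5b d5a sc 2 by blast
    then show ?thesis using f 2 by (auto simp: P0_BOTC)
  next
    case 3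
    then show ?thesis using f mem_C(2)[OF sc] by (auto simp: P0_BOTC)
  qed
qed

lemma BOTP_SP: "(c, e) \<in> P0 (d (URI BOTP)) \<Longrightarrow> (f, c) \<in> rel (URI SP) \<Longrightarrow> (f, e) \<in> P0 (d (URI BOTP))"
proof (erule relE)
  fix C A assume f: "f = d C" and c: "c = d A" and sc: "der U X C (URI SP) A"
    and "(c, e) \<in> P0 (d (URI BOTP))"
  then consider (1) A' B where "d A = d A'" "e = d B" "der U X A' (URI BOTP) B"
    | (2) A' where "d A = d A'" "der U X A' (URI BOTP) A'" "e \<in> DeltaP G"
    | (3) B where "e = d B" "der U X B (URI BOTP) B" unfolding P0_BOTP rel_def by blast
  then show "(f, e) \<in> P0 (d (URI BOTP))"
  proof cases
    case 1
    then have "A' = A" using join(1)[OF sc 1(3)] by simp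
    then have "der U X C (URI BOTP) B" using d6b sc 1 by blast
    then show ?thesis using f 1 relI by (auto simp: P0_BOTP)
  next
    case 2
    then have "A' = A" using join(1)[OF sc 2(2)] by simp
    then have "der U X C (URI BOTP) C" using d6b d6a sc 2 by blast
    then show ?thesis using f 2 by (auto simp: P0_BOTP)
  next
    case 3
    then show ?thesis using f mem_P(1)[OF sc] by (auto simp: P0_BOTP)
  qed
qed

text \<open>The added rows and columns create no new self-disjoint element.\<close>

lemma self_P0_BOTC: "(c, c) \<in> P0 (d (URI BOTC)) \<Longrightarrow> \<exists>A. c = d A \<and> der U X A (URI BOTC) A"
  using join(2)[OF _ d5a] unfolding P0_BOTC rel_def by blast

lemma self_P0_BOTP: "(c, c) \<in> P0 (d (URI BOTP)) \<Longrightarrow> \<exists>A. c = d A \<and> der U X A (URI BOTP) A"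
  using join(2)[OF _ d6a] unfolding P0_BOTP rel_def by blast

text \<open>The added rows and columns contribute nothing new here: \<open>C\<close> and
  \<open>D\<close> are objects of \<open>DOM\<close> or \<open>RANGE\<close> triples, hence satisfy
  \<open>cls\<close>, and rule 5c derives the pair.\<close>

lemma J_7:
  assumes u: "u \<in> {DOM, RANGE}" and 1: "(p, c) \<in> rel (URI u)" and 2: "(q, c') \<in> rel (URI u)"
    and self: "(c, c') \<in> P0 (d (URI BOTC))"
  shows "(p, q) \<in> P0 (d (URI BOTP))"
proof -
  obtain A C where AC: "p = d A" "c = d C" "der U X A (URI u) C" using 1 by (erule relE)
  obtain B D where BD: "q = d B" "c' = d D" "der U X B (URI u) D" using 2 by (erule relE)
  have cls: "cls U X C" "cls U X D" using AC BD u c1 by blast+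
  consider (1) C' D' where "d C = d C'" "d D = d D'" "der U X C' (URI BOTC) D'"
    | (2) C' where "d C = d C'" "der U X C' (URI BOTC) C'"
    | (3) D' where "d D = d D'" "der U X D' (URI BOTC) D'"
    using self unfolding AC(2) BD(2) P0_BOTC rel_def by blast
  then have "der U X C (URI BOTC) D"
  proof cases
    case 1
    then show ?thesis using join(1)[OF AC(3) 1(3)] join(3)[OF BD(3) 1(3)] by simp
  next
    case 2
    then show ?thesis using join(1)[OF AC(3) 2(2)] cls d5c by blast
  next
    case 3
    then show ?thesis using join(1)[OF BD(3) 3(2)] cls d5c d5a by blast
  qed
  then have "der U X A (URI BOTP) B" using AC BD u d7a d7b by blast
  then show ?thesis using AC BD relI by (auto simp: P0_BOTP)
qed

lemma J_models: "models J {}"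
proof -
  have nb: "der U X A p B \<Longrightarrow> A \<notin> rdf_bot \<and> B \<notin> rdf_bot" for A p B using wf[of A p B] by simp
  have voc: "rdf_bot \<union> uni {} \<subseteq> voc J" using mem_V by (auto simp: J_def uni_def)
  have e: "\<forall>e\<in>rdf_bot. den J e \<in> DP J" using dP mem_V by (auto simp: J_def)
  have DP: "DP J = DeltaP G" and DC: "DC J = DeltaC G" by (auto simp: J_def)
  have t1: "trans_on (DP J) (PU J SP)"
  proof -
    have "(x, z) \<in> rel (URI SP)" if "(x, y) \<in> rel (URI SP)" "(y, z) \<in> rel (URI SP)" for x y z
      by (rule rel_comp[OF that]) (rule d2a)
    then show ?thesis unfolding PU_J(1)[of SP, simplified] trans_on_def by blast
  qed
  have t2: "trans_on (DC J) (PU J SC)"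
  proof -
    have "(x, z) \<in> rel (URI SC)" if "(x, y) \<in> rel (URI SC)" "(y, z) \<in> rel (URI SC)" for x y z
      by (rule rel_comp[OF that]) (rule d3a)
    then show ?thesis unfolding PU_J(1)[of SC, simplified] trans_on_def by blast
  qed
  have s1: "p \<in> DP J \<and> q \<in> DP J \<and> Pext J p \<subseteq> Pext J q" if h: "(p, q) \<in> PU J SP" for p q
  proof -
    obtain A B where AB: "p = d A" "q = d B" "der U X A (URI SP) B"
      using h unfolding PU_J(1)[of SP, simplified] by (rule relE)
    have "rel A \<subseteq> rel B" unfolding rel_def using d2b[OF AB(3)] by blast
    then show ?thesis using AB mem_P[OF AB(3)] nb[OF AB(3)] rel_prop by (simp add: DP)
  qed
  have s2: "c \<in> DC J \<and> e \<in> DC J \<and> Cext J c \<subseteq> Cext J e" if h: "(c, e) \<in> PU J SC" for c e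
  proof -
    obtain A B where AB: "c = d A" "e = d B" "der U X A (URI SC) B"
      using h unfolding PU_J(1)[of SC, simplified] by (rule relE)
    have "(x, d A) \<in> rel (URI TYP) \<Longrightarrow> (x, d B) \<in> rel (URI TYP)" for x
      by (erule rel_comp[OF _ relI[OF AB(3)]]) (rule d3b)
    then show ?thesis using AB mem_C[OF AB(3)] by (auto simp: J_def)
  qed
  have y1: "x \<in> Cext J c \<longleftrightarrow> (x, c) \<in> PU J TYP" if "c \<in> DC J" for x c
    using that PU_J(1)[of TYP] by (simp add: J_def)
  have y2: "c \<in> DC J" if "(x, c) \<in> PU J TYP" for x c
    using that PU_J(1)[of TYP] mem_C(1) unfolding DC by (auto elim!: relE)
  have dm: "p \<in> DP J \<and> c \<in> DC J \<and> (\<forall>(x, y)\<in>Pext J p. x \<in> Cext J c)" if h: "(p, c) \<in> PU J DOM" for p c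
  proof -
    obtain A B where AB: "p = d A" "c = d B" "der U X A (URI DOM) B"
      using h unfolding PU_J(1)[of DOM, simplified] by (rule relE)
    have P: "Pext J p = rel A" using AB mem_P(1)[OF AB(3)] nb[OF AB(3)] rel_prop by simp
    have "x \<in> Cext J c" if xy: "(x, y) \<in> rel A" for x y
    proof -
      obtain Y Z where "x = d Y" "der U X Y A Z" using xy by (auto elim: relE)
      then show ?thesis using d4a[OF AB(3)] AB(2) mem_C(1)[OF AB(3)] relI by (auto simp: J_def)
    qed
    then show ?thesis using AB mem_P(1)[OF AB(3)] mem_C(1)[OF AB(3)] P by (auto simp: DP DC)
  qed
  have rg: "p \<in> DP J \<and> c \<in> DC J \<and> (\<forall>(x, y)\<in>Pext J p. y \<in> Cext J c)" if h: "(p, c) \<in> PU J RANGE" for p c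
  proof -
    obtain A B where AB: "p = d A" "c = d B" "der U X A (URI RANGE) B"
      using h unfolding PU_J(1)[of RANGE, simplified] by (rule relE)
    have P: "Pext J p = rel A" using AB mem_P(1)[OF AB(3)] nb[OF AB(3)] rel_prop by simp
    have "y \<in> Cext J c" if xy: "(x, y) \<in> rel A" for x y
    proof -
      obtain Y Z where "y = d Z" "der U X Y A Z" using xy by (auto elim: relE)
      then show ?thesis using d4b[OF AB(3)] AB(2) mem_C(1)[OF AB(3)] relI by (auto simp: J_def)
    qed
    then show ?thesis using AB mem_P(1)[OF AB(3)] mem_C(1)[OF AB(3)] P by (auto simp: DP DC)
  qed
  have b1: "PU J BOTC \<subseteq> DC J \<times> DC J"
    unfolding PU_J P0_BOTC DC rel_def using mem_C by blast
  have b2: "sym (PU J BOTC)"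
    unfolding PU_J P0_BOTC sym_def rel_def using d5a by blast
  have b3: "(c, c) \<in> PU J BOTC \<Longrightarrow> e \<in> DC J \<Longrightarrow> (c, e) \<in> PU J BOTC" for c e
    unfolding PU_J DC by (drule self_P0_BOTC) (auto simp: P0_BOTC)
  have p1: "PU J BOTP \<subseteq> DP J \<times> DP J"
    unfolding PU_J P0_BOTP DP rel_def using mem_P by blast
  have p2: "sym (PU J BOTP)"
    unfolding PU_J P0_BOTP sym_def rel_def using d6a by blast
  have p3: "(c, c) \<in> PU J BOTP \<Longrightarrow> e \<in> DP J \<Longrightarrow> (c, e) \<in> PU J BOTP" for c e
    unfolding PU_J DP by (drule self_P0_BOTP) (auto simp: P0_BOTP)
  have b4: "(c, e) \<in> PU J BOTC \<Longrightarrow> (f, c) \<in> PU J SC \<Longrightarrow> (f, e) \<in> PU J BOTC" for c e f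
    using BOTC_SC PU_J by simp
  have p4: "(c, e) \<in> PU J BOTP \<Longrightarrow> (f, c) \<in> PU J SP \<Longrightarrow> (f, e) \<in> PU J BOTP" for c e f
    using BOTP_SP PU_J by simp
  have x1: "(p, c) \<in> PU J DOM \<Longrightarrow> (q, e) \<in> PU J DOM \<Longrightarrow> (c, e) \<in> PU J BOTC \<Longrightarrow> (p, q) \<in> PU J BOTP" for p q c e
    using J_7[of DOM] PU_J by simp
  have x2: "(p, c) \<in> PU J RANGE \<Longrightarrow> (q, e) \<in> PU J RANGE \<Longrightarrow> (c, e) \<in> PU J BOTC \<Longrightarrow> (p, q) \<in> PU J BOTP" for p q c e
    using J_7[of RANGE] PU_J by simp
  have "\<forall>(p, q)\<in>PU J SP. p \<in> DP J \<and> q \<in> DP J \<and> Pext J p \<subseteq> Pext J q"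
    "\<forall>(c, e)\<in>PU J SC. c \<in> DC J \<and> e \<in> DC J \<and> Cext J c \<subseteq> Cext J e"
    "\<forall>c\<in>DC J. \<forall>x. x \<in> Cext J c \<longleftrightarrow> (x, c) \<in> PU J TYP" "\<forall>(x, c)\<in>PU J TYP. c \<in> DC J"
    "\<forall>(p, c)\<in>PU J DOM. p \<in> DP J \<and> c \<in> DC J \<and> (\<forall>(x, y)\<in>Pext J p. x \<in> Cext J c)"
    "\<forall>(p, c)\<in>PU J RANGE. p \<in> DP J \<and> c \<in> DC J \<and> (\<forall>(x, y)\<in>Pext J p. y \<in> Cext J c)"
    subgoal using s1 by blast
    subgoal using s2 by blast
    subgoal using y1 by blast
    subgoal using y2 by blast
    subgoal using dm by blast
    subgoal using rg by blast
    done
  moreover have "\<forall>c e f. (c, e) \<in> PU J BOTC \<and> (f, c) \<in> PU J SC \<longrightarrow> (f, e) \<in> PU J BOTC"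
    "\<forall>c. (c, c) \<in> PU J BOTC \<longrightarrow> (\<forall>e\<in>DC J. (c, e) \<in> PU J BOTC)"
    "\<forall>c e f. (c, e) \<in> PU J BOTP \<and> (f, c) \<in> PU J SP \<longrightarrow> (f, e) \<in> PU J BOTP"
    "\<forall>c. (c, c) \<in> PU J BOTP \<longrightarrow> (\<forall>e\<in>DP J. (c, e) \<in> PU J BOTP)"
    using b3 b4 p3 p4 by blast+
  moreover have "\<forall>p q c e. (p, c) \<in> PU J DOM \<and> (q, e) \<in> PU J DOM \<and> (c, e) \<in> PU J BOTC \<longrightarrow> (p, q) \<in> PU J BOTP"
    "\<forall>p q c e. (p, c) \<in> PU J RANGE \<and> (q, e) \<in> PU J RANGE \<and> (c, e) \<in> PU J BOTC \<longrightarrow> (p, q) \<in> PU J BOTP"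
    using x1 x2 by blast+
  moreover have "\<forall>(s, p, oo)\<in>{}. den J (URI p) \<in> DP J \<and> (den J s, den J oo) \<in> PU J p" by simp
  ultimately show ?thesis
    unfolding models_def using voc e t1 t2 b1 b2 p1 p2 by (intro conjI)
qed

text \<open>The alternatives to derivability are the added rows and columns. The assumption on
  \<open>p\<close> rules out a term that is no property itself but borrows an extension by sharing
  the denotation of one.\<close>

lemma holds_J:
  assumes "A \<in> U - rdf_bot" "B \<in> U - rdf_bot" "p \<in> V"
    and p: "p \<in> rdf_bot \<union> PR U X \<or> (\<forall>q\<in>rdf_bot \<union> PR U X. d q \<noteq> d p)"
  shows "holds J A p B \<Longrightarrow> der U X A p B \<or>
     (p = URI BOTC \<and> (der U X A (URI BOTC) A \<and> d B \<in> DeltaC G \<or> der U X B (URI BOTC) B \<and> d A \<in> DeltaC G)) \<or>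
     (p = URI BOTP \<and> (der U X A (URI BOTP) A \<or> der U X B (URI BOTP) B))"
proof -
  assume h: "holds J A p B"
  then have P0: "(d A, d B) \<in> P0 (d p)"
    using assms mem_V by (auto simp: holds_def J_def split: if_splits)
  show ?thesis
  proof (cases "p \<in> rdf_bot \<union> PR U X")
    case False
    then have n: "\<forall>q\<in>rdf_bot \<union> PR U X. d q \<noteq> d p" using p by blast
    have "d p \<noteq> d (URI BOTC)" "d p \<noteq> d (URI BOTP)" using n rdf_bot_simps(6,7) by (metis UnI1)+
    then have "P0 (d p) = {}" using n by (auto simp: P0_def)
    then show ?thesis using P0 by simp
  next
    case True
    consider "p = URI BOTC" | "p = URI BOTP" | "p \<noteq> URI BOTC" "p \<noteq> URI BOTP" by blast
    then show ?thesis
    proof cases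
      case 1
      then show ?thesis using P0 assms(1,2) wf d_eq unfolding 1 P0_BOTC by (fastforce simp: rel_iff)
    next
      case 2
      then show ?thesis using P0 assms(1,2) wf d_eq unfolding 2 P0_BOTP by (fastforce simp: rel_iff)
    next
      case 3
      then show ?thesis using P0_eq[OF True] rel_iff assms(1,2) P0 by simp
    qed
  qed
qed

lemma J_holds: "der U X A p B \<Longrightarrow> holds J A p B"
proof -
  assume der: "der U X A p B"
  then have w: "A \<in> U - rdf_bot" "B \<in> U - rdf_bot" "p \<in> V" and p: "p \<in> rdf_bot \<union> PR U X"
    using wf PR_der by (auto simp: V)
  have "(d A, d B) \<in> P0 (d p)"
    using relI[OF der] p unfolding P0_def by blast
  moreover have "d p \<in> DeltaP G" using dP p by blast
  ultimately show ?thesis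
    using w J_models mem_V by (auto simp: holds_def J_def)
qed

end

lemma strictified_eq: "strictified G = strs G \<union> defs G"
  by (auto simp: strictified_def strs_def defs_def)

lemma der_nonempty: "der U X A p B \<Longrightarrow> X \<noteq> {}" "cls U X B \<Longrightarrow> True"
  by (induction rule: der_cls.inducts) auto

lemma Cl_wf:
  assumes "\<And>t. t \<in> H \<Longrightarrow> wf_triple t"
  shows "(A, p, B) \<in> Cl H \<Longrightarrow> A \<notin> rdf_bot \<and> B \<notin> rdf_bot"
proof (induction "(A, p, B)" arbitrary: A p B rule: Cl.induct)
  case base
  then show ?case using assms by fastforce
qed auto

section \<open>Syntactic levels\<close>

definition derT :: "stmt set \<Rightarrow> triple set \<Rightarrow> triple \<Rightarrow> bool" where
  "derT G X = (\<lambda>(s, p, oo). der (uni (strictified G)) X s (URI p) oo)"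

primrec slev :: "stmt set \<Rightarrow> nat \<Rightarrow> triple set" where
  "slev G 0 = defs G"
| "slev G (Suc i) = {d \<in> slev G i. derT G (strs G \<union> slev G i) (vac d)}"

abbreviation XL :: "stmt set \<Rightarrow> nat \<Rightarrow> triple set" where
  "XL G i \<equiv> strs G \<union> slev G i"

lemma slev_antimono: "i \<le> j \<Longrightarrow> slev G j \<subseteq> slev G i"
  by (rule lift_Suc_antimono_le[of "slev G"]) auto

declare slev.simps(2) [simp del]

locale dgraph =
  fixes G :: "stmt set"
  assumes G: "defeasible_graph G"
begin

abbreviation "H \<equiv> strictified G"
abbreviation "U \<equiv> uni (strictified G)"

lemma finite_H: "finite H"
proof -
  have "H \<subseteq> (\<lambda>x. case x of Strict t \<Rightarrow> t | Defeasible t \<Rightarrow> t) ` G"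
    by (force simp: strictified_def)
  then show ?thesis using G finite_surj by (auto simp: defeasible_graph_def)
qed

lemma finite_U: "finite U"
proof -
  have "finite (terms_of t)" for t by (cases t) auto
  then show ?thesis using finite_H by (auto simp: uni_def)
qed

lemma finite_defs: "finite (defs G)"
  using finite_H by (auto simp: strictified_eq)

lemma wf_H: "t \<in> H \<Longrightarrow> wf_triple t"
  using G by (cases t) (force simp: strictified_def defeasible_graph_def)

lemma wfX_sub: "X \<subseteq> H \<Longrightarrow> wfX U X"
  using wf_H by (auto simp: wfX_def uni_def)

lemma wfd: "d \<in> defs G \<Longrightarrow> wfd d"
  using wfd_defs[OF G] .

text \<open>What \<open>Cl\<close> retains of a derivable generalized triple. A triple obtained
  through a literal in predicate position may be missing from \<open>Cl\<close>, and so may the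
  \<open>TYP\<close> triples drawn from it, but the positions that decide membership in
  \<open>DeltaP\<close> and \<open>DeltaC\<close> are still occupied.\<close>

definition in_Cl :: "rdf_term \<Rightarrow> rdf_term \<Rightarrow> rdf_term \<Rightarrow> bool" where
  "in_Cl A p B \<longleftrightarrow> (\<forall>u\<in>{SP, SC, DOM, RANGE, BOTC, BOTP}. p = URI u \<longrightarrow> (A, u, B) \<in> Cl H) \<and>
      (p = URI TYP \<longrightarrow> (\<exists>A'. \<exists>u\<in>{TYP, DOM, RANGE, SC}. (A', u, B) \<in> Cl H)) \<and>
      (p \<notin> rdf_bot \<longrightarrow> (\<exists>u A B. p = URI u \<and> (A, u, B) \<in> Cl H) \<or> (\<exists>A'. (A', SP, p) \<in> Cl H))"

lemma in_Cl_vocab: "u \<in> {SP, SC, DOM, RANGE, BOTC, BOTP} \<Longrightarrow> in_Cl A (URI u) B \<longleftrightarrow> (A, u, B) \<in> Cl H"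
  unfolding in_Cl_def by (auto simp: rdf_bot_def)

lemma in_ClD: "in_Cl A (URI u) B \<Longrightarrow> u \<in> {SP, SC, DOM, RANGE, BOTC, BOTP} \<Longrightarrow> (A, u, B) \<in> Cl H"
  using in_Cl_vocab[of u A B] by simp

lemma in_Cl_TYP: "in_Cl A (URI TYP) B \<longleftrightarrow> (\<exists>A'. \<exists>u\<in>{TYP, DOM, RANGE, SC}. (A', u, B) \<in> Cl H)"
  unfolding in_Cl_def by auto

lemma in_Cl_name: "p \<notin> rdf_bot \<Longrightarrow> (A', SP, p) \<in> Cl H \<Longrightarrow> in_Cl A p B"
  unfolding in_Cl_def by (auto simp: rdf_bot_def)

lemma der_Cl:
  assumes X: "wfX U X" and base: "X \<subseteq> Cl H"
  shows "der U X A p B \<Longrightarrow> in_Cl A p B"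
    and "cls U X B \<Longrightarrow> True"
proof (induction rule: der_cls.inducts)
  case (base A p B)
  then show ?case using assms(2) unfolding in_Cl_def by blast
next
  case (d2a A B C)
  then show ?case by (simp add: in_Cl_vocab) (blast intro: Cl.r2a)
next
  case (d2b D E A B)
  have "E \<notin> rdf_bot" using der_wf(1)[OF X d2b(1)] by simp
  then show ?case by (rule in_Cl_name) (use d2b in \<open>simp add: in_Cl_vocab\<close>)
next
  case (d3a A B C)
  then show ?case by (simp add: in_Cl_vocab) (blast intro: Cl.r3a)
next
  case (d5a A B)
  then show ?case by (simp add: in_Cl_vocab) (blast intro: Cl.r5a)
next
  case (d5b A B C)
  then show ?case by (simp add: in_Cl_vocab) (blast intro: Cl.r5b)
next
  case (d5c A B)
  have "B \<notin> rdf_bot" using der_wf(2)[OF X d5c(3)] by simp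
  then show ?case using d5c by (simp add: in_Cl_vocab) (blast intro: Cl.r5c)
next
  case (d6a A B)
  then show ?case by (simp add: in_Cl_vocab) (blast intro: Cl.r6a)
next
  case (d6b A B C)
  then show ?case by (simp add: in_Cl_vocab) (blast intro: Cl.r6b)
next
  case (d6c A B)
  then show ?case by (simp add: in_Cl_vocab) (blast intro: Cl.r6c)
next
  case (d7a A C B D)
  then show ?case by (simp add: in_Cl_vocab) (blast intro: Cl.r7a)
next
  case (d7b A C B D)
  then show ?case by (simp add: in_Cl_vocab) (blast intro: Cl.r7b)
qed (auto simp: in_Cl_vocab in_Cl_TYP)

lemma sub_Cl: "X \<subseteq> H \<Longrightarrow> X \<subseteq> Cl H"
  using Cl.base by blast

section \<open>Canonical models over the domains of the graph\<close>

context
  fixes X assumes X: "wfX U X" and XCl: "X \<subseteq> Cl H"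
begin

lemma der_Cl_vocab: "der U X A (URI u) B \<Longrightarrow> u \<in> {SP, SC, DOM, RANGE, BOTC, BOTP} \<Longrightarrow> (A, u, B) \<in> Cl H"
  using der_Cl(1)[OF X XCl] in_ClD by blast

lemma PR_DeltaP: "rdf_bot \<union> PR U X \<subseteq> DeltaP G"
proof -
  have "p \<in> DeltaP G" if p: "p \<in> PR U X" "p \<notin> rdf_bot" for p
  proof -
    consider (1) A B where "der U X A p B" | (2) u B where "u \<in> {SP, BOTP, DOM, RANGE}" "der U X p (URI u) B"
      | (3) u A where "u \<in> {SP, BOTP}" "der U X A (URI u) p"
      using p(1) unfolding PR_def by blast
    then show ?thesis
    proof cases
      case 1
      then have "p \<in> U" using der_wf(1)[OF X 1] that by blast
      moreover have "(\<exists>u A B. p = URI u \<and> (A, u, B) \<in> Cl H) \<or> (\<exists>A'. (A', SP, p) \<in> Cl H)"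
        using der_Cl(1)[OF X XCl 1] that unfolding in_Cl_def by blast
      ultimately show ?thesis unfolding DeltaP_def by blast
    next
      case 2
      then have "p \<in> U" "(p, u, B) \<in> Cl H" using der_wf(1)[OF X 2(2)] der_Cl_vocab[OF 2(2)] by auto
      then show ?thesis using 2(1) unfolding DeltaP_def by blast
    next
      case 3
      then have "p \<in> U" "(A, u, p) \<in> Cl H" using der_wf(1)[OF X 3(2)] der_Cl_vocab[OF 3(2)] by auto
      then show ?thesis using 3(1) unfolding DeltaP_def by blast
    qed
  qed
  then show ?thesis by (auto simp: DeltaP_def)
qed

lemma CP_DeltaC: "CP U X \<subseteq> DeltaC G"
proof
  fix c assume c: "c \<in> CP U X"
  consider (1) A where "der U X A (URI TYP) c"
    | (2) A u where "u \<in> {DOM, RANGE, SC, BOTC}" "der U X A (URI u) c"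
    | (3) A u where "u \<in> {SC, BOTC}" "der U X c (URI u) A"
    using c unfolding CP_def by blast
  then show "c \<in> DeltaC G"
  proof cases
    case 1
    then have "c \<in> U" "\<exists>A'. \<exists>u\<in>{TYP, DOM, RANGE, SC}. (A', u, c) \<in> Cl H"
      using der_wf(1)[OF X 1] der_Cl(1)[OF X XCl 1] unfolding in_Cl_TYP by auto
    then show ?thesis unfolding DeltaC_def by blast
  next
    case 2
    then have "c \<in> U" "(A, u, c) \<in> Cl H" using der_wf(1)[OF X 2(2)] der_Cl_vocab[OF 2(2)] by auto
    then show ?thesis using 2(1) unfolding DeltaC_def by blast
  next
    case 3
    then have "c \<in> U" "(c, u, A) \<in> Cl H" using der_wf(1)[OF X 3(2)] der_Cl_vocab[OF 3(2)] by auto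
    then show ?thesis using 3(1) unfolding DeltaC_def by blast
  qed
qed

lemma self_DeltaC: "der U X A (URI BOTC) A \<Longrightarrow> U - rdf_bot \<subseteq> DeltaC G"
  using der_Cl_vocab[of A BOTC A] Cl.r5c[of A H] unfolding DeltaC_def by blast

lemma self_DeltaP: "der U X A (URI BOTP) A \<Longrightarrow> U \<union> rdf_bot \<subseteq> DeltaP G"
  using der_Cl_vocab[of A BOTP A] Cl.r6c[of A H] unfolding DeltaP_def by blast

lemma canon_id: "canon G U (rdf_bot \<union> U) X (\<lambda>x. x)"
  using PR_DeltaP CP_DeltaC finite_U X by unfold_locales (auto simp: inj_on_def)

text \<open>The denotation is the identity. This model satisfies an underivable triple only where a
  self-disjoint term is involved.\<close>

lemma canonical_model:
  obtains J where "J \<in> Interps G" "\<And>t. t \<in> X \<Longrightarrow> sat J t"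
    "\<And>A p B. holds J A (URI p) B \<Longrightarrow> wf_triple (A, p, B) \<Longrightarrow> A \<in> U - rdf_bot \<and> B \<in> U - rdf_bot \<and>
       (der U X A (URI p) B \<or> (p = BOTC \<and> (der U X A (URI BOTC) A \<or> der U X B (URI BOTC) B))
       \<or> (p = BOTP \<and> (der U X A (URI BOTP) A \<or> der U X B (URI BOTP) B)))"
proof -
  interpret c: canon G U "rdf_bot \<union> U" X "\<lambda>x. x" by (rule canon_id)
  have 1: "sat c.J t" if "t \<in> X" for t
    using that c.J_holds der_cls.base by (cases t) (auto simp: sat_holds)
  have 2: "A \<in> U - rdf_bot \<and> B \<in> U - rdf_bot \<and>
       (der U X A (URI p) B \<or> (p = BOTC \<and> (der U X A (URI BOTC) A \<or> der U X B (URI BOTC) B))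
       \<or> (p = BOTP \<and> (der U X A (URI BOTP) A \<or> der U X B (URI BOTP) B)))"
    if h: "holds c.J A (URI p) B" and wf: "wf_triple (A, p, B)" for A p B
  proof -
    have v: "A \<in> U - rdf_bot" "B \<in> U - rdf_bot" "URI p \<in> rdf_bot \<union> U"
      using h wf by (auto simp: holds_def c.J_def)
    have "URI p \<in> rdf_bot \<union> PR U X \<or> (\<forall>q\<in>rdf_bot \<union> PR U X. q \<noteq> URI p)" by blast
    from c.holds_J[OF v this h] v show ?thesis by auto
  qed
  show ?thesis by (rule that[OF c.J_Interps 1 2])
qed

text \<open>Disjointness of \<open>a\<close> and \<open>b\<close> is refuted by letting
  \<open>b\<close> denote \<open>URI SP\<close>, which never belongs to \<open>DeltaC G\<close>. If
  \<open>b\<close> is also a property, \<open>URI SP\<close> denotes \<open>b\<close> in exchange,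
  to keep the denotation injective on properties. By rule \<open>c3\<close> the term
  \<open>b\<close> is no plain literal and so is free to move.\<close>

lemma avoiding_model:
  assumes a: "der U X a (URI BOTC) a" and b: "b \<in> U - rdf_bot" "\<not> cls U X b"
  obtains J where "J \<in> Interps G" "\<And>t. t \<in> X \<Longrightarrow> sat J t"
    "\<not> holds J a (URI BOTC) b" "\<not> holds J b (URI BOTC) a"
proof -
  define d where "d = (if b \<in> PR U X then (\<lambda>x. if x = b then URI SP else if x = URI SP then b else x)
     else (\<lambda>x. if x = b then URI SP else x))"
  have bC: "b \<notin> CP U X" using b(2) c1 c2 unfolding CP_def by blast
  have CPbot: "CP U X \<inter> rdf_bot = {}" unfolding CP_def using der_wf(1)[OF X] by blast
  have dC: "d ` CP U X \<subseteq> DeltaC G"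
  proof -
    have "d x = x" if "x \<in> CP U X" for x
      using that bC CPbot rdf_bot_simps(1) by (auto simp: d_def)
    then show ?thesis using CP_DeltaC by auto
  qed
  have dP: "d ` (rdf_bot \<union> PR U X) \<subseteq> DeltaP G"
  proof -
    have "d x \<in> rdf_bot \<union> PR U X" if "x \<in> rdf_bot \<union> PR U X" for x
      using that b(1) by (auto simp: d_def)
    then show ?thesis using PR_DeltaP by blast
  qed
  have np: "b \<noteq> PlainLit w" for w using b c3 by blast
  interpret c: canon G U "rdf_bot \<union> U" X d
  proof
    show "inj_on d (U - rdf_bot)" using rdf_bot_simps(1) by (auto simp: inj_on_def d_def split: if_splits)
    show "inj_on d (rdf_bot \<union> PR U X)" using b(1) by (auto simp: inj_on_def d_def split: if_splits)
    show "d ` (rdf_bot \<union> U) \<subseteq> rdf_bot \<union> U" using b(1) by (auto simp: d_def)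
    show "d (PlainLit w) = PlainLit w" for w using np[of w] by (auto simp: d_def)
  qed (use finite_U X dC dP in auto)
  have aU: "a \<in> U - rdf_bot" using der_wf(1)[OF X a] by blast
  have db: "d b = URI SP" by (simp add: d_def)
  have "URI SP \<notin> DeltaC G" using Cl_wf[OF wf_H] unfolding DeltaC_def by fastforce
  then have nd: "d b \<notin> DeltaC G" by (simp add: db)
  have nb: "\<not> der U X b (URI BOTC) x" "\<not> der U X x (URI BOTC) b" for x using b(2) c1 c2 by blast+
  have V: "URI BOTC \<in> rdf_bot \<union> U" "URI BOTC \<in> rdf_bot \<union> PR U X \<or> (\<forall>q\<in>rdf_bot \<union> PR U X. d q \<noteq> d (URI BOTC))"
    by auto
  have 1: "\<not> holds c.J a (URI BOTC) b" using c.holds_J[OF aU b(1) V] nb nd by auto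
  have 2: "\<not> holds c.J b (URI BOTC) a" using c.holds_J[OF b(1) aU V] nb nd by auto
  have 3: "sat c.J t" if "t \<in> X" for t
    using that c.J_holds der_cls.base by (cases t) (auto simp: sat_holds)
  show ?thesis by (rule that[OF c.J_Interps 3 1 2])
qed

end

section \<open>Agreement of semantic and syntactic levels\<close>

lemma WE_weak:
  assumes E: "E \<subseteq> defs G" and I: "I \<in> WE G E" and der: "der U (strs G \<union> E) A p B"
  shows "weak I A p B"
proof (rule der_weak(1)[OF _ _ der])
  show "wfX U (strs G \<union> E)" by (rule wfX_sub) (use E in \<open>auto simp: strictified_eq\<close>)
  fix A p B assume "(A, p, B) \<in> strs G \<union> E"
  then show "holds I A (URI p) B \<or> (p \<in> {SC, SP} \<and> sat I (vac (A, p, B)))"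
  proof
    assume "(A, p, B) \<in> strs G"
    then show ?thesis using I by (auto simp: WE_def simp flip: sat_holds)
  next
    assume t: "(A, p, B) \<in> E"
    then have "p \<in> {SC, SP}" using wfd[of "(A, p, B)"] E by (auto simp: wfd_def)
    then show ?thesis using I t by (auto simp: WE_def simp flip: sat_holds)
  qed
qed

text \<open>Derivability is sufficient by weak soundness. For necessity, the canonical model of
  \<open>strs G \<union> E\<close> satisfies all of \<open>E\<close> outright, so it belongs to
  \<open>WE G E\<close>, and it satisfies no underivable vacuity; in the second claim it must
  therefore satisfy \<open>d\<close> itself.\<close>

lemma WE_vac_iff:
  assumes E: "E \<subseteq> defs G" and d: "wfd d"
  shows "(\<forall>I\<in>WE G E. sat I (vac d)) \<longleftrightarrow> derT G (strs G \<union> E) (vac d)"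
    and "\<not> derT G (strs G \<union> E) (vac d) \<Longrightarrow>
      (\<forall>I\<in>WE G E. sat I (vac d) \<or> sat I d) \<longleftrightarrow> derT G (strs G \<union> E) d"
proof -
  let ?X = "strs G \<union> E"
  have XH: "?X \<subseteq> H" using E by (auto simp: strictified_eq)
  obtain J where J: "J \<in> Interps G" "\<And>t. t \<in> ?X \<Longrightarrow> sat J t"
    "\<And>A p B. holds J A (URI p) B \<Longrightarrow> wf_triple (A, p, B) \<Longrightarrow> A \<in> U - rdf_bot \<and> B \<in> U - rdf_bot \<and>
       (der U ?X A (URI p) B \<or> (p = BOTC \<and> (der U ?X A (URI BOTC) A \<or> der U ?X B (URI BOTC) B))
       \<or> (p = BOTP \<and> (der U ?X A (URI BOTP) A \<or> der U ?X B (URI BOTP) B)))"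
    using canonical_model[OF wfX_sub[OF XH] sub_Cl[OF XH]] by blast
  then have JW: "J \<in> WE G E" by (auto simp: WE_def)
  obtain s p oo where t: "d = (s, p, oo)" by (cases d)
  have wf: "s \<notin> rdf_bot" "oo \<notin> rdf_bot" "p = SC \<or> p = SP" using d t by (auto simp: wfd_def)
  have Jvac: "derT G ?X (vac d)" if "sat J (vac d)"
    using J(3)[of s "if p = SC then BOTC else BOTP" s] that wf by (auto simp: t derT_def sat_holds split: if_splits)
  have Jd: "derT G ?X d" if "sat J d"
    using J(3)[of s p oo] that wf by (auto simp: t derT_def sat_holds)
  have weak_vac: "sat I (vac d)" if I: "I \<in> WE G E" and "derT G ?X (vac d)" for I
  proof -
    have "weak I s (URI (if p = SC then BOTC else BOTP)) s"
      by (rule WE_weak[OF E I]) (use that(2) in \<open>simp add: t derT_def\<close>)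
    then show ?thesis by (cases "p = SC") (simp_all add: t sat_holds weak_def)
  qed
  have weak_d: "sat I (vac d) \<or> sat I d" if I: "I \<in> WE G E" and "derT G ?X d" for I
  proof -
    have "weak I s (URI p) oo"
      by (rule WE_weak[OF E I]) (use that(2) in \<open>simp add: t derT_def\<close>)
    then show ?thesis using wf(3) by (auto simp add: t sat_holds weak_def)
  qed
  show "(\<forall>I\<in>WE G E. sat I (vac d)) \<longleftrightarrow> derT G ?X (vac d)" using Jvac JW weak_vac by blast
  show "(\<forall>I\<in>WE G E. sat I (vac d) \<or> sat I d) \<longleftrightarrow> derT G ?X d" if "\<not> derT G ?X (vac d)"
    using Jvac Jd JW weak_d that by blast
qed

lemma slev_defs: "slev G i \<subseteq> defs G"
  using slev_antimono[of 0 i G] by simp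

lemma lev_eq_slev: "lev G i = slev G i"
proof (induction i)
  case (Suc i)
  have "(\<forall>I\<in>WE G (slev G i). sat I (vac d)) \<longleftrightarrow> derT G (XL G i) (vac d)" if "d \<in> slev G i" for d
    using WE_vac_iff(1)[OF slev_defs] wfd slev_defs that by blast
  then show ?case unfolding lev.simps slev.simps Suc.IH by blast
qed simp

lemma XL_H: "XL G i \<subseteq> H"
  using slev_defs by (auto simp: strictified_eq)

lemma R_min: "R_min G = rk G"
proof (rule R_min_eq[OF G])
  have "\<exists>J. J \<in> Interps G \<and> (\<forall>t\<in>H. sat J t)"
    by (rule canonical_model[OF wfX_sub[OF order_refl] sub_Cl[OF order_refl]]) blast
  then obtain J where "J \<in> Interps G" "\<forall>t\<in>H. sat J t" by blast
  then have "J \<in> Wl G 0" unfolding WE_def strictified_eq lev.simps by blast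
  then show "Wl G 0 \<noteq> {}" by blast
qed

theorem min_entails_Defeasible:
  assumes d: "wfd d"
  shows "G \<Turnstile>min Defeasible d \<longleftrightarrow>
     (\<forall>i. derT G (XL G i) (vac d) \<or> (\<exists>j<i. \<not> derT G (XL G j) (vac d)) \<or> derT G (XL G i) d)"
proof -
  have "G \<Turnstile>min Defeasible d \<longleftrightarrow> (\<forall>i. (\<exists>I\<in>Wl G i. \<not> sat I (vac d)) \<and> (\<forall>j<i. \<forall>I\<in>Wl G j. sat I (vac d)) \<longrightarrow>
      (\<forall>I\<in>Wl G i. sat I (vac d) \<or> sat I d))"
    unfolding min_entails_def R_min ranked_sat_Defeasible[OF d] rk_defeasible_iff ..
  moreover have "(\<forall>I\<in>Wl G i. sat I (vac d)) \<longleftrightarrow> derT G (XL G i) (vac d)" for i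
    using WE_vac_iff(1)[OF slev_defs d] by (simp add: lev_eq_slev)
  moreover have "\<not> derT G (XL G i) (vac d) \<Longrightarrow> (\<forall>I\<in>Wl G i. sat I (vac d) \<or> sat I d) \<longleftrightarrow> derT G (XL G i) d" for i
    using WE_vac_iff(2)[OF slev_defs d] by (simp add: lev_eq_slev)
  ultimately show ?thesis by blast
qed

text \<open>Each level is computed from its predecessor alone, so the first repetition is permanent;
  before it, every step loses a triple.\<close>

lemma slev_stable:
  assumes "card (defs G) \<le> n"
  shows "n \<le> m \<Longrightarrow> slev G m = slev G n"
proof -
  have step: "slev G (Suc i) = slev G i \<Longrightarrow> slev G (Suc (Suc i)) = slev G (Suc i)" for i
    by (simp add: slev.simps(2))
  have "\<exists>i\<le>n. slev G (Suc i) = slev G i"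
  proof (rule ccontr)
    assume neg: "\<not> ?thesis"
    have strict: "slev G (Suc i) \<subset> slev G i" if "i \<le> n" for i
    proof (rule psubsetI)
      show "slev G (Suc i) \<subseteq> slev G i" by (rule slev_antimono) simp
      show "slev G (Suc i) \<noteq> slev G i" using neg that by blast
    qed
    have less: "card (slev G (Suc i)) < card (slev G i)" if "i \<le> n" for i
      by (rule psubset_card_mono[OF finite_subset[OF slev_defs finite_defs] strict[OF that]])
    have "i \<le> Suc n \<Longrightarrow> card (slev G i) + i \<le> card (defs G)" for i
    proof (induction i)
      case (Suc i)
      then show ?case using less[of i] by simp
    qed simp
    from this[of "Suc n"] assms show False by simp
  qed
  then obtain i where i: "i \<le> n" "slev G (Suc i) = slev G i" by blast
  have "slev G (Suc (i + k)) = slev G (i + k)" for k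
    by (induction k) (use i step in auto)
  then have "slev G (i + k) = slev G i" for k by (induction k) (use i in auto)
  then show "slev G m = slev G n" if "n \<le> m" using that i(1) by (metis le_add_diff_inverse le_trans)
qed

text \<open>At a stable level every surviving triple has a derivable vacuity, so the disjunction it
  imposes collapses to that vacuity. The interpretations of finite rank are then given by strict
  triples.\<close>

definition YL :: "nat \<Rightarrow> triple set" where
  "YL n = strs G \<union> vac ` slev G n"

lemma wfX_YL: "wfX U (YL n)"
proof -
  have vac_wf: "wf_triple (vac e) \<and> terms_of (vac e) \<subseteq> U \<union> rdf_bot" if "e \<in> slev G n" for e
  proof (cases e)
    case (fields s p oo)
    have "e \<in> H" using that XL_H by blast
    then have "terms_of e \<subseteq> U" by (auto simp: uni_def)
    then have "s \<notin> rdf_bot" "s \<in> U" using wf_H[OF \<open>e \<in> H\<close>] by (simp_all add: fields)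
    then show ?thesis by (simp add: fields)
  qed
  have "wfX U (strs G)" by (rule wfX_sub) (simp add: strictified_eq)
  then show ?thesis using vac_wf unfolding wfX_def uni_def YL_def by blast
qed

theorem min_entails_Strict:
  assumes n: "card (defs G) \<le> n" and t: "wf_triple t"
  shows "G \<Turnstile>min Strict t \<longleftrightarrow> derT G (YL n) t"
proof -
  have stable: "slev G m = slev G n" if "n \<le> m" for m using slev_stable[OF n that] .
  have vac: "derT G (XL G n) (vac e)" if "e \<in> slev G n" for e
    using stable[of "Suc n"] that by (auto simp: slev.simps(2))
  have fin: "finite_rank G (rk G) = {I \<in> Interps G. \<forall>t\<in>YL n. sat I t}"
  proof -
    have "Wl G i \<subseteq> Wl G n" for i
      using Wl_mono[of i "max i n" G] stable[of "max i n"] by (simp add: lev_eq_slev)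
    then have "finite_rank G (rk G) = Wl G n" unfolding finite_rank_rk by blast
    also have "\<dots> = {I \<in> Interps G. \<forall>t\<in>YL n. sat I t}"
    proof -
      have "sat I (vac e)" if "I \<in> Wl G n" "e \<in> slev G n" for I e
        using WE_vac_iff(1)[OF slev_defs wfd, of e n] vac[OF that(2)] that slev_defs
        by (auto simp: lev_eq_slev)
      then show ?thesis by (auto simp: WE_def YL_def lev_eq_slev)
    qed
    finally show ?thesis .
  qed
  note wfYL = wfX_YL[of n]
  have YCl: "YL n \<subseteq> Cl H"
  proof -
    have "vac e \<in> Cl H" if "e \<in> slev G n" for e
    proof (cases e)
      case (fields s p oo)
      have "(s, u, s) \<in> Cl H" if "u \<in> {BOTC, BOTP}" "der U (XL G n) s (URI u) s" for u
        using der_Cl_vocab[OF wfX_sub[OF XL_H] sub_Cl[OF XL_H] that(2)] that(1) by blast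
      then show ?thesis using vac[OF that] by (auto simp: derT_def fields)
    qed
    then show ?thesis using Cl.base by (auto simp: YL_def strictified_eq)
  qed
  obtain s p oo where ts: "t = (s, p, oo)" by (cases t)
  have iff: "G \<Turnstile>min Strict t \<longleftrightarrow> (\<forall>I\<in>Interps G. (\<forall>t\<in>YL n. sat I t) \<longrightarrow> sat I t)"
    unfolding min_entails_def R_min by (auto simp: fin)
  show ?thesis unfolding iff
  proof
    assume der: "derT G (YL n) t"
    show "\<forall>I\<in>Interps G. (\<forall>t\<in>YL n. sat I t) \<longrightarrow> sat I t"
    proof (intro ballI impI)
      fix I assume I: "I \<in> Interps G" and sat: "\<forall>t\<in>YL n. sat I t"
      have der': "der U (YL n) s (URI p) oo" using der by (simp add: ts derT_def)
      \<comment> \<open>Members of \<open>Interps G\<close> need not meet the model conditions. A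
        derivation has a premise in \<open>YL n\<close>, and satisfying that one triple includes
        \<open>models I {}\<close>.\<close>
      obtain y where "y \<in> YL n" using der_nonempty(1)[OF der'] by blast
      then have mod: "models I {}" using sat models_Un[of I "{y}"] by blast
      have io: "voc I = rdf_bot \<union> U" "DR I = U \<union> rdf_bot" "DP I = DeltaP G" "DC I = DeltaC G"
        using I by (auto simp: Interps_def interpretation_of_def)
      have den: "den I x \<in> U \<union> rdf_bot \<union> DeltaP G" if "x \<in> U" for x
        using I that by (auto simp: Interps_def interpretation_of_def PiE_def Pi_def)
      have "holds I s (URI p) oo"
      proof (rule der_sound(1)[OF wfYL mod _ _ _ _ _ der'])
        show "holds I A (URI p) B" if "(A, p, B) \<in> YL n" for A p B
          using sat that by (auto simp flip: sat_holds)
        show "U \<subseteq> voc I" by (simp add: io)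
        show "den I (PlainLit w) = PlainLit w" if "PlainLit w \<in> U" for w
          using I that by (auto simp: Interps_def interpretation_of_def)
        show "U - rdf_bot \<subseteq> DC I" if "der U (YL n) A (URI BOTC) A" for A
          using self_DeltaC[OF wfYL YCl that] by (simp add: io)
        show "den I ` U \<subseteq> DP I" if "der U (YL n) A (URI BOTP) A" for A
          using self_DeltaP[OF wfYL YCl that] den by (auto simp: io)
      qed
      then show "sat I t" by (simp add: ts sat_holds)
    qed
  next
    assume all: "\<forall>I\<in>Interps G. (\<forall>t\<in>YL n. sat I t) \<longrightarrow> sat I t"
    obtain J where J: "J \<in> Interps G" "\<And>t. t \<in> YL n \<Longrightarrow> sat J t"
      "\<And>A p B. holds J A (URI p) B \<Longrightarrow> wf_triple (A, p, B) \<Longrightarrow> A \<in> U - rdf_bot \<and> B \<in> U - rdf_bot \<and>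
       (der U (YL n) A (URI p) B \<or> (p = BOTC \<and> (der U (YL n) A (URI BOTC) A \<or> der U (YL n) B (URI BOTC) B))
       \<or> (p = BOTP \<and> (der U (YL n) A (URI BOTP) A \<or> der U (YL n) B (URI BOTP) B)))"
      using canonical_model[OF wfYL YCl] by blast
    have "holds J s (URI p) oo" using all J(1,2) by (simp add: ts sat_holds)
    note c = J(3)[OF this t[unfolded ts]]
    \<comment> \<open>The canonical model makes a self-disjoint class disjoint from all of
      \<open>DeltaC G\<close>, which is more than is entailed. A second model, in which
      \<open>b\<close> denotes no class, shows that an entailed instance of rule 5c has
      \<open>cls\<close> at its disposal.\<close>
    have cls: "cls U (YL n) b" if h: "der U (YL n) a (URI BOTC) a" "b \<in> U - rdf_bot"
      "t = (a, BOTC, b) \<or> t = (b, BOTC, a)" for a b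
    proof (rule ccontr)
      assume "\<not> cls U (YL n) b"
      then obtain I where "I \<in> Interps G" "\<And>t. t \<in> YL n \<Longrightarrow> sat I t"
        "\<not> holds I a (URI BOTC) b" "\<not> holds I b (URI BOTC) a"
        using avoiding_model[OF wfYL YCl h(1,2)] by blast
      then show False using all h(3) by (auto simp: sat_holds)
    qed
    consider (1) "der U (YL n) s (URI p) oo" | (2) "p = BOTC" "der U (YL n) s (URI BOTC) s"
      | (3) "p = BOTC" "der U (YL n) oo (URI BOTC) oo" | (4) "p = BOTP" "der U (YL n) s (URI BOTP) s"
      | (5) "p = BOTP" "der U (YL n) oo (URI BOTP) oo"
      using c by blast
    then have "der U (YL n) s (URI p) oo"
    proof cases
      case 2
      have "cls U (YL n) oo" using cls[OF 2(2)] c 2(1) by (simp add: ts)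
      then show ?thesis using d5c[OF 2(2)] 2(1) by blast
    next
      case 3
      have "cls U (YL n) s" using cls[OF 3(2)] c 3(1) by (simp add: ts)
      then show ?thesis using d5a[OF d5c[OF 3(2)]] 3(1) by blast
    next
      case 4
      then show ?thesis using d6c[OF 4(2)] c by blast
    next
      case 5
      then show ?thesis using d6a[OF d6c[OF 5(2)]] c by blast
    qed
    then show "derT G (YL n) t" by (simp add: ts derT_def)
  qed
qed

end

section \<open>Segments of a word and codes\<close>

definition seg :: "bool list \<Rightarrow> bool list \<Rightarrow> nat \<Rightarrow> nat \<Rightarrow> bool" where
  "seg w c i j \<longleftrightarrow> j = i + length c \<and> j \<le> length w \<and> take (length c) (drop i w) = c"

lemma seg_Nil [simp]: "seg w [] i j \<longleftrightarrow> j = i \<and> i \<le> length w"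
  by (auto simp: seg_def)

lemma seg_Cons: "seg w (b # c) i j \<longleftrightarrow> i < length w \<and> w ! i = b \<and> seg w c (Suc i) j"
proof -
  have "i < length w \<Longrightarrow> drop i w = w ! i # drop (Suc i) w" by (simp add: Cons_nth_drop_Suc)
  then show ?thesis by (cases "i < length w") (auto simp: seg_def)
qed

lemma seg_append: "seg w (c @ c') i k \<longleftrightarrow> (\<exists>j. seg w c i j \<and> seg w c' j k)"
proof (induction c arbitrary: i)
  case Nil
  then show ?case by (auto simp: seg_def)
qed (auto simp: seg_Cons)

lemma seg_len: "seg w c i j \<Longrightarrow> j = i + length c \<and> j \<le> length w"
  by (simp add: seg_def)

lemma seg_drop: "seg w c i j \<Longrightarrow> drop i w = c @ drop j w"
  by (metis append_take_drop_id drop_drop seg_def add.commute)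

definition prefix_free :: "('a \<Rightarrow> bool list) \<Rightarrow> bool" where
  "prefix_free e \<longleftrightarrow> (\<forall>x y r r'. e x @ r = e y @ r' \<longrightarrow> x = y)"

lemma prefix_freeD: "prefix_free e \<Longrightarrow> e x @ r = e y @ r' \<Longrightarrow> x = y \<and> r = r'"
  unfolding prefix_free_def by (metis same_append_eq)

text \<open>At most one code starts at a given position. Tables may thus record mere end points, and
  the coded object is still determined.\<close>

lemma prefix_free_seg: "prefix_free e \<Longrightarrow> seg w (e x) i j \<Longrightarrow> seg w (e y) i k \<Longrightarrow> x = y \<and> j = k"
  by (metis prefix_freeD seg_drop seg_len)

lemma enc_char_length: "length (enc_char c) = 8"
  by (cases c) simp

lemma prefix_free_char: "prefix_free enc_char"
  unfolding prefix_free_def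
proof (intro allI impI)
  fix x y r r' assume "enc_char x @ r = enc_char y @ r'"
  then show "x = y" by (cases x; cases y) simp
qed

lemma prefix_free_list: "prefix_free e \<Longrightarrow> prefix_free (enc_list e)"
proof -
  assume e: "prefix_free e"
  have "enc_list e xs @ r = enc_list e ys @ r' \<Longrightarrow> xs = ys" for xs ys r r'
  proof (induction xs arbitrary: ys)
    case Nil
    then show ?case by (cases ys) (auto simp: enc_list_def)
  next
    case (Cons x xs)
    then obtain y zs where ys: "ys = y # zs" by (cases ys) (auto simp: enc_list_def)
    have "e x @ (enc_list e xs @ r) = e y @ (enc_list e zs @ r')"
      using Cons.prems by (simp add: ys enc_list_def)
    then show ?case using prefix_freeD[OF e] Cons.IH ys by blast
  qed
  then show ?thesis by (auto simp: prefix_free_def)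
qed

lemmas char_list_eqD = prefix_freeD[OF prefix_free_list[OF prefix_free_char]]

lemma prefix_free_uri: "prefix_free enc_uri"
  unfolding prefix_free_def
proof (intro allI impI)
  fix x y r r' assume eq: "enc_uri x @ r = enc_uri y @ r'"
  show "x = y"
  proof (cases "\<exists>v v'. x = Name v \<and> y = Name v'")
    case True
    then obtain v v' where v: "x = Name v" "y = Name v'" by blast
    have "enc_list enc_char v @ r = enc_list enc_char v' @ r'" using eq by (simp add: v)
    from char_list_eqD[OF this] show ?thesis by (simp add: v)
  next
    case False
    then show ?thesis using eq by (cases x; cases y) auto
  qed
qed

lemma prefix_free_term: "prefix_free enc_term"
  unfolding prefix_free_def
proof (intro allI impI)
  fix x y r r' assume eq: "enc_term x @ r = enc_term y @ r'"
  show "x = y"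
  proof (cases x)
    case (URI u)
    then obtain u' where y: "y = URI u'" using eq by (cases y) auto
    have "enc_uri u @ r = enc_uri u' @ r'" using eq by (simp add: URI y)
    from prefix_freeD[OF prefix_free_uri this] show ?thesis by (simp add: URI y)
  next
    case (PlainLit v)
    then obtain v' where y: "y = PlainLit v'" using eq by (cases y) auto
    have "enc_list enc_char v @ r = enc_list enc_char v' @ r'" using eq by (simp add: PlainLit y)
    from char_list_eqD[OF this] show ?thesis by (simp add: PlainLit y)
  next
    case (TypedLit v u)
    then obtain v' u' where y: "y = TypedLit v' u'" using eq by (cases y) auto
    have "enc_list enc_char v @ (enc_uri u @ r) = enc_list enc_char v' @ (enc_uri u' @ r')"
      using eq by (simp add: TypedLit y)
    from char_list_eqD[OF this] have "v = v'" "enc_uri u @ r = enc_uri u' @ r'" by auto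
    with prefix_freeD[OF prefix_free_uri this(2)] show ?thesis by (simp add: TypedLit y)
  qed
qed

lemmas uri_unique = prefix_free_seg[OF prefix_free_uri]
lemmas term_unique = prefix_free_seg[OF prefix_free_term]

abbreviation enc_chars :: "string \<Rightarrow> bool list" where
  "enc_chars \<equiv> enc_list enc_char"

lemma enc_list_simps: "enc_list e [] = [False]" "enc_list e (x # xs) = True # e x @ enc_list e xs"
  by (auto simp: enc_list_def)

lemma enc_uri_length: "3 \<le> length (enc_uri u)"
  by (cases u) auto

lemma enc_term_length: "2 \<le> length (enc_term t)"
proof (cases t)
  case (URI u)
  then show ?thesis using enc_uri_length[of u] by simp
qed (auto simp: enc_list_def)

section \<open>Vocabulary of the program\<close>

datatype tg = tSP | tSC | tTYP | tDOM | tRANGE | tBOTC | tBOTP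

fun ur :: "tg \<Rightarrow> uri" where
  "ur tSP = SP" | "ur tSC = SC" | "ur tTYP = TYP" | "ur tDOM = DOM" | "ur tRANGE = RANGE"
| "ur tBOTC = BOTC" | "ur tBOTP = BOTP"

definition tgs :: "tg list" where "tgs = [tSP, tSC, tTYP, tDOM, tRANGE, tBOTC, tBOTP]"

lemma tgs: "t \<in> set tgs"
  by (cases t) (auto simp: tgs_def)

text \<open>
  The intended contents of the tables are \<open>M1\<close> and \<open>M2\<close> below. The distances \<open>3\<close> and \<open>9\<close> of \<open>A3\<close> and \<open>A9\<close> are
  the length of a URI's tag and that of a character with its list marker.
\<close>

datatype tab = BIT | SEEN | SUC | HP | HS | A3 | A9 | CHL | UR | LIT | TE | LS | TR | KU | KL | PRE | SAME
  | GN | NB | ST | DF | QS | QD | TG tg | PNM | PLN | ACT | BASE | BIN tg | GEN | CL | ANS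

instance tab :: finite
proof
  have "x \<in> set ([BIT, SEEN, SUC, HP, HS, A3, A9, CHL, UR, LIT, TE, LS, TR, KU, KL, PRE, SAME, GN, NB, ST, DF,
     QS, QD, PNM, PLN, ACT, BASE, GEN, CL, ANS] @ map TG tgs @ map BIN tgs)" for x
    using tgs by (cases x) auto
  then have "UNIV \<subseteq> set ([BIT, SEEN, SUC, HP, HS, A3, A9, CHL, UR, LIT, TE, LS, TR, KU, KL, PRE, SAME, GN, NB, ST, DF,
     QS, QD, PNM, PLN, ACT, BASE, GEN, CL, ANS] @ map TG tgs @ map BIN tgs)" by blast
  then show "finite (UNIV :: tab set)" by (rule finite_subset) simp
qed

fun ar :: "tab \<Rightarrow> nat" where
  "ar BIT = 1" | "ar SEEN = 1" | "ar SUC = 2" | "ar HP = 1" | "ar HS = 1" | "ar A3 = 2" | "ar A9 = 2"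
| "ar CHL = 2" | "ar UR = 2" | "ar LIT = 2" | "ar TE = 2" | "ar LS = 1" | "ar TR = 4" | "ar KU = 3"
| "ar KL = 3" | "ar PRE = 4" | "ar SAME = 2" | "ar GN = 1" | "ar NB = 1" | "ar ST = 3" | "ar DF = 3"
| "ar QS = 3" | "ar QD = 3" | "ar (TG _) = 1" | "ar PNM = 1" | "ar PLN = 1" | "ar ACT = 4" | "ar BASE = 4"
| "ar (BIN _) = 3" | "ar GEN = 4" | "ar CL = 2" | "ar ANS = 0"

lemma ar_le_4: "ar t \<le> 4"
  by (cases t) auto

lemma all_args_Suc:
  "(\<forall>as. length as = Suc n \<and> set as \<subseteq> {..<D} \<and> L as \<longrightarrow> Q as) \<longleftrightarrow>
     (\<forall>a<D. \<forall>as. length as = n \<and> set as \<subseteq> {..<D} \<and> L (a # as) \<longrightarrow> Q (a # as))"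
  by (auto simp: length_Suc_conv)

lemma all_args_0:
  "(\<forall>as. length as = 0 \<and> set as \<subseteq> {..<D} \<and> L as \<longrightarrow> Q as) \<longleftrightarrow> (L [] \<longrightarrow> Q [])"
  by auto

lemma all_args:
  "(\<forall>as. length as = 1 \<and> set as \<subseteq> {..<D} \<and> L as \<longrightarrow> Q as) \<longleftrightarrow>
     (\<forall>a<D. L [a] \<longrightarrow> Q [a])"
  "(\<forall>as. length as = 2 \<and> set as \<subseteq> {..<D} \<and> L as \<longrightarrow> Q as) \<longleftrightarrow>
     (\<forall>a<D. \<forall>b<D. L [a, b] \<longrightarrow> Q [a, b])"
  "(\<forall>as. length as = 3 \<and> set as \<subseteq> {..<D} \<and> L as \<longrightarrow> Q as) \<longleftrightarrow>
     (\<forall>a<D. \<forall>b<D. \<forall>c<D. L [a, b, c] \<longrightarrow> Q [a, b, c])"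
  "(\<forall>as. length as = 4 \<and> set as \<subseteq> {..<D} \<and> L as \<longrightarrow> Q as) \<longleftrightarrow>
     (\<forall>a<D. \<forall>b<D. \<forall>c<D. \<forall>d<D. L [a, b, c, d] \<longrightarrow> Q [a, b, c, d])"
  "(\<forall>as. length as = 5 \<and> set as \<subseteq> {..<D} \<and> L as \<longrightarrow> Q as) \<longleftrightarrow>
     (\<forall>a<D. \<forall>b<D. \<forall>c<D. \<forall>d<D. \<forall>e<D. L [a, b, c, d, e] \<longrightarrow> Q [a, b, c, d, e])"
  "(\<forall>as. length as = 6 \<and> set as \<subseteq> {..<D} \<and> L as \<longrightarrow> Q as) \<longleftrightarrow>
     (\<forall>a<D. \<forall>b<D. \<forall>c<D. \<forall>d<D. \<forall>e<D. \<forall>f<D. L [a, b, c, d, e, f] \<longrightarrow> Q [a, b, c, d, e, f])"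
  "(\<forall>as. length as = 7 \<and> set as \<subseteq> {..<D} \<and> L as \<longrightarrow> Q as) \<longleftrightarrow>
     (\<forall>a<D. \<forall>b<D. \<forall>c<D. \<forall>d<D. \<forall>e<D. \<forall>f<D. \<forall>g<D. L [a, b, c, d, e, f, g] \<longrightarrow> Q [a, b, c, d, e, f, g])"
  unfolding eval_nat_numeral BitM.simps One_nat_def all_args_Suc all_args_0 by (rule refl)+

lemma lits_simps [simp]:
  "lits I X as []"
  "lits I X as ((True, t, xs) # B) \<longleftrightarrow> X t (map ((!) as) xs) \<and> lits I X as B"
  "lits I X as ((False, t, xs) # B) \<longleftrightarrow> \<not> I t (map ((!) as) xs) \<and> lits I X as B"
  by (auto simp: lits_def)

lemma dl_closed_simps:
  "dl_closed D [] I X \<longleftrightarrow> True"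
  "dl_closed D ((n, h, hs, B) # P) I X \<longleftrightarrow>
     (\<forall>as. length as = n \<and> set as \<subseteq> {..<D} \<and> lits I X as B \<longrightarrow> X h (map ((!) as) hs)) \<and> dl_closed D P I X"
  by (auto simp: dl_closed_def sat_clause_def)

lemma dl_closed_append: "dl_closed D (P @ Q) I X \<longleftrightarrow> dl_closed D P I X \<and> dl_closed D Q I X"
  by (auto simp: dl_closed_def)

lemma dl_closed_map: "dl_closed D (map f ts) I X \<longleftrightarrow> (\<forall>t\<in>set ts. dl_closed D [f t] I X)"
  by (auto simp: dl_closed_def)

section \<open>The order on positions\<close>

text \<open>The clauses have no order to refer to, so the order on positions is read off the order
  in which a loop visits them. When the outer loop reaches \<open>x > 0\<close>, the only position
  seen so far that lacks a successor is \<open>x - 1\<close>.\<close>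

definition order_prog :: "tab lp" where
  "order_prog = LFor (LSeq (LFor (LIf SEEN [1] (LIf HS [1] LSkip
     (LSeq (LSet SUC [1, 0]) (LSeq (LSet HP [0]) (LSet HS [1])))) LSkip)) (LSet SEEN [0]))"

text \<open>The tables after the outer loop has visited \<open>m\<close> positions.\<close>

definition order_tab :: "nat \<Rightarrow> bool list \<Rightarrow> tab tabs" where
  "order_tab m w t xs = (case t of BIT \<Rightarrow> (\<exists>i<length w. xs = [i] \<and> w ! i) | SEEN \<Rightarrow> (\<exists>y<m. xs = [y])
     | SUC \<Rightarrow> (\<exists>a. xs = [a, Suc a] \<and> Suc a < m) | HP \<Rightarrow> (\<exists>a. xs = [Suc a] \<and> Suc a < m)
     | HS \<Rightarrow> (\<exists>a. xs = [a] \<and> Suc a < m) | _ \<Rightarrow> False)"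

lemma order_tab_simps [simp]:
  "order_tab m w BIT [i] \<longleftrightarrow> i < length w \<and> w ! i" "order_tab m w SUC [a, b] \<longleftrightarrow> b = Suc a \<and> b < m"
  "order_tab m w HP [b] \<longleftrightarrow> 0 < b \<and> b < m" "order_tab m w HS [a] \<longleftrightarrow> Suc a < m"
  "order_tab m w SEEN [a] \<longleftrightarrow> a < m"
  by (auto simp: order_tab_def gr0_conv_Suc)

lemma exec_order_prog: "exec D order_prog 0 e (bit_tab BIT w) = order_tab D w"
proof -
  define step where "step = (\<lambda>x R. R(SUC := (R SUC)([x - 1, x] := True), HP := (R HP)([x] := True),
     HS := (R HS)([x - 1] := True)) :: tab tabs)"
  define body where "body = LIf SEEN [1] (LIf HS [1] LSkip
     (LSeq (LSet SUC [1, 0]) (LSeq (LSet HP [0]) (LSet HS [1])))) (LSkip :: tab lp)"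
  have body: "exec D body 2 e R = (if R SEEN [e 1] \<and> \<not> R HS [e 1] then
      R(SUC := (R SUC)([e 1, e 0] := True), HP := (R HP)([e 0] := True), HS := (R HS)([e 1] := True)) else R)" for e R
    by (simp add: body_def)
  have inner: "j \<le> D \<Longrightarrow> fold (\<lambda>i. exec D body 2 ((e(0 := x))(1 := i))) [0..<j] (order_tab x w)
      = (if 0 < x \<and> x \<le> j then step x (order_tab x w) else order_tab x w)" for x j e
  proof (induction j)
    case (Suc j)
    let ?F = "\<lambda>i. exec D body 2 ((e(0 := x))(1 := i))"
    have IH: "fold ?F [0..<j] (order_tab x w) = (if 0 < x \<and> x \<le> j then step x (order_tab x w) else order_tab x w)"
      by (rule Suc.IH) (use Suc.prems in simp)
    have "fold ?F [0..<Suc j] (order_tab x w) = ?F j (fold ?F [0..<j] (order_tab x w))" by simp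
    also have "\<dots> = exec D body 2 ((e(0 := x))(1 := j))
        (if 0 < x \<and> x \<le> j then step x (order_tab x w) else order_tab x w)" by (simp only: IH)
    also have "\<dots> = (if 0 < x \<and> x \<le> Suc j then step x (order_tab x w) else order_tab x w)"
    proof -
      consider "0 < x \<and> x \<le> j" | "x = Suc j" | "x = 0 \<or> Suc j < x" by linarith
      then show ?thesis
        unfolding body by cases (auto simp: step_def)
    qed
    finally show ?case .
  qed auto
  have step: "(step x (order_tab x w))(SEEN := (step x (order_tab x w) SEEN)([x] := True)) = order_tab (Suc x) w"
    if "0 < x" for x
  proof (intro ext)
    fix t xs
    show "((step x (order_tab x w))(SEEN := (step x (order_tab x w) SEEN)([x] := True))) t xs = order_tab (Suc x) w t xs"
      using that by (cases t) (auto simp: step_def order_tab_def less_Suc_eq gr0_conv_Suc)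
  qed
  have step0: "(order_tab 0 w)(SEEN := (order_tab 0 w SEEN)([0] := True)) = order_tab (Suc 0) w"
  proof (intro ext)
    fix t xs
    show "((order_tab 0 w)(SEEN := (order_tab 0 w SEEN)([0] := True))) t xs = order_tab (Suc 0) w t xs"
      by (cases t) (auto simp: order_tab_def)
  qed
  have "j \<le> D \<Longrightarrow> fold (\<lambda>i. exec D (LSeq (LFor body) (LSet SEEN [0])) (Suc 0) (e(0 := i))) [0..<j] (order_tab 0 w)
     = order_tab j w" for j e
  proof (induction j)
    case (Suc j)
    let ?F = "\<lambda>i. exec D (LSeq (LFor body) (LSet SEEN [0])) (Suc 0) (e(0 := i))"
    have IH: "fold ?F [0..<j] (order_tab 0 w) = order_tab j w"
      by (rule Suc.IH) (use Suc.prems in simp)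
    have "fold ?F [0..<Suc j] (order_tab 0 w) = ?F j (fold ?F [0..<j] (order_tab 0 w))" by simp
    also have "\<dots> = ?F j (order_tab j w)" by (simp only: IH)
    also have "\<dots> = order_tab (Suc j) w"
      using inner[of D e j] Suc.prems step[of j] step0 by (cases "0 < j") (simp_all add: numeral_2_eq_2)
    finally show ?case .
  qed simp
  moreover have "bit_tab BIT w = order_tab 0 w"
  proof (intro ext)
    fix t xs show "bit_tab BIT w t xs = order_tab 0 w t xs"
      by (cases t) (auto simp: bit_tab_def order_tab_def)
  qed
  ultimately show ?thesis by (simp add: order_prog_def body_def)
qed

section \<open>Parsing\<close>

abbreviation (input) "pos t xs \<equiv> (True, t, xs)"
abbreviation (input) "neg t xs \<equiv> (False, t, xs)"

text \<open>The marker bit in front of a statement is \<open>1\<close> in the graph and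
  \<open>0\<close> for the query. \<open>TR\<close> holds the positions of the marker and of the
  subject and the ends of subject and predicate; the position of the subject,
  \<open>off k + 2\<close>, is reused as the name of the predicate. The position behind the word
  carries no bit and would pass a negative test of \<open>BIT\<close>, so each such test is
  accompanied by literals that keep it inside the word.\<close>

definition parse_prog :: "tab clause list" where
  "parse_prog = [
    (4, A3, [0, 3], [pos SUC [0, 1], pos SUC [1, 2], pos SUC [2, 3]]),
    (4, A9, [0, 3], [pos A3 [0, 1], pos A3 [1, 2], pos A3 [2, 3]]),
    (2, CHL, [0, 1], [neg BIT [0], pos SUC [0, 1]]),
    (3, CHL, [0, 2], [pos BIT [0], pos A9 [0, 1], pos CHL [1, 2]]),
    (2, UR, [0, 1], [neg BIT [0], pos A3 [0, 1]]),
    (3, UR, [0, 1], [pos A3 [0, 1], pos SUC [0, 2], neg BIT [2]]),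
    (4, UR, [0, 1], [pos A3 [0, 1], pos SUC [0, 2], pos SUC [2, 3], neg BIT [3]]),
    (5, UR, [0, 4], [pos BIT [0], pos SUC [0, 1], pos BIT [1], pos SUC [1, 2], pos BIT [2], pos SUC [2, 3], pos CHL [3, 4]]),
    (4, LIT, [0, 3], [pos BIT [0], pos SUC [0, 1], neg BIT [1], pos SUC [1, 2], pos CHL [2, 3]]),
    (5, LIT, [0, 4], [pos BIT [0], pos SUC [0, 1], pos BIT [1], pos SUC [1, 2], pos CHL [2, 3], pos UR [3, 4]]),
    (3, TE, [0, 2], [neg BIT [0], pos SUC [0, 1], pos UR [1, 2]]),
    (2, TE, [0, 1], [pos LIT [0, 1]]),
    (1, LS, [0], [neg HP [0]]),
    (5, LS, [4], [pos BIT [0], pos TR [0, 1, 2, 3], pos TE [3, 4]]),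
    (6, TR, [0, 2, 3, 4], [pos LS [0], pos SUC [0, 1], pos SUC [1, 2], pos TE [2, 3], pos UR [3, 4], pos TE [4, 5]]),
    (7, KU, [4, 5, 6], [pos TR [0, 1, 2, 3], pos SUC [0, 4], neg BIT [1], pos SUC [1, 5], pos UR [5, 6]]),
    (6, KL, [4, 1, 5], [pos TR [0, 1, 2, 3], pos SUC [0, 4], pos LIT [1, 5]]),
    (4, KU, [1, 2, 3], [pos TR [0, 1, 2, 3]]),
    (7, KU, [4, 5, 6], [pos TR [0, 1, 2, 3], pos A3 [0, 4], neg BIT [3], pos SUC [3, 5], pos UR [5, 6]]),
    (6, KL, [4, 3, 5], [pos TR [0, 1, 2, 3], pos A3 [0, 4], pos LIT [3, 5]]),
    (2, PRE, [0, 0, 1, 1], []),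
    (6, PRE, [0, 2, 3, 5], [pos PRE [0, 1, 3, 4], pos SUC [1, 2], pos SUC [4, 5], pos BIT [1], pos BIT [4]]),
    (6, PRE, [0, 2, 3, 5], [pos PRE [0, 1, 3, 4], pos SUC [1, 2], pos SUC [4, 5], neg BIT [1], neg BIT [4]]),
    (6, SAME, [0, 3], [pos KU [0, 1, 2], pos KU [3, 4, 5], pos PRE [1, 2, 4, 5]]),
    (6, SAME, [0, 3], [pos KL [0, 1, 2], pos KL [3, 4, 5], pos PRE [1, 2, 4, 5]]),
    (5, GN, [4], [pos TR [0, 1, 2, 3], pos BIT [0], pos SUC [0, 4]]),
    (4, GN, [1], [pos TR [0, 1, 2, 3], pos BIT [0]]),
    (5, GN, [4], [pos TR [0, 1, 2, 3], pos BIT [0], pos A3 [0, 4]]),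
    (6, ST, [4, 1, 5], [pos TR [0, 1, 2, 3], pos BIT [0], pos SUC [0, 4], neg BIT [4], pos A3 [0, 5]]),
    (6, DF, [4, 1, 5], [pos TR [0, 1, 2, 3], pos BIT [0], pos SUC [0, 4], pos BIT [4], pos A3 [0, 5]]),
    (6, QS, [4, 1, 5], [pos TR [0, 1, 2, 3], neg BIT [0], pos SUC [0, 4], neg BIT [4], pos A3 [0, 5]]),
    (6, QD, [4, 1, 5], [pos TR [0, 1, 2, 3], neg BIT [0], pos SUC [0, 4], pos BIT [4], pos A3 [0, 5]]),
    (5, PNM, [0], [pos KU [0, 1, 2], pos SUC [1, 3], pos SUC [3, 4], pos BIT [1], pos BIT [3], pos BIT [4]]),
    (4, PLN, [0], [pos KL [0, 1, 2], pos SUC [1, 3], neg BIT [3]]),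
    (3, NB, [0], [pos KL [0, 1, 2]]),
    (1, NB, [0], [pos PNM [0]])]
   @ map (\<lambda>t. (5, TG t, [0], [pos KU [0, 1, 2], pos SUC [1, 3], pos SUC [3, 4],
       (enc_uri (ur t) ! 0, BIT, [1]), (enc_uri (ur t) ! 1, BIT, [3]), (enc_uri (ur t) ! 2, BIT, [4])])) tgs"

fun tr :: "stmt \<Rightarrow> triple" where
  "tr (Strict t) = t"
| "tr (Defeasible t) = t"

fun comp_of :: "triple \<Rightarrow> nat \<Rightarrow> rdf_term" where
  "comp_of (s, p, oo) r = (if r = 0 then s else if r = 1 then URI p else oo)"

locale instance_word =
  fixes xs :: "stmt list" and \<tau> :: stmt and w :: "bool list"
  assumes w: "w = enc_instance (xs, \<tau>)"
begin

abbreviation "N \<equiv> length w"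
abbreviation "n \<equiv> length xs"
text \<open>The \<open>False\<close> that ends the coded list stands directly before the query and
  serves as its marker, so graph and query form one sequence of marked statements.\<close>

definition "ys = xs @ [\<tau>]"

primrec off :: "nat \<Rightarrow> nat" where
  "off 0 = 0"
| "off (Suc k) = off k + 1 + length (enc_stmt (ys ! k))"

lemma off_seg: "k \<le> n \<Longrightarrow> seg w ((k < n) # enc_stmt (ys ! k)) (off k) (off (Suc k))"
proof -
  have pre: "k \<le> n \<Longrightarrow> drop (off k) w = enc_list enc_stmt (drop k xs) @ enc_stmt \<tau> \<and> off k \<le> length w" for k
  proof (induction k)
    case (Suc k)
    then have k: "k < n" by simp
    then have "drop k xs = xs ! k # drop (Suc k) xs" by (simp add: Cons_nth_drop_Suc)
    then have eq: "drop (off k) w = (True # enc_stmt (xs ! k)) @ (enc_list enc_stmt (drop (Suc k) xs) @ enc_stmt \<tau>)"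
      using Suc by (simp add: enc_list_simps)
    have "drop (off (Suc k)) w = drop (length (True # enc_stmt (xs ! k))) (drop (off k) w)"
      using k by (simp add: ys_def nth_append add.commute)
    then have 1: "drop (off (Suc k)) w = enc_list enc_stmt (drop (Suc k) xs) @ enc_stmt \<tau>"
      unfolding eq by simp
    have "length (drop (off k) w) \<ge> length (True # enc_stmt (xs ! k))" unfolding eq by simp
    then have "off (Suc k) \<le> length w" using k by (simp add: ys_def nth_append)
    with 1 show ?case by simp
  qed (simp add: w)
  assume k: "k \<le> n"
  have "drop (off k) w = ((k < n) # enc_stmt (ys ! k)) @ (if k < n then enc_list enc_stmt (drop (Suc k) xs) @ enc_stmt \<tau> else [])"
  proof (cases "k < n")
    case True
    then have "drop k xs = xs ! k # drop (Suc k) xs" by (simp add: Cons_nth_drop_Suc)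
    then show ?thesis using pre[OF k] True by (simp add: enc_list_simps ys_def nth_append)
  next
    case False
    then show ?thesis using pre[OF k] k by (simp add: enc_list_simps ys_def)
  qed
  note eq = this
  have "Suc (length (enc_stmt (ys ! k))) \<le> N - off k" using arg_cong[OF eq, of length] by simp
  then show ?thesis using eq pre[OF k] by (simp add: seg_def)
qed

lemma enc_stmt_eq: "enc_stmt x = (case x of Strict _ \<Rightarrow> False | Defeasible _ \<Rightarrow> True) # enc_triple (tr x)"
  by (cases x) auto

text \<open>A statement with its marker takes at least four positions. Hence the names
  \<open>off k + 1\<close>, \<open>off k + 2\<close> and \<open>off k + 3\<close> of different
  statements do not collide.\<close>

lemma off_mono: "j \<le> k \<Longrightarrow> off j + 4 * (k - j) \<le> off k"
proof (induction k)
  case (Suc k)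
  obtain s p oo where "tr (ys ! k) = (s, p, oo)" by (cases "tr (ys ! k)")
  then have "length (enc_stmt (ys ! k)) \<ge> 3"
    using enc_uri_length[of p] by (simp add: enc_stmt_eq)
  then show ?case using Suc by (cases "j = Suc k") auto
qed simp

lemma off_N: "off (Suc n) = N"
proof -
  have "drop (off n) w = False # enc_stmt \<tau>"
  proof -
    have "off k = length (concat (map (\<lambda>x. True # enc_stmt x) (take k xs)))" if "k \<le> n" for k
      using that by (induction k) (auto simp: take_Suc_conv_app_nth ys_def nth_append)
    from this[of n] show ?thesis by (simp add: w enc_list_def)
  qed
  then have "length (drop (off n) w) = 1 + length (enc_stmt \<tau>)" by simp
  then show ?thesis using seg_len[OF off_seg[of n]] by (simp add: ys_def)
qed

lemma n_less: "4 * n + 4 \<le> N"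
  using off_mono[of 0 "Suc n"] unfolding off_N by simp

text \<open>
  The positions \<open>off k + 1\<close>, \<open>off k + 2\<close>, \<open>off k + 3\<close> merely name the components of statement \<open>k\<close>, which need
  not be coded there; statement \<open>n\<close> is the query.
\<close>

definition node :: "nat \<Rightarrow> nat \<Rightarrow> rdf_term \<Rightarrow> bool" where
  "node k m t \<longleftrightarrow> (\<exists>r<3. m = off k + 1 + r \<and> comp_of (tr (ys ! k)) r = t)"

definition val :: "nat \<Rightarrow> rdf_term \<Rightarrow> bool" where
  "val m t \<longleftrightarrow> (\<exists>k\<le>n. node k m t)"

definition gval :: "nat \<Rightarrow> rdf_term \<Rightarrow> bool" where
  "gval m t \<longleftrightarrow> (\<exists>k<n. node k m t)"

lemma off_inj:
  assumes "off k + r = off k' + r'" "r < 4" "r' < 4"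
  shows "k = k' \<and> r = r'"
proof -
  have "False" if "k < k'" "off k + r = off k' + r'" "r < 4" for k k' r r'
    using off_mono[of k k'] that by simp
  then have "k = k'" using assms by (metis linorder_neqE_nat)
  then show ?thesis using assms by simp
qed

lemma node_unique: "node k m t \<Longrightarrow> node k' m t' \<Longrightarrow> k = k' \<and> t = t'"
  unfolding node_def using off_inj[of k "1 + _" k' "1 + _"] by fastforce

lemma val_unique: "val m t \<Longrightarrow> val m t' \<Longrightarrow> t = t'"
  unfolding val_def using node_unique by blast

lemma gval_val: "gval m t \<Longrightarrow> val m t"
  unfolding gval_def val_def by (meson less_imp_le)

definition stm :: "nat \<Rightarrow> nat list \<Rightarrow> bool" where
  "stm k as \<longleftrightarrow> as = [off k + 1, off k + 2, off k + 3]"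

fun strict :: "stmt \<Rightarrow> bool" where
  "strict (Strict _) = True" | "strict (Defeasible _) = False"

text \<open>Terms are compared through their codes. A URI is preceded by the leading bit of
  \<open>enc_term\<close> as subject or object but not as predicate; \<open>KU\<close> records the
  code without that bit, so that occurrences in all three places can be matched.\<close>

definition M1 :: "tab tabs" where
  "M1 t as = (case t of
      A3 \<Rightarrow> (\<exists>x. as = [x, x + 3] \<and> x + 3 \<le> N)
    | A9 \<Rightarrow> (\<exists>x. as = [x, x + 9] \<and> x + 9 \<le> N)
    | CHL \<Rightarrow> (\<exists>i j v. as = [i, j] \<and> seg w (enc_chars v) i j)
    | UR \<Rightarrow> (\<exists>i j u. as = [i, j] \<and> seg w (enc_uri u) i j)
    | LIT \<Rightarrow> (\<exists>i j t. as = [i, j] \<and> seg w (enc_term t) i j \<and> t \<in> Lits)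
    | TE \<Rightarrow> (\<exists>i j t. as = [i, j] \<and> seg w (enc_term t) i j)
    | LS \<Rightarrow> (\<exists>k\<le>n. as = [off k])
    | TR \<Rightarrow> (\<exists>k\<le>n. \<exists>s p oo a b. tr (ys ! k) = (s, p, oo) \<and> as = [off k, off k + 2, a, b] \<and>
        seg w (enc_term s) (off k + 2) a \<and> seg w (enc_uri p) a b)
    | KU \<Rightarrow> (\<exists>m c e u. as = [m, c, e] \<and> val m (URI u) \<and> seg w (enc_uri u) c e)
    | KL \<Rightarrow> (\<exists>m c e t. as = [m, c, e] \<and> val m t \<and> t \<in> Lits \<and> seg w (enc_term t) c e)
    | PRE \<Rightarrow> (\<exists>x y l. as = [x, x + l, y, y + l] \<and> x + l \<le> N \<and> y + l \<le> N \<and> (\<forall>i<l. w ! (x + i) = w ! (y + i)))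
    | SAME \<Rightarrow> (\<exists>m m' t. as = [m, m'] \<and> val m t \<and> val m' t)
    | GN \<Rightarrow> (\<exists>m t. as = [m] \<and> gval m t)
    | NB \<Rightarrow> (\<exists>m t. as = [m] \<and> val m t \<and> t \<notin> rdf_bot)
    | ST \<Rightarrow> (\<exists>k<n. stm k as \<and> strict (ys ! k))
    | DF \<Rightarrow> (\<exists>k<n. stm k as \<and> \<not> strict (ys ! k))
    | QS \<Rightarrow> stm n as \<and> strict \<tau>
    | QD \<Rightarrow> stm n as \<and> \<not> strict \<tau>
    | TG t \<Rightarrow> (\<exists>m. as = [m] \<and> val m (URI (ur t)))
    | PNM \<Rightarrow> (\<exists>m v. as = [m] \<and> val m (URI (Name v)))
    | PLN \<Rightarrow> (\<exists>m v. as = [m] \<and> val m (PlainLit v))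
    | _ \<Rightarrow> order_tab (Suc N) w t as)"

lemma M1_simps [simp]:
  "M1 BIT as \<longleftrightarrow> order_tab (Suc N) w BIT as" "M1 SUC as \<longleftrightarrow> order_tab (Suc N) w SUC as"
  "M1 HP as \<longleftrightarrow> order_tab (Suc N) w HP as" "M1 HS as \<longleftrightarrow> order_tab (Suc N) w HS as"
  "M1 A3 [a, b] \<longleftrightarrow> b = a + 3 \<and> b \<le> N" "M1 A9 [a, b] \<longleftrightarrow> b = a + 9 \<and> b \<le> N"
  "M1 CHL [i, j] \<longleftrightarrow> (\<exists>v. seg w (enc_chars v) i j)"
  "M1 UR [i, j] \<longleftrightarrow> (\<exists>u. seg w (enc_uri u) i j)"
  "M1 LIT [i, j] \<longleftrightarrow> (\<exists>t\<in>Lits. seg w (enc_term t) i j)"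
  "M1 TE [i, j] \<longleftrightarrow> (\<exists>t. seg w (enc_term t) i j)"
  "M1 LS [i] \<longleftrightarrow> (\<exists>k\<le>n. i = off k)"
  "M1 TR [i, x, a, b] \<longleftrightarrow> (\<exists>k\<le>n. \<exists>s p oo. tr (ys ! k) = (s, p, oo) \<and> i = off k \<and> x = off k + 2 \<and>
        seg w (enc_term s) (off k + 2) a \<and> seg w (enc_uri p) a b)"
  "M1 KU [m, c, e] \<longleftrightarrow> (\<exists>u. val m (URI u) \<and> seg w (enc_uri u) c e)"
  "M1 KL [m, c, e] \<longleftrightarrow> (\<exists>t\<in>Lits. val m t \<and> seg w (enc_term t) c e)"
  "M1 SAME [m, m'] \<longleftrightarrow> (\<exists>t. val m t \<and> val m' t)"
  "M1 GN [m] \<longleftrightarrow> (\<exists>t. gval m t)"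
  "M1 NB [m] \<longleftrightarrow> (\<exists>t. val m t \<and> t \<notin> rdf_bot)"
  "M1 ST as \<longleftrightarrow> (\<exists>k<n. stm k as \<and> strict (ys ! k))"
  "M1 DF as \<longleftrightarrow> (\<exists>k<n. stm k as \<and> \<not> strict (ys ! k))"
  "M1 QS as \<longleftrightarrow> stm n as \<and> strict \<tau>"
  "M1 QD as \<longleftrightarrow> stm n as \<and> \<not> strict \<tau>"
  "M1 (TG t) [m] \<longleftrightarrow> val m (URI (ur t))"
  "M1 PNM [m] \<longleftrightarrow> (\<exists>v. val m (URI (Name v)))"
  "M1 PLN [m] \<longleftrightarrow> (\<exists>v. val m (PlainLit v))"
  by (auto simp: M1_def)

lemma M1_PRE: "M1 PRE [x, a, y, c] \<longleftrightarrow> (\<exists>l. a = x + l \<and> c = y + l \<and> x + l \<le> N \<and> y + l \<le> N \<and> (\<forall>i<l. w ! (x + i) = w ! (y + i)))"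
  by (auto simp: M1_def)

lemma stmt_segs:
  assumes "k \<le> n" "tr (ys ! k) = (s, p, oo)"
  obtains a b where "off k < N" "w ! off k \<longleftrightarrow> k < n" "Suc (off k) < N" "w ! Suc (off k) \<longleftrightarrow> \<not> strict (ys ! k)"
    "seg w (enc_term s) (off k + 2) a" "seg w (enc_uri p) a b" "seg w (enc_term oo) b (off (Suc k))"
proof -
  have "enc_stmt (ys ! k) = (\<not> strict (ys ! k)) # enc_term s @ enc_uri p @ enc_term oo"
    using assms(2) by (cases "ys ! k") auto
  with off_seg[OF assms(1)] show ?thesis using that by (auto simp: seg_Cons seg_append)
qed

lemma node_stm:
  assumes "tr (ys ! k) = (s, p, oo)"
  shows "node k (off k + 1) s" "node k (off k + 2) (URI p)" "node k (off k + 3) oo"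
  subgoal unfolding node_def using assms by (intro exI[of _ 0]) simp
  subgoal unfolding node_def using assms by (intro exI[of _ 1]) simp
  subgoal unfolding node_def using assms by (intro exI[of _ 2]) simp
  done

lemma stm_val: "k \<le> n \<Longrightarrow> tr (ys ! k) = (s, p, oo) \<Longrightarrow>
    val (off k + 1) s \<and> val (off k + 2) (URI p) \<and> val (off k + 3) oo"
  unfolding val_def using node_stm by blast

lemma stm_gval: "k < n \<Longrightarrow> tr (ys ! k) = (s, p, oo) \<Longrightarrow>
    gval (off k + 1) s \<and> gval (off k + 2) (URI p) \<and> gval (off k + 3) oo"
  unfolding gval_def using node_stm by blast

lemma uri3: "i + 3 \<le> N \<Longrightarrow> \<not> (w ! i \<and> w ! Suc i \<and> w ! Suc (Suc i)) \<Longrightarrow> \<exists>t. seg w (enc_uri (ur t)) i (i + 3)"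
proof -
  assume i: "i + 3 \<le> N" and b: "\<not> (w ! i \<and> w ! Suc i \<and> w ! Suc (Suc i))"
  have "seg w [w ! i, w ! Suc i, w ! Suc (Suc i)] i (i + 3)" using i by (simp add: seg_Cons)
  moreover have "\<exists>t. enc_uri (ur t) = [w ! i, w ! Suc i, w ! Suc (Suc i)]"
  proof -
    consider "\<not> w ! i" "\<not> w ! Suc i" "\<not> w ! Suc (Suc i)" | "\<not> w ! i" "\<not> w ! Suc i" "w ! Suc (Suc i)"
      | "\<not> w ! i" "w ! Suc i" "\<not> w ! Suc (Suc i)" | "\<not> w ! i" "w ! Suc i" "w ! Suc (Suc i)"
      | "w ! i" "\<not> w ! Suc i" "\<not> w ! Suc (Suc i)" | "w ! i" "\<not> w ! Suc i" "w ! Suc (Suc i)"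
      | "w ! i" "w ! Suc i" "\<not> w ! Suc (Suc i)" using b by blast
    then show ?thesis
      by cases (auto intro: exI[of _ tSP] exI[of _ tSC] exI[of _ tTYP] exI[of _ tDOM] exI[of _ tRANGE]
          exI[of _ tBOTC] exI[of _ tBOTP])
  qed
  ultimately show ?thesis by metis
qed

lemma seg_enc_term:
  "seg w (enc_term (URI u)) i j \<longleftrightarrow> i < N \<and> \<not> w ! i \<and> seg w (enc_uri u) (Suc i) j"
  "seg w (enc_term (PlainLit v)) i j \<longleftrightarrow> Suc i < N \<and> w ! i \<and> \<not> w ! Suc i \<and> seg w (enc_chars v) (Suc (Suc i)) j"
  "seg w (enc_term (TypedLit v u)) i k \<longleftrightarrow> Suc i < N \<and> w ! i \<and> w ! Suc i \<and>
     (\<exists>j. seg w (enc_chars v) (Suc (Suc i)) j \<and> seg w (enc_uri u) j k)"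
  by (auto simp: seg_Cons seg_append)

lemma Lits_iff: "t \<in> Lits \<longleftrightarrow> (\<forall>u. t \<noteq> URI u)"
  by (cases t) (auto simp: Lits_def)

lemma bit0_lit: "seg w (enc_term t) i j \<Longrightarrow> w ! i \<longleftrightarrow> t \<in> Lits"
  by (cases t) (auto simp: seg_enc_term Lits_iff simp del: enc_term.simps)

lemma char9: "i + 9 \<le> N \<Longrightarrow> w ! i \<Longrightarrow> \<exists>c. seg w (True # enc_char c) i (i + 9)"
  by (rule exI[of _ "Char (w ! (i+1)) (w ! (i+2)) (w ! (i+3)) (w ! (i+4)) (w ! (i+5)) (w ! (i+6)) (w ! (i+7)) (w ! (i+8))"])
    (simp add: seg_Cons eval_nat_numeral)

lemma PRE_eq: "M1 PRE [x, a, y, c] \<Longrightarrow> seg w v x a \<Longrightarrow> seg w v' y c \<Longrightarrow> v = v'"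
  unfolding M1_PRE seg_def by (auto intro!: nth_equalityI simp: list_eq_iff_nth_eq)

end

text \<open>In the tag clauses the sign of a \<open>BIT\<close> literal is itself a bit of the code,
  so both kinds of literal need a common form.\<close>

lemma lits_BIT: "X BIT = I BIT \<Longrightarrow> lits I X as ((v, BIT, xs) # B) \<longleftrightarrow> (I BIT (map ((!) as) xs) \<longleftrightarrow> v) \<and> lits I X as B"
  by (cases v) auto

text \<open>Clauses are cited by their position in the program, counted from \<open>0\<close>, with
  \<open>as\<close> listing the values of their variables.\<close>

lemma nth_rule:
  "dl_closed D P I X \<Longrightarrow> i < length P \<Longrightarrow> (case P ! i of (n, h, hs, B) \<Rightarrow>
     length as = n \<and> set as \<subseteq> {..<D} \<and> lits I X as B \<longrightarrow> X h (map ((!) as) hs))"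
  using nth_mem[of i P] by (force simp: dl_closed_def sat_clause_def)

section \<open>Soundness of the parser\<close>

context instance_word
begin

lemma M1_BIT: "M1 BIT = order_tab (Suc N) w BIT"
  by (rule ext) simp

definition at_stm :: "nat \<Rightarrow> nat \<Rightarrow> nat \<Rightarrow> nat \<Rightarrow> nat \<Rightarrow> triple \<Rightarrow> bool" where
  "at_stm i x a b k = (\<lambda>(s, p, oo). k \<le> n \<and> tr (ys ! k) = (s, p, oo) \<and> i = off k \<and> x = off k + 2 \<and>
    seg w (enc_term s) x a \<and> seg w (enc_uri p) a b \<and> seg w (enc_term oo) b (off (Suc k)) \<and>
    (w ! off k \<longleftrightarrow> k < n) \<and> (w ! Suc (off k) \<longleftrightarrow> \<not> strict (ys ! k)) \<and>
    val (off k + 1) s \<and> val (off k + 2) (URI p) \<and> val (off k + 3) oo)"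

text \<open>\<open>TR\<close> stops before the object. Unique parsing identifies its end points with
  those of statement \<open>k\<close>, which locates the object as well.\<close>

lemma TR_at_stm:
  assumes "M1 TR [i, x, a, b]"
  shows "\<exists>k s p oo. at_stm i x a b k (s, p, oo)"
proof -
  obtain k s p oo where k: "k \<le> n" "tr (ys ! k) = (s, p, oo)" "i = off k" "x = off k + 2"
    "seg w (enc_term s) (off k + 2) a" "seg w (enc_uri p) a b" using assms by auto
  obtain a' b' where s: "off k < N" "w ! off k \<longleftrightarrow> k < n" "Suc (off k) < N" "w ! Suc (off k) \<longleftrightarrow> \<not> strict (ys ! k)"
    "seg w (enc_term s) (off k + 2) a'" "seg w (enc_uri p) a' b'" "seg w (enc_term oo) b' (off (Suc k))"
    by (rule stmt_segs[OF k(1,2)])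
  have "a' = a" using term_unique[OF s(5) k(5)] by simp
  then have "b' = b" using uri_unique[OF s(6)] k(6) by simp
  then have "at_stm i x a b k (s, p, oo)"
    using k s stm_val[OF k(1,2)] by (simp add: at_stm_def)
  then show ?thesis by blast
qed

lemma chars_Nil: "\<not> w ! i \<Longrightarrow> i < N \<Longrightarrow> \<exists>v. seg w (enc_chars v) i (Suc i)"
  by (rule exI[of _ "[]"]) (simp add: enc_list_simps seg_Cons)

lemma chars_Cons: "w ! i \<Longrightarrow> i + 9 \<le> N \<Longrightarrow> seg w (enc_chars v) (i + 9) j \<Longrightarrow> \<exists>v. seg w (enc_chars v) i j"
proof -
  assume i: "w ! i" "i + 9 \<le> N" and v: "seg w (enc_chars v) (i + 9) j"
  obtain c where "seg w (True # enc_char c) i (i + 9)" using char9 i by blast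
  then have "seg w ((True # enc_char c) @ enc_chars v) i j" using v seg_append by blast
  then have "seg w (enc_chars (c # v)) i j" by (simp add: enc_list_simps)
  then show ?thesis by blast
qed

lemma name_seg: "w ! i \<Longrightarrow> w ! Suc i \<Longrightarrow> w ! Suc (Suc i) \<Longrightarrow> seg w (enc_chars v) (i + 3) j \<Longrightarrow> seg w (enc_uri (Name v)) i j"
  using seg_len[of w "enc_chars v" "i + 3" j] by (simp add: seg_Cons numeral_3_eq_3)

lemma uri_nname: "seg w (enc_uri u) i j \<Longrightarrow> (w ! i \<and> w ! Suc i \<and> w ! Suc (Suc i)) \<longleftrightarrow> (\<exists>v. u = Name v)"
  by (cases u) (auto simp: seg_Cons)

lemma uri_tag: "seg w (enc_uri u) i j \<Longrightarrow> w ! i = enc_uri (ur t) ! 0 \<Longrightarrow> w ! Suc i = enc_uri (ur t) ! 1 \<Longrightarrow>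
    w ! Suc (Suc i) = enc_uri (ur t) ! 2 \<Longrightarrow> u = ur t"
  by (cases u; cases t) (auto simp: seg_Cons)

lemma Lits_not_bot: "t \<in> Lits \<Longrightarrow> t \<notin> rdf_bot"
  by (auto simp: Lits_def rdf_bot_def)

lemma term_lit_seg:
  assumes "seg w (enc_term s) x a" "t \<in> Lits" "seg w (enc_term t) x e"
  shows "s = t \<and> e = a \<and> s \<in> Lits"
  using term_unique[OF assms(1,3)] assms(2) by auto

lemma term_uri_seg:
  assumes "seg w (enc_term s) x a" "\<not> w ! x" "seg w (enc_uri u) (Suc x) e"
  shows "s = URI u"
proof -
  have "s \<notin> Lits" using bit0_lit[OF assms(1)] assms(2) by simp
  then obtain u' where u': "s = URI u'" by (auto simp: Lits_iff)
  then have "seg w (enc_uri u') (Suc x) a" using assms(1) by (simp only: seg_enc_term)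
  then show ?thesis using uri_unique[OF _ assms(3)] u' by blast
qed

lemma order_imp_M1: "order_tab (Suc N) w \<le> M1"
proof (intro le_funI le_boolI)
  fix t as assume "order_tab (Suc N) w t as"
  then show "M1 t as" by (cases t) (auto simp: M1_def order_tab_def)
qed

context
  fixes i x a b
  assumes TR: "M1 TR [i, x, a, b]"
begin

lemma TR_subj:
  "\<not> w ! x \<Longrightarrow> seg w (enc_uri u) (Suc x) e \<Longrightarrow> val (Suc i) (URI u)"
  "t \<in> Lits \<Longrightarrow> seg w (enc_term t) x e' \<Longrightarrow> val (Suc i) t"
proof -
  obtain k s p oo where c: "at_stm i x a b k (s, p, oo)" using TR_at_stm[OF TR] by blast
  then have s: "seg w (enc_term s) x a" "val (Suc i) s" by (auto simp: at_stm_def)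
  show "\<not> w ! x \<Longrightarrow> seg w (enc_uri u) (Suc x) e \<Longrightarrow> val (Suc i) (URI u)"
    using term_uri_seg[OF s(1)] s(2) by simp
  show "t \<in> Lits \<Longrightarrow> seg w (enc_term t) x e' \<Longrightarrow> val (Suc i) t"
    using term_lit_seg[OF s(1)] s(2) by blast
qed

lemma TR_pred: "\<exists>u. val x (URI u) \<and> seg w (enc_uri u) a b"
proof -
  obtain k s p oo where "at_stm i x a b k (s, p, oo)" using TR_at_stm[OF TR] by blast
  then show ?thesis by (auto simp: at_stm_def)
qed

lemma TR_obj:
  "\<not> w ! b \<Longrightarrow> seg w (enc_uri u) (Suc b) e \<Longrightarrow> val (i + 3) (URI u)"
  "t \<in> Lits \<Longrightarrow> seg w (enc_term t) b e' \<Longrightarrow> val (i + 3) t"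
proof -
  obtain k s p oo where c: "at_stm i x a b k (s, p, oo)" using TR_at_stm[OF TR] by blast
  then have s: "seg w (enc_term oo) b (off (Suc k))" "val (i + 3) oo" by (auto simp: at_stm_def simp del: off.simps)
  show "\<not> w ! b \<Longrightarrow> seg w (enc_uri u) (Suc b) e \<Longrightarrow> val (i + 3) (URI u)"
    using term_uri_seg[OF s(1)] s(2) by simp
  show "t \<in> Lits \<Longrightarrow> seg w (enc_term t) b e' \<Longrightarrow> val (i + 3) t"
    using term_lit_seg[OF s(1)] s(2) by blast
qed

lemma TR_gval: "w ! i \<Longrightarrow> (\<exists>t. gval (Suc i) t) \<and> (\<exists>t. gval x t) \<and> (\<exists>t. gval (i + 3) t)"
proof -
  assume i: "w ! i"
  obtain k s p oo where "at_stm i x a b k (s, p, oo)" using TR_at_stm[OF TR] by blast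
  then have "k < n" "tr (ys ! k) = (s, p, oo)" "i = off k" "x = off k + 2" using i by (auto simp: at_stm_def)
  then show ?thesis using stm_gval[of k s p oo] by auto
qed

lemma TR_stm: "\<exists>k\<le>n. stm k [Suc i, x, i + 3] \<and> (w ! i \<longleftrightarrow> k < n) \<and> (w ! Suc i \<longleftrightarrow> \<not> strict (ys ! k))"
proof -
  obtain k s p oo where "at_stm i x a b k (s, p, oo)" using TR_at_stm[OF TR] by blast
  then show ?thesis by (intro exI[of _ k]) (simp add: at_stm_def stm_def)
qed

lemma TR_next: "w ! i \<Longrightarrow> seg w (enc_term t) b e \<Longrightarrow> \<exists>k\<le>n. e = off k"
proof -
  assume i: "w ! i" and e: "seg w (enc_term t) b e"
  obtain k s p oo where "at_stm i x a b k (s, p, oo)" using TR_at_stm[OF TR] by blast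
  then have k: "k < n" "seg w (enc_term oo) b (off (Suc k))" using i by (auto simp: at_stm_def simp del: off.simps)
  then have "e = off (Suc k)" using term_unique[OF e k(2)] by simp
  then show ?thesis using k(1) by (intro exI[of _ "Suc k"]) simp
qed

end

lemma TR_intro:
  assumes k: "k \<le> n" and t: "seg w (enc_term t) (off k + 2) a" and u: "seg w (enc_uri u) a b"
  shows "M1 TR [off k, off k + 2, a, b]"
proof -
  obtain s p oo where tr: "tr (ys ! k) = (s, p, oo)" by (cases "tr (ys ! k)")
  obtain a' b' where s: "seg w (enc_term s) (off k + 2) a'" "seg w (enc_uri p) a' b'"
    by (rule stmt_segs[OF k tr])
  have "a' = a" using term_unique[OF s(1) t] by simp
  then have "b' = b" using uri_unique[OF s(2)] u by simp
  then show ?thesis using s k tr \<open>a' = a\<close> by auto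
qed

lemma PRE_step: "M1 PRE [x, a, y, c] \<Longrightarrow> a < N \<Longrightarrow> c < N \<Longrightarrow> w ! a = w ! c \<Longrightarrow> M1 PRE [x, Suc a, y, Suc c]"
  unfolding M1_PRE by (elim exE) (rule_tac x = "Suc l" in exI, auto simp: less_Suc_eq)

lemma PRE_uri: "M1 PRE [x, a, y, c] \<Longrightarrow> seg w (enc_uri u) x a \<Longrightarrow> seg w (enc_uri u') y c \<Longrightarrow> u = u'"
  using PRE_eq[of x a y c "enc_uri u" "enc_uri u'"] prefix_freeD[OF prefix_free_uri, of u "[]" u' "[]"] by simp

lemma PRE_term: "M1 PRE [x, a, y, c] \<Longrightarrow> seg w (enc_term t) x a \<Longrightarrow> seg w (enc_term t') y c \<Longrightarrow> t = t'"
  using PRE_eq[of x a y c "enc_term t" "enc_term t'"] prefix_freeD[OF prefix_free_term, of t "[]" t' "[]"] by simp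

lemma ys_n: "ys ! n = \<tau>"
  by (simp add: ys_def)

lemma uri3_name: "Suc (Suc i) < N \<Longrightarrow> \<not> (w ! i \<and> w ! Suc i \<and> w ! Suc (Suc i)) \<Longrightarrow> \<exists>u. seg w (enc_uri u) i (i + 3)"
  using uri3[of i] by auto

lemma TE_uri: "i < N \<Longrightarrow> \<not> w ! i \<Longrightarrow> seg w (enc_uri u) (Suc i) j \<Longrightarrow> \<exists>t. seg w (enc_term t) i j"
  using seg_enc_term(1) by blast

lemma lit_plain: "t \<in> Lits \<Longrightarrow> seg w (enc_term t) i j \<Longrightarrow> \<not> (Suc i < N \<and> w ! Suc i) \<Longrightarrow> \<exists>v. t = PlainLit v"
  by (cases t) (auto simp: seg_enc_term Lits_iff simp del: enc_term.simps)

lemma uri_seg3: "seg w (enc_uri u) i j \<Longrightarrow> Suc (Suc i) < N"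
  using seg_len[of w "enc_uri u" i j] enc_uri_length[of u] by simp

text \<open>As \<open>M1\<close> also contains the input tables, the least model lies below it. The
  subgoals follow the order of the clauses.\<close>

lemma M1_closed: "dl_closed (Suc N) parse_prog (order_tab (Suc N) w) M1"
  unfolding parse_prog_def dl_closed_append dl_closed_map dl_closed_simps all_args
  supply M1_simps(12)[simp del] enc_uri.simps[simp del] enc_term.simps[simp del] Suc_eq_plus1[symmetric, simp]
  apply (intro conjI ballI)
  subgoal by simp
  subgoal by simp
  subgoal using chars_Nil by simp
  subgoal using chars_Cons by auto
  subgoal using uri3_name by auto
  subgoal using uri3_name by auto
  subgoal using uri3_name by auto
  subgoal using name_seg by (auto simp: numeral_3_eq_3)
  subgoal by (auto simp: Lits_iff seg_enc_term intro!: bexI[of _ "PlainLit _"])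
  subgoal by (auto simp: Lits_iff seg_enc_term intro!: bexI[of _ "TypedLit _ _"])
  subgoal using TE_uri by auto
  subgoal by auto
  subgoal by (auto intro!: exI[of _ 0])
  subgoal using TR_next by auto
  subgoal using TR_intro by (auto simp: numeral_2_eq_2)
  subgoal using TR_subj(1) by clarsimp blast
  subgoal using TR_subj(2) by clarsimp blast
  subgoal using TR_pred by auto
  subgoal using TR_obj(1) by clarsimp blast
  subgoal using TR_obj(2) by clarsimp blast
  subgoal by (simp add: M1_PRE)
  subgoal using PRE_step by auto
  subgoal using PRE_step by auto
  subgoal using PRE_uri by (simp, blast)
  subgoal using PRE_term by (simp, blast)
  subgoal using TR_gval by auto
  subgoal using TR_gval by auto
  subgoal using TR_gval by auto
  subgoal using TR_stm by fastforce
  subgoal using TR_stm by fastforce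
  subgoal using TR_stm ys_n by fastforce
  subgoal using TR_stm ys_n by fastforce
  subgoal using uri_nname by (simp, blast)
  subgoal using lit_plain by clarsimp blast
  subgoal using Lits_not_bot by auto
  subgoal by (force simp: rdf_bot_def)
  subgoal by simp
  subgoal for t using uri_tag[of _ _ _ t] uri_seg3 by (clarsimp simp: lits_BIT M1_BIT) blast
  subgoal by simp
  done

lemma node_less: "val m t \<Longrightarrow> m < Suc N"
proof -
  assume "val m t"
  then obtain k r where "k \<le> n" "r < 3" "m = off k + 1 + r" by (auto simp: val_def node_def)
  then show ?thesis using off_mono[of k "Suc k"] off_mono[of "Suc k" "Suc n"] off_N by simp
qed

section \<open>Completeness of the parser\<close>

context
  fixes R
  assumes least: "least_model (Suc N) parse_prog (order_tab (Suc N) w) R"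
begin

lemma R_le_M1: "R t as \<Longrightarrow> M1 t as"
proof -
  have "R \<le> M1" using least order_imp_M1 M1_closed by (simp add: least_model_def)
  then show "R t as \<Longrightarrow> M1 t as" by (auto simp: le_fun_def)
qed

lemma R_order: "order_tab (Suc N) w t as \<Longrightarrow> R t as"
  using least by (auto simp: least_model_def le_fun_def)

lemma R_SUC: "a < N \<Longrightarrow> R SUC [a, Suc a]" by (rule R_order) simp
lemma R_BIT: "a < N \<Longrightarrow> w ! a \<Longrightarrow> R BIT [a]" by (rule R_order) simp

lemma closed: "dl_closed (Suc N) parse_prog (order_tab (Suc N) w) R"
  using least by (simp add: least_model_def)

lemmas rule = nth_rule[OF closed, unfolded parse_prog_def]

lemma R_A3: "a + 3 \<le> N \<Longrightarrow> R A3 [a, a + 3]"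
  using rule[of 0 "[a, Suc a, Suc (Suc a), a + 3]"] R_SUC[of a] R_SUC[of "Suc a"] R_SUC[of "Suc (Suc a)"]
  by (simp add: numeral_3_eq_3)

lemma R_A9: "a + 9 \<le> N \<Longrightarrow> R A9 [a, a + 9]"
  using rule[of 1 "[a, a + 3, a + 6, a + 9]"] R_A3[of a] R_A3[of "a + 3"] R_A3[of "a + 6"]
  by (simp add: add.commute)

lemma R_CHL: "seg w (enc_chars v) i j \<Longrightarrow> R CHL [i, j]"
proof (induction v arbitrary: i)
  case Nil
  then show ?case using rule[of 2 "[i, j]"] R_SUC[of i] by (simp add: enc_list_simps seg_Cons)
next
  case (Cons c v)
  then have "seg w ((True # enc_char c) @ enc_chars v) i j" by (simp add: enc_list_simps)
  then obtain l where l: "seg w (True # enc_char c) i l" "seg w (enc_chars v) l j" unfolding seg_append by blast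
  have "l = i + 9" using seg_len[OF l(1)] by (simp add: enc_char_length)
  moreover have "i < N" "w ! i" using l(1) by (simp_all add: seg_Cons)
  ultimately show ?case
    using rule[of 3 "[i, l, j]"] Cons.IH[OF l(2)] R_A9[of i] R_BIT[of i] seg_len[OF l(1)] seg_len[OF l(2)] by simp
qed

lemma R_UR: "seg w (enc_uri u) i j \<Longrightarrow> R UR [i, j]"
proof (cases "\<exists>v. u = Name v")
  case True
  assume "seg w (enc_uri u) i j"
  with True obtain v where v: "i < N" "Suc i < N" "Suc (Suc i) < N" "w ! i" "w ! Suc i" "w ! Suc (Suc i)"
    "seg w (enc_chars v) (Suc (Suc (Suc i))) j" by (auto simp: seg_Cons)
  then show ?thesis
    using rule[of 7 "[i, Suc i, Suc (Suc i), Suc (Suc (Suc i)), j]"] R_SUC[of i] R_SUC[of "Suc i"] R_SUC[of "Suc (Suc i)"]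
      R_BIT R_CHL[OF v(7)] seg_len[OF v(7)] by simp
next
  case False
  assume u: "seg w (enc_uri u) i j"
  have j: "j = i + 3" "i + 3 \<le> N" using seg_len[OF u] False by (cases u; simp)+
  have "\<not> w ! i \<or> \<not> w ! Suc i \<or> \<not> w ! Suc (Suc i)" using uri_nname[OF u] False by blast
  then show ?thesis
    using rule[of 4 "[i, i + 3]"] rule[of 5 "[i, i + 3, Suc i]"] rule[of 6 "[i, i + 3, Suc i, Suc (Suc i)]"]
      R_A3[of i] R_SUC[of i] R_SUC[of "Suc i"] j by auto
qed

lemma R_LIT: "t \<in> Lits \<Longrightarrow> seg w (enc_term t) i j \<Longrightarrow> R LIT [i, j]"
proof (cases t)
  case (URI u)
  then show "t \<in> Lits \<Longrightarrow> ?thesis" by (simp add: Lits_iff)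
next
  case (PlainLit v)
  assume "seg w (enc_term t) i j"
  then have s: "Suc i < N" "w ! i" "\<not> w ! Suc i" "seg w (enc_chars v) (Suc (Suc i)) j"
    unfolding PlainLit seg_enc_term by auto
  then show ?thesis using rule[of 8 "[i, Suc i, Suc (Suc i), j]"] R_BIT R_SUC[of i] R_SUC[of "Suc i"] R_CHL[OF s(4)]
      seg_len[OF s(4)] by simp
next
  case (TypedLit v u)
  assume "seg w (enc_term t) i j"
  then obtain l where s: "Suc i < N" "w ! i" "w ! Suc i" "seg w (enc_chars v) (Suc (Suc i)) l" "seg w (enc_uri u) l j"
    unfolding TypedLit seg_enc_term by auto
  then show ?thesis using rule[of 9 "[i, Suc i, Suc (Suc i), l, j]"] R_BIT R_SUC[of i] R_SUC[of "Suc i"] R_CHL[OF s(4)]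
      R_UR[OF s(5)] seg_len[OF s(4)] seg_len[OF s(5)] by simp
qed

lemma R_TE: "seg w (enc_term t) i j \<Longrightarrow> R TE [i, j]"
proof (cases "t \<in> Lits")
  case True
  assume t: "seg w (enc_term t) i j"
  show ?thesis using rule[of 11 "[i, j]"] R_LIT[OF True t] seg_len[OF t] by simp
next
  case False
  assume t: "seg w (enc_term t) i j"
  obtain u where u: "t = URI u" using False by (auto simp: Lits_iff)
  have s: "i < N" "\<not> w ! i" "seg w (enc_uri u) (Suc i) j" using t unfolding u seg_enc_term by auto
  show ?thesis using rule[of 10 "[i, Suc i, j]"] R_SUC[of i] R_UR[OF s(3)] s seg_len[OF s(3)] by simp
qed

lemma R_TR:
  assumes k: "k \<le> n" "tr (ys ! k) = (s, p, oo)" and LS: "R LS [off k]"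
    and s: "seg w (enc_term s) (off k + 2) a" "seg w (enc_uri p) a b" "seg w (enc_term oo) b c"
  shows "R TR [off k, off k + 2, a, b]"
  using rule[of 14 "[off k, Suc (off k), Suc (Suc (off k)), a, b, c]"] LS R_TE[OF s(1)] R_UR[OF s(2)] R_TE[OF s(3)]
    R_SUC[of "off k"] R_SUC[of "Suc (off k)"] seg_len[OF s(1)] seg_len[OF s(2)] seg_len[OF s(3)]
  by simp

text \<open>The start of statement \<open>k + 1\<close> is found only by parsing statement
  \<open>k\<close>; this is why \<open>R_TR\<close> takes the fact on \<open>LS\<close> as a
  premise.\<close>

lemma R_LS: "k \<le> n \<Longrightarrow> R LS [off k]"
proof (induction k)
  case 0
  show ?case using rule[of 12 "[0]"] by simp
next
  case (Suc k)
  obtain s p oo where t: "tr (ys ! k) = (s, p, oo)" by (cases "tr (ys ! k)")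
  have k: "k \<le> n" using Suc.prems by simp
  obtain a b where s: "off k < N" "w ! off k \<longleftrightarrow> k < n"
    "seg w (enc_term s) (off k + 2) a" "seg w (enc_uri p) a b" "seg w (enc_term oo) b (off (Suc k))"
    by (rule stmt_segs[OF k t])
  have TR: "R TR [off k, off k + 2, a, b]" by (rule R_TR[OF k t _ s(3-5)]) (use Suc in simp)
  show ?case
    using rule[of 13 "[off k, off k + 2, a, b, off (Suc k)]"] TR R_TE[OF s(5)] R_BIT[of "off k"] s(1,2) Suc.prems
      seg_len[OF s(3)] seg_len[OF s(4)] seg_len[OF s(5)]
    by (simp del: off.simps)
qed

lemma R_stm:
  assumes k: "k \<le> n"
  obtains s p oo a b where "tr (ys ! k) = (s, p, oo)" "R TR [off k, off k + 2, a, b]" "off k + 2 \<le> a" "a + 3 \<le> b" "b + 2 \<le> N"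
    "seg w (enc_term s) (off k + 2) a" "seg w (enc_uri p) a b" "seg w (enc_term oo) b (off (Suc k))"
    "w ! off k \<longleftrightarrow> k < n" "w ! Suc (off k) \<longleftrightarrow> \<not> strict (ys ! k)"
proof -
  obtain s p oo where t: "tr (ys ! k) = (s, p, oo)" by (cases "tr (ys ! k)")
  obtain a b where s: "off k < N" "w ! off k \<longleftrightarrow> k < n" "Suc (off k) < N" "w ! Suc (off k) \<longleftrightarrow> \<not> strict (ys ! k)"
    "seg w (enc_term s) (off k + 2) a" "seg w (enc_uri p) a b" "seg w (enc_term oo) b (off (Suc k))"
    by (rule stmt_segs[OF k t])
  have "off k + 2 \<le> a" "a + 3 \<le> b" "b + 2 \<le> N"
    using seg_len[OF s(5)] seg_len[OF s(6)] seg_len[OF s(7)] enc_uri_length[of p] enc_term_length[of oo] by auto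
  then show ?thesis using that[OF t R_TR[OF k t R_LS[OF k] s(5-7)]] s by blast
qed

lemma R_key:
  assumes "val m t"
  shows "(\<exists>u c e. t = URI u \<and> seg w (enc_uri u) c e \<and> R KU [m, c, e]) \<or>
    (t \<in> Lits \<and> (\<exists>c e. seg w (enc_term t) c e \<and> R KL [m, c, e]))"
proof -
  obtain k r where k: "k \<le> n" and r: "r < 3" "m = off k + 1 + r" "comp_of (tr (ys ! k)) r = t"
    using assms by (auto simp: val_def node_def)
  obtain s p oo a b where c: "tr (ys ! k) = (s, p, oo)" "R TR [off k, off k + 2, a, b]" "off k + 2 \<le> a" "a + 3 \<le> b" "b + 2 \<le> N"
    "seg w (enc_term s) (off k + 2) a" "seg w (enc_uri p) a b" "seg w (enc_term oo) b (off (Suc k))"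
    "w ! off k \<longleftrightarrow> k < n" "w ! Suc (off k) \<longleftrightarrow> \<not> strict (ys ! k)" by (rule R_stm[OF k])
  have N: "off (Suc k) \<le> N" using seg_len[OF c(8)] by simp
  consider "r = 0" "t = s" | "r = 1" "t = URI p" | "r = 2" "t = oo" using r c(1) by (auto simp: less_Suc_eq numeral_3_eq_3)
  then show ?thesis
  proof cases
    case 1
    show ?thesis
    proof (cases "t \<in> Lits")
      case True
      have "R KL [m, off k + 2, a]"
        using rule[of 16 "[off k, off k + 2, a, b, Suc (off k), a]"] c(2-5) R_SUC[of "off k"] R_LIT[OF True] c(6) 1 r(2) by simp
      then show ?thesis using True c(6) 1 by blast
    next
      case False
      then obtain u where u: "t = URI u" by (auto simp: Lits_iff)
      then have s: "\<not> w ! (off k + 2)" "seg w (enc_uri u) (Suc (off k + 2)) a"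
        using c(6) unfolding 1(2)[symmetric] u seg_enc_term by auto
      have "R KU [m, Suc (off k + 2), a]"
        using rule[of 15 "[off k, off k + 2, a, b, Suc (off k), Suc (off k + 2), a]"] c(2-5) R_SUC[of "off k"]
          R_SUC[of "off k + 2"] R_UR[OF s(2)] s(1) seg_len[OF s(2)] 1 r(2) by simp
      then show ?thesis using u s(2) by blast
    qed
  next
    case 2
    have "R KU [m, a, b]" using rule[of 17 "[off k, off k + 2, a, b]"] c(2-5) 2 r(2) by simp
    then show ?thesis using c(7) 2 by blast
  next
    case 3
    show ?thesis
    proof (cases "t \<in> Lits")
      case True
      have "R KL [m, b, off (Suc k)]"
        using rule[of 19 "[off k, off k + 2, a, b, off k + 3, off (Suc k)]"] c(2-5) R_A3[of "off k"] R_LIT[OF True] c(8) 3 r(2) N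
        by (simp add: numeral_3_eq_3 del: off.simps)
      then show ?thesis using True c(8) 3 by blast
    next
      case False
      then obtain u where u: "t = URI u" by (auto simp: Lits_iff)
      then have s: "\<not> w ! b" "seg w (enc_uri u) (Suc b) (off (Suc k))"
        using c(8) unfolding 3(2)[symmetric] u seg_enc_term by auto
      have "R KU [m, Suc b, off (Suc k)]"
        using rule[of 18 "[off k, off k + 2, a, b, off k + 3, Suc b, off (Suc k)]"] c(2-5) R_A3[of "off k"]
          R_SUC[of b] R_UR[OF s(2)] s(1) N 3 r(2) by (simp add: numeral_3_eq_3 del: off.simps)
      then show ?thesis using u s(2) by blast
    qed
  qed
qed

lemma R_PRE:
  assumes x: "seg w v x a" and y: "seg w v y c"
  shows "R PRE [x, a, y, c]"
proof -
  have nth: "w ! (x + l) = v ! l" "w ! (y + l) = v ! l" if "l < length v" for l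
    using x y that unfolding seg_def by (metis add_leE nth_drop nth_take)+
  have len: "a = x + length v" "a \<le> N" "c = y + length v" "c \<le> N" using seg_len[OF x] seg_len[OF y] by auto
  have "l \<le> length v \<Longrightarrow> R PRE [x, x + l, y, y + l]" for l
  proof (induction l)
    case 0
    show ?case using rule[of 20 "[x, y]"] len by simp
  next
    case (Suc l)
    then show ?case
      using rule[of 21 "[x, x + l, Suc (x + l), y, y + l, Suc (y + l)]"] rule[of 22 "[x, x + l, Suc (x + l), y, y + l, Suc (y + l)]"]
        R_SUC[of "x + l"] R_SUC[of "y + l"] R_BIT[of "x + l"] R_BIT[of "y + l"] nth[of l] len
      by (cases "v ! l") simp_all
  qed
  from this[of "length v"] show ?thesis using len by simp
qed

lemma R_SAME: "val m t \<Longrightarrow> val m' t \<Longrightarrow> R SAME [m, m']"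
proof -
  assume v: "val m t" "val m' t"
  show ?thesis
  proof (cases "t \<in> Lits")
    case True
    then obtain c e c' e' where s: "seg w (enc_term t) c e" "R KL [m, c, e]" "seg w (enc_term t) c' e'" "R KL [m', c', e']"
      using R_key[OF v(1)] R_key[OF v(2)] by (auto simp: Lits_iff)
    show ?thesis using rule[of 24 "[m, c, e, m', c', e']"] s R_PRE[OF s(1,3)] node_less[OF v(1)] node_less[OF v(2)]
      seg_len[OF s(1)] seg_len[OF s(3)] by simp
  next
    case False
    then obtain u c e c' e' where s: "seg w (enc_uri u) c e" "R KU [m, c, e]" "seg w (enc_uri u) c' e'" "R KU [m', c', e']"
      using R_key[OF v(1)] R_key[OF v(2)] by auto
    show ?thesis using rule[of 23 "[m, c, e, m', c', e']"] s R_PRE[OF s(1,3)] node_less[OF v(1)] node_less[OF v(2)]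
      seg_len[OF s(1)] seg_len[OF s(3)] by simp
  qed
qed

lemma R_GN: "gval m t \<Longrightarrow> R GN [m]"
proof -
  assume "gval m t"
  then obtain k r where k: "k < n" and r: "r < 3" "m = off k + 1 + r" by (auto simp: gval_def node_def)
  obtain s p oo a b where c: "R TR [off k, off k + 2, a, b]" "off k + 2 \<le> a" "a + 3 \<le> b" "b + 2 \<le> N" "w ! off k \<longleftrightarrow> k < n"
    by (rule R_stm[of k]) (use k in auto)
  consider "r = 0" | "r = 1" | "r = 2" using r by linarith
  then show ?thesis
    using rule[of 25 "[off k, off k + 2, a, b, Suc (off k)]"] rule[of 26 "[off k, off k + 2, a, b]"]
      rule[of 27 "[off k, off k + 2, a, b, off k + 3]"] c k r R_BIT[of "off k"] R_SUC[of "off k"] R_A3[of "off k"]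
    by cases (auto simp: numeral_3_eq_3)
qed

lemma R_stmts:
  assumes "k \<le> n" "stm k as"
  shows "k < n \<Longrightarrow> strict (ys ! k) \<Longrightarrow> R ST as" "k < n \<Longrightarrow> \<not> strict (ys ! k) \<Longrightarrow> R DF as"
    "k = n \<Longrightarrow> strict (ys ! k) \<Longrightarrow> R QS as" "k = n \<Longrightarrow> \<not> strict (ys ! k) \<Longrightarrow> R QD as"
proof -
  obtain s p oo a b where c: "R TR [off k, off k + 2, a, b]" "off k + 2 \<le> a" "a + 3 \<le> b" "b + 2 \<le> N"
    "w ! off k \<longleftrightarrow> k < n" "w ! Suc (off k) \<longleftrightarrow> \<not> strict (ys ! k)"
    by (rule R_stm[OF assms(1)])
  note * = c R_BIT[of "off k"] R_BIT[of "Suc (off k)"] R_SUC[of "off k"] R_A3[of "off k"] assms(2)[unfolded stm_def]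
  show "k < n \<Longrightarrow> strict (ys ! k) \<Longrightarrow> R ST as" using rule[of 28 "[off k, off k + 2, a, b, Suc (off k), off k + 3]"] * by simp
  show "k < n \<Longrightarrow> \<not> strict (ys ! k) \<Longrightarrow> R DF as" using rule[of 29 "[off k, off k + 2, a, b, Suc (off k), off k + 3]"] * by simp
  show "k = n \<Longrightarrow> strict (ys ! k) \<Longrightarrow> R QS as" using rule[of 30 "[off k, off k + 2, a, b, Suc (off k), off k + 3]"] * by simp
  show "k = n \<Longrightarrow> \<not> strict (ys ! k) \<Longrightarrow> R QD as" using rule[of 31 "[off k, off k + 2, a, b, Suc (off k), off k + 3]"] * by simp
qed

lemma R_uri:
  assumes "val m (URI u)"
  obtains c e where "seg w (enc_uri u) c e" "R KU [m, c, e]" "c + 3 \<le> e" "e \<le> N"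
proof -
  obtain c e where s: "seg w (enc_uri u) c e" "R KU [m, c, e]" using R_key[OF assms] by (auto simp: Lits_iff)
  then show ?thesis using that[OF s] seg_len[OF s(1)] enc_uri_length[of u] by simp
qed

lemma R_PNM: "val m (URI (Name v)) \<Longrightarrow> R PNM [m]"
proof -
  assume v: "val m (URI (Name v))"
  obtain c e where s: "seg w (enc_uri (Name v)) c e" "R KU [m, c, e]" "c + 3 \<le> e" "e \<le> N" by (rule R_uri[OF v])
  have "w ! c" "w ! Suc c" "w ! Suc (Suc c)" using uri_nname[OF s(1)] by auto
  then show ?thesis using rule[of 32 "[m, c, e, Suc c, Suc (Suc c)]"] s(2-4) node_less[OF v] R_SUC[of c] R_SUC[of "Suc c"]
    R_BIT[of c] R_BIT[of "Suc c"] R_BIT[of "Suc (Suc c)"] by simp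
qed

lemma R_TG: "val m (URI (ur t)) \<Longrightarrow> R (TG t) [m]"
proof -
  assume v: "val m (URI (ur t))"
  obtain c e where s: "seg w (enc_uri (ur t)) c e" "R KU [m, c, e]" "c + 3 \<le> e" "e \<le> N" by (rule R_uri[OF v])
  have b: "w ! c = enc_uri (ur t) ! 0" "w ! Suc c = enc_uri (ur t) ! 1" "w ! Suc (Suc c) = enc_uri (ur t) ! 2"
    using s(1) by (cases t; simp add: seg_Cons)+
  note * = s(2-4) b node_less[OF v] R_SUC[of c] R_SUC[of "Suc c"] R_BIT[of c] R_BIT[of "Suc c"] R_BIT[of "Suc (Suc c)"]
  show ?thesis
    \<comment> \<open>The clauses for the seven tags come after the 36 listed ones.\<close>
    using rule[of 36 "[m, c, e, Suc c, Suc (Suc c)]"] rule[of 37 "[m, c, e, Suc c, Suc (Suc c)]"]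
      rule[of 38 "[m, c, e, Suc c, Suc (Suc c)]"] rule[of 39 "[m, c, e, Suc c, Suc (Suc c)]"]
      rule[of 40 "[m, c, e, Suc c, Suc (Suc c)]"] rule[of 41 "[m, c, e, Suc c, Suc (Suc c)]"]
      rule[of 42 "[m, c, e, Suc c, Suc (Suc c)]"] *
    by (cases t) (simp_all add: tgs_def)
qed

lemma R_lit:
  assumes "val m t" "t \<in> Lits"
  obtains c e where "seg w (enc_term t) c e" "R KL [m, c, e]" "c + 2 \<le> e" "e \<le> N"
proof -
  obtain c e where s: "seg w (enc_term t) c e" "R KL [m, c, e]" using R_key[OF assms(1)] assms(2) by (auto simp: Lits_iff)
  then show ?thesis using that[OF s] seg_len[OF s(1)] enc_term_length[of t] by simp
qed

lemma R_PLN: "val m (PlainLit v) \<Longrightarrow> R PLN [m]"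
proof -
  assume v: "val m (PlainLit v)"
  obtain c e where s: "seg w (enc_term (PlainLit v)) c e" "R KL [m, c, e]" "c + 2 \<le> e" "e \<le> N"
    by (rule R_lit[OF v]) (simp_all add: Lits_iff)
  have "\<not> w ! Suc c" using s(1) unfolding seg_enc_term by simp
  then show ?thesis using rule[of 33 "[m, c, e, Suc c]"] s(2-4) node_less[OF v] R_SUC[of c] by simp
qed

lemma R_NB: "val m t \<Longrightarrow> t \<notin> rdf_bot \<Longrightarrow> R NB [m]"
proof -
  assume v: "val m t" "t \<notin> rdf_bot"
  show ?thesis
  proof (cases "t \<in> Lits")
    case True
    obtain c e where s: "R KL [m, c, e]" "c + 2 \<le> e" "e \<le> N" by (rule R_lit[OF v(1) True])
    then show ?thesis using rule[of 34 "[m, c, e]"] node_less[OF v(1)] by simp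
  next
    case False
    then obtain x where "t = URI (Name x)" using v(2) by (cases t) (auto simp: Lits_iff rdf_bot_def, metis uri.exhaust)
    then show ?thesis using rule[of 35 "[m]"] R_PNM node_less[OF v(1)] v(1) by simp
  qed
qed

theorem parse_tables:
  assumes "t \<in> {BIT, SEEN, SUC, HP, HS, SAME, GN, NB, ST, DF, QS, QD, PNM, PLN} \<union> range TG"
  shows "R t = M1 t"
proof
  fix as
  show "R t as = M1 t as"
  proof
    assume M: "M1 t as"
    show "R t as"
    proof (cases "t \<in> {BIT, SEEN, SUC, HP, HS}")
      case True
      then have "order_tab (Suc N) w t as" using M by (auto simp: M1_def)
      then show ?thesis by (rule R_order)
    next
      case False
      then show ?thesis
        using assms M R_stmts[of _ as] ys_n
        by (auto simp: M1_def intro: R_SAME R_GN R_NB R_PNM R_PLN R_TG less_imp_le)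
    qed
  qed (rule R_le_M1)
qed

end

end

section \<open>Closure by levels\<close>

text \<open>The first argument of the computed tables is the level. All levels fit into one stratum
  because survival asks for the derivability of a vacuity, never for its failure. \<open>HS\<close>
  holds of the indices below \<open>N\<close>; at index \<open>N\<close> the triples that survive at
  level \<open>N - 1\<close> enter only by their vacuities. The clauses for base triples copy them
  to all graph nodes with the same terms, after which the other clauses may join on equal
  nodes.\<close>

definition level_prog :: "tab clause list" where
  "level_prog = [
    (4, ACT, [0, 1, 2, 3], [neg HP [0], pos DF [1, 2, 3]]),
    (5, ACT, [4, 1, 2, 3], [pos ACT [0, 1, 2, 3], pos SUC [0, 4], pos HS [4], pos (TG tSC) [2], pos (BIN tBOTC) [0, 1, 1]]),
    (5, ACT, [4, 1, 2, 3], [pos ACT [0, 1, 2, 3], pos SUC [0, 4], pos HS [4], pos (TG tSP) [2], pos (BIN tBOTP) [0, 1, 1]]),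
    (4, BASE, [0, 1, 2, 3], [pos ST [1, 2, 3]]),
    (4, BASE, [0, 1, 2, 3], [pos ACT [0, 1, 2, 3]]),
    (7, BIN tBOTC, [4, 5, 6], [pos ACT [0, 1, 2, 3], pos SUC [0, 4], neg HS [4], pos (TG tSC) [2],
      pos SAME [1, 5], pos SAME [1, 6], pos GN [5], pos GN [6]]),
    (7, BIN tBOTP, [4, 5, 6], [pos ACT [0, 1, 2, 3], pos SUC [0, 4], neg HS [4], pos (TG tSP) [2],
      pos SAME [1, 5], pos SAME [1, 6], pos GN [5], pos GN [6]]),
    (7, GEN, [0, 4, 6, 5], [pos BASE [0, 1, 2, 3], pos PNM [2], pos SAME [1, 4], pos GN [4], pos SAME [3, 5], pos GN [5],
      pos SAME [2, 6], pos GN [6]]),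
    (4, BIN tSP, [0, 1, 3], [pos (BIN tSP) [0, 1, 2], pos (BIN tSP) [0, 2, 3]]),
    (5, GEN, [0, 3, 2, 4], [pos (BIN tSP) [0, 1, 2], pos GEN [0, 3, 1, 4]]),
    (4, BIN tSC, [0, 1, 3], [pos (BIN tSC) [0, 1, 2], pos (BIN tSC) [0, 2, 3]]),
    (4, BIN tTYP, [0, 3, 2], [pos (BIN tSC) [0, 1, 2], pos (BIN tTYP) [0, 3, 1]]),
    (5, BIN tTYP, [0, 3, 2], [pos (BIN tDOM) [0, 1, 2], pos GEN [0, 3, 1, 4]]),
    (5, BIN tTYP, [0, 4, 2], [pos (BIN tRANGE) [0, 1, 2], pos GEN [0, 3, 1, 4]]),
    (3, BIN tBOTC, [0, 2, 1], [pos (BIN tBOTC) [0, 1, 2]]),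
    (4, BIN tBOTC, [0, 3, 2], [pos (BIN tBOTC) [0, 1, 2], pos (BIN tSC) [0, 3, 1]]),
    (3, BIN tBOTC, [0, 1, 2], [pos (BIN tBOTC) [0, 1, 1], pos CL [0, 2]]),
    (3, BIN tBOTP, [0, 2, 1], [pos (BIN tBOTP) [0, 1, 2]]),
    (4, BIN tBOTP, [0, 3, 2], [pos (BIN tBOTP) [0, 1, 2], pos (BIN tSP) [0, 3, 1]]),
    (3, BIN tBOTP, [0, 1, 2], [pos (BIN tBOTP) [0, 1, 1], pos GN [2], pos NB [2]]),
    (5, BIN tBOTP, [0, 1, 3], [pos (BIN tDOM) [0, 1, 2], pos (BIN tDOM) [0, 3, 4], pos (BIN tBOTC) [0, 2, 4]]),
    (5, BIN tBOTP, [0, 1, 3], [pos (BIN tRANGE) [0, 1, 2], pos (BIN tRANGE) [0, 3, 4], pos (BIN tBOTC) [0, 2, 4]]),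
    (2, CL, [0, 1], [pos PLN [1], pos GN [1]]),
    (3, CL, [0, 2], [pos (BIN tTYP) [0, 1, 2]]),
    (3, CL, [0, 2], [pos (BIN tDOM) [0, 1, 2]]),
    (3, CL, [0, 2], [pos (BIN tRANGE) [0, 1, 2]]),
    (3, CL, [0, 2], [pos (BIN tSC) [0, 1, 2]]),
    (3, CL, [0, 2], [pos (BIN tBOTC) [0, 1, 2]]),
    (3, CL, [0, 1], [pos (BIN tSC) [0, 1, 2]]),
    (3, CL, [0, 1], [pos (BIN tBOTC) [0, 1, 2]])]
   @ map (\<lambda>t. (6, BIN t, [0, 4, 5], [pos BASE [0, 1, 2, 3], pos (TG t) [2], pos SAME [1, 4], pos GN [4],
       pos SAME [3, 5], pos GN [5]])) tgs"

text \<open>A vacuity lost at some level stays lost, so the first level without the vacuity of the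
  query is \<open>0\<close> or has a predecessor that still derives it. Query terms are looked up
  among the nodes of the graph; a term that does not occur there is in no derivable triple.\<close>

definition answer_prog :: "tab clause list" where
  "answer_prog = [
    (7, ANS, [], [pos QS [1, 2, 3], neg HS [0], pos PNM [2], pos SAME [1, 4], pos GN [4], pos SAME [3, 5], pos GN [5],
      pos SAME [2, 6], pos GN [6], pos GEN [0, 4, 6, 5]]),
    (6, ANS, [], [pos QD [1, 2, 3], pos (TG tSC) [2], pos SAME [1, 4], pos GN [4], pos SUC [0, 5], neg HS [5],
      pos (BIN tBOTC) [0, 4, 4]]),
    (6, ANS, [], [pos QD [1, 2, 3], pos (TG tSP) [2], pos SAME [1, 4], pos GN [4], pos SUC [0, 5], neg HS [5],
      pos (BIN tBOTP) [0, 4, 4]]),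
    (6, ANS, [], [pos QD [1, 2, 3], pos (TG tSC) [2], pos SAME [1, 4], pos GN [4], pos SAME [3, 5], pos GN [5],
      neg HP [0], neg (BIN tBOTC) [0, 4, 4], pos (BIN tSC) [0, 4, 5]]),
    (6, ANS, [], [pos QD [1, 2, 3], pos (TG tSP) [2], pos SAME [1, 4], pos GN [4], pos SAME [3, 5], pos GN [5],
      neg HP [0], neg (BIN tBOTP) [0, 4, 4], pos (BIN tSP) [0, 4, 5]]),
    (7, ANS, [], [pos QD [1, 2, 3], pos (TG tSC) [2], pos SAME [1, 4], pos GN [4], pos SAME [3, 5], pos GN [5],
      pos SUC [0, 6], pos HS [6], pos (BIN tBOTC) [0, 4, 4], neg (BIN tBOTC) [6, 4, 4], pos (BIN tSC) [6, 4, 5]]),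
    (7, ANS, [], [pos QD [1, 2, 3], pos (TG tSP) [2], pos SAME [1, 4], pos GN [4], pos SAME [3, 5], pos GN [5],
      pos SUC [0, 6], pos HS [6], pos (BIN tBOTP) [0, 4, 4], neg (BIN tBOTP) [6, 4, 4], pos (BIN tSP) [6, 4, 5]])]
   @ map (\<lambda>t. (6, ANS, [], [pos QS [1, 2, 3], neg HS [0], pos (TG t) [2], pos SAME [1, 4], pos GN [4],
       pos SAME [3, 5], pos GN [5], pos (BIN t) [0, 4, 5]])) tgs"

lemma der_mono:
  assumes "X \<subseteq> Y"
  shows "der U X A p B \<Longrightarrow> der U Y A p B" and "cls U X B \<Longrightarrow> cls U Y B"
proof (induction rule: der_cls.inducts)
  case (base A p B)
  then show ?case using assms der_cls.base by blast
qed (blast intro: der_cls.intros)+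

lemma vocab_cases: "URI u \<in> rdf_bot \<Longrightarrow> \<exists>t. u = ur t"
proof -
  assume "URI u \<in> rdf_bot"
  then consider "u = SP" | "u = SC" | "u = TYP" | "u = DOM" | "u = RANGE" | "u = BOTC" | "u = BOTP"
    by (auto simp: rdf_bot_def)
  then show ?thesis using ur.simps by cases metis+
qed

lemma ur_bot: "URI (ur t) \<in> rdf_bot"
  by (cases t) auto

lemma ur_inj: "ur s = ur t \<longleftrightarrow> s = t"
  by (cases s; cases t) auto

section \<open>A single instance and the soundness of the level program\<close>

locale decision_instance = instance_word +
  assumes graph: "defeasible_graph (set xs)" and query: "wf_stmt \<tau>"
begin

abbreviation "G \<equiv> set xs"

sublocale dgraph "set xs"
  by unfold_locales (rule graph)

lemma ys_less: "k < n \<Longrightarrow> ys ! k = xs ! k"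
  by (simp add: ys_def nth_append)

lemma strs_nth: "t \<in> strs G \<longleftrightarrow> (\<exists>k<n. strict (ys ! k) \<and> tr (ys ! k) = t)"
proof -
  have "strict x \<and> tr x = t \<longleftrightarrow> x = Strict t" for x by (cases x) auto
  then show ?thesis by (auto simp: strs_def in_set_conv_nth ys_less)
qed

lemma defs_nth: "t \<in> defs G \<longleftrightarrow> (\<exists>k<n. \<not> strict (ys ! k) \<and> tr (ys ! k) = t)"
proof -
  have "\<not> strict x \<and> tr x = t \<longleftrightarrow> x = Defeasible t" for x by (cases x) auto
  then show ?thesis by (auto simp: defs_def in_set_conv_nth ys_less)
qed

definition gv :: "nat \<Rightarrow> rdf_term" where "gv m = (THE t. gval m t)"
definition gnode :: "nat \<Rightarrow> bool" where "gnode m \<longleftrightarrow> (\<exists>t. gval m t)"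

lemma gval_eq: "gval m t \<longleftrightarrow> gnode m \<and> gv m = t"
proof -
  have u: "gval m t \<Longrightarrow> gval m t' \<Longrightarrow> t' = t" for t t' using val_unique gval_val by blast
  then have "gval m t \<Longrightarrow> gv m = t" for t unfolding gv_def by blast
  then show ?thesis unfolding gnode_def by blast
qed

lemma val_gnode: "gnode m \<Longrightarrow> val m t \<longleftrightarrow> t = gv m"
  using gval_eq gval_val val_unique by blast

lemma gnode_less: "gnode m \<Longrightarrow> m < Suc N"
  using node_less val_gnode by blast

lemma tr_cases: obtains s p oo where "tr x = (s, p, oo)"
  by (cases "tr x")

lemma U_gval: "t \<in> U \<longleftrightarrow> (\<exists>m. gval m t)"
proof
  assume "t \<in> U"
  then obtain x where x: "x \<in> H" "t \<in> terms_of x" by (auto simp: uni_def)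
  then obtain k where k: "k < n" "tr (ys ! k) = x"
    using strs_nth[of x] defs_nth[of x] by (auto simp: strictified_eq)
  obtain s p oo where t: "tr (ys ! k) = (s, p, oo)" by (rule tr_cases)
  then show "\<exists>m. gval m t" using stm_gval[OF k(1) t] x k by auto
next
  assume "\<exists>m. gval m t"
  then obtain k r where k: "k < n" "r < 3" "comp_of (tr (ys ! k)) r = t" by (auto simp: gval_def node_def)
  have "tr (ys ! k) \<in> H" using k strs_nth defs_nth by (auto simp: strictified_eq)
  moreover have "t \<in> terms_of (tr (ys ! k))" using k by (cases "tr (ys ! k)") (auto split: if_splits)
  ultimately show "t \<in> U" by (auto simp: uni_def)
qed

lemma U_node: "t \<in> U \<Longrightarrow> \<exists>m. gnode m \<and> gv m = t"
  using U_gval gval_eq by blast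

lemma gv_U: "gnode m \<Longrightarrow> gv m \<in> U"
  using U_gval gval_eq by blast

text \<open>
  The levels are stable at \<open>N - 1\<close>, so index \<open>N\<close> is free for the closure that decides strict triples.
\<close>

definition Lv :: "nat \<Rightarrow> triple set" where
  "Lv i = (if i < N then XL G i else YL (N - 1))"

abbreviation dr :: "nat \<Rightarrow> rdf_term \<Rightarrow> rdf_term \<Rightarrow> rdf_term \<Rightarrow> bool" where
  "dr i \<equiv> der U (Lv i)"

lemma wfX_Lv: "wfX U (Lv i)"
  using wfX_YL wfX_sub[OF XL_H] by (simp add: Lv_def)

lemma card_defs: "card (defs G) \<le> N - 1"
proof -
  have "defs G \<subseteq> tr ` set xs" unfolding defs_def by force
  then have "card (defs G) \<le> card (tr ` set xs)" by (rule card_mono[rotated]) simp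
  also have "\<dots> \<le> n" using card_image_le[of "set xs" tr] card_length[of xs] by simp
  finally show ?thesis using n_less by simp
qed

definition nodes :: "nat \<Rightarrow> nat list" where "nodes k = [off k + 1, off k + 2, off k + 3]"

lemma stm_nodes: "stm k as \<longleftrightarrow> as = nodes k"
  by (simp add: stm_def nodes_def)

definition M2 :: "tab tabs" where
  "M2 t as = (case t of
      ACT \<Rightarrow> (\<exists>i k. as = i # nodes k \<and> i < N \<and> k < n \<and> \<not> strict (ys ! k) \<and> tr (ys ! k) \<in> slev G i)
    | BASE \<Rightarrow> (\<exists>i k. as = i # nodes k \<and> i \<le> N \<and> k < n \<and>
        (strict (ys ! k) \<or> i < N \<and> tr (ys ! k) \<in> slev G i))
    | BIN t \<Rightarrow> (\<exists>i x y. as = [i, x, y] \<and> i \<le> N \<and> gnode x \<and> gnode y \<and> dr i (gv x) (URI (ur t)) (gv y))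
    | GEN \<Rightarrow> (\<exists>i x q y. as = [i, x, q, y] \<and> i \<le> N \<and> gnode x \<and> gnode q \<and> gnode y \<and> gv q \<notin> rdf_bot \<and> dr i (gv x) (gv q) (gv y))
    | CL \<Rightarrow> (\<exists>i x. as = [i, x] \<and> i \<le> N \<and> gnode x \<and> cls U (Lv i) (gv x))
    | ANS \<Rightarrow> False
    | _ \<Rightarrow> M1 t as)"

definition parse_tabs :: "tab set" where
  "parse_tabs = {BIT, SEEN, SUC, HP, HS, SAME, GN, NB, ST, DF, QS, QD, PNM, PLN} \<union> range TG"

lemma M2_parse: "t \<in> parse_tabs \<Longrightarrow> M2 t = M1 t"
  by (rule ext) (auto simp: M2_def parse_tabs_def)

lemma M2_simps [simp]:
  "M2 BIT = M1 BIT" "M2 SUC = M1 SUC" "M2 HP = M1 HP" "M2 HS = M1 HS" "M2 SAME = M1 SAME" "M2 GN = M1 GN"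
  "M2 NB = M1 NB" "M2 ST = M1 ST" "M2 DF = M1 DF" "M2 QS = M1 QS" "M2 QD = M1 QD" "M2 PNM = M1 PNM"
  "M2 PLN = M1 PLN" "M2 (TG t) = M1 (TG t)"
  "M2 ACT [i, a, b, c] \<longleftrightarrow> i < N \<and> (\<exists>k<n. [a, b, c] = nodes k \<and> \<not> strict (ys ! k) \<and> tr (ys ! k) \<in> slev G i)"
  "M2 BASE [i, a, b, c] \<longleftrightarrow> i \<le> N \<and> (\<exists>k<n. [a, b, c] = nodes k \<and> (strict (ys ! k) \<or> i < N \<and> tr (ys ! k) \<in> slev G i))"
  "M2 (BIN t) [i, x, y] \<longleftrightarrow> i \<le> N \<and> gnode x \<and> gnode y \<and> dr i (gv x) (URI (ur t)) (gv y)"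
  "M2 GEN [i, x, q, y] \<longleftrightarrow> i \<le> N \<and> gnode x \<and> gnode q \<and> gnode y \<and> gv q \<notin> rdf_bot \<and> dr i (gv x) (gv q) (gv y)"
  "M2 CL [i, x] \<longleftrightarrow> i \<le> N \<and> gnode x \<and> cls U (Lv i) (gv x)"
  by (auto simp: M2_def parse_tabs_def)

lemma M1_GN: "M1 GN [x] \<longleftrightarrow> gnode x"
  by (simp add: gnode_def)

lemma same_gv: "val m t \<Longrightarrow> M1 SAME [m, x] \<Longrightarrow> gnode x \<Longrightarrow> gv x = t"
  using val_unique val_gnode by auto

lemma stm_same:
  assumes "[a, b, c] = nodes k" "k \<le> n" "tr (ys ! k) = (s, p, oo)"
  shows "M1 SAME [a, x] \<Longrightarrow> gnode x \<Longrightarrow> gv x = s" "M1 SAME [c, x] \<Longrightarrow> gnode x \<Longrightarrow> gv x = oo"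
    "M1 SAME [b, x] \<Longrightarrow> gnode x \<Longrightarrow> gv x = URI p" "M1 (TG t) [b] \<Longrightarrow> p = ur t" "M1 PNM [b] \<Longrightarrow> URI p \<notin> rdf_bot"
proof -
  have v: "val a s" "val b (URI p)" "val c oo" using stm_val[OF assms(2,3)] assms(1) by (auto simp: nodes_def)
  show "M1 SAME [a, x] \<Longrightarrow> gnode x \<Longrightarrow> gv x = s" "M1 SAME [c, x] \<Longrightarrow> gnode x \<Longrightarrow> gv x = oo"
    "M1 SAME [b, x] \<Longrightarrow> gnode x \<Longrightarrow> gv x = URI p" using same_gv v by blast+
  show "M1 (TG t) [b] \<Longrightarrow> p = ur t" using val_unique[OF v(2)] by auto
  show "M1 PNM [b] \<Longrightarrow> URI p \<notin> rdf_bot" using val_unique[OF v(2)] by auto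
qed

lemma base_dr:
  assumes "M2 BASE [i, a, b, c]"
  obtains k s p oo where "i \<le> N" "[a, b, c] = nodes k" "k \<le> n" "tr (ys ! k) = (s, p, oo)" "dr i s (URI p) oo"
proof -
  obtain k where k: "i \<le> N" "k < n" "[a, b, c] = nodes k" "strict (ys ! k) \<or> i < N \<and> tr (ys ! k) \<in> slev G i"
    using assms by auto
  obtain s p oo where t: "tr (ys ! k) = (s, p, oo)" by (rule tr_cases)
  have "tr (ys ! k) \<in> Lv i" using k strs_nth by (auto simp: Lv_def YL_def)
  then have "dr i s (URI p) oo" using der_cls.base t by simp
  then show ?thesis using that k t by simp
qed

lemma gnode_stm: "[a, b, c] = nodes k \<Longrightarrow> k < n \<Longrightarrow> tr (ys ! k) = (s, p, oo) \<Longrightarrow>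
    gnode a \<and> gv a = s \<and> gnode b \<and> gv b = URI p \<and> gnode c \<and> gv c = oo"
  using stm_gval[of k s p oo] by (auto simp: nodes_def gval_eq)

lemma act_step:
  assumes "M2 ACT [i, a, b, c]" "Suc i < N" "M1 (TG t) [b]" "M2 (BIN t') [i, a, a]"
    and "(t, t') = (tSC, tBOTC) \<or> (t, t') = (tSP, tBOTP)"
  shows "M2 ACT [Suc i, a, b, c]"
proof -
  obtain k where k: "k < n" "[a, b, c] = nodes k" "\<not> strict (ys ! k)" "tr (ys ! k) \<in> slev G i" using assms(1) by auto
  obtain s p oo where tr: "tr (ys ! k) = (s, p, oo)" by (rule tr_cases)
  have p: "p = ur t" using stm_same(4)[OF k(2) _ tr assms(3)] k(1) by simp
  have "gv a = s" using gnode_stm[OF k(2,1) tr] by simp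
  then have "derT G (XL G i) (vac (s, p, oo))"
    using assms(2,4,5) p by (auto simp: derT_def Lv_def)
  then have "tr (ys ! k) \<in> slev G (Suc i)" using k(4) tr by (simp add: slev.simps(2))
  then show ?thesis unfolding M2_simps(15) using k(1-3) assms(2) by blast
qed

lemma last_bot:
  assumes "M2 ACT [i, a, b, c]" "\<not> Suc i < N" "M1 (TG t) [b]" "M1 SAME [a, x]" "M1 SAME [a, y]" "gnode x" "gnode y"
    and "(t, t') = (tSC, tBOTC) \<or> (t, t') = (tSP, tBOTP)"
  shows "M2 (BIN t') [Suc i, x, y]"
proof -
  obtain k where k: "k < n" "[a, b, c] = nodes k" "tr (ys ! k) \<in> slev G i" and i: "i < N" using assms(1) by auto
  obtain s p oo where tr: "tr (ys ! k) = (s, p, oo)" by (rule tr_cases)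
  have p: "p = ur t" using stm_same(4)[OF k(2) _ tr assms(3)] k(1) by simp
  have "gv x = s" "gv y = s" using stm_same(1)[OF k(2) _ tr] k(1) assms(4-7) by auto
  moreover have "vac (s, p, oo) \<in> Lv (Suc i)"
  proof -
    have "Suc i = N" "N - 1 = i" using i assms(2) by auto
    then show ?thesis using k(3) tr by (auto simp: Lv_def YL_def simp del: vac.simps)
  qed
  then have "dr (Suc i) s (URI (ur t')) s" using der_cls.base assms(8) p by auto
  ultimately show ?thesis using i assms(6,7) by auto
qed

lemma M2_closed:
  assumes I: "\<And>t. t \<in> parse_tabs \<Longrightarrow> I t = M1 t"
  shows "dl_closed (Suc N) level_prog I M2"
proof -
  have I': "I HP = M1 HP" "I HS = M1 HS" using I by (auto simp: parse_tabs_def)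
  show ?thesis
    unfolding level_prog_def dl_closed_append dl_closed_map dl_closed_simps all_args
    supply M1_simps(15,16,22,23)[simp del] M2_simps(15,16)[simp del] I'[simp] M1_GN[simp]
    apply (intro conjI ballI)
    subgoal using n_less defs_nth by (auto simp: M2_simps(15) stm_nodes)
    subgoal using act_step[of _ _ _ _ tSC tBOTC] by auto
    subgoal using act_step[of _ _ _ _ tSP tBOTP] by auto
    subgoal by (auto simp: M2_simps(16) stm_nodes)
    subgoal by (auto simp: M2_simps(15,16))
    subgoal using last_bot[of _ _ _ _ tSC _ _ tBOTC] by clarsimp
    subgoal using last_bot[of _ _ _ _ tSP _ _ tBOTP] by clarsimp
    subgoal by (clarsimp, elim base_dr) (simp add: stm_same)
    subgoal by (auto intro: d2a)
    subgoal using der_wf(1)[OF wfX_Lv] by (auto intro: d2b)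
    subgoal by (auto intro: d3a)
    subgoal by (auto intro: d3b)
    subgoal by (auto intro: d4a)
    subgoal by (auto intro: d4b)
    subgoal by (auto intro: d5a)
    subgoal by (auto intro: d5b)
    subgoal by (auto intro: d5c)
    subgoal by (auto intro: d6a)
    subgoal by (auto intro: d6b)
    subgoal using gv_U val_gnode by (auto intro: d6c)
    subgoal by (auto intro: d7a)
    subgoal by (auto intro: d7b)
    subgoal using gv_U val_gnode c3 by auto metis
    subgoal by (auto intro: c1)
    subgoal by (auto intro: c1)
    subgoal by (auto intro: c1)
    subgoal by (auto intro: c1)
    subgoal by (auto intro: c1)
    subgoal by (auto intro: c2)
    subgoal by (auto intro: c2)
    subgoal by simp
    subgoal for t by (clarsimp, elim base_dr, frule (3) stm_same(4)) (simp add: stm_same)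
    subgoal by simp
    done
qed

section \<open>Completeness of the level program\<close>

context
  fixes R1 R
  assumes R1: "\<And>t. t \<in> parse_tabs \<Longrightarrow> R1 t = M1 t" and R1_M1: "R1 \<le> M1"
    and least2: "least_model (Suc N) level_prog R1 R"
begin

lemma R1_M2: "R1 \<le> M2"
proof (intro le_funI le_boolI)
  fix t as assume R: "R1 t as"
  then have M: "M1 t as" using R1_M1 by (auto simp: le_fun_def)
  show "M2 t as"
    using M by (cases t) (simp_all add: M2_def, simp_all add: M1_def order_tab_def)
qed

lemma R_M2: "R t as \<Longrightarrow> M2 t as"
proof -
  have "R \<le> M2" using least2 M2_closed[OF R1] R1_M2 unfolding least_model_def by blast
  then show "R t as \<Longrightarrow> M2 t as" by (auto simp: le_fun_def)
qed

lemma R_parse: "t \<in> parse_tabs \<Longrightarrow> R t = M1 t"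
proof
  fix as assume t: "t \<in> parse_tabs"
  have "R1 t as \<Longrightarrow> R t as" using least2 by (auto simp: least_model_def le_fun_def)
  moreover have "R t as \<Longrightarrow> M1 t as" using R_M2[of t as] M2_parse[OF t] by simp
  ultimately show "R t as = M1 t as" using R1[OF t] by auto
qed

lemma R_parse_simps [simp]:
  "R SUC = M1 SUC" "R HP = M1 HP" "R HS = M1 HS" "R SAME = M1 SAME" "R GN = M1 GN" "R NB = M1 NB"
  "R ST = M1 ST" "R DF = M1 DF" "R QS = M1 QS" "R QD = M1 QD" "R PNM = M1 PNM" "R PLN = M1 PLN" "R (TG t) = M1 (TG t)"
  "R1 HP = M1 HP" "R1 HS = M1 HS"
  using R_parse R1 by (auto simp: parse_tabs_def)

lemma closed2: "dl_closed (Suc N) level_prog R1 R"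
  using least2 by (simp add: least_model_def)

lemmas rule2 = nth_rule[OF closed2, unfolded level_prog_def]

lemma nodes_less: "k < n \<Longrightarrow> off k + 3 < Suc N"
  using stm_val[of k] node_less by (cases "tr (ys ! k)") fastforce

lemma nodes_same:
  assumes "k < n" "tr (ys ! k) = (s, p, oo)"
  shows "gnode x \<Longrightarrow> gv x = s \<Longrightarrow> M1 SAME [off k + 1, x]" "gnode x \<Longrightarrow> gv x = URI p \<Longrightarrow> M1 SAME [off k + 2, x]"
    "gnode x \<Longrightarrow> gv x = oo \<Longrightarrow> M1 SAME [off k + 3, x]" "p = ur t \<Longrightarrow> M1 (TG t) [off k + 2]"
    "p = Name v \<Longrightarrow> M1 PNM [off k + 2]"
  using stm_val[of k s p oo] assms val_gnode by auto

text \<open>Completeness at a level needs the surviving triples to be listed there, and listing them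
  at the next level needs completeness at this one. \<open>act_ok\<close> separates the two, so that
  the induction on levels can call on \<open>R_der\<close>.\<close>

definition act_ok :: "nat \<Rightarrow> bool" where
  "act_ok i \<longleftrightarrow> (\<forall>k<n. \<not> strict (ys ! k) \<and> tr (ys ! k) \<in> slev G i \<longrightarrow> R ACT (i # nodes k))"

lemma base_rule:
  assumes i: "i \<le> N" and k: "k < n" "R BASE (i # nodes k)" and tr: "tr (ys ! k) = (s, p, oo)"
    and x: "gnode x" "gv x = s" and y: "gnode y" "gv y = oo"
  shows "p = ur t \<Longrightarrow> R (BIN t) [i, x, y]" "p = Name v \<Longrightarrow> gnode q \<Longrightarrow> gv q = URI p \<Longrightarrow> R GEN [i, x, q, y]"
proof -
  note * = nodes_same[OF k(1) tr] gnode_less i nodes_less[OF k(1)] k(2)[unfolded nodes_def] x y M1_GN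
  show "R (BIN t) [i, x, y]" if p: "p = ur t"
    using rule2[of 30 "[i, off k + 1, off k + 2, off k + 3, x, y]"] rule2[of 31 "[i, off k + 1, off k + 2, off k + 3, x, y]"]
      rule2[of 32 "[i, off k + 1, off k + 2, off k + 3, x, y]"] rule2[of 33 "[i, off k + 1, off k + 2, off k + 3, x, y]"]
      rule2[of 34 "[i, off k + 1, off k + 2, off k + 3, x, y]"] rule2[of 35 "[i, off k + 1, off k + 2, off k + 3, x, y]"]
      rule2[of 36 "[i, off k + 1, off k + 2, off k + 3, x, y]"] * p
    by (cases t) (simp_all add: tgs_def del: M1_simps)
  show "R GEN [i, x, q, y]" if "p = Name v" "gnode q" "gv q = URI p"
    using rule2[of 7 "[i, off k + 1, off k + 2, off k + 3, x, y, q]"] * that by (simp del: M1_simps)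
qed

lemma last_rule:
  assumes k: "k < n" "R ACT ((N - 1) # nodes k)" and tr: "tr (ys ! k) = (s, p, oo)"
    and x: "gnode x" "gv x = s" and y: "gnode y" "gv y = s"
  shows "p = SC \<Longrightarrow> R (BIN tBOTC) [N, x, y]" "p = SP \<Longrightarrow> R (BIN tBOTP) [N, x, y]"
proof -
  have N: "Suc (N - 1) = N" "0 < N" using n_less by auto
  have S: "M1 SUC [N - 1, N]" "\<not> M1 HS [N]" using N by auto
  note * = nodes_same[OF k(1) tr] gnode_less nodes_less[OF k(1)] k(2)[unfolded nodes_def] x y M1_GN S N
  show "p = SC \<Longrightarrow> R (BIN tBOTC) [N, x, y]"
    using rule2[of 5 "[N - 1, off k + 1, off k + 2, off k + 3, N, x, y]"] * by (simp del: M1_simps)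
  show "p = SP \<Longrightarrow> R (BIN tBOTP) [N, x, y]"
    using rule2[of 6 "[N - 1, off k + 1, off k + 2, off k + 3, N, x, y]"] * by (simp del: M1_simps)
qed

text \<open>Derivability concerns terms, the tables concern nodes. Demanding the fact for all nodes
  with the given terms lets an induction step choose any node for a shared term.\<close>

definition RD :: "nat \<Rightarrow> rdf_term \<Rightarrow> rdf_term \<Rightarrow> rdf_term \<Rightarrow> bool" where
  "RD i a p b \<longleftrightarrow> (\<forall>x y. gnode x \<and> gnode y \<and> gv x = a \<and> gv y = b \<longrightarrow>
      (\<forall>t. p = URI (ur t) \<longrightarrow> R (BIN t) [i, x, y]) \<and>
      (p \<notin> rdf_bot \<longrightarrow> (\<forall>q. gnode q \<and> gv q = p \<longrightarrow> R GEN [i, x, q, y])))"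

lemma RD_BIN: "RD i a (URI (ur t)) b \<longleftrightarrow>
    (\<forall>x y. gnode x \<and> gnode y \<and> gv x = a \<and> gv y = b \<longrightarrow> R (BIN t) [i, x, y])"
  using ur_bot[of t] ur_inj[of t] unfolding RD_def by auto

lemma RD_BIN_I: "(\<And>x y. gnode x \<Longrightarrow> gnode y \<Longrightarrow> gv x = a \<Longrightarrow> gv y = b \<Longrightarrow> R (BIN t) [i, x, y]) \<Longrightarrow> RD i a (URI (ur t)) b"
  unfolding RD_BIN by blast

lemma RD_BIN_D: "RD i a (URI (ur t)) b \<Longrightarrow> gnode x \<Longrightarrow> gnode y \<Longrightarrow> gv x = a \<Longrightarrow> gv y = b \<Longrightarrow> R (BIN t) [i, x, y]"
  unfolding RD_BIN by blast

lemmas RD_I = RD_BIN_I[of _ _ tSP, unfolded ur.simps] RD_BIN_I[of _ _ tSC, unfolded ur.simps]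
  RD_BIN_I[of _ _ tTYP, unfolded ur.simps] RD_BIN_I[of _ _ tDOM, unfolded ur.simps]
  RD_BIN_I[of _ _ tRANGE, unfolded ur.simps] RD_BIN_I[of _ _ tBOTC, unfolded ur.simps]
  RD_BIN_I[of _ _ tBOTP, unfolded ur.simps]

lemmas RD_D = RD_BIN_D[of _ _ tSP, unfolded ur.simps] RD_BIN_D[of _ _ tSC, unfolded ur.simps]
  RD_BIN_D[of _ _ tTYP, unfolded ur.simps] RD_BIN_D[of _ _ tDOM, unfolded ur.simps]
  RD_BIN_D[of _ _ tRANGE, unfolded ur.simps] RD_BIN_D[of _ _ tBOTC, unfolded ur.simps]
  RD_BIN_D[of _ _ tBOTP, unfolded ur.simps]

lemma RD_GEN: "p \<notin> rdf_bot \<Longrightarrow> RD i a p b \<longleftrightarrow>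
    (\<forall>x y q. gnode x \<and> gnode y \<and> gnode q \<and> gv x = a \<and> gv y = b \<and> gv q = p \<longrightarrow> R GEN [i, x, q, y])"
  using ur_bot unfolding RD_def by blast

lemma RD_GEN_I: "p \<notin> rdf_bot \<Longrightarrow> (\<And>x y q. gnode x \<Longrightarrow> gnode y \<Longrightarrow> gnode q \<Longrightarrow> gv x = a \<Longrightarrow> gv y = b \<Longrightarrow> gv q = p \<Longrightarrow>
    R GEN [i, x, q, y]) \<Longrightarrow> RD i a p b"
  by (simp add: RD_GEN)

lemma RD_GEN_D: "RD i a p b \<Longrightarrow> p \<notin> rdf_bot \<Longrightarrow> gnode x \<Longrightarrow> gnode y \<Longrightarrow> gnode q \<Longrightarrow> gv x = a \<Longrightarrow> gv y = b \<Longrightarrow> gv q = p \<Longrightarrow>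
    R GEN [i, x, q, y]"
  by (simp add: RD_GEN)

lemma RD_base:
  assumes i: "i \<le> N" and k: "k < n" "R BASE (i # nodes k)" "tr (ys ! k) = (A, p, B)"
  shows "RD i A (URI p) B"
proof (cases "URI p \<in> rdf_bot")
  case True
  then obtain t where t: "p = ur t" using vocab_cases by blast
  show ?thesis unfolding t RD_BIN using base_rule(1)[OF i k _ _ _ _ t] by blast
next
  case False
  then obtain v where v: "p = Name v" by (cases p) auto
  show ?thesis unfolding RD_GEN[OF False] using base_rule(2)[OF i k _ _ _ _ v] by blast
qed

text \<open>Index \<open>N\<close> draws on the survivors of level \<open>N - 1\<close>, hence the
  second assumption on \<open>act_ok\<close>. Intermediate terms of a rule lie in \<open>U\<close>
  by \<open>der_wf\<close> and so have a node.\<close>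

lemma R_der:
  assumes i: "i \<le> N" and act: "i < N \<Longrightarrow> act_ok i" "i = N \<Longrightarrow> act_ok (N - 1)"
  shows "dr i a p b \<Longrightarrow> RD i a p b"
    and "cls U (Lv i) b \<Longrightarrow> \<forall>x. gnode x \<and> gv x = b \<longrightarrow> R CL [i, x]"
proof (induction rule: der_cls.inducts)
  case (base A p B)
  consider (1) "(A, p, B) \<in> strs G" | (2) "i < N" "(A, p, B) \<in> slev G i"
    | (3) e where "i = N" "e \<in> slev G (N - 1)" "(A, p, B) = vac e"
    using base i by (auto simp: Lv_def YL_def split: if_splits)
  then show ?case
  proof cases
    case 1
    then obtain k where k: "k < n" "strict (ys ! k)" "tr (ys ! k) = (A, p, B)" using strs_nth by blast
    have "M1 ST (nodes k)" using k by (auto simp: stm_nodes)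
    then have "R BASE (i # nodes k)"
      using rule2[of 3 "i # nodes k"] i nodes_less[OF k(1)] by (simp add: nodes_def)
    then show ?thesis using RD_base[OF i] k by blast
  next
    case 2
    then obtain k where k: "k < n" "\<not> strict (ys ! k)" "tr (ys ! k) = (A, p, B)" using defs_nth slev_defs by blast
    have "R ACT (i # nodes k)" using act(1) 2 k by (simp add: act_ok_def)
    then have "R BASE (i # nodes k)"
      using rule2[of 4 "i # nodes k"] i nodes_less[OF k(1)] by (simp add: nodes_def)
    then show ?thesis using RD_base[OF i] k by blast
  next
    case 3
    then obtain k where k: "k < n" "\<not> strict (ys ! k)" "tr (ys ! k) = e" using defs_nth slev_defs by blast
    obtain s q oo where e: "e = (s, q, oo)" by (cases e)
    have q: "q = SC \<or> q = SP" using wfd[of e] 3(2) slev_defs e by (auto simp: wfd_def)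
    have "R ACT ((N - 1) # nodes k)" using act(2) 3 k by (simp add: act_ok_def)
    note l = last_rule[OF k(1) this k(3)[unfolded e]]
    have "A = s" "B = s" using 3(3) e by auto
    show ?thesis
    proof (cases "q = SC")
      case True
      then have "p = BOTC" using 3(3) e by simp
      then show ?thesis using l(1) True \<open>A = s\<close> \<open>B = s\<close> 3(1) RD_I(6)[of s s i] by simp
    next
      case False
      then have "p = BOTP" "q = SP" using 3(3) e q by auto
      then show ?thesis using l(2) \<open>A = s\<close> \<open>B = s\<close> 3(1) RD_I(7)[of s s i] by simp
    qed
  qed
next
  case (d2a A B C)
  obtain m where m: "gnode m" "gv m = B" using der_wf(1)[OF wfX_Lv d2a(1)] U_node by blast
  show ?case
  proof (rule RD_I(1))
    fix x y assume x: "gnode x" "gv x = A" and y: "gnode y" "gv y = C"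
    show "R (BIN tSP) [i, x, y]"
      using rule2[of 8 "[i, x, m, y]"] RD_D(1)[OF d2a(2) x(1) m(1) x(2) m(2)] RD_D(1)[OF d2a(4) m(1) y(1) m(2) y(2)]
        gnode_less[OF x(1)] gnode_less[OF y(1)] gnode_less[OF m(1)] i y(1) by (simp del: M1_simps)
  qed
next
  case (d2b D E A B)
  have D: "D \<in> U" "D \<notin> rdf_bot" "E \<notin> rdf_bot" using der_wf(1)[OF wfX_Lv d2b(1)] by auto
  then obtain m where m: "gnode m" "gv m = D" using U_node by blast
  show ?case
  proof (rule RD_GEN_I[OF D(3)])
    fix x y q assume x: "gnode x" "gv x = A" and y: "gnode y" "gv y = B" and q: "gnode q" "gv q = E"
    show "R GEN [i, x, q, y]"
      using rule2[of 9 "[i, m, q, x, y]"] RD_D(1)[OF d2b(2) m(1) q(1) m(2) q(2)]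
        RD_GEN_D[OF d2b(4) D(2) x(1) y(1) m(1) x(2) y(2) m(2)]
        gnode_less[OF x(1)] gnode_less[OF y(1)] gnode_less[OF m(1)] gnode_less[OF q(1)] i by simp
  qed
next
  case (d3a A B C)
  obtain m where m: "gnode m" "gv m = B" using der_wf(1)[OF wfX_Lv d3a(1)] U_node by blast
  show ?case
  proof (rule RD_I(2))
    fix x y assume x: "gnode x" "gv x = A" and y: "gnode y" "gv y = C"
    show "R (BIN tSC) [i, x, y]"
      using rule2[of 10 "[i, x, m, y]"] RD_D(2)[OF d3a(2) x(1) m(1) x(2) m(2)] RD_D(2)[OF d3a(4) m(1) y(1) m(2) y(2)]
        gnode_less[OF x(1)] gnode_less[OF y(1)] gnode_less[OF m(1)] i y(1) by (simp del: M1_simps)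
  qed
next
  case (d3b A B Y)
  obtain m where m: "gnode m" "gv m = A" using der_wf(1)[OF wfX_Lv d3b(1)] U_node by blast
  show ?case
  proof (rule RD_I(3))
    fix x y assume x: "gnode x" "gv x = Y" and y: "gnode y" "gv y = B"
    show "R (BIN tTYP) [i, x, y]"
      using rule2[of 11 "[i, m, y, x]"] RD_D(2)[OF d3b(2) m(1) y(1) m(2) y(2)] RD_D(3)[OF d3b(4) x(1) m(1) x(2) m(2)]
        gnode_less[OF x(1)] gnode_less[OF y(1)] gnode_less[OF m(1)] i y(1) by (simp del: M1_simps)
  qed
next
  case (d4a D B Y Z)
  obtain m where m: "gnode m" "gv m = D" using der_wf(1)[OF wfX_Lv d4a(1)] U_node by blast
  obtain z where z: "gnode z" "gv z = Z" using der_wf(1)[OF wfX_Lv d4a(3)] U_node by blast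
  have D: "D \<notin> rdf_bot" using der_wf(1)[OF wfX_Lv d4a(1)] by blast
  show ?case
  proof (rule RD_I(3))
    fix x y assume x: "gnode x" "gv x = Y" and y: "gnode y" "gv y = B"
    show "R (BIN tTYP) [i, x, y]"
      using rule2[of 12 "[i, m, y, x, z]"] RD_D(4)[OF d4a(2) m(1) y(1) m(2) y(2)] RD_GEN_D[OF d4a(4) D x(1) z(1) m(1) x(2) z(2) m(2)]
        gnode_less[OF x(1)] gnode_less[OF y(1)] gnode_less[OF m(1)] gnode_less[OF z(1)] i y(1) by (simp del: M1_simps)
  qed
next
  case (d4b D B Y Z)
  obtain m where m: "gnode m" "gv m = D" using der_wf(1)[OF wfX_Lv d4b(1)] U_node by blast
  obtain z where z: "gnode z" "gv z = Y" using der_wf(1)[OF wfX_Lv d4b(3)] U_node by blast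
  have D: "D \<notin> rdf_bot" using der_wf(1)[OF wfX_Lv d4b(1)] by blast
  show ?case
  proof (rule RD_I(3))
    fix x y assume x: "gnode x" "gv x = Z" and y: "gnode y" "gv y = B"
    show "R (BIN tTYP) [i, x, y]"
      using rule2[of 13 "[i, m, y, z, x]"] RD_D(5)[OF d4b(2) m(1) y(1) m(2) y(2)] RD_GEN_D[OF d4b(4) D z(1) x(1) m(1) z(2) x(2) m(2)]
        gnode_less[OF x(1)] gnode_less[OF y(1)] gnode_less[OF m(1)] gnode_less[OF z(1)] i y(1) by (simp del: M1_simps)
  qed
next
  case (d5a A B)
  show ?case
  proof (rule RD_I(6))
    fix x y assume x: "gnode x" "gv x = B" and y: "gnode y" "gv y = A"
    show "R (BIN tBOTC) [i, x, y]"
      using rule2[of 14 "[i, y, x]"] RD_D(6)[OF d5a(2) y(1) x(1) y(2) x(2)]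
        gnode_less[OF x(1)] gnode_less[OF y(1)] i y(1) by (simp del: M1_simps)
  qed
next
  case (d5b A B C)
  obtain m where m: "gnode m" "gv m = A" using der_wf(1)[OF wfX_Lv d5b(1)] U_node by blast
  show ?case
  proof (rule RD_I(6))
    fix x y assume x: "gnode x" "gv x = C" and y: "gnode y" "gv y = B"
    show "R (BIN tBOTC) [i, x, y]"
      using rule2[of 15 "[i, m, y, x]"] RD_D(6)[OF d5b(2) m(1) y(1) m(2) y(2)] RD_D(2)[OF d5b(4) x(1) m(1) x(2) m(2)]
        gnode_less[OF x(1)] gnode_less[OF y(1)] gnode_less[OF m(1)] i y(1) by (simp del: M1_simps)
  qed
next
  case (d5c A B)
  show ?case
  proof (rule RD_I(6))
    fix x y assume x: "gnode x" "gv x = A" and y: "gnode y" "gv y = B"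
    show "R (BIN tBOTC) [i, x, y]"
      using rule2[of 16 "[i, x, y]"] RD_D(6)[OF d5c(2) x(1) x(1) x(2) x(2)] d5c(4) y
        gnode_less[OF x(1)] gnode_less[OF y(1)] i y(1) by (simp del: M1_simps)
  qed
next
  case (d6a A B)
  show ?case
  proof (rule RD_I(7))
    fix x y assume x: "gnode x" "gv x = B" and y: "gnode y" "gv y = A"
    show "R (BIN tBOTP) [i, x, y]"
      using rule2[of 17 "[i, y, x]"] RD_D(7)[OF d6a(2) y(1) x(1) y(2) x(2)]
        gnode_less[OF x(1)] gnode_less[OF y(1)] i y(1) by (simp del: M1_simps)
  qed
next
  case (d6b A B C)
  obtain m where m: "gnode m" "gv m = A" using der_wf(1)[OF wfX_Lv d6b(1)] U_node by blast
  show ?case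
  proof (rule RD_I(7))
    fix x y assume x: "gnode x" "gv x = C" and y: "gnode y" "gv y = B"
    show "R (BIN tBOTP) [i, x, y]"
      using rule2[of 18 "[i, m, y, x]"] RD_D(7)[OF d6b(2) m(1) y(1) m(2) y(2)] RD_D(1)[OF d6b(4) x(1) m(1) x(2) m(2)]
        gnode_less[OF x(1)] gnode_less[OF y(1)] gnode_less[OF m(1)] i y(1) by (simp del: M1_simps)
  qed
next
  case (d6c A B)
  show ?case
  proof (rule RD_I(7))
    fix x y assume x: "gnode x" "gv x = A" and y: "gnode y" "gv y = B"
    have NB: "M1 NB [y]" using d6c(4) val_gnode y by auto
    show "R (BIN tBOTP) [i, x, y]"
      using rule2[of 19 "[i, x, y]"] RD_D(7)[OF d6c(2) x(1) x(1) x(2) x(2)] NB M1_GN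
        gnode_less[OF x(1)] gnode_less[OF y(1)] i y(1) by (simp del: M1_simps)
  qed
next
  case (d7a A C B D)
  obtain m where m: "gnode m" "gv m = C" using der_wf(1)[OF wfX_Lv d7a(1)] U_node by blast
  obtain z where z: "gnode z" "gv z = D" using der_wf(1)[OF wfX_Lv d7a(3)] U_node by blast
  show ?case
  proof (rule RD_I(7))
    fix x y assume x: "gnode x" "gv x = A" and y: "gnode y" "gv y = B"
    show "R (BIN tBOTP) [i, x, y]"
      using rule2[of 20 "[i, x, m, y, z]"] RD_D(4)[OF d7a(2) x(1) m(1) x(2) m(2)] RD_D(4)[OF d7a(4) y(1) z(1) y(2) z(2)] RD_D(6)[OF d7a(6) m(1) z(1) m(2) z(2)]
        gnode_less[OF x(1)] gnode_less[OF y(1)] gnode_less[OF m(1)] gnode_less[OF z(1)] i y(1) by (simp del: M1_simps)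
  qed
next
  case (d7b A C B D)
  obtain m where m: "gnode m" "gv m = C" using der_wf(1)[OF wfX_Lv d7b(1)] U_node by blast
  obtain z where z: "gnode z" "gv z = D" using der_wf(1)[OF wfX_Lv d7b(3)] U_node by blast
  show ?case
  proof (rule RD_I(7))
    fix x y assume x: "gnode x" "gv x = A" and y: "gnode y" "gv y = B"
    show "R (BIN tBOTP) [i, x, y]"
      using rule2[of 21 "[i, x, m, y, z]"] RD_D(5)[OF d7b(2) x(1) m(1) x(2) m(2)] RD_D(5)[OF d7b(4) y(1) z(1) y(2) z(2)] RD_D(6)[OF d7b(6) m(1) z(1) m(2) z(2)]
        gnode_less[OF x(1)] gnode_less[OF y(1)] gnode_less[OF m(1)] gnode_less[OF z(1)] i y(1) by (simp del: M1_simps)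
  qed
next
  case (c1 A p B)
  obtain m where m: "gnode m" "gv m = A" using der_wf(1)[OF wfX_Lv c1(1)] U_node by blast
  show ?case
  proof (intro allI impI)
    fix x assume "gnode x \<and> gv x = B"
    then have x: "gnode x" "gv x = B" by auto
    note * = m(1) x(1) m(2) x(2)
    show "R CL [i, x]"
      using c1(3) c1(2) rule2[of 23 "[i, m, x]"] rule2[of 24 "[i, m, x]"] rule2[of 25 "[i, m, x]"]
        rule2[of 26 "[i, m, x]"] rule2[of 27 "[i, m, x]"] i gnode_less[OF m(1)] gnode_less[OF x(1)]
        RD_D(2)[OF _ *] RD_D(3)[OF _ *] RD_D(4)[OF _ *] RD_D(5)[OF _ *] RD_D(6)[OF _ *] by auto
  qed
next
  case (c2 B p A)
  obtain m where m: "gnode m" "gv m = A" using der_wf(1)[OF wfX_Lv c2(1)] U_node by blast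
  show ?case
  proof (intro allI impI)
    fix x assume "gnode x \<and> gv x = B"
    then have x: "gnode x" "gv x = B" by auto
    note * = x(1) m(1) x(2) m(2)
    show "R CL [i, x]"
      using c2(3) c2(2) rule2[of 28 "[i, x, m]"] rule2[of 29 "[i, x, m]"] i gnode_less[OF m(1)] gnode_less[OF x(1)]
        RD_D(2)[OF _ *] RD_D(6)[OF _ *] by auto
  qed
next
  case (c3 v)
  show ?case
  proof (intro allI impI)
    fix x assume "gnode x \<and> gv x = PlainLit v"
    then have x: "gnode x" "M1 PLN [x]" using val_gnode by auto
    then show "R CL [i, x]" using rule2[of 22 "[i, x]"] i gnode_less[OF x(1)] M1_GN by (simp del: M1_simps)
  qed
qed

lemma act_ok: "i < N \<Longrightarrow> act_ok i"
proof (induction i)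
  case 0
  have "R ACT (0 # nodes k)" if "k < n" "\<not> strict (ys ! k)" for k
  proof -
    have "M1 DF (nodes k)" using that by (auto simp: stm_nodes)
    then show ?thesis using rule2[of 0 "0 # nodes k"] nodes_less[OF that(1)] by (simp add: nodes_def)
  qed
  then show ?case by (simp add: act_ok_def)
next
  case (Suc i)
  have i: "i \<le> N" "i < N" "Lv i = XL G i" using Suc.prems by (auto simp: Lv_def)
  show ?case unfolding act_ok_def
  proof (intro allI impI, elim conjE)
    fix k assume k: "k < n" "\<not> strict (ys ! k)" "tr (ys ! k) \<in> slev G (Suc i)"
    obtain s p oo where tr: "tr (ys ! k) = (s, p, oo)" by (rule tr_cases)
    have sl: "tr (ys ! k) \<in> slev G i" "derT G (XL G i) (vac (s, p, oo))" using k(3) tr by (auto simp: slev.simps(2))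
    have act: "R ACT (i # nodes k)" using Suc k sl by (simp add: act_ok_def)
    have g: "gnode (off k + 1)" "gv (off k + 1) = s" using gnode_stm[OF _ k(1) tr] by (auto simp: nodes_def)
    have p: "p = SC \<or> p = SP" using wfd[of "(s, p, oo)"] sl(1) slev_defs tr by (auto simp: wfd_def)
    have P: "act_ok i" using Suc by simp
    have D: "RD i s q s" if "der U (XL G i) s q s" for q
      by (rule R_der(1)[OF i(1)]) (use P i that in auto)
    have S: "M1 SUC [i, Suc i]" "M1 HS [Suc i]" using Suc.prems by auto
    have 1: "R (BIN tBOTC) [i, off k + 1, off k + 1]" if "p = SC"
      using RD_D(6)[OF D g(1) g(1) g(2) g(2)] sl(2) that by (simp add: derT_def)
    have 2: "R (BIN tBOTP) [i, off k + 1, off k + 1]" if "p = SP"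
      using RD_D(7)[OF D g(1) g(1) g(2) g(2)] sl(2) that by (simp add: derT_def)
    note * = nodes_same(4)[OF k(1) tr, of tSC] nodes_same(4)[OF k(1) tr, of tSP] nodes_less[OF k(1)]
      act[unfolded nodes_def] S Suc.prems
    show "R ACT (Suc i # nodes k)"
      using p rule2[of 1 "[i, off k + 1, off k + 2, off k + 3, Suc i]"] rule2[of 2 "[i, off k + 1, off k + 2, off k + 3, Suc i]"]
        1 2 * by (auto simp: nodes_def simp del: M1_simps)
  qed
qed

theorem level_tables:
  "R (BIN t) [i, x, y] \<longleftrightarrow> i \<le> N \<and> gnode x \<and> gnode y \<and> dr i (gv x) (URI (ur t)) (gv y)"
  "R GEN [i, x, q, y] \<longleftrightarrow> i \<le> N \<and> gnode x \<and> gnode q \<and> gnode y \<and> gv q \<notin> rdf_bot \<and> dr i (gv x) (gv q) (gv y)"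
proof -
  have act: "i < N \<Longrightarrow> act_ok i" "i = N \<Longrightarrow> act_ok (N - 1)" using act_ok n_less by auto
  show "R (BIN t) [i, x, y] \<longleftrightarrow> i \<le> N \<and> gnode x \<and> gnode y \<and> dr i (gv x) (URI (ur t)) (gv y)"
    using R_M2[of "BIN t" "[i, x, y]"] R_der(1)[OF _ act, of "gv x" "URI (ur t)" "gv y"] by (auto simp: RD_BIN)
  show "R GEN [i, x, q, y] \<longleftrightarrow> i \<le> N \<and> gnode x \<and> gnode q \<and> gnode y \<and> gv q \<notin> rdf_bot \<and> dr i (gv x) (gv q) (gv y)"
    using R_M2[of GEN "[i, x, q, y]"] R_der(1)[OF _ act, of "gv x" "gv q" "gv y"] by (auto simp: RD_GEN)
qed

end

end

section \<open>Answering the query\<close>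

context decision_instance
begin

lemma M2_ANS: "\<not> M2 ANS as"
  by (simp add: M2_def)

lemma Lv_XL: "i < N \<Longrightarrow> Lv i = XL G i"
  by (simp add: Lv_def)

lemma entails_strict:
  assumes "\<tau> = Strict (s, p, oo)"
  shows "G \<Turnstile>min \<tau> \<longleftrightarrow> dr N s (URI p) oo"
  using min_entails_Strict[OF card_defs, of "(s, p, oo)"] query assms by (simp add: derT_def Lv_def)

text \<open>The sets \<open>XL G i\<close> decrease, so derivability of the vacuity is antitone in
  \<open>i\<close>, and it no longer changes from the stable level \<open>N - 1\<close> on. The
  unbounded search for the first level without the vacuity thus becomes a test of neighbouring
  levels below \<open>N\<close>.\<close>

lemma entails_defeasible:
  assumes \<tau>: "\<tau> = Defeasible (s, p, oo)" and b: "b = (if p = SC then tBOTC else tBOTP)"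
  shows "G \<Turnstile>min \<tau> \<longleftrightarrow> dr (N - 1) s (URI (ur b)) s \<or> (\<not> dr 0 s (URI (ur b)) s \<and> dr 0 s (URI p) oo) \<or>
     (\<exists>i. Suc i < N \<and> dr i s (URI (ur b)) s \<and> \<not> dr (Suc i) s (URI (ur b)) s \<and> dr (Suc i) s (URI p) oo)"
proof -
  define v where "v i \<longleftrightarrow> derT G (XL G i) (vac (s, p, oo))" for i
  define d where "d i \<longleftrightarrow> derT G (XL G i) (s, p, oo)" for i
  have wfd: "wfd (s, p, oo)" using query \<tau> by (simp add: wfd_def)
  have N: "0 < N" "N - 1 < N" using n_less by auto
  have "i \<le> j \<Longrightarrow> XL G j \<subseteq> XL G i" for i j using slev_antimono by blast
  from der_mono(1)[OF this] have anti: "v j \<Longrightarrow> i \<le> j \<Longrightarrow> v i" for i j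
    unfolding v_def derT_def by (auto split: prod.splits)
  have stable: "v i \<longleftrightarrow> v (N - 1)" if "N - 1 \<le> i" for i
    using slev_stable[OF card_defs that] by (simp add: v_def)
  have "G \<Turnstile>min \<tau> \<longleftrightarrow> (\<forall>i. v i \<or> (\<exists>j<i. \<not> v j) \<or> d i)"
    unfolding \<tau> min_entails_Defeasible[OF wfd] v_def d_def ..
  also have "\<dots> \<longleftrightarrow> v (N - 1) \<or> (\<not> v 0 \<and> d 0) \<or> (\<exists>i. Suc i < N \<and> v i \<and> \<not> v (Suc i) \<and> d (Suc i))"
  proof
    assume E: "\<forall>i. v i \<or> (\<exists>j<i. \<not> v j) \<or> d i"
    show "v (N - 1) \<or> (\<not> v 0 \<and> d 0) \<or> (\<exists>i. Suc i < N \<and> v i \<and> \<not> v (Suc i) \<and> d (Suc i))"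
    proof (rule ccontr)
      assume neg: "\<not> ?thesis"
      then obtain i where i: "\<not> v i" "\<forall>j<i. v j" using exists_least_iff[of "\<lambda>i. \<not> v i"] by blast
      moreover have "i \<le> N - 1" using i neg not_less by blast
      ultimately have i: "\<not> v i" "i \<le> N - 1" "\<forall>j<i. v j" by blast+
      then have "d i" using E by blast
      then show False using neg i N by (cases i) auto
    qed
  next
    assume C: "v (N - 1) \<or> (\<not> v 0 \<and> d 0) \<or> (\<exists>i. Suc i < N \<and> v i \<and> \<not> v (Suc i) \<and> d (Suc i))"
    then consider (1) "v (N - 1)" | (2) "\<not> v 0" "d 0" | (3) k where "v k" "\<not> v (Suc k)" "d (Suc k)" by blast
    then show "\<forall>i. v i \<or> (\<exists>j<i. \<not> v j) \<or> d i"
    proof cases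
      case 1
      then have "v i" for i using anti[of "N - 1" i] stable[of i] by (cases "i \<le> N - 1") auto
      then show ?thesis by blast
    next
      case 2
      then show ?thesis by (metis neq0_conv)
    next
      case 3
      show ?thesis
      proof
        fix i
        consider "i \<le> k" | "i = Suc k" | "Suc k < i" by linarith
        then show "v i \<or> (\<exists>j<i. \<not> v j) \<or> d i" using 3 anti by cases blast+
      qed
    qed
  qed
  finally have main: "G \<Turnstile>min \<tau> \<longleftrightarrow> v (N - 1) \<or> (\<not> v 0 \<and> d 0) \<or> (\<exists>i. Suc i < N \<and> v i \<and> \<not> v (Suc i) \<and> d (Suc i))" .
  have vd: "v i \<longleftrightarrow> dr i s (URI (ur b)) s" "d i \<longleftrightarrow> dr i s (URI p) oo" if "i < N" for i
    using that b by (auto simp: v_def d_def derT_def Lv_XL)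
  have "(\<exists>i. Suc i < N \<and> v i \<and> \<not> v (Suc i) \<and> d (Suc i)) \<longleftrightarrow>
      (\<exists>i. Suc i < N \<and> dr i s (URI (ur b)) s \<and> \<not> dr (Suc i) s (URI (ur b)) s \<and> dr (Suc i) s (URI p) oo)"
    using vd Suc_lessD by blast
  then show ?thesis unfolding main vd[OF N(1)] vd(1)[OF N(2)] by blast
qed

context
  fixes R R3
  assumes parse: "\<And>t. t \<in> parse_tabs \<Longrightarrow> R t = M1 t" and no_ans: "\<And>as. \<not> R ANS as"
    and bin: "\<And>t i x y. R (BIN t) [i, x, y] \<longleftrightarrow> i \<le> N \<and> gnode x \<and> gnode y \<and> dr i (gv x) (URI (ur t)) (gv y)"
    and gen: "\<And>i x q y. R GEN [i, x, q, y] \<longleftrightarrow>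
      i \<le> N \<and> gnode x \<and> gnode q \<and> gnode y \<and> gv q \<notin> rdf_bot \<and> dr i (gv x) (gv q) (gv y)"
    and least3: "least_model (Suc N) answer_prog R R3"
begin

lemma parse_simps [simp]:
  "R SUC = M1 SUC" "R HP = M1 HP" "R HS = M1 HS" "R SAME = M1 SAME" "R GN = M1 GN"
  "R QS = M1 QS" "R QD = M1 QD" "R PNM = M1 PNM" "R (TG t) = M1 (TG t)"
  using parse by (auto simp: parse_tabs_def)

text \<open>To bound the answer by \<open>E\<close> it is enough to put the truth value of
  \<open>E\<close> into every cell of \<open>ANS\<close> and to check the clauses.\<close>

lemma closed_ans:
  assumes "dl_closed (Suc N) answer_prog R (R(ANS := \<lambda>_. E))"
  shows "R3 ANS [] \<Longrightarrow> E" and "t \<noteq> ANS \<Longrightarrow> R3 t = R t"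
proof -
  have "R \<le> R(ANS := \<lambda>_. E)" using no_ans by (auto simp: le_fun_def)
  then have "R3 \<le> R(ANS := \<lambda>_. E)" "R \<le> R3" using least3 assms by (auto simp: least_model_def)
  then have *: "R3 u as \<Longrightarrow> (R(ANS := \<lambda>_. E)) u as" "R u as \<Longrightarrow> R3 u as" for u as by (auto simp: le_fun_def)
  show "R3 ANS [] \<Longrightarrow> E" using *(1)[of ANS "[]"] by simp
  show "R3 t = R t" if "t \<noteq> ANS" using *[of t] that by fastforce
qed

text \<open>With \<open>E = True\<close> every clause holds for trivial reasons.\<close>

lemma R3_R: "t \<noteq> ANS \<Longrightarrow> R3 t = R t"
  by (rule closed_ans(2)[where E = True])
    (auto simp: answer_prog_def dl_closed_append dl_closed_map dl_closed_simps)

lemmas rule3 = nth_rule[of "Suc N" answer_prog R R3, unfolded answer_prog_def]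

lemma closed3: "dl_closed (Suc N) answer_prog R R3"
  using least3 by (simp add: least_model_def)

theorem answer_table: "R3 ANS [] \<longleftrightarrow> G \<Turnstile>min \<tau>"
proof -
  obtain s p oo where tr: "tr (ys ! n) = (s, p, oo)" by (rule tr_cases)
  have str: "\<tau> = Strict (s, p, oo)" if "strict \<tau>" using that tr ys_n by (cases \<tau>) auto
  have def: "\<tau> = Defeasible (s, p, oo)" if "\<not> strict \<tau>" using that tr ys_n by (cases \<tau>) auto
  obtain na nb nc where nd: "nodes n = [na, nb, nc]" and val: "val na s" "val nb (URI p)" "val nc oo"
    using stm_val[OF le_refl tr] by (simp add: nodes_def)
  have S: "M1 SAME [na, x] \<and> gnode x \<longleftrightarrow> gnode x \<and> gv x = s" for x
    using val val_gnode val_unique by auto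
  have P: "M1 SAME [nb, x] \<and> gnode x \<longleftrightarrow> gnode x \<and> gv x = URI p" for x
    using val val_gnode val_unique by auto
  have O: "M1 SAME [nc, x] \<and> gnode x \<longleftrightarrow> gnode x \<and> gv x = oo" for x
    using val val_gnode val_unique by auto
  have T: "M1 (TG t) [nb] \<longleftrightarrow> p = ur t" for t using val val_unique by auto
  have Nm: "M1 PNM [nb] \<longleftrightarrow> (\<exists>v. p = Name v)" using val val_unique by auto
  have Q: "M1 QS [a, b, c] \<longleftrightarrow> [a, b, c] = nodes n \<and> strict \<tau>" "M1 QD [a, b, c] \<longleftrightarrow> [a, b, c] = nodes n \<and> \<not> strict \<tau>" for a b c
    by (auto simp: stm_nodes)
  have succ: "M1 SUC [i, j] \<longleftrightarrow> j = Suc i \<and> i < N" "M1 HS [i] \<longleftrightarrow> i < N" "M1 HP [i] \<longleftrightarrow> 0 < i \<and> i \<le> N" for i j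
    by (auto simp: gr0_conv_Suc)
  have N: "0 < N" "N - 1 < N" "Suc (N - 1) = N" using n_less by auto
  have Sx: "M1 SAME [na, x] \<Longrightarrow> gnode x \<Longrightarrow> gv x = s" "gnode x \<Longrightarrow> gv x = s \<Longrightarrow> M1 SAME [na, x]" for x
    using S by blast+
  have Px: "M1 SAME [nb, x] \<Longrightarrow> gnode x \<Longrightarrow> gv x = URI p" "gnode x \<Longrightarrow> gv x = URI p \<Longrightarrow> M1 SAME [nb, x]" for x
    using P by blast+
  have Ox: "M1 SAME [nc, x] \<Longrightarrow> gnode x \<Longrightarrow> gv x = oo" "gnode x \<Longrightarrow> gv x = oo \<Longrightarrow> M1 SAME [nc, x]" for x
    using O by blast+
  note tabs = Q succ T Nm nd M1_GN bin gen
  have E1: "G \<Turnstile>min \<tau>" if "strict \<tau>" "\<not> i < N" "i < Suc N" "dr i s (URI p) oo" for i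
    using entails_strict[OF str] that less_antisym by blast
  have E2: "G \<Turnstile>min \<tau>" if "\<not> strict \<tau>" "p = SC \<and> t = tBOTC \<or> p = SP \<and> t = tBOTP" "dr (N - 1) s (URI (ur t)) s" for t
    using entails_defeasible[OF def refl] that by auto
  have E3: "G \<Turnstile>min \<tau>" if "\<not> strict \<tau>" "p = SC \<and> t = tBOTC \<or> p = SP \<and> t = tBOTP" "\<not> dr 0 s (URI (ur t)) s" "dr 0 s (URI p) oo" for t
    using entails_defeasible[OF def refl] that by auto
  have E4: "G \<Turnstile>min \<tau>" if "\<not> strict \<tau>" "p = SC \<and> t = tBOTC \<or> p = SP \<and> t = tBOTP" "Suc i < N" "dr i s (URI (ur t)) s"
      "\<not> dr (Suc i) s (URI (ur t)) s" "dr (Suc i) s (URI p) oo" for t i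
    using entails_defeasible[OF def refl] that by auto
  show ?thesis
  proof
    have "dl_closed (Suc N) answer_prog R (R(ANS := \<lambda>_. G \<Turnstile>min \<tau>))"
      unfolding answer_prog_def dl_closed_append dl_closed_map dl_closed_simps all_args
      supply M1_simps[simp del] tabs[simp]
      apply (intro conjI ballI)
      subgoal using E1 by (auto dest!: Sx(1) Px(1) Ox(1))
      subgoal using E2[of tBOTC] by (auto dest!: Sx(1) simp: not_less le_Suc_eq)
      subgoal using E2[of tBOTP] by (auto dest!: Sx(1) simp: not_less le_Suc_eq)
      subgoal using E3[of tBOTC] by (auto dest!: Sx(1) Ox(1))
      subgoal using E3[of tBOTP] by (auto dest!: Sx(1) Ox(1))
      subgoal using E4[of tBOTC] by (auto dest!: Sx(1) Ox(1))
      subgoal using E4[of tBOTP] by (auto dest!: Sx(1) Ox(1))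
      subgoal by simp
      subgoal using E1 by (auto dest!: Sx(1) Ox(1))
      subgoal by simp
      done
    then show "R3 ANS [] \<Longrightarrow> G \<Turnstile>min \<tau>" by (rule closed_ans(1))
  next
    assume E: "G \<Turnstile>min \<tau>"
    note r = rule3[OF closed3[unfolded answer_prog_def]]
    have off: "na < Suc N" "nb < Suc N" "nc < Suc N" using val node_less by blast+
    show "R3 ANS []"
    proof (cases "strict \<tau>")
      case True
      then have d: "dr N s (URI p) oo" using E entails_strict[OF str] by blast
      then have U: "s \<in> U" "oo \<in> U" "URI p \<in> U \<union> rdf_bot" using der_wf(1)[OF wfX_Lv] by blast+
      obtain x where x: "gnode x" "gv x = s" using U U_node by blast
      obtain y where y: "gnode y" "gv y = oo" using U U_node by blast
      show ?thesis
      proof (cases "URI p \<in> rdf_bot")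
        case True
        then obtain t where p: "p = ur t" using vocab_cases by blast
        have c: "dl_closed (Suc N) [(6, ANS, [], [pos QS [1, 2, 3], neg HS [0], pos (TG t) [2], pos SAME [1, 4], pos GN [4],
            pos SAME [3, 5], pos GN [5], pos (BIN t) [0, 4, 5]])] R R3"
          using closed3 tgs[of t] unfolding answer_prog_def dl_closed_append dl_closed_map by blast
        have "M1 QS [na, nb, nc]" using Q(1)[of na nb nc] nd \<open>strict \<tau>\<close> by metis
        moreover have "\<not> M1 HS [N]" using succ(2)[of N] by blast
        moreover have "M1 (TG t) [nb]" using T p by blast
        moreover have "M1 GN [x]" "M1 GN [y]" using M1_GN x(1) y(1) by blast+
        moreover have "R (BIN t) [N, x, y]" using bin x y d p by simp
        ultimately show ?thesis
          using nth_rule[OF c, of 0 "[N, na, nb, nc, x, y]"] Sx(2)[OF x] Ox(2)[OF y] off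
            gnode_less[OF x(1)] gnode_less[OF y(1)]
          by (simp add: R3_R del: M1_simps)
      next
        case False
        then obtain v where v: "p = Name v" by (cases p) auto
        obtain q where q: "gnode q" "gv q = URI p" using U False U_node by blast
        have "M1 QS [na, nb, nc]" "\<not> M1 HS [N]" "M1 PNM [nb]" "M1 GN [x]" "M1 GN [q]" "M1 GN [y]" "R GEN [N, x, q, y]"
          using Q(1)[of na nb nc] nd \<open>strict \<tau>\<close> succ(2) Nm v M1_GN x y q gen[of N x q y] d False by (simp_all del: M1_simps)
        then show ?thesis
          using r[of 0 "[N, na, nb, nc, x, y, q]"] Sx(2)[OF x] Ox(2)[OF y] Px(2)[OF q] off
            gnode_less[OF x(1)] gnode_less[OF y(1)] gnode_less[OF q(1)]
          by (simp add: R3_R del: M1_simps)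
      qed
    next
      case False
      define t where "t = (if p = SC then tBOTC else tBOTP)"
      have p: "p = SC \<and> t = tBOTC \<or> p = SP \<and> t = tBOTP" using query def[OF False] by (auto simp: t_def)
      have QD: "M1 QD [na, nb, nc]" "na < Suc N" "nb < Suc N" "nc < Suc N" using Q(2)[of na nb nc] nd False off by metis+
      consider (1) "dr (N - 1) s (URI (ur t)) s" | (2) "\<not> dr 0 s (URI (ur t)) s" "dr 0 s (URI p) oo"
        | (3) i where "Suc i < N" "dr i s (URI (ur t)) s" "\<not> dr (Suc i) s (URI (ur t)) s" "dr (Suc i) s (URI p) oo"
        using E entails_defeasible[OF def[OF False] t_def] by blast
      then show ?thesis
      proof cases
        case 1
        then obtain x where x: "gnode x" "gv x = s" using der_wf(1)[OF wfX_Lv] U_node by blast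
        have "M1 SUC [N - 1, N]" using succ(1)[of "N - 1" N] N(2,3) by metis
        moreover have "\<not> M1 HS [N]" using succ(2)[of N] by blast
        moreover have "R (BIN t) [N - 1, x, x]" using bin[of t "N - 1" x x] N(2) x 1 by simp
        ultimately have L: "M1 SUC [N - 1, N]" "\<not> M1 HS [N]" "M1 GN [x]" "M1 SAME [na, x]" "x < Suc N" "N - 1 < Suc N" "R (BIN t) [N - 1, x, x]"
          using M1_GN x(1) Sx(2)[OF x] gnode_less[OF x(1)] by auto
        from p show ?thesis
        proof (elim disjE conjE)
          assume t: "p = SC" "t = tBOTC"
          show ?thesis
            using r[of 1 "[N - 1, na, nb, nc, x, N]"] QD T[of tSC] L[unfolded t] t(1) by (simp add: R3_R del: M1_simps)
        next
          assume t: "p = SP" "t = tBOTP"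
          show ?thesis
            using r[of 2 "[N - 1, na, nb, nc, x, N]"] QD T[of tSP] L[unfolded t] t(1) by (simp add: R3_R del: M1_simps)
        qed
      next
        case 2
        obtain x where x: "gnode x" "gv x = s" using der_wf(1)[OF wfX_Lv 2(2)] U_node by blast
        obtain y where y: "gnode y" "gv y = oo" using der_wf(1)[OF wfX_Lv 2(2)] U_node by blast
        have "\<not> M1 HP [0]" using succ(3)[of 0] by blast
        moreover have "\<not> R (BIN t) [0, x, x]" using bin[of t 0 x x] x 2 by simp
        moreover have "p = ur u \<Longrightarrow> R (BIN u) [0, x, y]" for u using bin[of u 0 x y] x y 2 by simp
        ultimately have L: "\<not> M1 HP [0]" "M1 GN [x]" "M1 GN [y]" "M1 SAME [na, x]" "M1 SAME [nc, y]" "x < Suc N" "y < Suc N"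
            "\<not> R (BIN t) [0, x, x]" "p = ur tSC \<Longrightarrow> R (BIN tSC) [0, x, y]" "p = ur tSP \<Longrightarrow> R (BIN tSP) [0, x, y]"
          using M1_GN x(1) y(1) Sx(2)[OF x] Ox(2)[OF y] gnode_less[OF x(1)] gnode_less[OF y(1)] by auto
        from p show ?thesis
        proof (elim disjE conjE)
          assume t: "p = SC" "t = tBOTC"
          show ?thesis
            using r[of 3 "[0, na, nb, nc, x, y]"] QD T[of tSC] L[unfolded t] t(1) by (simp add: R3_R del: M1_simps)
        next
          assume t: "p = SP" "t = tBOTP"
          show ?thesis
            using r[of 4 "[0, na, nb, nc, x, y]"] QD T[of tSP] L[unfolded t] t(1) by (simp add: R3_R del: M1_simps)
        qed
      next
        case 3
        obtain x where x: "gnode x" "gv x = s" using der_wf(1)[OF wfX_Lv 3(4)] U_node by blast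
        obtain y where y: "gnode y" "gv y = oo" using der_wf(1)[OF wfX_Lv 3(4)] U_node by blast
        have "M1 SUC [i, Suc i]" "M1 HS [Suc i]" using succ(1)[of i "Suc i"] succ(2)[of "Suc i"] 3(1) by auto
        moreover have "R (BIN t) [i, x, x]" "\<not> R (BIN t) [Suc i, x, x]"
          using bin[of t i x x] bin[of t "Suc i" x x] x 3 by auto
        moreover have "p = ur u \<Longrightarrow> R (BIN u) [Suc i, x, y]" for u using bin[of u "Suc i" x y] x y 3 by simp
        ultimately have L: "M1 SUC [i, Suc i]" "M1 HS [Suc i]" "M1 GN [x]" "M1 GN [y]" "M1 SAME [na, x]" "M1 SAME [nc, y]"
            "x < Suc N" "y < Suc N" "i < N" "Suc i < Suc N" "R (BIN t) [i, x, x]" "\<not> R (BIN t) [Suc i, x, x]"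
            "p = ur tSC \<Longrightarrow> R (BIN tSC) [Suc i, x, y]" "p = ur tSP \<Longrightarrow> R (BIN tSP) [Suc i, x, y]"
          using M1_GN x(1) y(1) Sx(2)[OF x] Ox(2)[OF y] gnode_less[OF x(1)] gnode_less[OF y(1)] 3(1) by auto
        from p show ?thesis
        proof (elim disjE conjE)
          assume t: "p = SC" "t = tBOTC"
          show ?thesis
            using r[of 5 "[i, na, nb, nc, x, y, Suc i]"] QD T[of tSC] L[unfolded t] t(1) by (simp add: R3_R del: M1_simps)
        next
          assume t: "p = SP" "t = tBOTP"
          show ?thesis
            using r[of 6 "[i, na, nb, nc, x, y, Suc i]"] QD T[of tSP] L[unfolded t] t(1) by (simp add: R3_R del: M1_simps)
        qed
      qed
    qed
  qed
qed

end

end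

section \<open>The decision procedure\<close>

theorem corollary3p45:
  "poly_time_decidable
     {(xs :: stmt list, \<tau> :: stmt). defeasible_graph (set xs) \<and> wf_stmt \<tau>}
     enc_instance
     (\<lambda>(xs, \<tau>). set xs \<Turnstile>min \<tau>)"
proof -
  define nt where "nt = card (UNIV :: tab set)"
  obtain ix :: "tab \<Rightarrow> nat" where ix: "bij_betw ix UNIV {..<nt}"
    unfolding nt_def using ex_bij_betw_finite_nat[of "UNIV :: tab set"] by (auto simp: atLeast0LessThan)
  \<comment> \<open>Arities are at most \<open>4\<close>, so this is \<open>A + nt\<close> for the
    layout below. The variables beyond \<open>K\<close> leave room for those of a clause, of which
    there are at most seven.\<close>
  define K where "K = 4 + nt"
  define V where "V = K + 8"
  interpret layout ix ar V 4 nt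
    using ix ar_le_4 by unfold_locales
  define prog where "prog = LSeq order_prog
    (LSeq (stratum K parse_prog) (LSeq (stratum K level_prog) (stratum K answer_prog)))"
  \<comment> \<open>\<open>T\<close> collects the tables that may be negated; it must not meet the
    heads.\<close>
  have strat: "wf_stratum P" if "\<forall>cl\<in>set P. wf_clause cl" "\<forall>(n, h, hs, B)\<in>set P. h \<notin> T \<and> (\<forall>(b, t, xs)\<in>set B. b \<or> t \<in> T)"
    for P T
  proof -
    have "heads P \<inter> T = {}" using that(2) unfolding heads_def split_beta by blast
    then have "stratified P" using that(2) unfolding stratified_def split_beta by blast
    then show ?thesis using that(1) wf_stratum_def by blast
  qed
  have "wf_stratum parse_prog"
    by (rule strat[where T = "{BIT, HP, HS}"]) (simp_all add: parse_prog_def tgs_def)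
  moreover have "wf_stratum level_prog"
    by (rule strat[where T = "{HP, HS}"]) (simp_all add: level_prog_def tgs_def)
  moreover have "wf_stratum answer_prog"
    by (rule strat[where T = "- {ANS}"]) (simp_all add: answer_prog_def tgs_def)
  ultimately have wf: "wf_stratum parse_prog" "wf_stratum level_prog" "wf_stratum answer_prog" by blast+
  have small: "\<forall>cl\<in>set P. K + fst cl \<le> V" if "P \<in> {parse_prog, level_prog, answer_prog}" for P
    using that by (auto simp: V_def parse_prog_def level_prog_def answer_prog_def tgs_def)
  have wfl: "wfl prog 0"
  proof -
    have "2 < V" by (simp add: V_def)
    then have "wfl order_prog 0" by (simp add: order_prog_def)
    moreover have "wfl (stratum K P) 0" if "P \<in> {parse_prog, level_prog, answer_prog}" for P
      using wfl_stratum[OF _ small[OF that]] wf that by (auto simp: V_def)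
    ultimately show ?thesis by (simp add: prog_def)
  qed
  have correct: "set xs \<Turnstile>min \<tau> \<longleftrightarrow>
      exec (length (enc_instance (xs, \<tau>)) + 1) prog 0 (\<lambda>_. 0) (bit_tab BIT (enc_instance (xs, \<tau>))) ANS []"
    if inst: "defeasible_graph (set xs)" "wf_stmt \<tau>" for xs \<tau>
  proof -
    interpret decision_instance xs \<tau> "enc_instance (xs, \<tau>)"
      using inst by unfold_locales auto
    define R0 where "R0 = order_tab (Suc N) (enc_instance (xs, \<tau>))"
    define R1 where "R1 = exec (Suc N) (stratum K parse_prog) 0 (\<lambda>_. 0) R0"
    define R2 where "R2 = exec (Suc N) (stratum K level_prog) 0 (\<lambda>_. 0) R1"
    define R3 where "R3 = exec (Suc N) (stratum K answer_prog) 0 (\<lambda>_. 0) R2"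
    have N: "2 \<le> Suc N" using n_less by simp
    have K: "4 + nt \<le> K" by (simp add: K_def)
    have least1: "least_model (Suc N) parse_prog (order_tab (Suc N) (enc_instance (xs, \<tau>))) R1"
      unfolding R1_def R0_def using stratum_correct[OF wf(1) small N K] by simp
    have least2: "least_model (Suc N) level_prog R1 R2"
      unfolding R2_def using stratum_correct[OF wf(2) small N K] by simp
    have least3: "least_model (Suc N) answer_prog R2 R3"
      unfolding R3_def using stratum_correct[OF wf(3) small N K] by simp
    have R1: "R1 t = M1 t" if "t \<in> parse_tabs" for t
      using parse_tables[OF least1] that by (simp add: parse_tabs_def)
    have R1_M1: "R1 \<le> M1" using R_le_M1[OF least1] by (auto simp: le_fun_def)
    note level = R1 R1_M1 least2
    have "R3 ANS [] \<longleftrightarrow> set xs \<Turnstile>min \<tau>"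
    proof (rule answer_table[where R = R2])
      show "\<not> R2 ANS as" for as using R_M2[OF level] M2_ANS by blast
    qed (use R_parse[OF level] level_tables[OF level] least3 in blast)+
    moreover have "exec (length (enc_instance (xs, \<tau>)) + 1) prog 0 (\<lambda>_. 0) (bit_tab BIT (enc_instance (xs, \<tau>))) = R3"
      by (simp add: prog_def R3_def R2_def R1_def R0_def exec_order_prog)
    ultimately show ?thesis by simp
  qed
  show ?thesis
    by (rule loop_program_decides[OF wfl, of BIT ANS]) (auto simp: correct)
qed

end
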